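(* Let $\mathcal F=\{\Phi_\Omega:V_\Omega\to\mathbb K\}$ be a Film Topological Field Theory on a family of finite-dimensional vector spaces $\{B_\sigma\mid\sigma\in\Sigma\}$. Define a bilinear form and a three-linear form on $B_\star=\bigoplus_{\sigma\in\Sigma}B_\sigma$ by multilinear extension of the following formulas: \begin{itemize} \item for $x'\in B_{\sigma_1}$, $x''\in B_{\sigma_2}$: $(x',x'')=\Phi_{\Omega(\sigma_1,\sigma_2)}(x'_{q_1}\otimes x''_{q_2})$ (and $(x',x'')=0$ if $\Omega(\sigma_1,\sigma_2)=\emptyset$); \item for $x'\in B_{\sigma_1}$, $x''\in B_{\sigma_2}$, $x'''\in B_{\sigma_3}$: $(x',x'',x''')=\Phi_{\Omega(\sigma_1,\sigma_2,\sigma_3)}(x'_{q_1}\otimes x''_{q_2}\otimes x'''_{q_3})$ (and $(x',x'',x''')=0$ if $\Omega(\sigma_1,\sigma_2,\sigma_3)=\emptyset$). \end{itemize} Here $q_i$ is the vertex with vertex graph $\sigma_i$, and $x_{q}$ denotes the copy in $B_{q}$ of $x\in B_{\sigma_q}$. Then these forms give $B_\star$ the structure of a graph-Frobenius algebra.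
   Context: **Conventions.** $\mathbb K\supset\mathbb Q$ is a field and $S$ is a fixed set of colors. For a finite family $\{X_m\}_{m\in M}$ of vector spaces, $\otimes_{m\in M}X_m$ is the unordered tensor product (canonically isomorphic to the tensor product in any chosen order). **Graphs and complexes.** A graph is a compact 1-dimensional complex with edges and vertices; it is regular if the closure of every edge is a segment (no loops). A regular CW-complex $\Omega$ is a compact CW-complex of oriented 2-cells (disks), edges and vertices whose edges form a regular graph. It is given by a set $\check\Omega$ of closed oriented disks, a regular graph $\Delta$ and a gluing map $\varphi:\partial\check\Omega\to\Delta$ that is a homeomorphism (onto its image) on each boundary circle, with $\varphi(\partial\check\Omega)=\Delta$. A cyclic order on $\Omega$ is a choice, for each connected component, of a cyclic order on its vertices compatible with the orientations of the disks (the vertices met along each oriented disk boundary appear in that cyclic order). A regular CW-complex with a cyclic order is an almost cyclic complex. A graph-cut of a connected almost cyclic complex $\Omega$ is a connected regular graph $\gamma\subset\Omega$ such that (i) the restriction of $\gamma$ to any disk is empty or is one edge of $\gamma$; (ii) $\gamma$ divides $\Omega$ into two connected components, splitting the vertices of $\Omega$ into two nonempty groups compatibly with the cyclic order (each group consecutive). An almost cyclic complex is a cyclic complex if every division of the vertices compatible with the cyclic order is realized by a graph-cut. A graph (resp. CW-complex) is colored if each edge (resp. disk) has a color in $S$ and the colors are pairwise different within each connected component. A film surface is a colored cyclic complex; $\Omega_b$ is its set of vertices. A small neighborhood of a vertex $q$ is a cone over a regular graph $\sigma_q$, the vertex graph of $q$; its edges are oriented by the orientations of the disks outside the neighborhood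 and colored by the colors of the disks. $\Sigma$ is the set of isomorphism classes (homeomorphisms preserving colors and orientations) of connected regular oriented colored graphs; $\sigma\mapsto\sigma^*$ reverses all orientations. **Compatible surfaces.** $\Omega(\sigma_1,\dots,\sigma_n)$ denotes the set of isomorphism classes of connected film surfaces whose vertex graphs are $\sigma_1,\dots,\sigma_n$, with the numbering giving the cyclic order of the vertices. It is empty or has one element; in the latter case the same symbol denotes that film surface. **Film Topological Field Theory.** Given finite-dimensional spaces $B_\sigma$ and tensors $K_\sigma^\otimes\in B_\sigma\otimes B_{\sigma^*}$ ($\sigma\in\Sigma$), put $V_\Omega=\otimes_{q\in\Omega_b}B_q$, where $B_q$ is a copy of $B_{\sigma_q}$. An isomorphism $\phi:\Omega\to\Omega'$ of film surfaces (homeomorphism preserving cyclic orders, orientations and colors) induces $\phi_*:V_\Omega\to V_{\Omega'}$. Cutting a connected $\Omega$ along a graph-cut $\gamma$ and contracting the two copies of $\gamma$ to points $q_+,q_-$ gives a film surface $\Omega'$ with $V_{\Omega'}=V_\Omega\otimes B_{q_+}\otimes B_{q_-}$, and the cut morphism $\eta:\Omega\to\Omega'$ induces $\eta_*(x)=x\otimes K_\sigma^\otimes$, $\sigma=\sigma_{q_+}=\sigma_{q_-}^*$. Disjoint union induces $\theta_*:V_{\Omega'}\otimes V_{\Omega''}\to V_{\Omega'\sqcup\Omega''}$. A Film Topological Field Theory is a family of linear forms $\Phi_\Omega:V_\Omega\to\mathbb K$, for all film surfaces $\Omega$, such that: 1. $\Phi_{\Omega'}(\phi_*(x))=\Phi_\Omega(x)$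 for every isomorphism $\phi$; 2. for a film surface $\Omega$ with exactly two vertices $q_1,q_2$ (then $\sigma_{q_2}=\sigma^*$ where $\sigma=\sigma_{q_1}$), the form $(x',x'')_\sigma=\Phi_\Omega(x'_{q_1}\otimes x''_{q_2})$ on $B_\sigma\times B_{\sigma^*}$ is non-degenerate, for all $\sigma\in\Sigma$; 3. $\Phi_{\Omega'}(\eta_*(x))=\Phi_\Omega(x)$ for every cut morphism $\eta$; 4. $\Phi_{\Omega'\sqcup\Omega''}(\theta_*(x'\otimes x''))=\Phi_{\Omega'}(x')\Phi_{\Omega''}(x'')$. **Graph-Frobenius algebra.** If $\Omega(\sigma_1,\sigma_2,\sigma_3,\sigma_4)\neq\emptyset$, there are unique classes $\sigma_{(1,2|3,4)}$, $\sigma_{(4,1|2,3)}\in\Sigma$ such that, with $\sigma_{(3,4|1,2)}=\sigma_{(1,2|3,4)}^*$ and $\sigma_{(2,3|4,1)}=\sigma_{(4,1|2,3)}^*$, the sets $\Omega(\sigma_1,\sigma_2,\sigma_{(1,2|3,4)})$, $\Omega(\sigma_{(3,4|1,2)},\sigma_3,\sigma_4)$, $\Omega(\sigma_4,\sigma_1,\sigma_{(4,1|2,3)})$, $\Omega(\sigma_{(2,3|4,1)},\sigma_2,\sigma_3)$ are nonempty. A graph-Frobenius algebra is a direct sum $B_\star=\bigoplus_{\sigma\in\Sigma}B_\sigma$ of finite-dimensional spaces with a bilinear form $(\cdot,\cdot)$ and a three-linear form $(\cdot,\cdot,\cdot)$ with values in $\mathbb K$ such that - $(B_{\sigma_1},B_{\sigma_2})=0$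 for $\sigma_1\ne\sigma_2^*$; - $(\cdot,\cdot)$ is non-degenerate; - $(B_{\sigma_1},B_{\sigma_2},B_{\sigma_3})=0$ if $\Omega(\sigma_1,\sigma_2,\sigma_3)=\emptyset$; - whenever $\Omega(\sigma_1,\sigma_2,\sigma_3,\sigma_4)\neq\emptyset$ and $x_k\in B_{\sigma_k}$, $$\sum_{i,j}(x_1,x_2,b_i^{(1,2|3,4)})F^{ij}_{(1,2|3,4)}(b_j^{(3,4|1,2)},x_3,x_4)=\sum_{i,j}(x_4,x_1,b_i^{(4,1|2,3)})F^{ij}_{(4,1|2,3)}(b_j^{(2,3|4,1)},x_2,x_3),$$ where $\{b_i^{(s,t|k,r)}\}$ is a basis of $B_{\sigma_{(s,t|k,r)}}$ and $F^{ij}_{(s,t|k,r)}$ is the inverse matrix of $(b_i^{(s,t|k,r)},b_j^{(k,r|s,t)})$, indexed so that $\sum_iF^{ij}_{(s,t|k,r)}(b_i^{(s,t|k,r)},b_l^{(k,r|s,t)})=\delta_{jl}$. *)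

theory Defs
  imports
    "Graph_Theory.Digraph_Isomorphism"
    "HOL-Library.Poly_Mapping"
    "HOL-Library.FuncSet"
begin

section \<open>Oriented coloured graphs and their isomorphism classes\<close>

type_synonym ('v, 'a, 'c) cgraph = "('v, 'a) pre_digraph \<times> ('a \<Rightarrow> 'c)"

text \<open>A single point is not 1-dimensional, hence the condition that there is an edge. (It could not
  be the vertex graph of a vertex of a regular CW-complex either.)\<close>
definition regular_cgraph :: "'c set \<Rightarrow> ('v, 'a, 'c) cgraph \<Rightarrow> bool" where
  "regular_cgraph S = (\<lambda>(G, c).
     fin_digraph G \<and> loopfree_digraph G \<and> Digraph_Component.connected G \<and> arcs G \<noteq> {} \<and>
     inj_on c (arcs G) \<and> c ` arcs G \<subseteq> S)"

definition cgraph_iso :: "('v, 'a, 'c) cgraph \<Rightarrow> ('w, 'b, 'c) cgraph \<Rightarrow> bool" where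
  "cgraph_iso = (\<lambda>(G, c) (H, d). \<exists>f. pre_digraph.digraph_isomorphism G f \<and> H = app_iso f G \<and>
     (\<forall>a\<in>arcs G. d (iso_arcs f a) = c a))"

text \<open>Isomorphism classes are formed among graphs with cells labelled by natural numbers, so that
  graphs over arbitrary label types have their class in one common type.\<close>
type_synonym 'c gclass = "(nat, nat, 'c) cgraph set"

definition iso_class :: "('v, 'a, 'c) cgraph \<Rightarrow> 'c gclass" where
  "iso_class X = {Y. cgraph_iso X Y}"

definition Sigma_classes :: "'c set \<Rightarrow> 'c gclass set" where
  "Sigma_classes S = iso_class ` {X :: (nat, nat, 'c) cgraph. regular_cgraph S X}"

definition reverse_graph :: "('v, 'a) pre_digraph \<Rightarrow> ('v, 'a) pre_digraph" where
  "reverse_graph G = \<lparr>verts = verts G, arcs = arcs G, tail = head G, head = tail G\<rparr>"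

definition dual :: "'c gclass \<Rightarrow> 'c gclass" where
  "dual \<sigma> = (\<lambda>(G, c). (reverse_graph G, c)) ` \<sigma>"


section \<open>Regular CW-complexes with cyclic order\<close>

text \<open>
  A regular CW-complex is given by its cells and their gluing. The graph \<open>\<Delta>\<close> consists of
  \<open>vertices\<close>, \<open>edges\<close> and the two \<open>ends\<close> of each edge; parallel edges are allowed. The gluing map
  is a homeomorphism from the oriented boundary circle of a disk onto a cycle of \<open>\<Delta>\<close>. If
  \<open>glue d = [(v\<^sub>0, e\<^sub>0), \<dots>, (v\<^sub>m, e\<^sub>m)]\<close>, this cycle is
  \<open>v\<^sub>0 \<rightarrow> v\<^sub>1 \<rightarrow> \<dots> \<rightarrow> v\<^sub>m \<rightarrow> v\<^sub>0\<close> where \<open>e\<^sub>i\<close> is the edge along which it leaves \<open>v\<^sub>i\<close>; the list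
  is relevant up to rotation only. The cyclic orders of the vertices of the components are given
  by the ternary relation \<open>cyc\<close>: \<open>(a, b, c) \<in> cyc\<close> if \<open>a\<close>, \<open>b\<close>, \<open>c\<close> are met in this order.
\<close>
record ('v, 'e, 'd, 'c) complex2 =
  vertices :: "'v set"
  edges :: "'e set"
  ends :: "'e \<Rightarrow> 'v set"
  disks :: "'d set"
  glue :: "'d \<Rightarrow> ('v \<times> 'e) list"
  cyc :: "('v \<times> 'v \<times> 'v) set"
  dcol :: "'d \<Rightarrow> 'c"

definition disk_verts :: "('v, 'e, 'd, 'c) complex2 \<Rightarrow> 'd \<Rightarrow> 'v set" where
  "disk_verts \<Omega> d = fst ` set (glue \<Omega> d)"

definition disk_edges :: "('v, 'e, 'd, 'c) complex2 \<Rightarrow> 'd \<Rightarrow> 'e set" where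
  "disk_edges \<Omega> d = snd ` set (glue \<Omega> d)"

text \<open>The last two conditions say that the gluing map is onto \<open>\<Delta>\<close>.\<close>
definition regular_complex :: "('v, 'e, 'd, 'c) complex2 \<Rightarrow> bool" where
  "regular_complex \<Omega> \<longleftrightarrow>
     finite (vertices \<Omega>) \<and> finite (edges \<Omega>) \<and> finite (disks \<Omega>) \<and>
     (\<forall>e\<in>edges \<Omega>. ends \<Omega> e \<subseteq> vertices \<Omega> \<and> card (ends \<Omega> e) = 2) \<and>
     (\<forall>d\<in>disks \<Omega>. let w = glue \<Omega> d; n = length w in
        w \<noteq> [] \<and> distinct (map fst w) \<and> distinct (map snd w) \<and>
        set w \<subseteq> vertices \<Omega> \<times> edges \<Omega> \<and>
        (\<forall>i<n. ends \<Omega> (snd (w ! i)) = {fst (w ! i), fst (w ! (Suc i mod n))})) \<and>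
     (\<Union>d\<in>disks \<Omega>. disk_edges \<Omega> d) = edges \<Omega> \<and>
     (\<Union>d\<in>disks \<Omega>. disk_verts \<Omega> d) = vertices \<Omega>"

text \<open>The vertex sets of the connected components of \<open>\<Omega>\<close> after its edges in \<open>X\<close> have been cut in
  the middle. As the boundary of each disk is connected, the disks add no connections.\<close>
definition components_cut :: "('v, 'e, 'd, 'c) complex2 \<Rightarrow> 'e set \<Rightarrow> 'v set set" where
  "components_cut \<Omega> X = vertices \<Omega> //
     {(u, v). u \<in> vertices \<Omega> \<and> v \<in> vertices \<Omega> \<and>
        (u, v) \<in> {(p, q). \<exists>e\<in>edges \<Omega> - X. ends \<Omega> e = {p, q}}\<^sup>*}"

abbreviation components :: "('v, 'e, 'd, 'c) complex2 \<Rightarrow> 'v set set" where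
  "components \<Omega> \<equiv> components_cut \<Omega> {}"

definition connected_complex :: "('v, 'e, 'd, 'c) complex2 \<Rightarrow> bool" where
  "connected_complex \<Omega> \<longleftrightarrow> components \<Omega> = {vertices \<Omega>}"

definition component_complex ::
    "('v, 'e, 'd, 'c) complex2 \<Rightarrow> 'v set \<Rightarrow> ('v, 'e, 'd, 'c) complex2" where
  "component_complex \<Omega> C =
     \<lparr>vertices = C,
      edges = {e \<in> edges \<Omega>. ends \<Omega> e \<subseteq> C},
      ends = ends \<Omega>,
      disks = {d \<in> disks \<Omega>. disk_verts \<Omega> d \<subseteq> C},
      glue = glue \<Omega>,
      cyc = cyc \<Omega> \<inter> C \<times> C \<times> C,
      dcol = dcol \<Omega>\<rparr>"

definition cyclic_order_on :: "'v set \<Rightarrow> ('v \<times> 'v \<times> 'v) set \<Rightarrow> bool" where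
  "cyclic_order_on A R \<longleftrightarrow>
     R \<subseteq> A \<times> A \<times> A \<and>
     (\<forall>a b c. (a, b, c) \<in> R \<longrightarrow> (b, c, a) \<in> R) \<and>
     (\<forall>a b c. (a, b, c) \<in> R \<longrightarrow> (c, b, a) \<notin> R) \<and>
     (\<forall>a b c d. (a, b, c) \<in> R \<and> (a, c, d) \<in> R \<longrightarrow> (a, b, d) \<in> R) \<and>
     (\<forall>a\<in>A. \<forall>b\<in>A. \<forall>c\<in>A. a \<noteq> b \<and> b \<noteq> c \<and> a \<noteq> c \<longrightarrow> (a, b, c) \<in> R \<or> (c, b, a) \<in> R)"

definition almost_cyclic_complex :: "('v, 'e, 'd, 'c) complex2 \<Rightarrow> bool" where
  "almost_cyclic_complex \<Omega> \<longleftrightarrow>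
     regular_complex \<Omega> \<and>
     cyc \<Omega> \<subseteq> (\<Union>C\<in>components \<Omega>. C \<times> C \<times> C) \<and>
     (\<forall>C\<in>components \<Omega>. cyclic_order_on C (cyc (component_complex \<Omega> C))) \<and>
     (\<forall>d\<in>disks \<Omega>. \<forall>i j k. i < j \<and> j < k \<and> k < length (glue \<Omega> d) \<longrightarrow>
        (fst (glue \<Omega> d ! i), fst (glue \<Omega> d ! j), fst (glue \<Omega> d ! k)) \<in> cyc \<Omega>)"

text \<open>Division of the vertices into two nonempty groups that are consecutive in the cyclic
  order: one does not meet \<open>A\<close>, \<open>B\<close>, \<open>A\<close>, \<open>B\<close> successively when going around.\<close>
definition division :: "('v, 'e, 'd, 'c) complex2 \<Rightarrow> 'v set \<Rightarrow> 'v set \<Rightarrow> bool" where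
  "division \<Omega> A B \<longleftrightarrow>
     A \<union> B = vertices \<Omega> \<and> A \<inter> B = {} \<and> A \<noteq> {} \<and> B \<noteq> {} \<and>
     (\<forall>a\<in>A. \<forall>a'\<in>A. \<forall>b\<in>B. \<forall>b'\<in>B. \<not> ((a, b, a') \<in> cyc \<Omega> \<and> (a', b', a) \<in> cyc \<Omega>))"

text \<open>
  A graph-cut of the connected complex \<open>\<Omega>\<close> with groups \<open>A\<close> and \<open>B\<close>. A vertex of \<open>\<gamma>\<close> is an
  interior point of an edge of \<open>\<Omega>\<close> and an edge of \<open>\<gamma>\<close> is a chord of a disk; they are named by
  the edge and the disk that contain them (the orientation of \<open>\<gamma>\<close> is irrelevant). No more than one
  vertex of \<open>\<gamma>\<close> lies on an edge \<open>e\<close> of \<open>\<Omega>\<close>: otherwise, in each disk around \<open>e\<close>, the one edge of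
  \<open>\<gamma>\<close> joins two points of \<open>e\<close>, and \<open>\<gamma>\<close>, being connected, cuts off a part without vertices.
  The ends of a chord lie on different edges of \<open>\<Omega>\<close>, so each half of a cut disk contains
  vertices of \<open>\<Omega>\<close>, and the components of \<open>\<Omega> - \<gamma>\<close> are those of the graph \<open>\<Delta>\<close> with the vertices of
  \<open>\<gamma>\<close> removed.
\<close>
definition graph_cut ::
    "('v, 'e, 'd, 'c) complex2 \<Rightarrow> ('e, 'd) pre_digraph \<Rightarrow> 'v set \<Rightarrow> 'v set \<Rightarrow> bool" where
  "graph_cut \<Omega> \<gamma> A B \<longleftrightarrow>
     loopfree_digraph \<gamma> \<and> Digraph_Component.connected \<gamma> \<and>
     verts \<gamma> \<subseteq> edges \<Omega> \<and> arcs \<gamma> \<subseteq> disks \<Omega> \<and>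
     (\<forall>d\<in>arcs \<gamma>. disk_edges \<Omega> d \<inter> verts \<gamma> = {tail \<gamma> d, head \<gamma> d}) \<and>
     (\<forall>d\<in>disks \<Omega> - arcs \<gamma>. disk_edges \<Omega> d \<inter> verts \<gamma> = {}) \<and>
     components_cut \<Omega> (verts \<gamma>) = {A, B} \<and>
     division \<Omega> A B"

definition cyclic_complex :: "('v, 'e, 'd, 'c) complex2 \<Rightarrow> bool" where
  "cyclic_complex \<Omega> \<longleftrightarrow>
     almost_cyclic_complex \<Omega> \<and>
     (\<forall>C\<in>components \<Omega>. \<forall>A B. division (component_complex \<Omega> C) A B \<longrightarrow>
        (\<exists>\<gamma>. graph_cut (component_complex \<Omega> C) \<gamma> A B))"

definition film_surface :: "'c set \<Rightarrow> ('v, 'e, 'd, 'c) complex2 \<Rightarrow> bool" where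
  "film_surface S \<Omega> \<longleftrightarrow>
     cyclic_complex \<Omega> \<and> dcol \<Omega> ` disks \<Omega> \<subseteq> S \<and>
     (\<forall>C\<in>components \<Omega>. inj_on (dcol \<Omega>) (disks (component_complex \<Omega> C)))"

text \<open>The vertex graph of \<open>q\<close> has a vertex for each edge at \<open>q\<close> and an edge for each disk \<open>d\<close>
  at \<open>q\<close>, namely the arc that cuts the corner \<open>q\<close> off \<open>d\<close>. As part of the oriented boundary of
  the rest of \<open>d\<close>, this arc leads from the edge along which \<open>\<partial>d\<close> arrives at \<open>q\<close> to the edge along
  which it leaves \<open>q\<close>.\<close>
definition vertex_graph :: "('v, 'e, 'd, 'c) complex2 \<Rightarrow> 'v \<Rightarrow> ('e, 'd, 'c) cgraph" where
  "vertex_graph \<Omega> q =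
     (\<lparr>verts = {e \<in> edges \<Omega>. q \<in> ends \<Omega> e},
       arcs = {d \<in> disks \<Omega>. q \<in> disk_verts \<Omega> d},
       tail = (\<lambda>d. THE e. \<exists>p. (p, e) \<in> set (glue \<Omega> d) \<and> ends \<Omega> e = {p, q} \<and> p \<noteq> q),
       head = (\<lambda>d. THE e. (q, e) \<in> set (glue \<Omega> d))\<rparr>,
      dcol \<Omega>)"

definition vertex_class :: "('v, 'e, 'd, 'c) complex2 \<Rightarrow> 'v \<Rightarrow> 'c gclass" where
  "vertex_class \<Omega> q = iso_class (vertex_graph \<Omega> q)"

definition complex_iso ::
    "('v \<Rightarrow> 'w) \<Rightarrow> ('e \<Rightarrow> 'f) \<Rightarrow> ('d \<Rightarrow> 'g) \<Rightarrow>
     ('v, 'e, 'd, 'c) complex2 \<Rightarrow> ('w, 'f, 'g, 'c) complex2 \<Rightarrow> bool" where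
  "complex_iso fv fe fd \<Omega> \<Omega>' \<longleftrightarrow>
     bij_betw fv (vertices \<Omega>) (vertices \<Omega>') \<and>
     bij_betw fe (edges \<Omega>) (edges \<Omega>') \<and>
     bij_betw fd (disks \<Omega>) (disks \<Omega>') \<and>
     (\<forall>e\<in>edges \<Omega>. ends \<Omega>' (fe e) = fv ` ends \<Omega> e) \<and>
     (\<forall>d\<in>disks \<Omega>. \<exists>k. glue \<Omega>' (fd d) = rotate k (map (map_prod fv fe) (glue \<Omega> d))) \<and>
     (\<forall>d\<in>disks \<Omega>. dcol \<Omega>' (fd d) = dcol \<Omega> d) \<and>
     cyc \<Omega>' = map_prod fv (map_prod fv fv) ` cyc \<Omega>"


section \<open>Disjoint union and cutting\<close>

definition disjoint_union ::
    "('v, 'e, 'd, 'c) complex2 \<Rightarrow> ('w, 'f, 'g, 'c) complex2 \<Rightarrow>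
     ('v + 'w, 'e + 'f, 'd + 'g, 'c) complex2" where
  "disjoint_union \<Omega>' \<Omega>'' =
     \<lparr>vertices = vertices \<Omega>' <+> vertices \<Omega>'',
      edges = edges \<Omega>' <+> edges \<Omega>'',
      ends = case_sum (\<lambda>e. Inl ` ends \<Omega>' e) (\<lambda>e. Inr ` ends \<Omega>'' e),
      disks = disks \<Omega>' <+> disks \<Omega>'',
      glue = case_sum (\<lambda>d. map (map_prod Inl Inl) (glue \<Omega>' d))
                      (\<lambda>d. map (map_prod Inr Inr) (glue \<Omega>'' d)),
      cyc = map_prod Inl (map_prod Inl Inl) ` cyc \<Omega>' \<union>
            map_prod Inr (map_prod Inr Inr) ` cyc \<Omega>'',
      dcol = case_sum (dcol \<Omega>') (dcol \<Omega>'')\<rparr>"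

text \<open>
  Result of cutting \<open>\<Omega>\<close> along a graph-cut with groups \<open>A\<close>, \<open>B\<close> and contracting the two copies
  of the cut to points \<open>q\<^sub>+ = Inr True\<close>, \<open>q\<^sub>- = Inr False\<close>. The component of \<open>q\<^sub>+\<close> contains \<open>A\<close>,
  that of \<open>q\<^sub>-\<close> contains \<open>B\<close>. The pieces of edges and disks are labelled by their side, so an edge
  joining \<open>A\<close> and \<open>B\<close>, i.e. containing a vertex of the cut, appears twice. Seen from one side, all
  that lies beyond the cut is contracted to a point: \<open>collapse\<close> replaces the vertices of the other
  side by the new point and the edges without end on this side disappear.
\<close>
definition side :: "'v set \<Rightarrow> 'v set \<Rightarrow> bool \<Rightarrow> 'v set" where
  "side A B s = (if s then A else B)"

definition collapse :: "'v set \<Rightarrow> bool \<Rightarrow> 'v \<Rightarrow> 'v + bool" where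
  "collapse P s v = (if v \<in> P then Inl v else Inr s)"

definition cut_complex ::
    "('v, 'e, 'd, 'c) complex2 \<Rightarrow> 'v set \<Rightarrow> 'v set \<Rightarrow>
     ('v + bool, 'e \<times> bool, 'd \<times> bool, 'c) complex2" where
  "cut_complex \<Omega> A B =
     \<lparr>vertices = vertices \<Omega> <+> UNIV,
      edges = {(e, s). e \<in> edges \<Omega> \<and> ends \<Omega> e \<inter> side A B s \<noteq> {}},
      ends = (\<lambda>(e, s). collapse (side A B s) s ` ends \<Omega> e),
      disks = {(d, s). d \<in> disks \<Omega> \<and> disk_verts \<Omega> d \<inter> side A B s \<noteq> {}},
      glue = (\<lambda>(d, s). map (\<lambda>(v, e). (collapse (side A B s) s v, (e, s)))
                (filter (\<lambda>(v, e). ends \<Omega> e \<inter> side A B s \<noteq> {}) (glue \<Omega> d))),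
      cyc = {(x, y, z). x \<noteq> y \<and> y \<noteq> z \<and> x \<noteq> z \<and>
               (\<exists>s. let r = collapse (side A B s) s in
                  (x, y, z) \<in> map_prod r (map_prod r r) ` cyc \<Omega>)},
      dcol = (\<lambda>(d, s). dcol \<Omega> d)\<rparr>"


section \<open>Surfaces with prescribed vertex graphs\<close>

text \<open>Every finite complex is isomorphic to one with cells labelled by natural numbers.\<close>
type_synonym 'c surface = "(nat, nat, nat, 'c) complex2"

text \<open>The film surfaces representing \<open>\<Omega>(\<sigma>\<^sub>1, \<dots>, \<sigma>\<^sub>n)\<close>, each with the numbering of its vertices.
  If there are any, all of them are isomorphic.\<close>
definition surfaces :: "'c set \<Rightarrow> 'c gclass list \<Rightarrow> ('c surface \<times> nat list) set" where
  "surfaces S \<sigma>s = {(\<Omega>, qs).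
     film_surface S \<Omega> \<and> connected_complex \<Omega> \<and>
     distinct qs \<and> vertices \<Omega> = set qs \<and> map (vertex_class \<Omega>) qs = \<sigma>s \<and>
     (\<forall>i j k. i < j \<and> j < k \<and> k < length qs \<longrightarrow> (qs ! i, qs ! j, qs ! k) \<in> cyc \<Omega>)}"

text \<open>The class \<open>\<sigma>\<^bsub>(1,2|3,4)\<^esub>\<close>; its dual is \<open>\<sigma>\<^bsub>(3,4|1,2)\<^esub>\<close>.\<close>
definition cut_class ::
    "'c set \<Rightarrow> 'c gclass \<Rightarrow> 'c gclass \<Rightarrow> 'c gclass \<Rightarrow> 'c gclass \<Rightarrow> 'c gclass" where
  "cut_class S \<sigma>1 \<sigma>2 \<sigma>3 \<sigma>4 = (THE \<sigma>. \<sigma> \<in> Sigma_classes S \<and>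
     surfaces S [\<sigma>1, \<sigma>2, \<sigma>] \<noteq> {} \<and> surfaces S [dual \<sigma>, \<sigma>3, \<sigma>4] \<noteq> {})"


section \<open>Unordered tensor products\<close>

text \<open>
  The tensor product of the subspaces \<open>X m\<close>, \<open>m \<in> M\<close>, is the vector space of formal linear
  combinations of families \<open>f \<in> (\<Pi>\<^sub>E m\<in>M. X m)\<close> modulo the relations of multilinearity. Its
  elements are the cosets \<open>tensor_class M X t\<close>. Maps between tensor products are given by their
  values on representatives.
\<close>
type_synonym ('m, 'b, 'k) formal = "('m \<Rightarrow> 'b) \<Rightarrow>\<^sub>0 'k"

definition formal_scale :: "'k \<Rightarrow> ('m, 'b, 'k) formal \<Rightarrow> ('m, 'b, 'k::field) formal" where
  "formal_scale a t = Poly_Mapping.map ((*) a) t"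

definition formal_push ::
    "(('m \<Rightarrow> 'b) \<Rightarrow> ('n \<Rightarrow> 'b)) \<Rightarrow> ('m, 'b, 'k) formal \<Rightarrow> ('n, 'b, 'k::field) formal" where
  "formal_push g t =
     (\<Sum>f\<in>Poly_Mapping.keys t. Poly_Mapping.single (g f) (Poly_Mapping.lookup t f))"

definition formal_prod ::
    "('m, 'b, 'k) formal \<Rightarrow> ('n, 'b, 'k) formal \<Rightarrow> ('m + 'n, 'b, 'k::field) formal" where
  "formal_prod t u =
     (\<Sum>f\<in>Poly_Mapping.keys t. \<Sum>g\<in>Poly_Mapping.keys u. Poly_Mapping.single (case_sum f g)
        (Poly_Mapping.lookup t f * Poly_Mapping.lookup u g))"

locale char_0_space = vector_space scale
  for scale :: "'k::field_char_0 \<Rightarrow> 'b::ab_group_add \<Rightarrow> 'b" (infixr \<open>*s\<close> 75)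
begin

definition tensor_relations :: "'m set \<Rightarrow> ('m \<Rightarrow> 'b set) \<Rightarrow> ('m, 'b, 'k) formal set" where
  "tensor_relations M X =
     {Poly_Mapping.single (f(m := x + y)) 1
        - Poly_Mapping.single (f(m := x)) 1 - Poly_Mapping.single (f(m := y)) 1 |f m x y.
        f \<in> Pi\<^sub>E M X \<and> m \<in> M \<and> x \<in> X m \<and> y \<in> X m} \<union>
     {Poly_Mapping.single (f(m := a *s x)) 1 - Poly_Mapping.single (f(m := x)) a |f m a x.
        f \<in> Pi\<^sub>E M X \<and> m \<in> M \<and> x \<in> X m}"

definition tensor_class ::
    "'m set \<Rightarrow> ('m \<Rightarrow> 'b set) \<Rightarrow> ('m, 'b, 'k) formal \<Rightarrow> ('m, 'b, 'k) formal set" where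
  "tensor_class M X t = {u. u - t \<in> module.span formal_scale (tensor_relations M X)}"

definition formal_space :: "'m set \<Rightarrow> ('m \<Rightarrow> 'b set) \<Rightarrow> ('m, 'b, 'k) formal set" where
  "formal_space M X = {t. Poly_Mapping.keys t \<subseteq> Pi\<^sub>E M X}"

definition tensor_space :: "'m set \<Rightarrow> ('m \<Rightarrow> 'b set) \<Rightarrow> ('m, 'b, 'k) formal set set" where
  "tensor_space M X = tensor_class M X ` formal_space M X"

definition tensor_linear_form ::
    "'m set \<Rightarrow> ('m \<Rightarrow> 'b set) \<Rightarrow> (('m, 'b, 'k) formal set \<Rightarrow> 'k) \<Rightarrow> bool" where
  "tensor_linear_form M X L \<longleftrightarrow>
     (\<forall>t\<in>formal_space M X. \<forall>u\<in>formal_space M X. \<forall>a.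
        L (tensor_class M X (t + u)) = L (tensor_class M X t) + L (tensor_class M X u) \<and>
        L (tensor_class M X (formal_scale a t)) = a * L (tensor_class M X t))"

end


section \<open>The spaces of a film surface\<close>

text \<open>\<open>V\<^sub>\<Omega>\<close> is the tensor product of the family \<open>B\<^sub>q\<close> over the vertices \<open>q\<close>. The copy
  of \<open>x\<close> in \<open>B\<^sub>q\<close> is \<open>x\<close> at the index \<open>q\<close>.\<close>
definition vertex_space ::
    "('c gclass \<Rightarrow> 'b set) \<Rightarrow> ('v, 'e, 'd, 'c) complex2 \<Rightarrow> 'v \<Rightarrow> 'b set" where
  "vertex_space B \<Omega> q = B (vertex_class \<Omega> q)"

context char_0_space
begin

definition V_space ::
    "('c gclass \<Rightarrow> 'b set) \<Rightarrow> ('v, 'e, 'd, 'c) complex2 \<Rightarrow> ('v, 'b, 'k) formal set set" where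
  "V_space B \<Omega> = tensor_space (vertices \<Omega>) (vertex_space B \<Omega>)"

definition V_class ::
    "('c gclass \<Rightarrow> 'b set) \<Rightarrow> ('v, 'e, 'd, 'c) complex2 \<Rightarrow>
     ('v, 'b, 'k) formal \<Rightarrow> ('v, 'b, 'k) formal set" where
  "V_class B \<Omega> t = tensor_class (vertices \<Omega>) (vertex_space B \<Omega>) t"

definition V_pure ::
    "('c gclass \<Rightarrow> 'b set) \<Rightarrow> ('v, 'e, 'd, 'c) complex2 \<Rightarrow> ('v \<Rightarrow> 'b) \<Rightarrow> ('v, 'b, 'k) formal set" where
  "V_pure B \<Omega> f = V_class B \<Omega> (Poly_Mapping.single (restrict f (vertices \<Omega>)) 1)"

text \<open>The map \<open>\<phi>\<^sub>* : V\<^sub>\<Omega> \<rightarrow> V\<^bsub>\<Omega>'\<^esub>\<close> of an isomorphism with vertex map \<open>fv\<close>.\<close>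
definition iso_push ::
    "('c gclass \<Rightarrow> 'b set) \<Rightarrow> ('v, 'e, 'd, 'c) complex2 \<Rightarrow> ('w, 'f, 'g, 'c) complex2 \<Rightarrow>
     ('v \<Rightarrow> 'w) \<Rightarrow> ('v, 'b, 'k) formal set \<Rightarrow> ('w, 'b, 'k) formal set" where
  "iso_push B \<Omega> \<Omega>' fv T = (\<Union>t\<in>T. V_class B \<Omega>'
     (formal_push (\<lambda>f. \<lambda>q\<in>vertices \<Omega>'. f (inv_into (vertices \<Omega>) fv q)) t))"

text \<open>The product of tensors as an element of \<open>V\<^sub>\<Omega>\<close>, where the vertices of \<open>\<Omega>\<close> are the disjoint
  union of the two index sets.\<close>
definition V_prod ::
    "('c gclass \<Rightarrow> 'b set) \<Rightarrow> ('v + 'w, 'e, 'd, 'c) complex2 \<Rightarrow>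
     ('v, 'b, 'k) formal set \<Rightarrow> ('w, 'b, 'k) formal set \<Rightarrow> ('v + 'w, 'b, 'k) formal set" where
  "V_prod B \<Omega> T U = (\<Union>t\<in>T. \<Union>u\<in>U. V_class B \<Omega> (formal_prod t u))"

end


section \<open>Film Topological Field Theories\<close>

definition nondegenerate_on :: "'x::zero set \<Rightarrow> 'y::zero set \<Rightarrow> ('x \<Rightarrow> 'y \<Rightarrow> 'k::zero) \<Rightarrow> bool" where
  "nondegenerate_on X Y \<beta> \<longleftrightarrow>
     (\<forall>x\<in>X. (\<forall>y\<in>Y. \<beta> x y = 0) \<longrightarrow> x = 0) \<and> (\<forall>y\<in>Y. (\<forall>x\<in>X. \<beta> x y = 0) \<longrightarrow> y = 0)"

text \<open>All \<open>B\<^sub>\<sigma>\<close> are realized as subspaces of one ambient vector space, whose only role is to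
  provide a type; no relation between the subspaces is assumed.\<close>
locale graph_graded_space = char_0_space scale
  for scale :: "'k::field_char_0 \<Rightarrow> 'b::ab_group_add \<Rightarrow> 'b" (infixr \<open>*s\<close> 75) +
  fixes S :: "'c set"
    and B :: "'c gclass \<Rightarrow> 'b set"
  assumes subspace_B: "\<sigma> \<in> Sigma_classes S \<Longrightarrow> subspace (B \<sigma>)"
    and finite_dim_B: "\<sigma> \<in> Sigma_classes S \<Longrightarrow> \<exists>F. finite F \<and> span F = B \<sigma>"

text \<open>
  \<open>K \<sigma> \<in> B\<^sub>\<sigma> \<otimes> B\<^bsub>\<sigma>*\<^esub>\<close> is indexed by \<open>True\<close> (for the factor at \<open>q\<^sub>+\<close>) and \<open>False\<close> (at \<open>q\<^sub>-\<close>).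
  A cut morphism (resp. disjoint union) leads to the explicit complex \<open>cut_complex\<close>
  (resp. \<open>disjoint_union\<close>) and from there by an isomorphism to a complex labelled by natural
  numbers. As \<open>A\<close> and \<open>B'\<close> may be exchanged in \<open>graph_cut\<close>, either of the two new points may be
  called \<open>q\<^sub>+\<close>.
\<close>
locale film_TFT = graph_graded_space scale S B
  for scale :: "'k::field_char_0 \<Rightarrow> 'b::ab_group_add \<Rightarrow> 'b" (infixr \<open>*s\<close> 75)
    and S :: "'c set" and B :: "'c gclass \<Rightarrow> 'b set" +
  fixes K :: "'c gclass \<Rightarrow> (bool, 'b, 'k) formal set"
    and \<Phi> :: "'c surface \<Rightarrow> (nat, 'b, 'k) formal set \<Rightarrow> 'k"
  assumes K_in: "\<sigma> \<in> Sigma_classes S \<Longrightarrow>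
      K \<sigma> \<in> tensor_space UNIV (\<lambda>s. if s then B \<sigma> else B (dual \<sigma>))"
    and linear_form: "film_surface S \<Omega> \<Longrightarrow>
      tensor_linear_form (vertices \<Omega>) (vertex_space B \<Omega>) (\<Phi> \<Omega>)"
    and isomorphism: "\<lbrakk>film_surface S \<Omega>; film_surface S \<Omega>'; complex_iso fv fe fd \<Omega> \<Omega>';
        x \<in> V_space B \<Omega>\<rbrakk> \<Longrightarrow>
      \<Phi> \<Omega>' (iso_push B \<Omega> \<Omega>' fv x) = \<Phi> \<Omega> x"
    and nondegenerate: "\<lbrakk>film_surface S \<Omega>; vertices \<Omega> = {q1, q2}; q1 \<noteq> q2;
        \<sigma> = vertex_class \<Omega> q1\<rbrakk> \<Longrightarrow>
      nondegenerate_on (B \<sigma>) (B (dual \<sigma>)) (\<lambda>x' x''. \<Phi> \<Omega> (V_pure B \<Omega> (undefined(q1 := x', q2 := x''))))"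
    and cut: "\<lbrakk>film_surface S \<Omega>; connected_complex \<Omega>; graph_cut \<Omega> \<gamma> A B'; film_surface S \<Omega>';
        complex_iso gv ge gd (cut_complex \<Omega> A B') \<Omega>'; x \<in> V_space B \<Omega>;
        \<sigma> = vertex_class (cut_complex \<Omega> A B') (Inr True)\<rbrakk> \<Longrightarrow>
      \<Phi> \<Omega>' (iso_push B (cut_complex \<Omega> A B') \<Omega>' gv (V_prod B (cut_complex \<Omega> A B') x (K \<sigma>))) = \<Phi> \<Omega> x"
    and multiplicative: "\<lbrakk>film_surface S \<Omega>'; film_surface S \<Omega>''; film_surface S \<Omega>;
        complex_iso kv ke kd (disjoint_union \<Omega>' \<Omega>'') \<Omega>;
        x' \<in> V_space B \<Omega>'; x'' \<in> V_space B \<Omega>''\<rbrakk> \<Longrightarrow>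
      \<Phi> \<Omega> (iso_push B (disjoint_union \<Omega>' \<Omega>'') \<Omega> kv (V_prod B (disjoint_union \<Omega>' \<Omega>'') x' x'')) =
        \<Phi> \<Omega>' x' * \<Phi> \<Omega>'' x''"


section \<open>Graph-Frobenius algebras\<close>

context char_0_space
begin

definition is_basis :: "'b set \<Rightarrow> nat \<Rightarrow> (nat \<Rightarrow> 'b) \<Rightarrow> bool" where
  "is_basis W n b \<longleftrightarrow>
     inj_on b {..<n} \<and> independent (b ` {..<n}) \<and> span (b ` {..<n}) = W"

end

text \<open>\<open>B\<^sub>\<star>\<close> as the set of finitely supported families, with the embedding of \<open>B\<^sub>\<sigma>\<close>.\<close>
definition B_star :: "'c set \<Rightarrow> ('c gclass \<Rightarrow> 'b set) \<Rightarrow> ('c gclass \<Rightarrow> 'b::zero) set" where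
  "B_star S B = {x. (\<forall>\<sigma>\<in>Sigma_classes S. x \<sigma> \<in> B \<sigma>) \<and> (\<forall>\<sigma>. \<sigma> \<notin> Sigma_classes S \<longrightarrow> x \<sigma> = 0) \<and>
     finite {\<sigma>. x \<sigma> \<noteq> 0}}"

definition emb :: "'c gclass \<Rightarrow> 'b::zero \<Rightarrow> 'c gclass \<Rightarrow> 'b" where
  "emb \<sigma> x = (\<lambda>_. 0)(\<sigma> := x)"

context graph_graded_space
begin

definition star_linear :: "(('c gclass \<Rightarrow> 'b) \<Rightarrow> 'k) \<Rightarrow> bool" where
  "star_linear L \<longleftrightarrow>
     (\<forall>x\<in>B_star S B. \<forall>y\<in>B_star S B. L (\<lambda>\<sigma>. x \<sigma> + y \<sigma>) = L x + L y) \<and>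
     (\<forall>a. \<forall>x\<in>B_star S B. L (\<lambda>\<sigma>. a *s x \<sigma>) = a * L x)"

text \<open>\<open>F i j\<close> is the inverse, indexed as in the associativity axiom, of the matrix of the
  pairing between the bases \<open>b\<close> of \<open>B\<^sub>\<sigma>\<close> and \<open>b'\<close> of \<open>B\<^bsub>\<sigma>*\<^esub>\<close>.\<close>
definition dual_bases ::
    "(('c gclass \<Rightarrow> 'b) \<Rightarrow> ('c gclass \<Rightarrow> 'b) \<Rightarrow> 'k) \<Rightarrow> 'c gclass \<Rightarrow>
     nat \<Rightarrow> (nat \<Rightarrow> 'b) \<Rightarrow> (nat \<Rightarrow> 'b) \<Rightarrow> (nat \<Rightarrow> nat \<Rightarrow> 'k) \<Rightarrow> bool" where
  "dual_bases bil \<sigma> n b b' F \<longleftrightarrow>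
     is_basis (B \<sigma>) n b \<and> is_basis (B (dual \<sigma>)) n b' \<and>
     (\<forall>j<n. \<forall>l<n. (\<Sum>i<n. F i j * bil (emb \<sigma> (b i)) (emb (dual \<sigma>) (b' l))) =
        (if j = l then 1 else 0))"

end

locale graph_Frobenius_algebra = graph_graded_space scale S B
  for scale :: "'k::field_char_0 \<Rightarrow> 'b::ab_group_add \<Rightarrow> 'b" (infixr \<open>*s\<close> 75)
    and S :: "'c set" and B :: "'c gclass \<Rightarrow> 'b set" +
  fixes bil :: "('c gclass \<Rightarrow> 'b) \<Rightarrow> ('c gclass \<Rightarrow> 'b) \<Rightarrow> 'k"
    and tri :: "('c gclass \<Rightarrow> 'b) \<Rightarrow> ('c gclass \<Rightarrow> 'b) \<Rightarrow> ('c gclass \<Rightarrow> 'b) \<Rightarrow> 'k"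
  assumes bilinear: "\<lbrakk>x \<in> B_star S B; y \<in> B_star S B\<rbrakk> \<Longrightarrow>
      star_linear (\<lambda>u. bil u y) \<and> star_linear (\<lambda>u. bil x u)"
    and trilinear: "\<lbrakk>x \<in> B_star S B; y \<in> B_star S B; z \<in> B_star S B\<rbrakk> \<Longrightarrow>
      star_linear (\<lambda>u. tri u y z) \<and> star_linear (\<lambda>u. tri x u z) \<and> star_linear (\<lambda>u. tri x y u)"
    and bil_eq_0: "\<lbrakk>\<sigma>1 \<in> Sigma_classes S; \<sigma>2 \<in> Sigma_classes S; \<sigma>1 \<noteq> dual \<sigma>2;
        x1 \<in> B \<sigma>1; x2 \<in> B \<sigma>2\<rbrakk> \<Longrightarrow>
      bil (emb \<sigma>1 x1) (emb \<sigma>2 x2) = 0"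
    and nondegenerate: "x \<in> B_star S B \<Longrightarrow>
      ((\<forall>y\<in>B_star S B. bil x y = 0) \<longrightarrow> (\<forall>\<sigma>. x \<sigma> = 0)) \<and>
      ((\<forall>y\<in>B_star S B. bil y x = 0) \<longrightarrow> (\<forall>\<sigma>. x \<sigma> = 0))"
    and tri_eq_0: "\<lbrakk>\<sigma>1 \<in> Sigma_classes S; \<sigma>2 \<in> Sigma_classes S; \<sigma>3 \<in> Sigma_classes S;
        surfaces S [\<sigma>1, \<sigma>2, \<sigma>3] = {}; x1 \<in> B \<sigma>1; x2 \<in> B \<sigma>2; x3 \<in> B \<sigma>3\<rbrakk> \<Longrightarrow>
      tri (emb \<sigma>1 x1) (emb \<sigma>2 x2) (emb \<sigma>3 x3) = 0"
    and associativity: "\<lbrakk>\<sigma>1 \<in> Sigma_classes S; \<sigma>2 \<in> Sigma_classes S;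
        \<sigma>3 \<in> Sigma_classes S; \<sigma>4 \<in> Sigma_classes S; surfaces S [\<sigma>1, \<sigma>2, \<sigma>3, \<sigma>4] \<noteq> {};
        x1 \<in> B \<sigma>1; x2 \<in> B \<sigma>2; x3 \<in> B \<sigma>3; x4 \<in> B \<sigma>4;
        \<sigma> = cut_class S \<sigma>1 \<sigma>2 \<sigma>3 \<sigma>4; dual_bases bil \<sigma> m b b' F;
        \<tau> = cut_class S \<sigma>4 \<sigma>1 \<sigma>2 \<sigma>3; dual_bases bil \<tau> n c c' G\<rbrakk> \<Longrightarrow>
      (\<Sum>i<m. \<Sum>j<m. tri (emb \<sigma>1 x1) (emb \<sigma>2 x2) (emb \<sigma> (b i)) * F i j *
          tri (emb (dual \<sigma>) (b' j)) (emb \<sigma>3 x3) (emb \<sigma>4 x4)) =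
      (\<Sum>i<n. \<Sum>j<n. tri (emb \<sigma>4 x4) (emb \<sigma>1 x1) (emb \<tau> (c i)) * G i j *
          tri (emb (dual \<tau>) (c' j)) (emb \<sigma>2 x2) (emb \<sigma>3 x3))"


section \<open>The forms of a Film Topological Field Theory\<close>

context char_0_space
begin

text \<open>\<open>\<Phi>\<^bsub>\<Omega>(\<sigma>\<^sub>1,\<dots>,\<sigma>\<^sub>n)\<^esub>(x\<^sub>1 \<otimes> \<dots> \<otimes> x\<^sub>n)\<close> with \<open>x\<^sub>i\<close> placed at the \<open>i\<close>-th vertex, or \<open>0\<close> if
  there is no such surface.\<close>
definition correlator ::
    "'c set \<Rightarrow> ('c gclass \<Rightarrow> 'b set) \<Rightarrow> ('c surface \<Rightarrow> (nat, 'b, 'k) formal set \<Rightarrow> 'k) \<Rightarrow>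
     'c gclass list \<Rightarrow> 'b list \<Rightarrow> 'k" where
  "correlator S B \<Phi> \<sigma>s xs =
     (if surfaces S \<sigma>s = {} then 0
      else let (\<Omega>, qs) = (SOME p. p \<in> surfaces S \<sigma>s)
           in \<Phi> \<Omega> (V_pure B \<Omega> (the \<circ> map_of (zip qs xs))))"

definition TFT_bilinear ::
    "'c set \<Rightarrow> ('c gclass \<Rightarrow> 'b set) \<Rightarrow> ('c surface \<Rightarrow> (nat, 'b, 'k) formal set \<Rightarrow> 'k) \<Rightarrow>
     ('c gclass \<Rightarrow> 'b) \<Rightarrow> ('c gclass \<Rightarrow> 'b) \<Rightarrow> 'k" where
  "TFT_bilinear S B \<Phi> x y =
     (\<Sum>\<sigma>1 | x \<sigma>1 \<noteq> 0. \<Sum>\<sigma>2 | y \<sigma>2 \<noteq> 0. correlator S B \<Phi> [\<sigma>1, \<sigma>2] [x \<sigma>1, y \<sigma>2])"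

definition TFT_trilinear ::
    "'c set \<Rightarrow> ('c gclass \<Rightarrow> 'b set) \<Rightarrow> ('c surface \<Rightarrow> (nat, 'b, 'k) formal set \<Rightarrow> 'k) \<Rightarrow>
     ('c gclass \<Rightarrow> 'b) \<Rightarrow> ('c gclass \<Rightarrow> 'b) \<Rightarrow> ('c gclass \<Rightarrow> 'b) \<Rightarrow> 'k" where
  "TFT_trilinear S B \<Phi> x y z =
     (\<Sum>\<sigma>1 | x \<sigma>1 \<noteq> 0. \<Sum>\<sigma>2 | y \<sigma>2 \<noteq> 0. \<Sum>\<sigma>3 | z \<sigma>3 \<noteq> 0.
        correlator S B \<Phi> [\<sigma>1, \<sigma>2, \<sigma>3] [x \<sigma>1, y \<sigma>2, z \<sigma>3])"

end

end

theory Submission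
  imports Defs "HOL-Library.Countable"
begin

text \<open>
  A correlator is the value of \<open>\<Phi>\<close> on the surface \<open>\<Omega>(\<sigma>\<^sub>1,\<dots>,\<sigma>\<^sub>n)\<close>. It does not depend on the representing
  surface because the vertex graphs determine how the sides of the disks are glued along the edges. Cutting
  the surface with four vertices into two surfaces with three vertices expresses its correlator as
  a contraction of two trilinear forms with \<open>K\<^sub>\<sigma>\<close>. Cutting the surface with two vertices in the same way
  shows that \<open>K\<^sub>\<sigma>\<close> is inverse to the pairing of \<open>B\<^sub>\<sigma>\<close> with \<open>B\<^bsub>\<sigma>*\<^esub>\<close>, so that the contraction is the one with the matrix
  \<open>F\<close> of any pair of bases. Associativity compares two cuts of one surface with four vertices,
  the second being the first up to a rotation of the cyclic order of the vertices. Non-degeneracy requires every class \<open>\<sigma>\<close> to be a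
  vertex graph of some surface with two vertices; such a surface is the suspension of the graph.
\<close>

text \<open>A cyclic complex has some graph \<open>\<gamma>\<close> for each division of its
  vertices. Such a \<open>\<gamma>\<close> has no freedom: its vertices must be exactly the edges
  joining the two groups. Hence the existence of a graph-cut is a property of the division alone
  (\<open>cut_ok\<close>). To show that the pieces of a cut are film surfaces again, one pulls the
  divisions of a piece back along the map contracting what lies beyond the cut. Colours turn gluing
  into data: a disk is named by its colour, and a side of it at a vertex by the colour and a truth
  value. A vertex class becomes a relation between such sides, and reversing orientations negates
  the truth values. In the associativity law the intermediate class is given by a definite
  description, so its uniqueness has to be proved. Two vertex classes and merely the colours of the
  third determine a surface with three vertices, which reduces the question to colours. Boundary
  words matter only up to rotation and are therefore replaced by their sets of steps. Complexes
  obtained by cutting have sum and product types as labels and are carried to natural numbers by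
  \<open>to_nat\<close>.\<close>

section \<open>Coloured graphs and their isomorphism classes\<close>

text \<open>Connectedness of a hypergraph. It applies to graphs as well as to the vertices of a graph-cut, where the
  hyperedges are the sets of edges of the complex that a disk meets.\<close>
definition hconn :: "'a set \<Rightarrow> 'a set set \<Rightarrow> bool" where
  "hconn V E \<longleftrightarrow> V \<noteq> {} \<and> (\<forall>U\<subseteq>V. U \<noteq> {} \<and> (\<forall>e\<in>E. e \<inter> U \<noteq> {} \<longrightarrow> e \<subseteq> U) \<longrightarrow> U = V)"

lemma hconnD:
  assumes "hconn V E" "U \<subseteq> V" "U \<noteq> {}" "\<And>e. e \<in> E \<Longrightarrow> e \<inter> U \<noteq> {} \<Longrightarrow> e \<subseteq> U"
  shows "U = V"
  using assms unfolding hconn_def by blast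

text \<open>The preimage of a closed set of vertices is closed. Allowing \<open>f x = f y\<close>
  covers contractions, where a hyperedge may shrink to a point and vanish; linking only pairs covers
  the passage between the blocks cut out by disks and the arcs of a graph.\<close>

lemma hconn_image:
  assumes h: "hconn V E" and sub: "\<And>e. e \<in> E \<Longrightarrow> e \<subseteq> V"
    and link: "\<And>e x y. e \<in> E \<Longrightarrow> x \<in> e \<Longrightarrow> y \<in> e \<Longrightarrow> f x = f y \<or> (\<exists>e'\<in>E'. f x \<in> e' \<and> f y \<in> e')"
  shows "hconn (f ` V) E'"
  unfolding hconn_def
proof (intro conjI allI impI)
  show "f ` V \<noteq> {}" using h by (auto simp: hconn_def)
  fix U' assume U': "U' \<subseteq> f ` V" "U' \<noteq> {} \<and> (\<forall>e\<in>E'. e \<inter> U' \<noteq> {} \<longrightarrow> e \<subseteq> U')"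
  have "{v\<in>V. f v \<in> U'} = V"
  proof (rule hconnD[OF h])
    obtain u where "u \<in> U'" using U'(2) by blast
    with U'(1) obtain v where "v \<in> V" "f v \<in> U'" by auto
    then show "{v\<in>V. f v \<in> U'} \<noteq> {}" by blast
    fix e assume e: "e \<in> E" "e \<inter> {v\<in>V. f v \<in> U'} \<noteq> {}"
    then obtain x where x: "x \<in> e" "f x \<in> U'" by blast
    show "e \<subseteq> {v\<in>V. f v \<in> U'}"
    proof
      fix y assume y: "y \<in> e"
      have "f y \<in> U'" using link[OF e(1) x(1) y]
      proof
        assume "\<exists>e'\<in>E'. f x \<in> e' \<and> f y \<in> e'"
        then obtain e' where e': "e' \<in> E'" "f x \<in> e'" "f y \<in> e'" by blast
        then have "e' \<inter> U' \<noteq> {}" using x by blast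
        then have "e' \<subseteq> U'" using U' e' by blast
        then show ?thesis using e' by blast
      qed (use x in simp)
      then show "y \<in> {v\<in>V. f v \<in> U'}" using sub[OF e(1)] y by auto
    qed
  qed auto
  then have "f ` V \<subseteq> U'" by blast
  then show "U' = f ` V" using U'(1) by (rule subset_antisym[rotated])
qed

lemma hconn_mono:
  assumes "hconn V E" "\<And>e. e \<in> E \<Longrightarrow> e \<subseteq> V"
    and "\<And>e x y. e \<in> E \<Longrightarrow> x \<in> e \<Longrightarrow> y \<in> e \<Longrightarrow> x = y \<or> (\<exists>e'\<in>E'. x \<in> e' \<and> y \<in> e')"
  shows "hconn V E'"
  using hconn_image[of V E "\<lambda>x. x" E'] assms by auto

lemma hconn_singleton [simp]: "hconn {x} E"
  unfolding hconn_def by auto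

text \<open>A closed set contains everything reachable from its members through the symmetric
  closure; conversely, the set of vertices reachable from a given one is closed.\<close>

lemma connected_iff_hconn:
  assumes wf: "wf_digraph G"
  shows "Digraph_Component.connected G \<longleftrightarrow> hconn (verts G) ((\<lambda>a. {tail G a, head G a}) ` arcs G)"
proof
  interpret wf_digraph G by (rule wf)
  assume c: "Digraph_Component.connected G"
  show "hconn (verts G) ((\<lambda>a. {tail G a, head G a}) ` arcs G)"
    unfolding hconn_def
  proof (intro conjI allI impI)
    show "verts G \<noteq> {}" using c by (auto simp: connected_def strongly_connected_def)
    fix U assume U: "U \<subseteq> verts G"
      "U \<noteq> {} \<and> (\<forall>e\<in>(\<lambda>a. {tail G a, head G a}) ` arcs G. e \<inter> U \<noteq> {} \<longrightarrow> e \<subseteq> U)"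
    then obtain u where u: "u \<in> U" by blast
    have "v \<in> U" if "v \<in> verts G" for v
    proof -
      have "u \<rightarrow>\<^sup>*\<^bsub>with_proj (mk_symmetric G)\<^esub> v"
        using c u U that by (auto simp: connected_def strongly_connected_def)
      then have "(u, v) \<in> (parcs (mk_symmetric G))\<^sup>*"
        by (auto simp: reachable_def dest: rtrancl_on_rtranclI)
      then show ?thesis
      proof (induction rule: rtrancl_induct)
        case base then show ?case using u .
      next
        case (step y z)
        then obtain a where "a \<in> arcs G" "{y, z} = {tail G a, head G a}"
          by (auto simp: parcs_mk_symmetric)
        with step U show ?case by blast
      qed
    qed
    then show "U = verts G" using U by blast
  qed
next
  interpret wf_digraph G by (rule wf)
  interpret S: pair_wf_digraph "mk_symmetric G" ..
  assume h: "hconn (verts G) ((\<lambda>a. {tail G a, head G a}) ` arcs G)"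
  have "u \<rightarrow>\<^sup>*\<^bsub>with_proj (mk_symmetric G)\<^esub> v" if u: "u \<in> verts G" and v: "v \<in> verts G" for u v
  proof -
    have "{v \<in> verts G. u \<rightarrow>\<^sup>*\<^bsub>with_proj (mk_symmetric G)\<^esub> v} = verts G"
    proof (rule hconnD[OF h])
      show "{v \<in> verts G. u \<rightarrow>\<^sup>*\<^bsub>with_proj (mk_symmetric G)\<^esub> v} \<noteq> {}" using u
        by (auto intro!: exI[of _ u])
      fix e assume e: "e \<in> (\<lambda>a. {tail G a, head G a}) ` arcs G"
        "e \<inter> {v \<in> verts G. u \<rightarrow>\<^sup>*\<^bsub>with_proj (mk_symmetric G)\<^esub> v} \<noteq> {}"
      then obtain a where a: "a \<in> arcs G" "e = {tail G a, head G a}" by blast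
      then have "(tail G a, head G a) \<in> parcs (mk_symmetric G)" "(head G a, tail G a) \<in> parcs (mk_symmetric G)"
        by (auto simp: parcs_mk_symmetric)
      then show "e \<subseteq> {v \<in> verts G. u \<rightarrow>\<^sup>*\<^bsub>with_proj (mk_symmetric G)\<^esub> v}"
        using e a by (auto intro: S.reachable_adj_trans)
    qed auto
    then show ?thesis using v by blast
  qed
  then show "Digraph_Component.connected G"
    using h by (auto simp: connected_def strongly_connected_def hconn_def)
qed

text \<open>A truth value names the end, \<open>True\<close> being the head, so that both ends are
  treated alike and the reversal of an arc becomes negation.\<close>

definition arc_end :: "('v, 'a) pre_digraph \<Rightarrow> 'a \<Rightarrow> bool \<Rightarrow> 'v" where
  "arc_end G a s = (if s then head G a else tail G a)"

text \<open>As colours name the arcs, a vertex is known by the coloured arc ends that meet there. Hence this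
  relation determines the coloured graph up to isomorphism.\<close>
definition incidence :: "('v, 'a, 'c) cgraph \<Rightarrow> (('c \<times> bool) \<times> ('c \<times> bool)) set" where
  "incidence X = {((snd X a, s), (snd X b, t)) | a s b t.
     a \<in> arcs (fst X) \<and> b \<in> arcs (fst X) \<and> arc_end (fst X) a s = arc_end (fst X) b t}"

text \<open>This makes \<open>incidence\<close> a complete invariant. It is weaker than regularity,
  so that vertex graphs can be compared before they are known to be connected.\<close>

definition arc_spanned :: "('v, 'a, 'c) cgraph \<Rightarrow> bool" where
  "arc_spanned X \<longleftrightarrow> finite (arcs (fst X)) \<and> inj_on (snd X) (arcs (fst X)) \<and>
     verts (fst X) = {arc_end (fst X) a s | a s. a \<in> arcs (fst X)}"

lemma arc_spanned_wf: "arc_spanned (G, c) \<Longrightarrow> wf_digraph G"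
  unfolding arc_spanned_def arc_end_def wf_digraph_def by auto

lemma cgraph_iso_arc_spanned:
  assumes X: "arc_spanned X" and iso: "cgraph_iso X Y"
  shows "arc_spanned Y" "incidence Y = incidence X"
proof -
  obtain G c H d where XY: "X = (G, c)" "Y = (H, d)" by (cases X, cases Y) auto
  from iso obtain f where f: "pre_digraph.digraph_isomorphism G f" "H = app_iso f G"
    "\<forall>a\<in>arcs G. d (iso_arcs f a) = c a" unfolding cgraph_iso_def XY by auto
  have inj: "inj_on (iso_verts f) (verts G)" "inj_on (iso_arcs f) (arcs G)"
    and ep: "\<And>a s. a \<in> arcs G \<Longrightarrow> arc_end H (iso_arcs f a) s = iso_verts f (arc_end G a s)"
    using f unfolding pre_digraph.digraph_isomorphism_def by (auto simp: arc_end_def)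
  have V: "verts G = {arc_end G a s |a s. a \<in> arcs G}" "inj_on c (arcs G)" "finite (arcs G)"
    using X unfolding arc_spanned_def XY by auto
  have A: "arcs H = iso_arcs f ` arcs G" "verts H = iso_verts f ` verts G" using f by auto
  have "inj_on d (arcs H)" using V(2) f(3) unfolding A inj_on_def by auto
  moreover have "verts H = {arc_end H a s |a s. a \<in> arcs H}"
  proof (intro set_eqI iffI)
    fix v assume "v \<in> verts H"
    then obtain a s where "a \<in> arcs G" "v = iso_verts f (arc_end G a s)" unfolding A V(1) by auto
    then show "v \<in> {arc_end H a s |a s. a \<in> arcs H}" using ep A by (auto intro!: exI[of _ "iso_arcs f a"] exI[of _ s])
  next
    fix v assume "v \<in> {arc_end H a s |a s. a \<in> arcs H}"
    then obtain a s where "a \<in> arcs G" "v = arc_end H (iso_arcs f a) s" unfolding A by auto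
    then show "v \<in> verts H" using ep unfolding A V(1) by auto
  qed
  ultimately show "arc_spanned Y" unfolding arc_spanned_def XY using V(3) by (auto simp: A)
  have eq: "arc_end H (iso_arcs f a) s = arc_end H (iso_arcs f b) t \<longleftrightarrow> arc_end G a s = arc_end G b t"
    if "a \<in> arcs G" "b \<in> arcs G" for a b s t
  proof -
    have "arc_end G a s \<in> verts G" "arc_end G b t \<in> verts G" using that V(1) by auto
    then show ?thesis using inj(1) that by (simp add: ep inj_on_eq_iff)
  qed
  show "incidence Y = incidence X"
  proof (intro set_eqI iffI)
    fix p assume "p \<in> incidence Y"
    then obtain a' b' s t where "p = ((d a', s), (d b', t))"
      "a' \<in> arcs H" "b' \<in> arcs H" "arc_end H a' s = arc_end H b' t"
      unfolding incidence_def XY by auto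
    then obtain a b where "p = ((d (iso_arcs f a), s), (d (iso_arcs f b), t))"
      "a \<in> arcs G" "b \<in> arcs G" "arc_end H (iso_arcs f a) s = arc_end H (iso_arcs f b) t"
      unfolding A by auto
    then show "p \<in> incidence X" unfolding incidence_def XY using f(3) eq by auto
  next
    fix p assume "p \<in> incidence X"
    then obtain a b s t where "p = ((c a, s), (c b, t))"
      "a \<in> arcs G" "b \<in> arcs G" "arc_end G a s = arc_end G b t"
      unfolding incidence_def XY by auto
    then have "p = ((d (iso_arcs f a), s), (d (iso_arcs f b), t))"
      "arc_end H (iso_arcs f a) s = arc_end H (iso_arcs f b) t" "iso_arcs f a \<in> arcs H" "iso_arcs f b \<in> arcs H"
      using f(3) eq by (auto simp: A)
    then show "p \<in> incidence Y" unfolding incidence_def XY by force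
  qed
qed

lemma incidence_colour: "c \<in> snd X ` arcs (fst X) \<longleftrightarrow> ((c, s), (c, s)) \<in> incidence X"
  unfolding incidence_def by auto

lemma incidence_arc_end:
  assumes "inj_on (snd X) (arcs (fst X))" "a \<in> arcs (fst X)" "b \<in> arcs (fst X)"
  shows "((snd X a, s), (snd X b, t)) \<in> incidence X \<longleftrightarrow> arc_end (fst X) a s = arc_end (fst X) b t"
proof
  assume "((snd X a, s), (snd X b, t)) \<in> incidence X"
  then obtain a' b' where *: "snd X a = snd X a'" "snd X b = snd X b'" "a' \<in> arcs (fst X)" "b' \<in> arcs (fst X)"
    "arc_end (fst X) a' s = arc_end (fst X) b' t" unfolding incidence_def by auto
  then have "a' = a" "b' = b" using assms by (auto dest: inj_onD)
  then show "arc_end (fst X) a s = arc_end (fst X) b t" using * by simp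
qed (use assms in \<open>auto simp: incidence_def\<close>)

text \<open>Arcs correspond through their colours. A vertex amounts to the set of arc ends meeting
  there, and equal incidence relations partition the arc ends in the same way.\<close>

lemma arc_spanned_incidence_iso:
  fixes X :: "('v, 'a, 'c) cgraph" and Y :: "('w, 'b, 'c) cgraph"
  assumes X: "arc_spanned X" and Y: "arc_spanned Y" and p: "incidence X = incidence Y"
  shows "cgraph_iso X Y"
proof -
  obtain G c H d where XY: "X = (G, c)" "Y = (H, d)" by (cases X, cases Y) auto
  have VX: "verts G = {arc_end G a s |a s. a \<in> arcs G}" "inj_on c (arcs G)"
    using X unfolding arc_spanned_def XY by auto
  have VY: "verts H = {arc_end H a s |a s. a \<in> arcs H}" "inj_on d (arcs H)"
    using Y unfolding arc_spanned_def XY by auto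
  have col: "c ` arcs G = d ` arcs H" using incidence_colour[of _ X] incidence_colour[of _ Y] p XY by auto
  define fa where "fa a = inv_into (arcs H) d (c a)" for a
  have fa: "fa a \<in> arcs H" "d (fa a) = c a" if "a \<in> arcs G" for a
    using that col unfolding fa_def by (metis imageI inv_into_into, metis f_inv_into_f imageI)
  have fa_surj: "fa ` arcs G = arcs H"
  proof
    show "arcs H \<subseteq> fa ` arcs G"
    proof
      fix b assume b: "b \<in> arcs H"
      then obtain a where "a \<in> arcs G" "c a = d b" using col by (metis image_iff)
      then show "b \<in> fa ` arcs G" using fa VY(2) b by (metis image_iff inj_onD)
    qed
  qed (use fa in auto)
  have eq: "arc_end H (fa a) s = arc_end H (fa b) t \<longleftrightarrow> arc_end G a s = arc_end G b t"
    if "a \<in> arcs G" "b \<in> arcs G" for a b s t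
    using incidence_arc_end[of X a b s t] incidence_arc_end[of Y "fa a" "fa b" s t] that fa p VX VY unfolding XY by auto
  \<comment> \<open>Any arc end at \<open>v\<close> may serve; by \<open>eq\<close> all of them lead
    to the same vertex of \<open>H\<close>.\<close>
  define fv where "fv v = (SOME w. \<exists>a\<in>arcs G. \<exists>s. arc_end G a s = v \<and> w = arc_end H (fa a) s)" for v
  have fv: "fv (arc_end G a s) = arc_end H (fa a) s" if "a \<in> arcs G" for a s
    unfolding fv_def
    by (rule some_equality) (use that eq in auto)
  have fv_inj: "inj_on fv (verts G)"
    unfolding inj_on_def VX(1) using fv eq by auto
  let ?f = "\<lparr>iso_verts = fv, iso_arcs = fa, iso_head = head H, iso_tail = tail H\<rparr>"
  have "pre_digraph.digraph_isomorphism G ?f"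
    unfolding pre_digraph.digraph_isomorphism_def
  proof (intro conjI)
    show "wf_digraph G" using X XY arc_spanned_wf by auto
    show "inj_on (iso_arcs ?f) (arcs G)"
      using fa(2) VX(2) unfolding inj_on_def by simp metis
    show "\<forall>a\<in>arcs G. iso_verts ?f (tail G a) = iso_tail ?f (iso_arcs ?f a) \<and>
      iso_verts ?f (head G a) = iso_head ?f (iso_arcs ?f a)"
      using fv[of _ True] fv[of _ False] by (auto simp: arc_end_def)
  qed (use fv_inj in simp)
  moreover have "verts H = fv ` verts G"
  proof (intro set_eqI iffI)
    fix v assume "v \<in> verts H"
    then obtain a s where "a \<in> arcs G" "v = arc_end H (fa a) s" unfolding VY(1) fa_surj[symmetric] by auto
    moreover from this have "arc_end G a s \<in> verts G" unfolding VX(1) by auto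
    ultimately show "v \<in> fv ` verts G" using fv[of a s] by (metis image_eqI)
  next
    fix v assume "v \<in> fv ` verts G"
    then obtain a s where "a \<in> arcs G" "v = fv (arc_end G a s)" unfolding VX(1) by auto
    then show "v \<in> verts H" using fv[of a s] fa unfolding VY(1) by auto
  qed
  then have "H = app_iso ?f G" using fa_surj by (auto intro!: pre_digraph.equality)
  ultimately show ?thesis unfolding cgraph_iso_def XY using fa by auto
qed

lemma iso_class_conv:
  assumes "arc_spanned X" shows "iso_class X = {Z. arc_spanned Z \<and> incidence Z = incidence X}"
proof -
  have "cgraph_iso X Z \<longleftrightarrow> arc_spanned Z \<and> incidence Z = incidence X" for Z :: "(nat, nat, 'c) cgraph"
    using cgraph_iso_arc_spanned[of X Z] arc_spanned_incidence_iso[of X Z] assms by metis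
  then show ?thesis unfolding iso_class_def by (intro Collect_cong)
qed

text \<open>An isomorphism class collects only graphs labelled by natural numbers, so equality of
  classes would say nothing about \<open>X\<close> if they were empty. A finite graph has a copy
  with such labels.\<close>

lemma iso_class_nonempty:
  fixes X :: "('v, 'a, 'c) cgraph"
  assumes X: "arc_spanned X"
  shows "iso_class X \<noteq> {}"
proof -
  obtain G c where XY: "X = (G, c)" by (cases X) auto
  have VX: "verts G = {arc_end G a s |a s. a \<in> arcs G}" "inj_on c (arcs G)" "finite (arcs G)"
    using X unfolding arc_spanned_def XY by auto
  have "verts G \<subseteq> head G ` arcs G \<union> tail G ` arcs G" unfolding VX arc_end_def by auto
  then have fin: "finite (verts G)" using VX(3) finite_subset by blast
  obtain fv :: "'v \<Rightarrow> nat" where fv: "inj_on fv (verts G)" using finite_imp_inj_to_nat_seg[OF fin] by metis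
  obtain fa :: "'a \<Rightarrow> nat" where fa: "inj_on fa (arcs G)" using finite_imp_inj_to_nat_seg[OF VX(3)] by metis
  let ?f = "\<lparr>iso_verts = fv, iso_arcs = fa, iso_head = fv \<circ> head G \<circ> inv_into (arcs G) fa,
     iso_tail = fv \<circ> tail G \<circ> inv_into (arcs G) fa\<rparr>"
  have "pre_digraph.digraph_isomorphism G ?f"
    unfolding pre_digraph.digraph_isomorphism_def using arc_spanned_wf X fv fa XY by auto
  then have "cgraph_iso X (app_iso ?f G, c \<circ> inv_into (arcs G) fa)"
    unfolding cgraph_iso_def XY using fa by auto
  then show ?thesis unfolding iso_class_def by blast
qed

lemma iso_class_eq_iff:
  assumes "arc_spanned X" "arc_spanned Y"
  shows "iso_class X = iso_class Y \<longleftrightarrow> incidence X = incidence Y"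
  using assms iso_class_nonempty[of X] by (auto simp: iso_class_conv)

section \<open>Reversal of orientations, dual classes and regular graphs\<close>

definition rev_cgraph :: "('v, 'a, 'c) cgraph \<Rightarrow> ('v, 'a, 'c) cgraph" where
  "rev_cgraph X = (reverse_graph (fst X), snd X)"

definition swap_incidence :: "(('c \<times> bool) \<times> ('c \<times> bool)) set \<Rightarrow> (('c \<times> bool) \<times> ('c \<times> bool)) set" where
  "swap_incidence P = {((c, s), (d, t)) | c s d t. ((c, \<not> s), (d, \<not> t)) \<in> P}"

lemma swap_swap [simp]: "swap_incidence (swap_incidence P) = P"
  unfolding swap_incidence_def by auto

lemma rev_rev [simp]: "rev_cgraph (rev_cgraph X) = X"
  unfolding rev_cgraph_def reverse_graph_def by (cases X) auto

lemma arc_end_reverse [simp]: "arc_end (reverse_graph G) a s = arc_end G a (\<not> s)"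
  unfolding arc_end_def reverse_graph_def by auto

lemma rev_cgraph_simps [simp]: "arcs (fst (rev_cgraph X)) = arcs (fst X)" "verts (fst (rev_cgraph X)) = verts (fst X)"
  "snd (rev_cgraph X) = snd X" "arc_end (fst (rev_cgraph X)) a s = arc_end (fst X) a (\<not> s)"
  "head (fst (rev_cgraph X)) = tail (fst X)" "tail (fst (rev_cgraph X)) = head (fst X)"
  unfolding rev_cgraph_def by (auto simp: reverse_graph_def arc_end_def)

lemma incidence_iff: "((c, s), (d, t)) \<in> incidence X \<longleftrightarrow> (\<exists>a\<in>arcs (fst X). \<exists>b\<in>arcs (fst X).
    c = snd X a \<and> d = snd X b \<and> arc_end (fst X) a s = arc_end (fst X) b t)"
  unfolding incidence_def by auto

lemma swap_incidence_iff: "((c, s), (d, t)) \<in> swap_incidence P \<longleftrightarrow> ((c, \<not> s), (d, \<not> t)) \<in> P"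
  unfolding swap_incidence_def by auto

lemma incidence_rev: "incidence (rev_cgraph X) = swap_incidence (incidence X)"
  by (auto simp: incidence_iff swap_incidence_iff)

lemma arc_spanned_rev [simp]: "arc_spanned (rev_cgraph X) = arc_spanned X"
proof -
  have "{arc_end (fst X) a (\<not> s) |a s. a \<in> arcs (fst X)} = {arc_end (fst X) a s |a s. a \<in> arcs (fst X)}"
    by (intro Collect_cong iffI; elim exE conjE; force intro: exI[of _ "\<not> _"])
  then show ?thesis unfolding arc_spanned_def by simp
qed

lemma dual_conv: "dual \<sigma> = rev_cgraph ` \<sigma>"
  unfolding dual_def by (intro image_cong) (auto simp: rev_cgraph_def)

lemma dual_dual [simp]: "dual (dual \<sigma>) = \<sigma>"
  unfolding dual_conv image_image rev_rev by simp

lemma dual_iso_class: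
  fixes X :: "('v, 'a, 'c) cgraph"
  assumes "arc_spanned X" shows "dual (iso_class X) = iso_class (rev_cgraph X)"
proof -
  have "iso_class (rev_cgraph X) = {Z. arc_spanned Z \<and> incidence Z = swap_incidence (incidence X)}"
    using assms by (simp add: iso_class_conv incidence_rev)
  moreover have "dual (iso_class X) = {Z. arc_spanned Z \<and> incidence Z = swap_incidence (incidence X)}"
  proof (intro set_eqI iffI)
    fix Z :: "(nat, nat, 'c) cgraph" assume "Z \<in> {Z. arc_spanned Z \<and> incidence Z = swap_incidence (incidence X)}"
    then have "rev_cgraph Z \<in> iso_class X" using assms by (simp add: iso_class_conv incidence_rev)
    then show "Z \<in> dual (iso_class X)" unfolding dual_conv by (metis image_eqI rev_rev)
  qed (use assms in \<open>auto simp: dual_conv iso_class_conv incidence_rev\<close>)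
  ultimately show ?thesis by simp
qed

text \<open>As there is an arc, the arc ends form a nonempty closed set of vertices, and
  connectedness makes it the whole vertex set; thus a regular graph is spanned by its arcs.\<close>

lemma regular_conv:
  "regular_cgraph S X \<longleftrightarrow> arc_spanned X \<and> (\<forall>a\<in>arcs (fst X). tail (fst X) a \<noteq> head (fst X) a) \<and>
     hconn (verts (fst X)) ((\<lambda>a. {tail (fst X) a, head (fst X) a}) ` arcs (fst X)) \<and>
     arcs (fst X) \<noteq> {} \<and> snd X ` arcs (fst X) \<subseteq> S" (is "?L \<longleftrightarrow> ?R")
proof -
  obtain G c where X: "X = (G, c)" by (cases X) auto
  show ?thesis
  proof
    assume L: ?L
    then interpret fin_digraph G unfolding regular_cgraph_def X by auto
    have lf: "loopfree_digraph G" using L unfolding regular_cgraph_def X by auto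
    have h: "hconn (verts G) ((\<lambda>a. {tail G a, head G a}) ` arcs G)"
      using L connected_iff_hconn[of G] wf_digraph unfolding regular_cgraph_def X by auto
    have ne: "arcs G \<noteq> {}" using L unfolding regular_cgraph_def X by auto
    have sub: "{arc_end G a s |a s. a \<in> arcs G} \<subseteq> verts G" by (auto simp: arc_end_def)
    have "{arc_end G a s |a s. a \<in> arcs G} = verts G"
    proof (rule hconnD[OF h sub])
      fix e assume "e \<in> (\<lambda>a. {tail G a, head G a}) ` arcs G"
      then show "e \<subseteq> {arc_end G a s |a s. a \<in> arcs G}" unfolding arc_end_def by force
    qed (use ne in auto)
    then show ?R using L h ne lf unfolding arc_spanned_def X regular_cgraph_def
      by (auto simp: loopfree_digraph_def loopfree_digraph_axioms_def)
  next
    assume R: ?R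
    then have wf: "wf_digraph G" using arc_spanned_wf X by auto
    have "verts G \<subseteq> head G ` arcs G \<union> tail G ` arcs G" using R unfolding arc_spanned_def X arc_end_def by auto
    then have fin: "finite (verts G)" using R finite_subset unfolding arc_spanned_def X by fastforce
    show ?L using R wf connected_iff_hconn[OF wf] fin unfolding regular_cgraph_def X arc_spanned_def
      by (auto simp: fin_digraph_def fin_digraph_axioms_def loopfree_digraph_def loopfree_digraph_axioms_def)
  qed
qed

lemma regular_rev: "regular_cgraph S (rev_cgraph X) = regular_cgraph S X"
proof -
  have "(\<lambda>a. {head (fst X) a, tail (fst X) a}) = (\<lambda>a. {tail (fst X) a, head (fst X) a})" by auto
  then show ?thesis unfolding regular_conv by simp metis
qed

lemma SigmaE:
  assumes "\<sigma> \<in> Sigma_classes S"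
  obtains X :: "(nat, nat, 'c) cgraph" where "regular_cgraph S X" "arc_spanned X" "\<sigma> = iso_class X"
  using assms unfolding Sigma_classes_def regular_conv by blast

lemma dual_Sigma:
  fixes \<sigma> :: "'c gclass"
  assumes "\<sigma> \<in> Sigma_classes S" shows "dual \<sigma> \<in> Sigma_classes S"
  using assms
proof (rule SigmaE)
  fix X :: "(nat, nat, 'c) cgraph" assume X: "regular_cgraph S X" "arc_spanned X" "\<sigma> = iso_class X"
  then show ?thesis unfolding Sigma_classes_def X(3) dual_iso_class[OF X(2)] using regular_rev by blast
qed

section \<open>Regular complexes\<close>

text \<open>Adding \<open>k * (length w - 1)\<close> rotations to the first \<open>k\<close>
  completes \<open>k\<close> full turns.\<close>

lemma rotate_back: "\<exists>k'. rotate k' (rotate k w) = w"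
proof -
  have "k * (length w - 1) + k = k * length w \<or> w = []" by (cases w) auto
  then have "rotate (k * (length w - 1)) (rotate k w) = w"
    by (auto simp: rotate_rotate rotate_conv_mod[of "k * length w"])
  then show ?thesis by blast
qed

text \<open>The cyclic word as a set of triples (vertex, edge, next vertex). It forgets where the
  list starts, which is the ambiguity inherent in \<open>glue\<close>.\<close>

definition steps :: "('v \<times> 'e) list \<Rightarrow> ('v \<times> 'e \<times> 'v) set" where
  "steps w = (\<lambda>i. (fst (w ! i), snd (w ! i), fst (w ! (Suc i mod length w)))) ` {..<length w}"

lemma steps_rotate [simp]: "steps (rotate k w) = steps w"
proof -
  have sub: "steps (rotate k w) \<subseteq> steps w" for k and w :: "('v \<times> 'e) list"
  proof
    fix x assume "x \<in> steps (rotate k w)"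
    then obtain i where i: "i < length w" "x = (fst (rotate k w ! i), snd (rotate k w ! i),
        fst (rotate k w ! (Suc i mod length w)))" unfolding steps_def by auto
    let ?j = "(k + i) mod length w"
    have l: "length w > 0" using i by auto
    then have "?j < length w" "Suc ?j mod length w = (k + Suc i mod length w) mod length w"
      by (auto simp: mod_simps)
    moreover have "Suc i mod length w < length w" using l by auto
    ultimately show "x \<in> steps w" unfolding steps_def i(2)
      using i(1) by (auto simp: nth_rotate intro!: image_eqI[of _ _ ?j])
  qed
  show ?thesis using sub[of k w] rotate_back[of k w] sub[of _ "rotate k w"] by (metis subset_antisym)
qed

lemma steps_map: "steps (map (map_prod f g) w) = (\<lambda>(v, e, u). (f v, g e, f u)) ` steps w"
  unfolding steps_def image_image length_map
proof (intro image_cong refl)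
  fix i assume "i \<in> {..<length w}"
  then have i: "i < length w" by simp
  then have "Suc i mod length w < length w" by (intro mod_less_divisor) auto
  with i show "(fst (map (map_prod f g) w ! i), snd (map (map_prod f g) w ! i), fst (map (map_prod f g) w ! (Suc i mod length w)))
      = (case (fst (w ! i), snd (w ! i), fst (w ! (Suc i mod length w))) of (v, e, u) \<Rightarrow> (f v, g e, f u))" by simp
qed

lemma steps_exhaust:
  shows "(v, e) \<in> set w \<longleftrightarrow> (\<exists>u. (v, e, u) \<in> steps w)"
    and "u \<in> fst ` set w \<longleftrightarrow> (\<exists>v e. (v, e, u) \<in> steps w)"
    and "(v, e, u) \<in> steps w \<Longrightarrow> v \<in> fst ` set w \<and> e \<in> snd ` set w \<and> u \<in> fst ` set w"
proof -
  show "(v, e) \<in> set w \<longleftrightarrow> (\<exists>u. (v, e, u) \<in> steps w)"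
  proof
    assume "(v, e) \<in> set w"
    then obtain i where "i < length w" "w ! i = (v, e)" by (auto simp: in_set_conv_nth)
    then show "\<exists>u. (v, e, u) \<in> steps w" unfolding steps_def by (auto intro!: exI image_eqI[of _ _ i])
  next
    assume "\<exists>u. (v, e, u) \<in> steps w"
    then obtain i where "i < length w" "w ! i = (v, e)" unfolding steps_def by auto
    then show "(v, e) \<in> set w" using nth_mem by metis
  qed
  show a: "(v, e, u) \<in> steps w \<Longrightarrow> v \<in> fst ` set w \<and> e \<in> snd ` set w \<and> u \<in> fst ` set w" for v e u
  proof -
    assume "(v, e, u) \<in> steps w"
    then obtain i where i: "i < length w" "v = fst (w ! i)" "e = snd (w ! i)" "u = fst (w ! (Suc i mod length w))"
      unfolding steps_def by auto
    then have "Suc i mod length w < length w" by (intro mod_less_divisor) auto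
    then show ?thesis using i by auto
  qed
  show "u \<in> fst ` set w \<longleftrightarrow> (\<exists>v e. (v, e, u) \<in> steps w)"
  proof
    assume "u \<in> fst ` set w"
    then obtain i where i: "i < length w" "u = fst (w ! i)" by (auto simp: in_set_conv_nth)
    let ?j = "(i + (length w - 1)) mod length w"
    have j: "?j < length w" using i by (intro mod_less_divisor) auto
    have "Suc ?j mod length w = Suc (i + (length w - 1)) mod length w" by (rule mod_Suc_eq)
    also have "Suc (i + (length w - 1)) = i + length w" using i by linarith
    finally have "Suc ?j mod length w = i" using i by simp
    then have "(fst (w ! ?j), snd (w ! ?j), u) \<in> steps w" unfolding steps_def using j i by auto
    then show "\<exists>v e. (v, e, u) \<in> steps w" by blast
  qed (use a in blast)
qed

text \<open>Each vertex and each edge occurs once on the boundary circle, and the cyclic successor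
  is injective on positions, so any one component identifies the position.\<close>

lemma steps_unique:
  assumes "distinct (map fst w)" "distinct (map snd w)" "(v, e, u) \<in> steps w" "(v', e', u') \<in> steps w"
    and "v = v' \<or> e = e' \<or> u = u'"
  shows "v = v' \<and> e = e' \<and> u = u'"
proof -
  from assms obtain i where i: "i < length w" "v = fst (w ! i)" "e = snd (w ! i)" "u = fst (w ! (Suc i mod length w))"
    unfolding steps_def by auto
  from assms obtain j where j: "j < length w" "v' = fst (w ! j)" "e' = snd (w ! j)" "u' = fst (w ! (Suc j mod length w))"
    unfolding steps_def by auto
  have l: "length w > 0" using i by auto
  from assms(5) have "i = j"
  proof (elim disjE)
    assume "v = v'" then show ?thesis using i j nth_eq_iff_index_eq[OF assms(1), of i j] by auto
  next
    assume "e = e'" then show ?thesis using i j nth_eq_iff_index_eq[OF assms(2), of i j] by auto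
  next
    assume "u = u'"
    then have "Suc i mod length w = Suc j mod length w"
      using i j l nth_eq_iff_index_eq[OF assms(1), of "Suc i mod length w" "Suc j mod length w"] by auto
    then show ?thesis using i(1) j(1) by (auto simp: mod_Suc split: if_splits)
  qed
  then show ?thesis using i j by simp
qed

definition disk_ok :: "'v set \<Rightarrow> 'e set \<Rightarrow> ('e \<Rightarrow> 'v set) \<Rightarrow> ('v \<times> 'e) list \<Rightarrow> bool" where
  "disk_ok V E en w \<longleftrightarrow> w \<noteq> [] \<and> distinct (map fst w) \<and> distinct (map snd w) \<and> set w \<subseteq> V \<times> E \<and>
     (\<forall>(v, e, u) \<in> steps w. en e = {v, u})"

lemma regular_complex_conv:
  fixes \<Omega> :: "('v, 'e, 'd, 'c) complex2"
  shows
  "regular_complex \<Omega> \<longleftrightarrow>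
     finite (vertices \<Omega>) \<and> finite (edges \<Omega>) \<and> finite (disks \<Omega>) \<and>
     (\<forall>e\<in>edges \<Omega>. ends \<Omega> e \<subseteq> vertices \<Omega> \<and> card (ends \<Omega> e) = 2) \<and>
     (\<forall>d\<in>disks \<Omega>. disk_ok (vertices \<Omega>) (edges \<Omega>) (ends \<Omega>) (glue \<Omega> d)) \<and>
     (\<Union>d\<in>disks \<Omega>. disk_edges \<Omega> d) = edges \<Omega> \<and>
     (\<Union>d\<in>disks \<Omega>. disk_verts \<Omega> d) = vertices \<Omega>"
proof -
  have "(\<forall>i<length w. en (snd (w ! i)) = {fst (w ! i), fst (w ! (Suc i mod length w))}) \<longleftrightarrow>
     (\<forall>(v, e, u) \<in> steps w. en e = {v, u})" for w :: "('v \<times> 'e) list" and en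
    unfolding steps_def by auto
  then show ?thesis unfolding regular_complex_def disk_ok_def Let_def by simp
qed

definition disk_step :: "('v, 'e, 'd, 'c) complex2 \<Rightarrow> 'd \<Rightarrow> 'v \<Rightarrow> 'e \<Rightarrow> 'v \<Rightarrow> bool" where
  "disk_step \<Omega> d v e u \<longleftrightarrow> (v, e, u) \<in> steps (glue \<Omega> d)"

text \<open>The edge along which \<open>\<partial>d\<close> leaves (\<open>s\<close>) or reaches (\<open>\<not> s\<close>) the vertex \<open>q\<close>, that is, the head or the tail
  of \<open>d\<close> in the vertex graph.\<close>
definition corner_edge :: "('v, 'e, 'd, 'c) complex2 \<Rightarrow> 'd \<Rightarrow> 'v \<Rightarrow> bool \<Rightarrow> 'e \<Rightarrow> bool" where
  "corner_edge \<Omega> d q s e \<longleftrightarrow> (if s then \<exists>u. disk_step \<Omega> d q e u else \<exists>p. disk_step \<Omega> d p e q)"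

lemma disk_step_exists:
  shows "v \<in> disk_verts \<Omega> d \<Longrightarrow> \<exists>e u. disk_step \<Omega> d v e u"
    and "u \<in> disk_verts \<Omega> d \<Longrightarrow> \<exists>v e. disk_step \<Omega> d v e u"
    and "e \<in> disk_edges \<Omega> d \<Longrightarrow> \<exists>v u. disk_step \<Omega> d v e u"
  unfolding disk_step_def disk_verts_def disk_edges_def using steps_exhaust(1)[of _ _ "glue \<Omega> d"]
  by (force, use steps_exhaust(2)[of u "glue \<Omega> d"] in blast, force)

lemma disk_step_mem:
  assumes "disk_step \<Omega> d v e u"
  shows "v \<in> disk_verts \<Omega> d" "u \<in> disk_verts \<Omega> d" "e \<in> disk_edges \<Omega> d"
  using steps_exhaust(3)[of v e u "glue \<Omega> d"] assms
  unfolding disk_step_def disk_verts_def disk_edges_def by auto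

locale regular_cx =
  fixes \<Omega> :: "('v, 'e, 'd, 'c) complex2"
  assumes regular: "regular_complex \<Omega>"
begin

lemma finite_cells: "finite (vertices \<Omega>)" "finite (edges \<Omega>)" "finite (disks \<Omega>)"
  using regular by (auto simp: regular_complex_conv)

lemma ends_sub: "e \<in> edges \<Omega> \<Longrightarrow> ends \<Omega> e \<subseteq> vertices \<Omega>" "e \<in> edges \<Omega> \<Longrightarrow> card (ends \<Omega> e) = 2"
  using regular by (auto simp: regular_complex_conv)

lemma disk_ok: "d \<in> disks \<Omega> \<Longrightarrow> disk_ok (vertices \<Omega>) (edges \<Omega>) (ends \<Omega>) (glue \<Omega> d)"
  using regular by (auto simp: regular_complex_conv)

lemma edge_disk: "e \<in> edges \<Omega> \<Longrightarrow> \<exists>d\<in>disks \<Omega>. e \<in> disk_edges \<Omega> d"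
  using regular unfolding regular_complex_conv by blast

lemma vertex_disk: "v \<in> vertices \<Omega> \<Longrightarrow> \<exists>d\<in>disks \<Omega>. v \<in> disk_verts \<Omega> d"
  using regular unfolding regular_complex_conv by blast

lemma disk_sub: "d \<in> disks \<Omega> \<Longrightarrow> disk_verts \<Omega> d \<subseteq> vertices \<Omega>" "d \<in> disks \<Omega> \<Longrightarrow> disk_edges \<Omega> d \<subseteq> edges \<Omega>"
  using regular unfolding regular_complex_conv by blast+

lemma disk_step_unique:
  assumes "d \<in> disks \<Omega>" "disk_step \<Omega> d v e u" "disk_step \<Omega> d v' e' u'" "v = v' \<or> e = e' \<or> u = u'"
  shows "v = v'" "e = e'" "u = u'"
  using steps_unique[of "glue \<Omega> d" v e u v' e' u'] disk_ok[OF assms(1)] assms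
  unfolding disk_step_def disk_ok_def by auto

lemma disk_step_ends:
  assumes "d \<in> disks \<Omega>" "disk_step \<Omega> d v e u"
  shows "e \<in> edges \<Omega>" "ends \<Omega> e = {v, u}" "v \<noteq> u" "v \<in> vertices \<Omega>" "u \<in> vertices \<Omega>"
proof -
  show e: "e \<in> edges \<Omega>" using disk_step_mem(3)[OF assms(2)] disk_sub[OF assms(1)] by auto
  show en: "ends \<Omega> e = {v, u}" using disk_ok[OF assms(1)] assms(2) unfolding disk_step_def disk_ok_def by auto
  show "v \<noteq> u" using ends_sub(2)[OF e] en by auto
  show "v \<in> vertices \<Omega>" "u \<in> vertices \<Omega>" using ends_sub(1)[OF e] en by auto
qed

lemma corner_edge_exists: "d \<in> disks \<Omega> \<Longrightarrow> q \<in> disk_verts \<Omega> d \<Longrightarrow> \<exists>e. corner_edge \<Omega> d q s e"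
  using disk_step_exists(1)[of q \<Omega> d] disk_step_exists(2)[of q \<Omega> d] unfolding corner_edge_def by auto

lemma corner_edge_unique: "d \<in> disks \<Omega> \<Longrightarrow> corner_edge \<Omega> d q s e \<Longrightarrow> corner_edge \<Omega> d q s e' \<Longrightarrow> e = e'"
  unfolding corner_edge_def using disk_step_unique(2) by (metis (full_types))

lemma corner_edge_mem:
  assumes "d \<in> disks \<Omega>" "corner_edge \<Omega> d q s e"
  shows "e \<in> edges \<Omega>" "q \<in> ends \<Omega> e" "q \<in> disk_verts \<Omega> d" "e \<in> disk_edges \<Omega> d"
proof -
  obtain v u where *: "disk_step \<Omega> d v e u" "q = v \<or> q = u" using assms(2) unfolding corner_edge_def by (auto split: if_splits)
  show "e \<in> edges \<Omega>" "q \<in> ends \<Omega> e" "q \<in> disk_verts \<Omega> d" "e \<in> disk_edges \<Omega> d"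
    using disk_step_ends[OF assms(1) *(1)] disk_step_mem[OF *(1)] *(2) by auto
qed

text \<open>Removes the definite descriptions from \<open>vertex_graph\<close>: each is satisfied by
  a single edge because the boundary of a disk passes through \<open>q\<close> at most once.\<close>

lemma arc_end_vertex_graph:
  assumes d: "d \<in> disks \<Omega>" "q \<in> disk_verts \<Omega> d"
  shows "corner_edge \<Omega> d q s e \<longleftrightarrow> e = arc_end (fst (vertex_graph \<Omega> q)) d s"
proof -
  have 1: "(q, e) \<in> set (glue \<Omega> d) \<longleftrightarrow> corner_edge \<Omega> d q True e" for e
    unfolding corner_edge_def disk_step_def using steps_exhaust(1) by force
  have 2: "(\<exists>p. (p, e) \<in> set (glue \<Omega> d) \<and> ends \<Omega> e = {p, q} \<and> p \<noteq> q) \<longleftrightarrow> corner_edge \<Omega> d q False e" for e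
  proof
    assume "\<exists>p. (p, e) \<in> set (glue \<Omega> d) \<and> ends \<Omega> e = {p, q} \<and> p \<noteq> q"
    then obtain p u where p: "disk_step \<Omega> d p e u" "ends \<Omega> e = {p, q}" "p \<noteq> q"
      unfolding disk_step_def using steps_exhaust(1) by metis
    then have "u = q" using disk_step_ends[OF d(1) p(1)] by (auto simp: doubleton_eq_iff)
    then show "corner_edge \<Omega> d q False e" using p unfolding corner_edge_def by auto
  next
    assume "corner_edge \<Omega> d q False e"
    then obtain p where p: "disk_step \<Omega> d p e q" unfolding corner_edge_def by auto
    then show "\<exists>p. (p, e) \<in> set (glue \<Omega> d) \<and> ends \<Omega> e = {p, q} \<and> p \<noteq> q"
      using disk_step_ends[OF d(1) p] steps_exhaust(1)[of p e "glue \<Omega> d"] unfolding disk_step_def by blast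
  qed
  have "arc_end (fst (vertex_graph \<Omega> q)) d s = (THE e. corner_edge \<Omega> d q s e)"
    unfolding vertex_graph_def arc_end_def using 1 2 by (cases s) auto
  moreover obtain e0 where "corner_edge \<Omega> d q s e0" using corner_edge_exists[OF d] by blast
  ultimately show ?thesis using corner_edge_unique[OF d(1)] by (metis (no_types, lifting) theI)
qed

definition disks_at :: "'v \<Rightarrow> 'd set" where
  "disks_at q = {d \<in> disks \<Omega>. q \<in> disk_verts \<Omega> d}"

text \<open>Since the gluing map is onto, every edge at \<open>q\<close> lies on the boundary of a
  disk, where it is a step into \<open>q\<close> or out of \<open>q\<close>.\<close>

lemma vertex_graph_arc_spanned:
  assumes inj: "inj_on (dcol \<Omega>) (disks_at q)"
  shows "arc_spanned (vertex_graph \<Omega> q)"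
  unfolding arc_spanned_def
proof (intro conjI)
  show "finite (arcs (fst (vertex_graph \<Omega> q)))" using finite_cells by (simp add: vertex_graph_def)
  show "inj_on (snd (vertex_graph \<Omega> q)) (arcs (fst (vertex_graph \<Omega> q)))"
    using inj by (simp add: vertex_graph_def disks_at_def)
  have A: "arcs (fst (vertex_graph \<Omega> q)) = disks_at q" by (simp add: vertex_graph_def disks_at_def)
  show "verts (fst (vertex_graph \<Omega> q)) =
    {arc_end (fst (vertex_graph \<Omega> q)) a s |a s. a \<in> arcs (fst (vertex_graph \<Omega> q))}"
  proof (intro set_eqI iffI)
    fix e assume "e \<in> verts (fst (vertex_graph \<Omega> q))"
    then have e: "e \<in> edges \<Omega>" "q \<in> ends \<Omega> e" by (auto simp: vertex_graph_def)
    then obtain d where d: "d \<in> disks \<Omega>" "e \<in> disk_edges \<Omega> d" using edge_disk by blast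
    then obtain v u where s: "disk_step \<Omega> d v e u" using disk_step_exists(3) by metis
    have "q = v \<or> q = u" using e disk_step_ends[OF d(1) s] by auto
    then obtain s where "corner_edge \<Omega> d q s e" using s unfolding corner_edge_def by (metis (full_types))
    then show "e \<in> {arc_end (fst (vertex_graph \<Omega> q)) a s |a s. a \<in> arcs (fst (vertex_graph \<Omega> q))}"
      using arc_end_vertex_graph d(1) corner_edge_mem unfolding A disks_at_def by blast
  next
    fix e assume "e \<in> {arc_end (fst (vertex_graph \<Omega> q)) a s |a s. a \<in> arcs (fst (vertex_graph \<Omega> q))}"
    then obtain d s where "d \<in> disks \<Omega>" "q \<in> disk_verts \<Omega> d" "corner_edge \<Omega> d q s e"
      using arc_end_vertex_graph unfolding A disks_at_def by blast
    then show "e \<in> verts (fst (vertex_graph \<Omega> q))" using corner_edge_mem by (auto simp: vertex_graph_def)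
  qed
qed

text \<open>Reads a vertex class as gluing data: it records which sides of which coloured disks
  share an edge at \<open>q\<close>.\<close>

lemma vertex_incidence_iff:
  "((c, s), (c', t)) \<in> incidence (vertex_graph \<Omega> q) \<longleftrightarrow>
     (\<exists>d\<in>disks \<Omega>. \<exists>d'\<in>disks \<Omega>. \<exists>e. dcol \<Omega> d = c \<and> dcol \<Omega> d' = c' \<and> corner_edge \<Omega> d q s e \<and> corner_edge \<Omega> d' q t e)"
proof -
  have A: "arcs (fst (vertex_graph \<Omega> q)) = {d \<in> disks \<Omega>. q \<in> disk_verts \<Omega> d}" "snd (vertex_graph \<Omega> q) = dcol \<Omega>"
    by (simp_all add: vertex_graph_def)
  show ?thesis unfolding incidence_iff A
  proof
    assume "\<exists>d\<in>disks \<Omega>. \<exists>d'\<in>disks \<Omega>. \<exists>e. dcol \<Omega> d = c \<and> dcol \<Omega> d' = c' \<and> corner_edge \<Omega> d q s e \<and> corner_edge \<Omega> d' q t e"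
    then obtain d d' e where *: "d \<in> disks \<Omega>" "d' \<in> disks \<Omega>" "dcol \<Omega> d = c" "dcol \<Omega> d' = c'"
      "corner_edge \<Omega> d q s e" "corner_edge \<Omega> d' q t e" by blast
    moreover have "q \<in> disk_verts \<Omega> d" "q \<in> disk_verts \<Omega> d'" using * corner_edge_mem(3) by blast+
    ultimately show "\<exists>a\<in>{d \<in> disks \<Omega>. q \<in> disk_verts \<Omega> d}. \<exists>b\<in>{d \<in> disks \<Omega>. q \<in> disk_verts \<Omega> d}.
      c = dcol \<Omega> a \<and> c' = dcol \<Omega> b \<and> arc_end (fst (vertex_graph \<Omega> q)) a s = arc_end (fst (vertex_graph \<Omega> q)) b t"
      using arc_end_vertex_graph by (intro bexI[of _ d] bexI[of _ d']) auto
  next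
    assume "\<exists>a\<in>{d \<in> disks \<Omega>. q \<in> disk_verts \<Omega> d}. \<exists>b\<in>{d \<in> disks \<Omega>. q \<in> disk_verts \<Omega> d}.
      c = dcol \<Omega> a \<and> c' = dcol \<Omega> b \<and> arc_end (fst (vertex_graph \<Omega> q)) a s = arc_end (fst (vertex_graph \<Omega> q)) b t"
    then obtain a b where *: "a \<in> disks \<Omega>" "b \<in> disks \<Omega>" "q \<in> disk_verts \<Omega> a" "q \<in> disk_verts \<Omega> b"
      "c = dcol \<Omega> a" "c' = dcol \<Omega> b" "arc_end (fst (vertex_graph \<Omega> q)) a s = arc_end (fst (vertex_graph \<Omega> q)) b t"
      by blast
    then have "corner_edge \<Omega> a q s (arc_end (fst (vertex_graph \<Omega> q)) a s)" "corner_edge \<Omega> b q t (arc_end (fst (vertex_graph \<Omega> q)) a s)"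
      using arc_end_vertex_graph by simp_all
    then show "\<exists>d\<in>disks \<Omega>. \<exists>d'\<in>disks \<Omega>. \<exists>e. dcol \<Omega> d = c \<and> dcol \<Omega> d' = c' \<and> corner_edge \<Omega> d q s e \<and> corner_edge \<Omega> d' q t e"
      using * by blast
  qed
qed

end

text \<open>Colours have to differ only among the disks at \<open>q\<close>. In a cut surface the
  colour of a divided disk occurs in both components, so a global condition would fail
  there.\<close>

definition vertex_ok :: "('v, 'e, 'd, 'c) complex2 \<Rightarrow> 'v \<Rightarrow> bool" where
  "vertex_ok \<Omega> q \<longleftrightarrow> regular_complex \<Omega> \<and> inj_on (dcol \<Omega>) {d \<in> disks \<Omega>. q \<in> disk_verts \<Omega> d}"

lemma vertex_ok_arc_spanned: "vertex_ok \<Omega> q \<Longrightarrow> arc_spanned (vertex_graph \<Omega> q)"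
  using regular_cx.vertex_graph_arc_spanned[of \<Omega> q] regular_cx.disks_at_def[of \<Omega> q]
  unfolding vertex_ok_def regular_cx_def by auto

lemma vertex_class_eq_iff:
  assumes "vertex_ok \<Omega> q" "vertex_ok \<Omega>' q'"
  shows "vertex_class \<Omega> q = vertex_class \<Omega>' q' \<longleftrightarrow> incidence (vertex_graph \<Omega> q) = incidence (vertex_graph \<Omega>' q')"
  unfolding vertex_class_def using iso_class_eq_iff[OF vertex_ok_arc_spanned[OF assms(1)] vertex_ok_arc_spanned[OF assms(2)]] .

lemma vertex_class_dual_iff:
  assumes "vertex_ok \<Omega> q" "vertex_ok \<Omega>' q'"
  shows "vertex_class \<Omega> q = dual (vertex_class \<Omega>' q') \<longleftrightarrow>
    incidence (vertex_graph \<Omega> q) = swap_incidence (incidence (vertex_graph \<Omega>' q'))"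
  unfolding vertex_class_def using assms
  by (simp add: dual_iso_class vertex_ok_arc_spanned iso_class_eq_iff incidence_rev)

text \<open>One argument for equality and for duality: \<open>s = b\<close> keeps the side if
  \<open>b\<close> is \<open>True\<close> and exchanges leaving and reaching if \<open>b\<close> is
  \<open>False\<close>.\<close>

lemma vertex_incidence_transfer:
  assumes "regular_complex \<Omega>" "regular_complex \<Omega>'"
    and img: "fd ` {d \<in> disks \<Omega>. q \<in> disk_verts \<Omega> d} = {d \<in> disks \<Omega>'. q' \<in> disk_verts \<Omega>' d}"
    and col: "\<And>d. d \<in> disks \<Omega> \<Longrightarrow> q \<in> disk_verts \<Omega> d \<Longrightarrow> dcol \<Omega>' (fd d) = dcol \<Omega> d"
    and corner_edge: "\<And>d s e. d \<in> disks \<Omega> \<Longrightarrow> corner_edge \<Omega> d q s e \<Longrightarrow> corner_edge \<Omega>' (fd d) q' (s = b) (fe e)"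
    and inj: "inj_on fe {e \<in> edges \<Omega>. q \<in> ends \<Omega> e}"
  shows "((c, s), (c', t)) \<in> incidence (vertex_graph \<Omega> q) \<longleftrightarrow> ((c, s = b), (c', t = b)) \<in> incidence (vertex_graph \<Omega>' q')"
proof -
  interpret \<Omega>: regular_cx \<Omega> by unfold_locales fact
  interpret \<Omega>': regular_cx \<Omega>' by unfold_locales fact
  show ?thesis unfolding \<Omega>.vertex_incidence_iff \<Omega>'.vertex_incidence_iff
  proof
    assume "\<exists>d\<in>disks \<Omega>. \<exists>d'\<in>disks \<Omega>. \<exists>e. dcol \<Omega> d = c \<and> dcol \<Omega> d' = c' \<and> corner_edge \<Omega> d q s e \<and> corner_edge \<Omega> d' q t e"
    then obtain d d' e where *: "d \<in> disks \<Omega>" "d' \<in> disks \<Omega>" "dcol \<Omega> d = c" "dcol \<Omega> d' = c'"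
      "corner_edge \<Omega> d q s e" "corner_edge \<Omega> d' q t e" by blast
    then have "q \<in> disk_verts \<Omega> d" "q \<in> disk_verts \<Omega> d'" using \<Omega>.corner_edge_mem(3) by blast+
    then have "fd d \<in> disks \<Omega>'" "fd d' \<in> disks \<Omega>'" using img * by blast+
    then show "\<exists>d\<in>disks \<Omega>'. \<exists>d'\<in>disks \<Omega>'. \<exists>e. dcol \<Omega>' d = c \<and> dcol \<Omega>' d' = c' \<and>
      corner_edge \<Omega>' d q' (s = b) e \<and> corner_edge \<Omega>' d' q' (t = b) e"
      using corner_edge * col \<open>q \<in> disk_verts \<Omega> d\<close> \<open>q \<in> disk_verts \<Omega> d'\<close> by metis
  next
    assume "\<exists>d\<in>disks \<Omega>'. \<exists>d'\<in>disks \<Omega>'. \<exists>e. dcol \<Omega>' d = c \<and> dcol \<Omega>' d' = c' \<and>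
      corner_edge \<Omega>' d q' (s = b) e \<and> corner_edge \<Omega>' d' q' (t = b) e"
    then obtain d1 d1' e1 where *: "d1 \<in> disks \<Omega>'" "d1' \<in> disks \<Omega>'" "dcol \<Omega>' d1 = c" "dcol \<Omega>' d1' = c'"
      "corner_edge \<Omega>' d1 q' (s = b) e1" "corner_edge \<Omega>' d1' q' (t = b) e1" by blast
    then have "q' \<in> disk_verts \<Omega>' d1" "q' \<in> disk_verts \<Omega>' d1'" using \<Omega>'.corner_edge_mem(3) by blast+
    then have "d1 \<in> fd ` {d \<in> disks \<Omega>. q \<in> disk_verts \<Omega> d}" "d1' \<in> fd ` {d \<in> disks \<Omega>. q \<in> disk_verts \<Omega> d}"
      unfolding img using * by auto
    then obtain d d' where d: "d \<in> disks \<Omega>" "q \<in> disk_verts \<Omega> d" "d1 = fd d"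
      "d' \<in> disks \<Omega>" "q \<in> disk_verts \<Omega> d'" "d1' = fd d'" by blast
    obtain e e' where e: "corner_edge \<Omega> d q s e" "corner_edge \<Omega> d' q t e'" using \<Omega>.corner_edge_exists d by metis
    have "fe e = e1" "fe e' = e1" using corner_edge[OF d(1) e(1)] corner_edge[OF d(4) e(2)] * d \<Omega>'.corner_edge_unique by metis+
    then have "e = e'" using inj e \<Omega>.corner_edge_mem(1,2) d unfolding inj_on_def by (metis (no_types, lifting) mem_Collect_eq)
    then show "\<exists>d\<in>disks \<Omega>. \<exists>d'\<in>disks \<Omega>. \<exists>e. dcol \<Omega> d = c \<and> dcol \<Omega> d' = c' \<and> corner_edge \<Omega> d q s e \<and> corner_edge \<Omega> d' q t e"
      using d e * col by metis
  qed
qed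

lemma vertex_class_transfer:
  assumes "vertex_ok \<Omega> q" "vertex_ok \<Omega>' q'"
    and "fd ` {d \<in> disks \<Omega>. q \<in> disk_verts \<Omega> d} = {d \<in> disks \<Omega>'. q' \<in> disk_verts \<Omega>' d}"
    and "\<And>d. d \<in> disks \<Omega> \<Longrightarrow> q \<in> disk_verts \<Omega> d \<Longrightarrow> dcol \<Omega>' (fd d) = dcol \<Omega> d"
    and corner_edge: "\<And>d s e. d \<in> disks \<Omega> \<Longrightarrow> corner_edge \<Omega> d q s e \<Longrightarrow> corner_edge \<Omega>' (fd d) q' s (fe e)"
    and "inj_on fe {e \<in> edges \<Omega>. q \<in> ends \<Omega> e}"
  shows "vertex_class \<Omega>' q' = vertex_class \<Omega> q"
proof -
  have "((c, s), (c', t)) \<in> incidence (vertex_graph \<Omega> q) \<longleftrightarrow> ((c, s), (c', t)) \<in> incidence (vertex_graph \<Omega>' q')" for c s c' t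
    by (rule vertex_incidence_transfer[of \<Omega> \<Omega>' fd q q' True fe c s c' t, simplified])
      (use assms(1,2) in \<open>simp add: vertex_ok_def\<close>, use assms(1,2) in \<open>simp add: vertex_ok_def\<close>, (fact assms)+)
  then have "incidence (vertex_graph \<Omega>' q') = incidence (vertex_graph \<Omega> q)" by auto
  then show ?thesis using vertex_class_eq_iff[OF assms(2,1)] by simp
qed

lemma vertex_class_transfer_dual:
  assumes "vertex_ok \<Omega> q" "vertex_ok \<Omega>' q'"
    and "fd ` {d \<in> disks \<Omega>. q \<in> disk_verts \<Omega> d} = {d \<in> disks \<Omega>'. q' \<in> disk_verts \<Omega>' d}"
    and "\<And>d. d \<in> disks \<Omega> \<Longrightarrow> q \<in> disk_verts \<Omega> d \<Longrightarrow> dcol \<Omega>' (fd d) = dcol \<Omega> d"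
    and corner_edge: "\<And>d s e. d \<in> disks \<Omega> \<Longrightarrow> corner_edge \<Omega> d q s e \<Longrightarrow> corner_edge \<Omega>' (fd d) q' (\<not> s) (fe e)"
    and "inj_on fe {e \<in> edges \<Omega>. q \<in> ends \<Omega> e}"
  shows "vertex_class \<Omega>' q' = dual (vertex_class \<Omega> q)"
proof -
  have "((c, s), (c', t)) \<in> incidence (vertex_graph \<Omega> q) \<longleftrightarrow> ((c, \<not> s), (c', \<not> t)) \<in> incidence (vertex_graph \<Omega>' q')" for c s c' t
    by (rule vertex_incidence_transfer[of \<Omega> \<Omega>' fd q q' False fe c s c' t, simplified])
      (use assms(1,2) in \<open>simp add: vertex_ok_def\<close>, use assms(1,2) in \<open>simp add: vertex_ok_def\<close>, (fact assms)+)
  then have "incidence (vertex_graph \<Omega>' q') = swap_incidence (incidence (vertex_graph \<Omega> q))" by (auto simp: swap_incidence_iff)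
  then show ?thesis using vertex_class_dual_iff[OF assms(2,1)] by simp
qed

section \<open>Cyclic orders and connectedness\<close>

text \<open>Serves both for the boundary words of disks and for the numberings of the vertices of a
  surface.\<close>

definition cyc_list :: "('v \<times> 'v \<times> 'v) set \<Rightarrow> 'v list \<Rightarrow> bool" where
  "cyc_list R vs \<longleftrightarrow> (\<forall>i j k. i < j \<and> j < k \<and> k < length vs \<longrightarrow> (vs ! i, vs ! j, vs ! k) \<in> R)"

lemma cyc_listD: "cyc_list R vs \<Longrightarrow> i < j \<Longrightarrow> j < k \<Longrightarrow> k < length vs \<Longrightarrow> (vs ! i, vs ! j, vs ! k) \<in> R"
  unfolding cyc_list_def by blast

lemma cyc_list_Cons:
  "cyc_list R (a # vs) \<longleftrightarrow> cyc_list R vs \<and> sorted_wrt (\<lambda>b c. (a, b, c) \<in> R) vs" (is "?L \<longleftrightarrow> ?R")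
proof
  assume L: ?L
  show ?R unfolding cyc_list_def sorted_wrt_iff_nth_less
    using cyc_listD[OF L, of "Suc _" "Suc _" "Suc _"] cyc_listD[OF L, of 0 "Suc _" "Suc _"] by auto
next
  assume R: ?R
  show ?L unfolding cyc_list_def
  proof (intro allI impI)
    fix i j k assume ijk: "i < j \<and> j < k \<and> k < length (a # vs)"
    then obtain j' k' where jk: "j = Suc j'" "k = Suc k'" by (metis Suc_lessE less_trans_Suc gr0_implies_Suc less_nat_zero_code not_gr_zero)
    show "((a # vs) ! i, (a # vs) ! j, (a # vs) ! k) \<in> R"
      using R ijk jk unfolding cyc_list_def sorted_wrt_iff_nth_less by (cases i) auto
  qed
qed

lemma cyc_list_rotate:
  assumes rot: "\<And>a b c. (a, b, c) \<in> R \<Longrightarrow> (b, c, a) \<in> R" and "cyc_list R vs"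
  shows "cyc_list R (rotate k vs)"
proof (induction k)
  case (Suc k)
  have "cyc_list R (rotate1 ws)" if ws: "cyc_list R ws" for ws
  proof (cases ws)
    case (Cons a us)
    show ?thesis unfolding cyc_list_def
    proof (intro allI impI)
      fix i j k assume ijk: "i < j \<and> j < k \<and> k < length (rotate1 ws)"
      show "(rotate1 ws ! i, rotate1 ws ! j, rotate1 ws ! k) \<in> R"
      proof (cases "k < length us")
        case True
        then show ?thesis using cyc_listD[OF ws, of "Suc i" "Suc j" "Suc k"] ijk Cons by (auto simp: nth_append)
      next
        case False
        then have "k = length us" using ijk Cons by auto
        then show ?thesis using rot[OF cyc_listD[OF ws, of 0 "Suc i" "Suc j"]] ijk Cons by (auto simp: nth_append)
      qed
    qed
  qed (simp add: cyc_list_def)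
  then show ?case using Suc by simp
qed (use assms in simp)

locale cyclic_order =
  fixes A :: "'v set" and R :: "('v \<times> 'v \<times> 'v) set"
  assumes cyc_order: "cyclic_order_on A R"
begin

lemma sub: "(a, b, c) \<in> R \<Longrightarrow> a \<in> A \<and> b \<in> A \<and> c \<in> A"
  and rot: "(a, b, c) \<in> R \<Longrightarrow> (b, c, a) \<in> R"
  and asym: "(a, b, c) \<in> R \<Longrightarrow> (c, b, a) \<notin> R"
  and tr: "(a, b, c) \<in> R \<Longrightarrow> (a, c, d) \<in> R \<Longrightarrow> (a, b, d) \<in> R"
  and total: "a \<in> A \<Longrightarrow> b \<in> A \<Longrightarrow> c \<in> A \<Longrightarrow> a \<noteq> b \<Longrightarrow> b \<noteq> c \<Longrightarrow> a \<noteq> c \<Longrightarrow> (a, b, c) \<in> R \<or> (c, b, a) \<in> R"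
proof -
  from cyc_order have c: "R \<subseteq> A \<times> A \<times> A" "\<forall>a b c. (a, b, c) \<in> R \<longrightarrow> (b, c, a) \<in> R"
    "\<forall>a b c. (a, b, c) \<in> R \<longrightarrow> (c, b, a) \<notin> R"
    "\<forall>a b c d. (a, b, c) \<in> R \<and> (a, c, d) \<in> R \<longrightarrow> (a, b, d) \<in> R"
    "\<forall>a\<in>A. \<forall>b\<in>A. \<forall>c\<in>A. a \<noteq> b \<and> b \<noteq> c \<and> a \<noteq> c \<longrightarrow> (a, b, c) \<in> R \<or> (c, b, a) \<in> R"
    unfolding cyclic_order_on_def by - (elim conjE, assumption)+
  show "(a, b, c) \<in> R \<Longrightarrow> a \<in> A \<and> b \<in> A \<and> c \<in> A" using c(1) by blast
  show "(a, b, c) \<in> R \<Longrightarrow> (b, c, a) \<in> R" using c(2) by blast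
  show "(a, b, c) \<in> R \<Longrightarrow> (c, b, a) \<notin> R" using c(3) by blast
  show "(a, b, c) \<in> R \<Longrightarrow> (a, c, d) \<in> R \<Longrightarrow> (a, b, d) \<in> R" using c(4) by blast
  show "a \<in> A \<Longrightarrow> b \<in> A \<Longrightarrow> c \<in> A \<Longrightarrow> a \<noteq> b \<Longrightarrow> b \<noteq> c \<Longrightarrow> a \<noteq> c \<Longrightarrow> (a, b, c) \<in> R \<or> (c, b, a) \<in> R"
    using c(5) by blast
qed

lemma distinct3: "(a, b, c) \<in> R \<Longrightarrow> a \<noteq> b \<and> b \<noteq> c \<and> a \<noteq> c"
  using asym[of a b c] asym[of b c a] asym[of c a b] rot[of a b c] rot[of b c a] by blast

lemma cyc_list_rot: "cyc_list R vs \<Longrightarrow> cyc_list R (rotate k vs)"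
  using cyc_list_rotate rot by metis

end

definition consec :: "('v \<times> 'v \<times> 'v) set \<Rightarrow> 'v set \<Rightarrow> 'v set \<Rightarrow> bool" where
  "consec R A B \<longleftrightarrow> (\<forall>a\<in>A. \<forall>a'\<in>A. \<forall>b\<in>B. \<forall>b'\<in>B. \<not> ((a, b, a') \<in> R \<and> (a', b', a) \<in> R))"

lemma division_conv: "division \<Omega> A B \<longleftrightarrow> A \<union> B = vertices \<Omega> \<and> A \<inter> B = {} \<and> A \<noteq> {} \<and> B \<noteq> {} \<and> consec (cyc \<Omega>) A B"
  unfolding division_def consec_def by blast

text \<open>Four points alternating between the groups still alternate when the reading starts one
  point later; transitivity supplies the two triples that begin at members of the other
  group.\<close>

lemma (in cyclic_order) consec_sym:
  assumes "consec R P Q" shows "consec R Q P"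
  unfolding consec_def
proof (intro ballI notI, elim conjE)
  fix a a' b b' assume *: "a \<in> Q" "a' \<in> Q" "b \<in> P" "b' \<in> P" "(a, b, a') \<in> R" "(a', b', a) \<in> R"
  have "(a, b, b') \<in> R" using tr[of a b a' b'] rot * by blast
  moreover have "(a', b', b) \<in> R" using tr[of a' b' a b] rot * by blast
  ultimately have "(b', a, b) \<in> R" "(b, a', b') \<in> R" using rot by blast+
  then show False using assms * unfolding consec_def by blast
qed

text \<open>The steps of a word without the closing one, used to take a boundary circle apart into
  arcs.\<close>

definition lsteps :: "('v \<times> 'e) list \<Rightarrow> ('v \<times> 'e \<times> 'v) set" where
  "lsteps w = (\<lambda>i. (fst (w ! i), snd (w ! i), fst (w ! Suc i))) ` {i. Suc i < length w}"

lemma lsteps_mem: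
  assumes "(v, e, u) \<in> lsteps w" shows "(v, e) \<in> set w" "v \<in> fst ` set w" "e \<in> snd ` set w" "u \<in> fst ` set w"
proof -
  obtain i where i: "Suc i < length w" "v = fst (w ! i)" "e = snd (w ! i)" "u = fst (w ! Suc i)"
    using assms unfolding lsteps_def by auto
  then show "(v, e) \<in> set w" "v \<in> fst ` set w" "e \<in> snd ` set w" "u \<in> fst ` set w" by auto
qed

lemma steps_lsteps:
  assumes "w \<noteq> []"
  shows "steps w = insert (fst (last w), snd (last w), fst (hd w)) (lsteps w)"
proof -
  have n: "{..<length w} = insert (length w - 1) {i. Suc i < length w}" using assms by auto
  have l: "Suc (length w - 1) = length w" using assms by (cases w) auto
  have "(\<lambda>i. (fst (w ! i), snd (w ! i), fst (w ! (Suc i mod length w)))) ` {i. Suc i < length w} = lsteps w"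
    unfolding lsteps_def by (intro image_cong) auto
  then show ?thesis unfolding steps_def n image_insert
    using assms by (simp add: l last_conv_nth hd_conv_nth)
qed

lemma lsteps_append:
  assumes "xs \<noteq> []" "ys \<noteq> []"
  shows "lsteps (xs @ ys) = insert (fst (last xs), snd (last xs), fst (hd ys)) (lsteps xs \<union> lsteps ys)"
proof -
  let ?f = "\<lambda>w i. (fst (w ! i), snd (w ! i), fst (w ! Suc i))"
  have l: "Suc (length xs - 1) = length xs" using assms by (cases xs) auto
  have split: "{i. Suc i < length (xs @ ys)} =
    insert (length xs - 1) ({i. Suc i < length xs} \<union> (\<lambda>i. length xs + i) ` {i. Suc i < length ys})" (is "?A = ?B")
  proof
    show "?A \<subseteq> ?B"
    proof
      fix i assume "i \<in> ?A"
      then have "Suc i < length xs \<or> i = length xs - 1 \<or> (i = length xs + (i - length xs) \<and> Suc (i - length xs) < length ys)"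
        by auto
      then show "i \<in> ?B" by blast
    qed
    have "0 < length xs" "0 < length ys" using assms by auto
    then show "?B \<subseteq> ?A" by auto
  qed
  have 1: "?f (xs @ ys) ` {i. Suc i < length xs} = lsteps xs"
    unfolding lsteps_def by (intro image_cong) (auto simp: nth_append)
  have 2: "?f (xs @ ys) ` (\<lambda>i. length xs + i) ` {i. Suc i < length ys} = lsteps ys"
    unfolding lsteps_def image_image by (intro image_cong) (auto simp: nth_append)
  have 3: "?f (xs @ ys) (length xs - 1) = (fst (last xs), snd (last xs), fst (hd ys))"
    using assms by (simp add: l nth_append last_conv_nth hd_conv_nth)
  show ?thesis unfolding lsteps_def[of "xs @ ys"] split image_insert image_Un 1 2 3 ..
qed

lemma steps_append:
  assumes "xs \<noteq> []" "ys \<noteq> []"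
  shows "steps (xs @ ys) = lsteps xs \<union> lsteps ys \<union>
    {(fst (last xs), snd (last xs), fst (hd ys)), (fst (last ys), snd (last ys), fst (hd xs))}"
proof -
  have "xs @ ys \<noteq> []" "last (xs @ ys) = last ys" "hd (xs @ ys) = hd xs" using assms by auto
  then show ?thesis using steps_lsteps[of "xs @ ys"] by (simp only: lsteps_append[OF assms]) blast
qed

text \<open>After rotating \<open>x\<close> to the front, the word is cut behind its last letter
  violating \<open>P\<close>. What follows that letter moves to the front; if nothing follows,
  \<open>x\<close> stays first.\<close>

lemma rotate_split_ends:
  assumes "x \<in> set w" "P x" "y \<in> set w" "\<not> P y"
  shows "\<exists>k us. w = rotate k us \<and> us \<noteq> [] \<and> P (hd us) \<and> \<not> P (last us)"
proof -
  have sym: "\<exists>k'. w = rotate k' us" if "us = rotate k w" for k us using rotate_back[of k w] that by metis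
  obtain us vs where w: "w = us @ x # vs" using split_list[OF assms(1)] by blast
  then have 1: "rotate (length us) w = x # (vs @ us)" using rotate_append[of us "x # vs"] by simp
  have "y \<in> set (x # (vs @ us))" using assms(3) w by auto
  then obtain as b bs where 2: "x # (vs @ us) = as @ b # bs" "\<not> P b" "\<forall>c\<in>set bs. P c"
    using split_list_last_prop[of "x # (vs @ us)" "\<lambda>c. \<not> P c"] assms(4) by blast
  then have as: "as \<noteq> []" "hd as = x" using assms(2) by (cases as; auto)+
  have 3: "rotate (length as + 1) (as @ b # bs) = bs @ as @ [b]"
    using rotate_append[of "as @ [b]" bs] by simp
  have "rotate (length as + 1 + length us) w = bs @ as @ [b]"
    using 1 2(1) 3 by (metis rotate_rotate)
  moreover have "P (hd (bs @ as @ [b]))" "\<not> P (last (bs @ as @ [b]))"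
    using as 2 assms(2) by (cases bs; auto)+
  ultimately show ?thesis using sym[of "bs @ as @ [b]"] by (metis append_is_Nil_conv not_Cons_self2)
qed

text \<open>Rotate the word so that it starts in \<open>P\<close> and ends outside. If it came back
  to \<open>P\<close> after leaving it, then the first letter, the first letter outside, the return
  and the last letter would alternate between the two groups.\<close>

lemma cyc_list_two_arcs:
  assumes cl: "cyc_list R (map fst w)" and rot: "\<And>a b c. (a, b, c) \<in> R \<Longrightarrow> (b, c, a) \<in> R"
    and "a \<in> fst ` set w" "a \<in> P" "b \<in> fst ` set w" "b \<notin> P"
    and consec: "consec R P (fst ` set w - P)"
  obtains k xs ys where "w = rotate k (xs @ ys)" "xs \<noteq> []" "ys \<noteq> []"
    "fst ` set xs \<subseteq> P" "fst ` set ys \<inter> P = {}"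
proof -
  let ?P = "\<lambda>x. fst x \<in> P"
  obtain x y where "x \<in> set w" "?P x" "y \<in> set w" "\<not> ?P y" using assms by auto
  then obtain k us where us: "w = rotate k us" "us \<noteq> []" "?P (hd us)" "\<not> ?P (last us)"
    using rotate_split_ends[of x w ?P y] by blast
  obtain k' where "us = rotate k' w" using rotate_back[of k us] us by metis
  then have clu: "cyc_list R (map fst us)" using cyc_list_rotate[OF rot cl, of k'] by (simp add: rotate_map)
  have setu: "set us = set w" using us by simp
  define xs ys where "xs = takeWhile ?P us" and "ys = dropWhile ?P us"
  have xy: "us = xs @ ys" unfolding xs_def ys_def by simp
  have xs: "xs \<noteq> []" unfolding xs_def using us by (cases us) auto
  have xsP: "fst ` set xs \<subseteq> P" unfolding xs_def using set_takeWhileD by fast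
  have ys: "ys \<noteq> []" unfolding ys_def using us by (metis dropWhile_eq_Nil_conv last_in_set)
  then have hd: "\<not> ?P (hd ys)" unfolding ys_def by (rule hd_dropWhile[of ?P])
  have "fst ` set ys \<inter> P = {}"
  proof (rule ccontr)
    assume "fst ` set ys \<inter> P \<noteq> {}"
    then obtain y where "y \<in> set ys" "?P y" by blast
    then obtain j where j: "j < length ys" "?P (ys ! j)" by (metis in_set_conv_nth)
    have j0: "j \<noteq> 0" using hd j(2) hd_conv_nth[OF ys] by metis
    have lastu: "last us = us ! (length us - 1)" "hd us = us ! 0" using us by (auto simp: last_conv_nth hd_conv_nth)
    let ?i1 = "length xs" and ?i2 = "length xs + j" and ?i3 = "length us - 1"
    have "us ! ?i2 = ys ! j" using xy by simp
    then have ne: "?i2 \<noteq> ?i3" using j us(4) lastu(1) by metis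
    have l: "length us = length xs + length ys" "0 < length xs" using xy xs by auto
    have lt: "0 < ?i1" "?i1 < ?i2" "?i2 < ?i3" "?i3 < length us" using l j0 j ne by linarith+
    have nm: "map fst us ! i = fst (us ! i)" if "i < length us" for i using that by simp
    have r1: "(fst (us ! 0), fst (us ! ?i1), fst (us ! ?i2)) \<in> R"
      using cyc_listD[OF clu, of 0 ?i1 ?i2] lt nm[of 0] nm[of ?i1] nm[of ?i2] by (metis length_map less_trans)
    have "(fst (us ! 0), fst (us ! ?i2), fst (us ! ?i3)) \<in> R"
      using cyc_listD[OF clu, of 0 ?i2 ?i3] lt nm[of 0] nm[of ?i2] nm[of ?i3] by (metis length_map less_trans)
    then have r2: "(fst (us ! ?i2), fst (us ! ?i3), fst (us ! 0)) \<in> R" by (rule rot)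
    have m1: "fst (us ! 0) \<in> P" using us lastu by simp
    have m2: "fst (us ! ?i2) \<in> P" using j xy by (simp add: nth_append)
    have m3: "fst (us ! ?i1) \<in> fst ` set w - P"
    proof -
      have "us ! ?i1 \<in> set us" "us ! ?i1 = hd ys" using lt xy ys by (auto simp: nth_append hd_conv_nth)
      then show ?thesis using setu hd by auto
    qed
    have m4: "fst (us ! ?i3) \<in> fst ` set w - P"
      using us lastu setu by (metis DiffI imageI last_in_set)
    show False using consec[unfolded consec_def, rule_format, OF m1 m2 m3 m4] r1 r2 by blast
  qed
  then show thesis using that us(1) xy xs xsP ys by blast
qed

section \<open>Crossing edges, blocks and connected components\<close>

definition inner :: "('v, 'e, 'd, 'c) complex2 \<Rightarrow> 'v set \<Rightarrow> 'v set set" where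
  "inner \<Omega> P = {ends \<Omega> e | e. e \<in> edges \<Omega> \<and> ends \<Omega> e \<subseteq> P}"

definition cross :: "('v, 'e, 'd, 'c) complex2 \<Rightarrow> 'v set \<Rightarrow> 'e set" where
  "cross \<Omega> P = {e \<in> edges \<Omega>. ends \<Omega> e \<inter> P \<noteq> {} \<and> \<not> ends \<Omega> e \<subseteq> P}"

definition cut_blocks :: "('v, 'e, 'd, 'c) complex2 \<Rightarrow> 'v set \<Rightarrow> 'e set set" where
  "cut_blocks \<Omega> P = (\<lambda>d. disk_edges \<Omega> d \<inter> cross \<Omega> P) ` disks \<Omega>"

text \<open>The existence of a graph-cut for a given division, with \<open>\<gamma>\<close>
  eliminated: its vertices are the crossing edges, and two of them are adjacent when they lie on a
  common disk. \<open>graph_cut_iff\<close> proves the equivalence.\<close>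

definition cut_ok :: "('v, 'e, 'd, 'c) complex2 \<Rightarrow> 'v set \<Rightarrow> 'v set \<Rightarrow> bool" where
  "cut_ok \<Omega> A B \<longleftrightarrow> hconn A (inner \<Omega> A) \<and> hconn B (inner \<Omega> B) \<and> hconn (cross \<Omega> A) (cut_blocks \<Omega> A)"

text \<open>Describes the components by their properties instead of as a quotient by reachability,
  so that a proposed set of components can be checked directly.\<close>

definition blocks_of :: "('v, 'e, 'd, 'c) complex2 \<Rightarrow> 'e set \<Rightarrow> 'v set set \<Rightarrow> bool" where
  "blocks_of \<Omega> X \<C> \<longleftrightarrow> \<Union>\<C> = vertices \<Omega> \<and> (\<forall>C\<in>\<C>. \<forall>D\<in>\<C>. C \<inter> D \<noteq> {} \<longrightarrow> C = D) \<and>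
     (\<forall>C\<in>\<C>. hconn C {ends \<Omega> e | e. e \<in> edges \<Omega> - X \<and> ends \<Omega> e \<subseteq> C}) \<and>
     (\<forall>e\<in>edges \<Omega> - X. \<exists>C\<in>\<C>. ends \<Omega> e \<subseteq> C)"

lemma (in regular_cx) components_cut_iff:
  "components_cut \<Omega> X = \<C> \<longleftrightarrow> blocks_of \<Omega> X \<C>"
proof -
  define r where "r = {(p, q). \<exists>e\<in>edges \<Omega> - X. ends \<Omega> e = {p, q}}"
  define R where "R = {(u, v). u \<in> vertices \<Omega> \<and> v \<in> vertices \<Omega> \<and> (u, v) \<in> r\<^sup>*}"
  have cc: "components_cut \<Omega> X = vertices \<Omega> // R" unfolding components_cut_def R_def r_def by simp
  have symr: "sym r" unfolding r_def sym_def by (auto simp: insert_commute)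
  have eq: "equiv (vertices \<Omega>) R"
  proof (rule equivI)
    show "R \<subseteq> vertices \<Omega> \<times> vertices \<Omega>" "refl_on (vertices \<Omega>) R" unfolding refl_on_def R_def by auto
    show "sym R" unfolding R_def using symD[OF sym_rtrancl[OF symr]] by (auto intro: symI)
    show "trans R" unfolding R_def by (auto intro: transI rtrancl_trans)
  qed
  have rmem: "p \<in> vertices \<Omega> \<and> q \<in> vertices \<Omega>" if "(p, q) \<in> r" for p q
    using that ends_sub(1) unfolding r_def by auto
  have cls: "R `` {x} = {v. (x, v) \<in> r\<^sup>*}" if "x \<in> vertices \<Omega>" for x
  proof -
    have "v \<in> vertices \<Omega>" if "(x, v) \<in> r\<^sup>*" for v using that \<open>x \<in> vertices \<Omega>\<close>
      by (induction rule: rtrancl_induct) (auto dest: rmem)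
    then show ?thesis unfolding R_def using that by auto
  qed
  have ends2: "\<exists>p q. ends \<Omega> e = {p, q}" if "e \<in> edges \<Omega>" for e
    using ends_sub(2)[OF that] by (auto simp: card_2_iff)
  have forward: "blocks_of \<Omega> X (vertices \<Omega> // R)"
    unfolding blocks_of_def
  proof (intro conjI ballI impI)
    show "\<Union> (vertices \<Omega> // R) = vertices \<Omega>" using Union_quotient[OF eq] .
    fix C assume C: "C \<in> vertices \<Omega> // R"
    show "C = D" if "D \<in> vertices \<Omega> // R" "C \<inter> D \<noteq> {}" for D
      using quotient_disj[OF eq C that(1)] that(2) by auto
    obtain x where x: "x \<in> vertices \<Omega>" "C = R `` {x}" using C by (auto simp: quotient_def)
    show "hconn C {ends \<Omega> e | e. e \<in> edges \<Omega> - X \<and> ends \<Omega> e \<subseteq> C}"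
      unfolding hconn_def
    proof (intro conjI allI impI)
      show "C \<noteq> {}" using x cls by auto
      fix U assume U: "U \<subseteq> C" "U \<noteq> {} \<and> (\<forall>e\<in>{ends \<Omega> e | e. e \<in> edges \<Omega> - X \<and> ends \<Omega> e \<subseteq> C}. e \<inter> U \<noteq> {} \<longrightarrow> e \<subseteq> U)"
      then obtain u where u: "u \<in> U" by blast
      have xu: "(x, u) \<in> r\<^sup>*" using u U(1) cls x by auto
      have "v \<in> U" if "v \<in> C" for v
      proof -
        have "(x, v) \<in> r\<^sup>*" using that cls x by auto
        then have "(u, v) \<in> r\<^sup>*" using xu symD[OF sym_rtrancl[OF symr]] by (meson rtrancl_trans)
        then show ?thesis
        proof (induction rule: rtrancl_induct)
          case (step y z)
          then obtain e where e: "e \<in> edges \<Omega> - X" "ends \<Omega> e = {y, z}" unfolding r_def by auto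
          have "y \<in> C" using step U by auto
          moreover have "z \<in> C" using \<open>y \<in> C\<close> step(2) cls x by (auto intro: rtrancl_into_rtrancl)
          ultimately have "ends \<Omega> e \<in> {ends \<Omega> e | e. e \<in> edges \<Omega> - X \<and> ends \<Omega> e \<subseteq> C}" "ends \<Omega> e \<inter> U \<noteq> {}"
            using e step(3) by auto
          then have "ends \<Omega> e \<subseteq> U" using U(2) by simp
          then show ?case using e by auto
        qed (use u in simp)
      qed
      then show "U = C" using U by blast
    qed
  next
    fix e assume e: "e \<in> edges \<Omega> - X"
    then obtain p q where pq: "ends \<Omega> e = {p, q}" using ends2[of e] by blast
    then have "(p, q) \<in> r" unfolding r_def using e by auto
    then have "ends \<Omega> e \<subseteq> R `` {p}" using cls[of p] rmem pq by auto
    moreover have "R `` {p} \<in> vertices \<Omega> // R" using \<open>(p, q) \<in> r\<close> rmem by (auto simp: quotient_def)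
    ultimately show "\<exists>C\<in>vertices \<Omega> // R. ends \<Omega> e \<subseteq> C" by blast
  qed
  \<comment> \<open>A block contains all that is reachable from its member \<open>x\<close>, since
    no uncut edge leaves the block, and nothing else, since the block is connected.\<close>
  have backward: "\<C> = vertices \<Omega> // R" if B: "blocks_of \<Omega> X \<C>" for \<C>
  proof -
    have cl: "R `` {x} = C" if C: "C \<in> \<C>" "x \<in> C" for C x
    proof -
      have xV: "x \<in> vertices \<Omega>" using B C unfolding blocks_of_def by blast
      have sub: "R `` {x} \<subseteq> C"
      proof
        fix v assume "v \<in> R `` {x}"
        then have "(x, v) \<in> r\<^sup>*" using cls xV by auto
        then show "v \<in> C"
        proof (induction rule: rtrancl_induct)
          case (step y z)
          then obtain e where e: "e \<in> edges \<Omega> - X" "ends \<Omega> e = {y, z}" unfolding r_def by auto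
          then obtain D where D: "D \<in> \<C>" "{y, z} \<subseteq> D" using B unfolding blocks_of_def by metis
          have "\<forall>C\<in>\<C>. \<forall>D\<in>\<C>. C \<inter> D \<noteq> {} \<longrightarrow> C = D" using B unfolding blocks_of_def by simp
          moreover have "D \<inter> C \<noteq> {}" using D step(3) by auto
          ultimately have "D = C" using D(1) C(1) by simp
          then show ?case using D by auto
        qed (use C in simp)
      qed
      have "R `` {x} = C"
      proof (rule hconnD[OF _ sub])
        show "hconn C {ends \<Omega> e | e. e \<in> edges \<Omega> - X \<and> ends \<Omega> e \<subseteq> C}" using B C unfolding blocks_of_def by blast
        show "R `` {x} \<noteq> {}" using xV cls by auto
        fix b assume "b \<in> {ends \<Omega> e | e. e \<in> edges \<Omega> - X \<and> ends \<Omega> e \<subseteq> C}" "b \<inter> R `` {x} \<noteq> {}"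
        then obtain e y where e: "b = ends \<Omega> e" "e \<in> edges \<Omega> - X" "y \<in> ends \<Omega> e" "(x, y) \<in> r\<^sup>*"
          using cls xV by blast
        show "b \<subseteq> R `` {x}"
        proof
          fix z assume "z \<in> b"
          moreover obtain p q where "ends \<Omega> e = {p, q}" using ends2 e by blast
          ultimately have "z = y \<or> (y, z) \<in> r" using e symD[OF symr] unfolding r_def by (auto simp: insert_commute)
          then have "(x, z) \<in> r\<^sup>*" using e(4) by (auto intro: rtrancl_into_rtrancl)
          then show "z \<in> R `` {x}" using cls xV by auto
        qed
      qed
      then show ?thesis .
    qed
    show ?thesis
    proof (intro set_eqI iffI)
      fix C assume C: "C \<in> \<C>"
      then have "C \<noteq> {}" using B unfolding blocks_of_def hconn_def by blast
      then obtain x where "x \<in> C" by blast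
      moreover have "x \<in> vertices \<Omega>" using B C \<open>x \<in> C\<close> unfolding blocks_of_def by blast
      ultimately show "C \<in> vertices \<Omega> // R" using cl[OF C] by (auto simp: quotient_def)
    next
      fix C assume "C \<in> vertices \<Omega> // R"
      then obtain x where x: "x \<in> vertices \<Omega>" "C = R `` {x}" by (auto simp: quotient_def)
      then obtain D where "D \<in> \<C>" "x \<in> D" using B unfolding blocks_of_def by blast
      then show "C \<in> \<C>" using cl x by blast
    qed
  qed
  show ?thesis unfolding cc using forward backward by metis
qed

lemma (in regular_cx) connected_iff: "connected_complex \<Omega> \<longleftrightarrow> hconn (vertices \<Omega>) (inner \<Omega> (vertices \<Omega>))"
  unfolding connected_complex_def components_cut_iff blocks_of_def inner_def using ends_sub(1) by auto

lemma (in regular_cx) blocks_of_components: "blocks_of \<Omega> {} (components \<Omega>)"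
  using components_cut_iff by blast

text \<open>Consecutive vertices of the boundary are joined by an edge, so walking along the
  boundary never leaves the component.\<close>

lemma (in regular_cx) disk_component:
  assumes "d \<in> disks \<Omega>" shows "\<exists>C\<in>components \<Omega>. disk_verts \<Omega> d \<subseteq> C"
proof -
  let ?w = "glue \<Omega> d"
  have ne: "?w \<noteq> []" using disk_ok[OF assms] unfolding disk_ok_def by auto
  have B: "\<Union> (components \<Omega>) = vertices \<Omega>" "\<forall>C\<in>components \<Omega>. \<forall>D\<in>components \<Omega>. C \<inter> D \<noteq> {} \<longrightarrow> C = D"
    "\<forall>e\<in>edges \<Omega>. \<exists>C\<in>components \<Omega>. ends \<Omega> e \<subseteq> C" using blocks_of_components unfolding blocks_of_def by auto
  have "fst (?w ! 0) \<in> disk_verts \<Omega> d" unfolding disk_verts_def using ne by simp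
  then obtain C where C: "C \<in> components \<Omega>" "fst (?w ! 0) \<in> C" using B(1) disk_sub[OF assms] by blast
  have "i < length ?w \<Longrightarrow> fst (?w ! i) \<in> C" for i
  proof (induction i)
    case (Suc i)
    then have "(fst (?w ! i), snd (?w ! i), fst (?w ! (Suc i mod length ?w))) \<in> steps ?w"
      unfolding steps_def by auto
    then have "disk_step \<Omega> d (fst (?w ! i)) (snd (?w ! i)) (fst (?w ! Suc i))" unfolding disk_step_def using Suc by simp
    from disk_step_ends[OF assms this] B(3) obtain D where "D \<in> components \<Omega>" "{fst (?w ! i), fst (?w ! Suc i)} \<subseteq> D" by metis
    moreover have "fst (?w ! i) \<in> C" using Suc by auto
    ultimately show ?case using B(2) C(1) by blast
  qed (use C in auto)
  then have "fst ` set ?w \<subseteq> C" by (metis (no_types, lifting) image_subsetI in_set_conv_nth)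
  then show ?thesis using C(1) unfolding disk_verts_def by blast
qed

section \<open>Graph-cuts and film surfaces\<close>

locale almost_cyclic_cx = regular_cx \<Omega> for \<Omega> :: "('v, 'e, 'd, 'c) complex2" +
  assumes conn: "hconn (vertices \<Omega>) (inner \<Omega> (vertices \<Omega>))"
    and order: "cyclic_order_on (vertices \<Omega>) (cyc \<Omega>)"
    and disk_cyc: "d \<in> disks \<Omega> \<Longrightarrow> cyc_list (cyc \<Omega>) (map fst (glue \<Omega> d))"
begin

sublocale O: cyclic_order "vertices \<Omega>" "cyc \<Omega>" by unfold_locales (rule order)

lemma disk_arcs:
  assumes d: "d \<in> disks \<Omega>" and c: "consec (cyc \<Omega>) P (vertices \<Omega> - P)"
    and "\<not> disk_verts \<Omega> d \<subseteq> P" "disk_verts \<Omega> d \<inter> P \<noteq> {}"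
  obtains k xs ys where "glue \<Omega> d = rotate k (xs @ ys)" "xs \<noteq> []" "ys \<noteq> []"
    "fst ` set xs \<subseteq> P" "fst ` set ys \<inter> P = {}"
proof -
  obtain a b where "a \<in> fst ` set (glue \<Omega> d)" "a \<in> P" "b \<in> fst ` set (glue \<Omega> d)" "b \<notin> P"
    using assms unfolding disk_verts_def by blast
  moreover have "fst ` set (glue \<Omega> d) - P \<subseteq> vertices \<Omega> - P" using disk_sub(1)[OF d] unfolding disk_verts_def by blast
  then have "consec (cyc \<Omega>) P (fst ` set (glue \<Omega> d) - P)" using c unfolding consec_def by (meson subsetD)
  ultimately show thesis using cyc_list_two_arcs[OF disk_cyc[OF d] O.rot] that by metis
qed

text \<open>The boundary consists of an arc in \<open>P\<close> and an arc outside, so it crosses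
  only at the two junctions. Their edges are the ends of the chord that a graph-cut has to run
  through the disk.\<close>

lemma disk_cross:
  assumes d: "d \<in> disks \<Omega>" and c: "consec (cyc \<Omega>) P (vertices \<Omega> - P)"
  shows "disk_edges \<Omega> d \<inter> cross \<Omega> P = {} \<or> (\<exists>e f. e \<noteq> f \<and> disk_edges \<Omega> d \<inter> cross \<Omega> P = {e, f})"
proof (cases "disk_verts \<Omega> d \<subseteq> P \<or> disk_verts \<Omega> d \<inter> P = {}")
  case True
  have "e \<notin> cross \<Omega> P" if "e \<in> disk_edges \<Omega> d" for e
  proof -
    obtain v u where s: "disk_step \<Omega> d v e u" using disk_step_exists(3)[OF \<open>e \<in> disk_edges \<Omega> d\<close>] by blast
    have "ends \<Omega> e \<subseteq> disk_verts \<Omega> d" using disk_step_ends(2)[OF d s] disk_step_mem[OF s] by auto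
    then show ?thesis using True unfolding cross_def by blast
  qed
  then show ?thesis by blast
next
  case False
  then obtain k xs ys where w: "glue \<Omega> d = rotate k (xs @ ys)" "xs \<noteq> []" "ys \<noteq> []"
    "fst ` set xs \<subseteq> P" "fst ` set ys \<inter> P = {}" using disk_arcs[OF d c] by metis
  let ?e = "snd (last xs)" and ?f = "snd (last ys)"
  have st: "steps (glue \<Omega> d) = lsteps xs \<union> lsteps ys \<union>
    {(fst (last xs), ?e, fst (hd ys)), (fst (last ys), ?f, fst (hd xs))}"
    unfolding w(1) steps_rotate using steps_append w by blast
  have P: "fst (last xs) \<in> P" "fst (hd xs) \<in> P" "fst (last ys) \<notin> P" "fst (hd ys) \<notin> P"
    using w by (auto simp: hd_in_set last_in_set image_subset_iff disjoint_iff)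
  have dist: "distinct (map snd (xs @ ys))"
    using disk_ok[OF d] unfolding disk_ok_def w(1) by (simp add: rotate_map[symmetric])
  then have ne: "?e \<noteq> ?f" using w last_in_set by (metis IntI distinct_append empty_iff imageI map_append set_map)
  have "e \<in> cross \<Omega> P \<longleftrightarrow> e = ?e \<or> e = ?f" if "e \<in> disk_edges \<Omega> d" for e
  proof -
    obtain v u where s: "disk_step \<Omega> d v e u" using disk_step_exists(3)[OF \<open>e \<in> disk_edges \<Omega> d\<close>] by blast
    note en = disk_step_ends[OF d s]
    have cr: "e \<in> cross \<Omega> P \<longleftrightarrow> (v \<in> P) \<noteq> (u \<in> P)" unfolding cross_def using en by auto
    consider "(v, e, u) \<in> lsteps xs" | "(v, e, u) \<in> lsteps ys" | "e = ?e" "v = fst (last xs)" "u = fst (hd ys)"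
      | "e = ?f" "v = fst (last ys)" "u = fst (hd xs)" using s unfolding disk_step_def st by auto
    then show ?thesis
    proof cases
      case 1
      then have "v \<in> P" "u \<in> P" using lsteps_mem[OF 1] w(4) by auto
      moreover have "e \<noteq> ?f" using lsteps_mem(3)[OF 1] dist w(3) last_in_set
        by (metis IntI distinct_append empty_iff imageI map_append set_map)
      moreover have "e \<noteq> ?e"
      proof
        assume "e = ?e"
        then have "disk_step \<Omega> d (fst (last xs)) e (fst (hd ys))" unfolding disk_step_def st by simp
        then have "u = fst (hd ys)" using disk_step_unique(3)[OF d s] by blast
        then show False using \<open>u \<in> P\<close> P by simp
      qed
      ultimately show ?thesis using cr by simp
    next
      case 2
      then have "v \<notin> P" "u \<notin> P" using lsteps_mem[OF 2] w(5) by auto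
      moreover have "e \<noteq> ?e" using lsteps_mem(3)[OF 2] dist w(2) last_in_set
        by (metis IntI distinct_append empty_iff imageI map_append set_map)
      moreover have "e \<noteq> ?f"
      proof
        assume "e = ?f"
        then have "disk_step \<Omega> d (fst (last ys)) e (fst (hd xs))" unfolding disk_step_def st by simp
        then have "u = fst (hd xs)" using disk_step_unique(3)[OF d s] by blast
        then show False using \<open>u \<notin> P\<close> P by simp
      qed
      ultimately show ?thesis using cr by simp
    qed (use cr P in auto)
  qed
  moreover have "?e \<in> disk_edges \<Omega> d" "?f \<in> disk_edges \<Omega> d"
    unfolding disk_edges_def w(1) using w(2,3) by auto
  ultimately show ?thesis using ne by blast
qed

lemma cross_nonempty:
  assumes "P \<subseteq> vertices \<Omega>" "P \<noteq> {}" "P \<noteq> vertices \<Omega>" shows "cross \<Omega> P \<noteq> {}"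
proof
  assume a: "cross \<Omega> P = {}"
  have "P = vertices \<Omega>"
  proof (rule hconnD[OF conn assms(1,2)])
    fix e assume "e \<in> inner \<Omega> (vertices \<Omega>)" "e \<inter> P \<noteq> {}"
    then show "e \<subseteq> P" using a unfolding inner_def cross_def by auto
  qed
  then show False using assms by simp
qed

lemma divisionD:
  assumes "division \<Omega> A B"
  shows "B = vertices \<Omega> - A" "A \<subseteq> vertices \<Omega>" "A \<noteq> {}" "A \<noteq> vertices \<Omega>" "consec (cyc \<Omega>) A (vertices \<Omega> - A)"
    "division \<Omega> B A"
proof -
  show B: "B = vertices \<Omega> - A" "A \<subseteq> vertices \<Omega>" "A \<noteq> {}" "A \<noteq> vertices \<Omega>"
    using assms unfolding division_conv by auto
  show "consec (cyc \<Omega>) A (vertices \<Omega> - A)" using assms B unfolding division_conv by auto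
  show "division \<Omega> B A" using assms O.consec_sym unfolding division_conv by auto
qed

text \<open>Removing the crossing edges leaves the edges inside each group, so the groups are the
  components precisely if these edges connect them.\<close>

lemma cut_ok_blocks:
  assumes div: "division \<Omega> A B"
  shows "components_cut \<Omega> (cross \<Omega> A) = {A, B} \<longleftrightarrow> hconn A (inner \<Omega> A) \<and> hconn B (inner \<Omega> B)"
proof -
  note D = divisionD[OF div]
  have inA: "{ends \<Omega> e | e. e \<in> edges \<Omega> - cross \<Omega> A \<and> ends \<Omega> e \<subseteq> A} = inner \<Omega> A"
    unfolding inner_def cross_def by auto
  have "e \<notin> cross \<Omega> A" if "e \<in> edges \<Omega>" "ends \<Omega> e \<subseteq> B" for e using that D unfolding cross_def by auto
  then have inB: "{ends \<Omega> e | e. e \<in> edges \<Omega> - cross \<Omega> A \<and> ends \<Omega> e \<subseteq> B} = inner \<Omega> B"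
    unfolding inner_def by auto
  have 1: "\<Union>{A, B} = vertices \<Omega>" "\<forall>C\<in>{A, B}. \<forall>D\<in>{A, B}. C \<inter> D \<noteq> {} \<longrightarrow> C = D" using D by auto
  have 2: "\<forall>e\<in>edges \<Omega> - cross \<Omega> A. \<exists>C\<in>{A, B}. ends \<Omega> e \<subseteq> C"
  proof
    fix e assume "e \<in> edges \<Omega> - cross \<Omega> A"
    then have "ends \<Omega> e \<inter> A = {} \<or> ends \<Omega> e \<subseteq> A" "ends \<Omega> e \<subseteq> vertices \<Omega>"
      using ends_sub(1) unfolding cross_def by auto
    then show "\<exists>C\<in>{A, B}. ends \<Omega> e \<subseteq> C" using D(1) by auto
  qed
  have 3: "(\<forall>C\<in>{A, B}. hconn C {ends \<Omega> e | e. e \<in> edges \<Omega> - cross \<Omega> A \<and> ends \<Omega> e \<subseteq> C}) \<longleftrightarrow>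
    hconn A (inner \<Omega> A) \<and> hconn B (inner \<Omega> B)"
    by (simp only: ball_simps inA inB) simp
  show ?thesis unfolding components_cut_iff blocks_of_def 3 using 1 2 by argo
qed

text \<open>Every crossing edge is a vertex of \<open>\<gamma>\<close>, as it would otherwise join
  the two groups. A chord ending at one crossing edge has the two crossing edges of its disk as its
  ends, so no chord leads away from the crossing edges. As \<open>\<gamma>\<close> is connected, it
  has no further vertices.\<close>

lemma graph_cut_iff:
  "(\<exists>\<gamma>. graph_cut \<Omega> \<gamma> A B) \<longleftrightarrow> division \<Omega> A B \<and> cut_ok \<Omega> A B"
proof
  assume "\<exists>\<gamma>. graph_cut \<Omega> \<gamma> A B"
  then obtain \<gamma> where g: "loopfree_digraph \<gamma>" "Digraph_Component.connected \<gamma>" "verts \<gamma> \<subseteq> edges \<Omega>" "arcs \<gamma> \<subseteq> disks \<Omega>"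
    "\<forall>d\<in>arcs \<gamma>. disk_edges \<Omega> d \<inter> verts \<gamma> = {tail \<gamma> d, head \<gamma> d}"
    "\<forall>d\<in>disks \<Omega> - arcs \<gamma>. disk_edges \<Omega> d \<inter> verts \<gamma> = {}"
    "components_cut \<Omega> (verts \<gamma>) = {A, B}" and div: "division \<Omega> A B" unfolding graph_cut_def by auto
  note D = divisionD[OF div]
  interpret g: loopfree_digraph \<gamma> by (rule g(1))
  have h: "hconn (verts \<gamma>) ((\<lambda>a. {tail \<gamma> a, head \<gamma> a}) ` arcs \<gamma>)"
    using g(2) connected_iff_hconn[OF g.wf_digraph] by simp
  have "\<forall>e\<in>edges \<Omega> - verts \<gamma>. \<exists>C\<in>{A, B}. ends \<Omega> e \<subseteq> C"
    using g(7) unfolding components_cut_iff blocks_of_def by simp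
  then have B: "ends \<Omega> e \<subseteq> A \<or> ends \<Omega> e \<subseteq> B" if "e \<in> edges \<Omega>" "e \<notin> verts \<gamma>" for e
    using that by simp
  have sub: "cross \<Omega> A \<subseteq> verts \<gamma>"
  proof
    fix e assume e: "e \<in> cross \<Omega> A"
    then have "\<not> ends \<Omega> e \<subseteq> A" "\<not> ends \<Omega> e \<subseteq> B" "e \<in> edges \<Omega>" using D(1) unfolding cross_def by auto
    then show "e \<in> verts \<gamma>" using B by meson
  qed
  have eq: "cross \<Omega> A = verts \<gamma>"
  proof (rule hconnD[OF h sub])
    show "cross \<Omega> A \<noteq> {}" using cross_nonempty D by blast
    fix b assume b: "b \<in> (\<lambda>a. {tail \<gamma> a, head \<gamma> a}) ` arcs \<gamma>" "b \<inter> cross \<Omega> A \<noteq> {}"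
    then obtain d where d: "d \<in> arcs \<gamma>" "b = {tail \<gamma> d, head \<gamma> d}" by blast
    then have bd: "disk_edges \<Omega> d \<inter> verts \<gamma> = b" using g(5) by simp
    then have "disk_edges \<Omega> d \<inter> cross \<Omega> A \<noteq> {}" using b(2) by blast
    then obtain e f where ef: "e \<noteq> f" "disk_edges \<Omega> d \<inter> cross \<Omega> A = {e, f}"
      using disk_cross[OF _ D(5), of d] d(1) g(4) by blast
    then have "{e, f} \<subseteq> b" using bd sub by blast
    then have "b = {e, f}" using d(2) ef(1) by auto
    then show "b \<subseteq> cross \<Omega> A" using ef by blast
  qed
  have "hconn (cross \<Omega> A) (cut_blocks \<Omega> A)" unfolding eq
  proof (rule hconn_mono[OF h])
    fix b x y assume "b \<in> (\<lambda>a. {tail \<gamma> a, head \<gamma> a}) ` arcs \<gamma>" "x \<in> b" "y \<in> b"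
    then obtain d where d: "d \<in> arcs \<gamma>" "x \<in> {tail \<gamma> d, head \<gamma> d}" "y \<in> {tail \<gamma> d, head \<gamma> d}" by auto
    then have "x \<in> disk_edges \<Omega> d \<inter> cross \<Omega> A" "y \<in> disk_edges \<Omega> d \<inter> cross \<Omega> A"
      unfolding eq using g(5) by blast+
    then show "x = y \<or> (\<exists>e'\<in>cut_blocks \<Omega> A. x \<in> e' \<and> y \<in> e')"
      unfolding cut_blocks_def using d(1) g(4) by blast
  qed auto
  then show "division \<Omega> A B \<and> cut_ok \<Omega> A B"
    using div g(7)[folded eq] cut_ok_blocks[OF div] unfolding cut_ok_def by simp
next
  assume a: "division \<Omega> A B \<and> cut_ok \<Omega> A B"
  then have div: "division \<Omega> A B" and ok: "cut_ok \<Omega> A B" by auto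
  note D = divisionD[OF div]
  define X where "X = {d \<in> disks \<Omega>. disk_edges \<Omega> d \<inter> cross \<Omega> A \<noteq> {}}"
  have "\<exists>p. fst p \<noteq> snd p \<and> disk_edges \<Omega> d \<inter> cross \<Omega> A = {fst p, snd p}" if "d \<in> X" for d
    using disk_cross[OF _ D(5), of d] that unfolding X_def by auto
  \<comment> \<open>Chords have no preferred direction; \<open>p\<close> chooses one for each
    disk.\<close>
  then obtain p where p: "\<And>d. d \<in> X \<Longrightarrow> fst (p d) \<noteq> snd (p d) \<and> disk_edges \<Omega> d \<inter> cross \<Omega> A = {fst (p d), snd (p d)}"
    by metis
  define \<gamma> where "\<gamma> = \<lparr>verts = cross \<Omega> A, arcs = X, tail = fst \<circ> p, head = snd \<circ> p\<rparr>"
  have lf: "loopfree_digraph \<gamma>"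
  proof
    fix d assume "d \<in> arcs \<gamma>"
    then have d: "d \<in> X" unfolding \<gamma>_def by simp
    have "fst (p d) \<in> cross \<Omega> A" "snd (p d) \<in> cross \<Omega> A" using p[OF d] by blast+
    then show "tail \<gamma> d \<in> verts \<gamma>" "head \<gamma> d \<in> verts \<gamma>" "tail \<gamma> d \<noteq> head \<gamma> d"
      using p[OF d] unfolding \<gamma>_def by auto
  qed
  have h: "hconn (cross \<Omega> A) (cut_blocks \<Omega> A)" using ok unfolding cut_ok_def by simp
  have "hconn (verts \<gamma>) ((\<lambda>a. {tail \<gamma> a, head \<gamma> a}) ` arcs \<gamma>)"
    unfolding \<gamma>_def pre_digraph.simps
  proof (rule hconn_mono[OF h])
    fix b x y assume "b \<in> cut_blocks \<Omega> A" "x \<in> b" "y \<in> b"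
    then obtain d where "d \<in> X" "b = disk_edges \<Omega> d \<inter> cross \<Omega> A" unfolding cut_blocks_def X_def by blast
    then have "b = {(fst \<circ> p) d, (snd \<circ> p) d}" using p by auto
    then show "x = y \<or> (\<exists>e'\<in>(\<lambda>a. {(fst \<circ> p) a, (snd \<circ> p) a}) ` X. x \<in> e' \<and> y \<in> e')"
      using \<open>d \<in> X\<close> \<open>x \<in> b\<close> \<open>y \<in> b\<close> by blast
  qed (auto simp: cut_blocks_def)
  then have "Digraph_Component.connected \<gamma>"
    using connected_iff_hconn lf unfolding loopfree_digraph_def by blast
  moreover have "components_cut \<Omega> (verts \<gamma>) = {A, B}"
    using cut_ok_blocks[OF div] ok unfolding cut_ok_def \<gamma>_def by simp
  ultimately have "graph_cut \<Omega> \<gamma> A B"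
    unfolding graph_cut_def using lf div p unfolding \<gamma>_def X_def by (auto simp: cross_def)
  then show "\<exists>\<gamma>. graph_cut \<Omega> \<gamma> A B" ..
qed

end

text \<open>The connected film surfaces, with graph-cuts replaced by \<open>cut_ok\<close>;
  \<open>film_conn_iff\<close> shows that the notion is the same.\<close>

definition film_conn :: "'c set \<Rightarrow> ('v, 'e, 'd, 'c) complex2 \<Rightarrow> bool" where
  "film_conn S \<Omega> \<longleftrightarrow> almost_cyclic_cx \<Omega> \<and> (\<forall>A B. division \<Omega> A B \<longrightarrow> cut_ok \<Omega> A B) \<and>
     inj_on (dcol \<Omega>) (disks \<Omega>) \<and> dcol \<Omega> ` disks \<Omega> \<subseteq> S"

section \<open>From connected surfaces to arbitrary ones\<close>

lemma almost_cyclic_disk_conv: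
  "(\<forall>i j k. i < j \<and> j < k \<and> k < length w \<longrightarrow> (fst (w ! i), fst (w ! j), fst (w ! k)) \<in> R) \<longleftrightarrow> cyc_list R (map fst w)"
  unfolding cyc_list_def by (intro iff_allI) auto

lemma component_complex_simps [simp]:
  "vertices (component_complex \<Omega> C) = C" "edges (component_complex \<Omega> C) = {e \<in> edges \<Omega>. ends \<Omega> e \<subseteq> C}"
  "ends (component_complex \<Omega> C) = ends \<Omega>" "disks (component_complex \<Omega> C) = {d \<in> disks \<Omega>. disk_verts \<Omega> d \<subseteq> C}"
  "glue (component_complex \<Omega> C) = glue \<Omega>" "cyc (component_complex \<Omega> C) = cyc \<Omega> \<inter> C \<times> C \<times> C"
  "dcol (component_complex \<Omega> C) = dcol \<Omega>"
  unfolding component_complex_def by simp_all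

lemma component_complex_disk [simp]:
  "disk_verts (component_complex \<Omega> C) = disk_verts \<Omega>" "disk_edges (component_complex \<Omega> C) = disk_edges \<Omega>"
  "disk_step (component_complex \<Omega> C) = disk_step \<Omega>" "corner_edge (component_complex \<Omega> C) = corner_edge \<Omega>"
  unfolding disk_verts_def disk_edges_def disk_step_def corner_edge_def by (auto simp: fun_eq_iff disk_step_def)

context regular_cx
begin

lemma components_facts:
  "\<Union> (components \<Omega>) = vertices \<Omega>" "C \<in> components \<Omega> \<Longrightarrow> D \<in> components \<Omega> \<Longrightarrow> C \<inter> D \<noteq> {} \<Longrightarrow> C = D"
  "e \<in> edges \<Omega> \<Longrightarrow> \<exists>C\<in>components \<Omega>. ends \<Omega> e \<subseteq> C"
  "C \<in> components \<Omega> \<Longrightarrow> hconn C {ends \<Omega> e | e. e \<in> edges \<Omega> \<and> ends \<Omega> e \<subseteq> C}"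
  using blocks_of_components unfolding blocks_of_def by auto

lemma disk_in_component:
  assumes "d \<in> disks \<Omega>" "C \<in> components \<Omega>" "v \<in> disk_verts \<Omega> d" "v \<in> C"
  shows "disk_verts \<Omega> d \<subseteq> C"
  using disk_component[OF assms(1)] components_facts(2) assms by blast

lemma edge_in_disk:
  assumes "d \<in> disks \<Omega>" "e \<in> disk_edges \<Omega> d" shows "ends \<Omega> e \<subseteq> disk_verts \<Omega> d"
proof -
  obtain v u where s: "disk_step \<Omega> d v e u" using disk_step_exists(3)[OF assms(2)] by blast
  show ?thesis unfolding disk_step_ends(2)[OF assms(1) s] using disk_step_mem(1,2)[OF s] by simp
qed

lemma regular_component:
  assumes C: "C \<in> components \<Omega>" shows "regular_complex (component_complex \<Omega> C)"
  unfolding regular_complex_conv component_complex_simps component_complex_disk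
proof (intro conjI ballI)
  have "C \<subseteq> vertices \<Omega>" using components_facts(1) C by blast
  then show "finite C" using finite_cells(1) by (rule finite_subset)
  show "finite {e \<in> edges \<Omega>. ends \<Omega> e \<subseteq> C}" "finite {d \<in> disks \<Omega>. disk_verts \<Omega> d \<subseteq> C}" using finite_cells by auto
  show "ends \<Omega> e \<subseteq> C" "card (ends \<Omega> e) = 2" if "e \<in> {e \<in> edges \<Omega>. ends \<Omega> e \<subseteq> C}" for e using that ends_sub(2) by auto
  show "disk_ok C {e \<in> edges \<Omega>. ends \<Omega> e \<subseteq> C} (ends \<Omega>) (glue \<Omega> d)" if d: "d \<in> {d \<in> disks \<Omega>. disk_verts \<Omega> d \<subseteq> C}" for d
  proof -
    have "fst x \<in> C \<and> snd x \<in> edges \<Omega> \<and> ends \<Omega> (snd x) \<subseteq> C" if "x \<in> set (glue \<Omega> d)" for x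
    proof -
      have "fst x \<in> disk_verts \<Omega> d" "snd x \<in> disk_edges \<Omega> d" using that unfolding disk_verts_def disk_edges_def by auto
      then show ?thesis using d edge_in_disk[of d "snd x"] disk_sub(2)[of d] by auto
    qed
    then have "set (glue \<Omega> d) \<subseteq> C \<times> {e \<in> edges \<Omega>. ends \<Omega> e \<subseteq> C}" by force
    then show ?thesis using disk_ok[of d] d unfolding disk_ok_def by auto
  qed
  show "\<Union> (disk_edges \<Omega> ` {d \<in> disks \<Omega>. disk_verts \<Omega> d \<subseteq> C}) = {e \<in> edges \<Omega>. ends \<Omega> e \<subseteq> C}"
  proof (intro set_eqI iffI)
    fix e assume "e \<in> \<Union> (disk_edges \<Omega> ` {d \<in> disks \<Omega>. disk_verts \<Omega> d \<subseteq> C})"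
    then obtain d where "d \<in> disks \<Omega>" "disk_verts \<Omega> d \<subseteq> C" "e \<in> disk_edges \<Omega> d" by blast
    then show "e \<in> {e \<in> edges \<Omega>. ends \<Omega> e \<subseteq> C}" using edge_in_disk disk_sub(2) by blast
  next
    fix e assume "e \<in> {e \<in> edges \<Omega>. ends \<Omega> e \<subseteq> C}"
    then have e: "e \<in> edges \<Omega>" "ends \<Omega> e \<subseteq> C" by auto
    obtain d where d: "d \<in> disks \<Omega>" "e \<in> disk_edges \<Omega> d" using edge_disk[OF e(1)] by blast
    have "ends \<Omega> e \<noteq> {}" using ends_sub(2)[OF e(1)] by auto
    then obtain v where v: "v \<in> ends \<Omega> e" by blast
    have "disk_verts \<Omega> d \<subseteq> C" using disk_in_component[OF d(1) C, of v] edge_in_disk[OF d] v e by blast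
    then show "e \<in> \<Union> (disk_edges \<Omega> ` {d \<in> disks \<Omega>. disk_verts \<Omega> d \<subseteq> C})" using d by blast
  qed
  show "\<Union> (disk_verts \<Omega> ` {d \<in> disks \<Omega>. disk_verts \<Omega> d \<subseteq> C}) = C"
  proof
    show "C \<subseteq> \<Union> (disk_verts \<Omega> ` {d \<in> disks \<Omega>. disk_verts \<Omega> d \<subseteq> C})"
    proof
      fix v assume v: "v \<in> C"
      then obtain d where d: "d \<in> disks \<Omega>" "v \<in> disk_verts \<Omega> d" using vertex_disk components_facts(1) C by blast
      then have "disk_verts \<Omega> d \<subseteq> C" using disk_in_component[OF d(1) C d(2) v] by blast
      then show "v \<in> \<Union> (disk_verts \<Omega> ` {d \<in> disks \<Omega>. disk_verts \<Omega> d \<subseteq> C})" using d by blast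
    qed
  qed blast
qed
lemma connected_component:
  assumes C: "C \<in> components \<Omega>"
  shows "hconn (vertices (component_complex \<Omega> C)) (inner (component_complex \<Omega> C) (vertices (component_complex \<Omega> C)))"
proof -
  have "inner (component_complex \<Omega> C) C = {ends \<Omega> e | e. e \<in> edges \<Omega> \<and> ends \<Omega> e \<subseteq> C}"
    unfolding inner_def by auto
  then show ?thesis using components_facts(4)[OF C] by simp
qed
lemma almost_cyclic_component:
  assumes C: "C \<in> components \<Omega>"
  shows "almost_cyclic_cx (component_complex \<Omega> C) \<longleftrightarrow> cyclic_order_on C (cyc (component_complex \<Omega> C)) \<and>
    (\<forall>d\<in>disks (component_complex \<Omega> C). cyc_list (cyc (component_complex \<Omega> C)) (map fst (glue \<Omega> d)))"
  unfolding almost_cyclic_cx_def almost_cyclic_cx_axioms_def regular_cx_def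
  using regular_component[OF C] connected_component[OF C] by auto

end

text \<open>All conditions can be tested on components, since every edge and every disk lies in a
  single one. This serves for cut surfaces, which are disconnected, whereas graph-cuts are treated
  on connected complexes.\<close>

lemma film_surface_components:
  "film_surface S \<Omega> \<longleftrightarrow> regular_complex \<Omega> \<and> cyc \<Omega> \<subseteq> (\<Union>C\<in>components \<Omega>. C \<times> C \<times> C) \<and>
     (\<forall>C\<in>components \<Omega>. film_conn S (component_complex \<Omega> C))" (is "?L \<longleftrightarrow> ?R")
proof (cases "regular_complex \<Omega>")
  case reg: True
  then interpret regular_cx \<Omega> by unfold_locales
  have disk_cycC: "(\<forall>d\<in>disks \<Omega>. cyc_list (cyc \<Omega>) (map fst (glue \<Omega> d))) \<longleftrightarrow>
    (\<forall>C\<in>components \<Omega>. \<forall>d\<in>disks (component_complex \<Omega> C). cyc_list (cyc (component_complex \<Omega> C)) (map fst (glue \<Omega> d)))"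
    (is "?D \<longleftrightarrow> ?E")
  proof
    assume D: ?D
    show ?E unfolding component_complex_simps
    proof (intro ballI)
      fix C d assume C: "C \<in> components \<Omega>" and d: "d \<in> {d \<in> disks \<Omega>. disk_verts \<Omega> d \<subseteq> C}"
      have m: "map fst (glue \<Omega> d) ! i \<in> C" if "i < length (glue \<Omega> d)" for i
        using d that unfolding disk_verts_def by auto
      show "cyc_list (cyc \<Omega> \<inter> C \<times> C \<times> C) (map fst (glue \<Omega> d))"
        unfolding cyc_list_def
      proof (intro allI impI)
        fix i j k assume ijk: "i < j \<and> j < k \<and> k < length (map fst (glue \<Omega> d))"
        then have "(map fst (glue \<Omega> d) ! i, map fst (glue \<Omega> d) ! j, map fst (glue \<Omega> d) ! k) \<in> cyc \<Omega>"
          using D d cyc_listD by blast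
        then show "(map fst (glue \<Omega> d) ! i, map fst (glue \<Omega> d) ! j, map fst (glue \<Omega> d) ! k) \<in> cyc \<Omega> \<inter> C \<times> C \<times> C"
          using m[of i] m[of j] m[of k] ijk by simp
      qed
    qed
  next
    assume E: ?E
    show ?D
    proof
      fix d assume d: "d \<in> disks \<Omega>"
      then obtain C where "C \<in> components \<Omega>" "disk_verts \<Omega> d \<subseteq> C" using disk_component by blast
      then have "cyc_list (cyc \<Omega> \<inter> C \<times> C \<times> C) (map fst (glue \<Omega> d))" using E d unfolding component_complex_simps by blast
      then show "cyc_list (cyc \<Omega>) (map fst (glue \<Omega> d))" unfolding cyc_list_def by blast
    qed
  qed
  have alm: "almost_cyclic_complex \<Omega> \<longleftrightarrow> cyc \<Omega> \<subseteq> (\<Union>C\<in>components \<Omega>. C \<times> C \<times> C) \<and> (\<forall>C\<in>components \<Omega>. almost_cyclic_cx (component_complex \<Omega> C))"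
    unfolding almost_cyclic_complex_def almost_cyclic_disk_conv disk_cycC using reg almost_cyclic_component by blast
  have gc: "(\<exists>\<gamma>. graph_cut (component_complex \<Omega> C) \<gamma> A B) \<longleftrightarrow> division (component_complex \<Omega> C) A B \<and> cut_ok (component_complex \<Omega> C) A B"
    if "almost_cyclic_cx (component_complex \<Omega> C)" for C A B using almost_cyclic_cx.graph_cut_iff[OF that] .
  have cyc: "cyclic_complex \<Omega> \<longleftrightarrow> cyc \<Omega> \<subseteq> (\<Union>C\<in>components \<Omega>. C \<times> C \<times> C) \<and> (\<forall>C\<in>components \<Omega>. almost_cyclic_cx (component_complex \<Omega> C) \<and>
    (\<forall>A B. division (component_complex \<Omega> C) A B \<longrightarrow> cut_ok (component_complex \<Omega> C) A B))"
  proof -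
    have "(\<forall>A B. division (component_complex \<Omega> C) A B \<longrightarrow> (\<exists>\<gamma>. graph_cut (component_complex \<Omega> C) \<gamma> A B)) \<longleftrightarrow>
      (\<forall>A B. division (component_complex \<Omega> C) A B \<longrightarrow> cut_ok (component_complex \<Omega> C) A B)"
      if "almost_cyclic_cx (component_complex \<Omega> C)" for C unfolding gc[OF that] by blast
    then show ?thesis unfolding cyclic_complex_def alm by blast
  qed
  have col: "dcol \<Omega> ` disks \<Omega> \<subseteq> S \<longleftrightarrow> (\<forall>C\<in>components \<Omega>. dcol \<Omega> ` disks (component_complex \<Omega> C) \<subseteq> S)"
    unfolding component_complex_simps using disk_component by blast
  show ?thesis unfolding film_surface_def cyc col film_conn_def component_complex_simps(7) using reg by blast
next
  case False
  then show ?thesis unfolding film_surface_def cyclic_complex_def almost_cyclic_complex_def by blast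
qed

lemma component_complex_self:
  assumes "regular_complex \<Omega>" "cyc \<Omega> \<subseteq> vertices \<Omega> \<times> vertices \<Omega> \<times> vertices \<Omega>"
  shows "component_complex \<Omega> (vertices \<Omega>) = \<Omega>"
proof -
  interpret regular_cx \<Omega> by unfold_locales fact
  have "{e \<in> edges \<Omega>. ends \<Omega> e \<subseteq> vertices \<Omega>} = edges \<Omega>" "{d \<in> disks \<Omega>. disk_verts \<Omega> d \<subseteq> vertices \<Omega>} = disks \<Omega>"
    using ends_sub(1) disk_sub(1) by auto
  moreover have "cyc \<Omega> \<inter> vertices \<Omega> \<times> vertices \<Omega> \<times> vertices \<Omega> = cyc \<Omega>" using assms(2) by blast
  ultimately show ?thesis unfolding component_complex_def by (auto intro: complex2.equality)
qed

lemma film_conn_iff: "film_surface S \<Omega> \<and> connected_complex \<Omega> \<longleftrightarrow> film_conn S \<Omega>"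
proof
  assume a: "film_surface S \<Omega> \<and> connected_complex \<Omega>"
  then have "components \<Omega> = {vertices \<Omega>}" unfolding connected_complex_def by simp
  then show "film_conn S \<Omega>" using a component_complex_self[of \<Omega>] unfolding film_surface_components by auto
next
  assume a: "film_conn S \<Omega>"
  then interpret almost_cyclic_cx \<Omega> unfolding film_conn_def by blast
  have c: "connected_complex \<Omega>" unfolding connected_iff by (rule conn)
  have s: "cyc \<Omega> \<subseteq> vertices \<Omega> \<times> vertices \<Omega> \<times> vertices \<Omega>" using O.sub by auto
  have "components \<Omega> = {vertices \<Omega>}" using c unfolding connected_complex_def .
  then show "film_surface S \<Omega> \<and> connected_complex \<Omega>"
    unfolding film_surface_components using c a s regular component_complex_self[OF regular s] by auto
qed

lemma film_surface_component:
  assumes "film_surface S \<Omega>" "C \<in> components \<Omega>"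
  shows "film_surface S (component_complex \<Omega> C)" "connected_complex (component_complex \<Omega> C)"
  using assms film_conn_iff unfolding film_surface_components by blast+

text \<open>All disks at \<open>q\<close> lie in the component of \<open>q\<close>, where colours
  are distinct.\<close>

lemma film_vertex_ok:
  assumes f: "film_surface S \<Omega>" and q: "q \<in> vertices \<Omega>"
  shows "vertex_ok \<Omega> q"
proof -
  have reg: "regular_complex \<Omega>" using f unfolding film_surface_components by blast
  then interpret regular_cx \<Omega> by unfold_locales
  have B: "\<Union> (components \<Omega>) = vertices \<Omega>" "\<And>C D. C\<in>components \<Omega> \<Longrightarrow> D\<in>components \<Omega> \<Longrightarrow> C \<inter> D \<noteq> {} \<Longrightarrow> C = D"
    using blocks_of_components unfolding blocks_of_def by auto
  obtain C where C: "C \<in> components \<Omega>" "q \<in> C" using B q by blast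
  have "{d \<in> disks \<Omega>. q \<in> disk_verts \<Omega> d} \<subseteq> disks (component_complex \<Omega> C)"
    unfolding component_complex_def using disk_component B(2) C by fastforce
  then show ?thesis unfolding vertex_ok_def using f C(1) reg unfolding film_surface_def by (meson inj_on_subset)
qed

section \<open>Cutting a film surface\<close>

text \<open>Deleting letters commutes with rotation up to the amount: moving a letter that is
  deleted anyway does not change what remains.\<close>

lemma filter_rotate: "\<exists>k'. filter Q (rotate k w) = rotate k' (filter Q w)"
proof (induction k)
  case (Suc k)
  then obtain k' where k': "filter Q (rotate k w) = rotate k' (filter Q w)" by blast
  have "\<exists>m. filter Q (rotate1 u) = rotate m (filter Q u)" for u
  proof (cases u)
    case (Cons a v)
    show ?thesis
    proof (cases "Q a")
      case True
      then have "filter Q (rotate1 u) = rotate1 (filter Q u)" using Cons by simp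
      then show ?thesis by (metis rotate1_rotate_swap rotate_Suc rotate0 id_apply)
    next
      case False
      then have "filter Q (rotate1 u) = rotate 0 (filter Q u)" using Cons by simp
      then show ?thesis by blast
    qed
  qed simp
  then obtain m where "filter Q (rotate1 (rotate k w)) = rotate m (filter Q (rotate k w))" by blast
  then show ?case using k' by (auto simp: rotate_rotate)
qed (auto intro: exI[of _ 0])

lemma cyclic_order_on_inj:
  assumes "cyclic_order_on A R" "inj_on u C" "u ` C \<subseteq> A"
  shows "cyclic_order_on C {(x, y, z). x \<in> C \<and> y \<in> C \<and> z \<in> C \<and> (u x, u y, u z) \<in> R}"
proof -
  interpret cyclic_order A R by unfold_locales fact
  show ?thesis unfolding cyclic_order_on_def
  proof (intro conjI allI impI ballI)
    fix a b c assume "a \<in> C" "b \<in> C" "c \<in> C" "a \<noteq> b \<and> b \<noteq> c \<and> a \<noteq> c"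
    then show "(a, b, c) \<in> {(x, y, z). x \<in> C \<and> y \<in> C \<and> z \<in> C \<and> (u x, u y, u z) \<in> R} \<or>
      (c, b, a) \<in> {(x, y, z). x \<in> C \<and> y \<in> C \<and> z \<in> C \<and> (u x, u y, u z) \<in> R}"
      using total[of "u a" "u b" "u c"] assms by (auto simp: inj_on_eq_iff image_subset_iff)
  qed (auto intro: rot tr dest: asym)
qed

locale film_cut = almost_cyclic_cx \<Omega> for \<Omega> :: "('v, 'e, 'd, 'c) complex2" +
  fixes A B :: "'v set" and S :: "'c set"
  assumes film: "film_conn S \<Omega>" and div: "division \<Omega> A B"
begin

abbreviation "\<Gamma> \<equiv> cut_complex \<Omega> A B"
abbreviation "P \<equiv> side A B"
abbreviation "r \<equiv> \<lambda>s. collapse (P s) s"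

definition half :: "bool \<Rightarrow> ('v + bool) set" where
  "half s = insert (Inr s) (Inl ` P s)"

lemma cut_ok: "division \<Omega> X Y \<Longrightarrow> cut_ok \<Omega> X Y"
  using film unfolding film_conn_def by blast

lemma side_facts:
  "P s \<subseteq> vertices \<Omega>" "P s \<noteq> {}" "P s \<noteq> vertices \<Omega>" "P (\<not> s) = vertices \<Omega> - P s"
  "consec (cyc \<Omega>) (P s) (vertices \<Omega> - P s)" "consec (cyc \<Omega>) (vertices \<Omega> - P s) (P s)"
proof -
  note D = divisionD[OF div] and D' = divisionD[OF divisionD(6)[OF div]]
  show "P s \<subseteq> vertices \<Omega>" "P s \<noteq> {}" "P s \<noteq> vertices \<Omega>" "consec (cyc \<Omega>) (P s) (vertices \<Omega> - P s)"
    using D D' unfolding side_def by auto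
  show "P (\<not> s) = vertices \<Omega> - P s" using D(1) D'(1) unfolding side_def by auto
  then show "consec (cyc \<Omega>) (vertices \<Omega> - P s) (P s)" using D D' unfolding side_def by (auto split: if_splits)
qed

lemma collapse_simps: "v \<in> P s \<Longrightarrow> r s v = Inl v" "v \<notin> P s \<Longrightarrow> r s v = Inr s"
  unfolding collapse_def by auto

lemma collapse_eq: "r s v = r s u \<longleftrightarrow> v = u \<or> (v \<notin> P s \<and> u \<notin> P s)"
  unfolding collapse_def by auto

lemma collapse_half: "r s v \<in> half s" unfolding collapse_def half_def by auto

lemma collapse_image: "r s ` vertices \<Omega> = half s"
proof
  show "half s \<subseteq> r s ` vertices \<Omega>"
  proof
    fix x assume "x \<in> half s"
    then consider v where "v \<in> P s" "x = Inl v" | "x = Inr s" unfolding half_def by auto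
    then show "x \<in> r s ` vertices \<Omega>"
    proof cases
      case 1 then show ?thesis using side_facts(1) collapse_simps(1) by (metis image_eqI subsetD)
    next
      case 2
      obtain v where "v \<in> vertices \<Omega>" "v \<notin> P s" using side_facts(1,3)[of s] by blast
      then show ?thesis using 2 collapse_simps(2) by (metis image_eqI)
    qed
  qed
qed (use collapse_half in auto)

lemma half_disjoint: "x \<in> half s \<Longrightarrow> x \<in> half t \<Longrightarrow> s = t"
  using side_facts(4)[of s] unfolding half_def by (cases "s = t") auto

lemma cut_simps:
  "vertices \<Gamma> = half True \<union> half False"
  "edges \<Gamma> = {(e, s). e \<in> edges \<Omega> \<and> ends \<Omega> e \<inter> P s \<noteq> {}}"
  "ends \<Gamma> (e, s) = r s ` ends \<Omega> e"
  "disks \<Gamma> = {(d, s). d \<in> disks \<Omega> \<and> disk_verts \<Omega> d \<inter> P s \<noteq> {}}"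
  "glue \<Gamma> (d, s) = map (map_prod (r s) (\<lambda>e. (e, s))) (filter (\<lambda>(v, e). ends \<Omega> e \<inter> P s \<noteq> {}) (glue \<Omega> d))"
  "dcol \<Gamma> (d, s) = dcol \<Omega> d"
  "(x, y, z) \<in> cyc \<Gamma> \<longleftrightarrow> x \<noteq> y \<and> y \<noteq> z \<and> x \<noteq> z \<and>
     (\<exists>s a b c. (a, b, c) \<in> cyc \<Omega> \<and> x = r s a \<and> y = r s b \<and> z = r s c)"
proof -
  have "vertices \<Omega> = P True \<union> P False" using side_facts(1)[of True] side_facts(4)[of True] by auto
  then show "vertices \<Gamma> = half True \<union> half False"
    unfolding cut_complex_def half_def by (auto simp: Plus_def UNIV_bool)
  show "edges \<Gamma> = {(e, s). e \<in> edges \<Omega> \<and> ends \<Omega> e \<inter> P s \<noteq> {}}"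
    "ends \<Gamma> (e, s) = r s ` ends \<Omega> e"
    "disks \<Gamma> = {(d, s). d \<in> disks \<Omega> \<and> disk_verts \<Omega> d \<inter> P s \<noteq> {}}"
    "dcol \<Gamma> (d, s) = dcol \<Omega> d" unfolding cut_complex_def by simp_all
  show "glue \<Gamma> (d, s) = map (map_prod (r s) (\<lambda>e. (e, s))) (filter (\<lambda>(v, e). ends \<Omega> e \<inter> P s \<noteq> {}) (glue \<Omega> d))"
    unfolding cut_complex_def by (auto intro!: map_cong)
  show "(x, y, z) \<in> cyc \<Gamma> \<longleftrightarrow> x \<noteq> y \<and> y \<noteq> z \<and> x \<noteq> z \<and>
     (\<exists>s a b c. (a, b, c) \<in> cyc \<Omega> \<and> x = r s a \<and> y = r s b \<and> z = r s c)"
  proof -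
    have "(x, y, z) \<in> map_prod g (map_prod g g) ` R \<longleftrightarrow> (\<exists>a b c. (a, b, c) \<in> R \<and> x = g a \<and> y = g b \<and> z = g c)"
      for g :: "'v \<Rightarrow> 'v + bool" and R by force
    then show ?thesis unfolding cut_complex_def by (simp add: Let_def)
  qed
qed

text \<open>The boundary of a disk that meets both sides is, seen from one side, the arc on that side
  followed by the single edge that leads back to it from the other side.\<close>
lemma cut_glue_cases:
  assumes d: "d \<in> disks \<Omega>" "disk_verts \<Omega> d \<inter> P s \<noteq> {}"
  obtains (inside) "disk_verts \<Omega> d \<subseteq> P s" "glue \<Gamma> (d, s) = map (map_prod (r s) (\<lambda>e. (e, s))) (glue \<Omega> d)"
    | (across) k k' xs ys where "glue \<Omega> d = rotate k (xs @ ys)" "xs \<noteq> []" "ys \<noteq> []"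
      "fst ` set xs \<subseteq> P s" "fst ` set ys \<inter> P s = {}"
      "glue \<Gamma> (d, s) = rotate k' (map (map_prod (r s) (\<lambda>e. (e, s))) (xs @ [last ys]))"
proof (cases "disk_verts \<Omega> d \<subseteq> P s")
  case True
  have "filter (\<lambda>(v, e). ends \<Omega> e \<inter> P s \<noteq> {}) (glue \<Omega> d) = glue \<Omega> d"
  proof (rule filter_True, rule ballI)
    fix x assume x: "x \<in> set (glue \<Omega> d)"
    obtain v e where ve: "x = (v, e)" by (cases x)
    obtain u where s: "disk_step \<Omega> d v e u" using steps_exhaust(1)[of v e "glue \<Omega> d"] x ve unfolding disk_step_def by blast
    then have "v \<in> P s" "v \<in> ends \<Omega> e" using True disk_step_mem(1)[OF s] disk_step_ends(2)[OF d(1) s] by auto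
    then show "case x of (v, e) \<Rightarrow> ends \<Omega> e \<inter> P s \<noteq> {}" using ve by auto
  qed
  then show thesis using inside True cut_simps(5) by simp
next
  case False
  then obtain k xs ys where w: "glue \<Omega> d = rotate k (xs @ ys)" "xs \<noteq> []" "ys \<noteq> []"
      "fst ` set xs \<subseteq> P s" "fst ` set ys \<inter> P s = {}" using disk_arcs[OF d(1) side_facts(5) False d(2)] by metis
  let ?Q = "\<lambda>(v, e). ends \<Omega> e \<inter> P s \<noteq> {}"
  have st: "steps (glue \<Omega> d) = lsteps xs \<union> lsteps ys \<union>
    {(fst (last xs), snd (last xs), fst (hd ys)), (fst (last ys), snd (last ys), fst (hd xs))}"
    unfolding w(1) steps_rotate using steps_append w by blast
  have 1: "filter ?Q xs = xs"
  proof (rule filter_True, rule ballI)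
    fix x assume x: "x \<in> set xs"
    obtain v e where ve: "x = (v, e)" by (cases x)
    have "x \<in> set (glue \<Omega> d)" using x w by simp
    then obtain u where s: "disk_step \<Omega> d v e u" using steps_exhaust(1)[of v e "glue \<Omega> d"] ve unfolding disk_step_def by blast
    have "v \<in> P s" using w(4) x ve by force
    then show "?Q x" using ve disk_step_ends(2)[OF d(1) s] by auto
  qed
  have 2: "filter ?Q ys = [last ys]"
  proof -
    have ys: "ys = butlast ys @ [last ys]" using w(3) by simp
    have "\<not> ?Q x" if x: "x \<in> set (butlast ys)" for x
    proof -
      obtain i where i: "i < length (butlast ys)" "x = butlast ys ! i" using x by (metis in_set_conv_nth)
      then have i': "Suc i < length ys" "x = ys ! i" by (auto simp: nth_butlast)
      then have l: "(fst x, snd x, fst (ys ! Suc i)) \<in> lsteps ys" unfolding lsteps_def by auto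
      then have s: "disk_step \<Omega> d (fst x) (snd x) (fst (ys ! Suc i))" unfolding disk_step_def st by simp
      have "fst x \<notin> P s" "fst (ys ! Suc i) \<notin> P s" using lsteps_mem[OF l] w(5) by blast+
      then show ?thesis using disk_step_ends(2)[OF d(1) s] by (simp add: case_prod_unfold)
    qed
    then have "filter ?Q (butlast ys) = []" by (simp add: filter_empty_conv)
    moreover have "?Q (last ys)"
    proof -
      have s: "disk_step \<Omega> d (fst (last ys)) (snd (last ys)) (fst (hd xs))" unfolding disk_step_def st by simp
      have "fst (hd xs) \<in> P s" using w(2,4) by auto
      then show ?thesis using disk_step_ends(2)[OF d(1) s] by (simp add: case_prod_unfold)
    qed
    ultimately show ?thesis by (metis (no_types, lifting) ys filter_append append_Nil filter.simps)
  qed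
  obtain k' where "filter ?Q (glue \<Omega> d) = rotate k' (filter ?Q (xs @ ys))" using filter_rotate w(1) by metis
  then have "glue \<Gamma> (d, s) = rotate k' (map (map_prod (r s) (\<lambda>e. (e, s))) (xs @ [last ys]))"
    unfolding cut_simps(5) using 1 2 by (simp add: rotate_map del: map_append)
  then show thesis using across w by blast
qed

lemma steps_cut:
  assumes d: "d \<in> disks \<Omega>" "disk_verts \<Omega> d \<inter> P s \<noteq> {}"
  shows "steps (glue \<Gamma> (d, s)) = (\<lambda>(v, e, u). (r s v, (e, s), r s u)) ` {(v, e, u). disk_step \<Omega> d v e u \<and> (v \<in> P s \<or> u \<in> P s)}"
  using d
proof (cases rule: cut_glue_cases)
  case inside
  have "{(v, e, u). disk_step \<Omega> d v e u \<and> (v \<in> P s \<or> u \<in> P s)} = steps (glue \<Omega> d)"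
  proof -
    have "v \<in> P s" if "disk_step \<Omega> d v e u" for v e u using disk_step_mem(1)[OF that] inside(1) by blast
    then show ?thesis unfolding disk_step_def by auto
  qed
  then show ?thesis unfolding inside(2) steps_map by simp
next
  case (across k k' xs ys)
  let ?l = "last ys"
  have st: "steps (glue \<Omega> d) = lsteps xs \<union> lsteps ys \<union>
    {(fst (last xs), snd (last xs), fst (hd ys)), (fst ?l, snd ?l, fst (hd xs))}"
    unfolding across(1) steps_rotate using steps_append across by blast
  have m: "fst (last xs) \<in> P s" "fst (hd xs) \<in> P s" "fst ?l \<notin> P s" "fst (hd ys) \<notin> P s"
    using across(2-5) by (auto simp: image_subset_iff disjoint_iff)
  have 1: "lsteps [?l] = {}" unfolding lsteps_def by auto
  have "{(v, e, u). disk_step \<Omega> d v e u \<and> (v \<in> P s \<or> u \<in> P s)} = lsteps xs \<union>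
    {(fst (last xs), snd (last xs), fst (hd ys)), (fst ?l, snd ?l, fst (hd xs))}"
  proof (intro set_eqI iffI)
    fix x assume x: "x \<in> {(v, e, u). disk_step \<Omega> d v e u \<and> (v \<in> P s \<or> u \<in> P s)}"
    obtain v e u where veu: "x = (v, e, u)" by (cases x)
    have "(v, e, u) \<notin> lsteps ys" using lsteps_mem(2,4)[of v e u ys] across(5) x veu by blast
    then show "x \<in> lsteps xs \<union> {(fst (last xs), snd (last xs), fst (hd ys)), (fst ?l, snd ?l, fst (hd xs))}"
      using x veu unfolding disk_step_def st by auto
  next
    fix x assume x: "x \<in> lsteps xs \<union> {(fst (last xs), snd (last xs), fst (hd ys)), (fst ?l, snd ?l, fst (hd xs))}"
    obtain v e u where veu: "x = (v, e, u)" by (cases x)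
    have "v \<in> P s" if "(v, e, u) \<in> lsteps xs" using lsteps_mem(2)[OF that] across(4) by blast
    then show "x \<in> {(v, e, u). disk_step \<Omega> d v e u \<and> (v \<in> P s \<or> u \<in> P s)}"
      using x m veu unfolding disk_step_def st by auto
  qed
  \<comment> \<open>The step that leaves the arc and the step that returns to it now meet at the new
    point, which closes the shortened boundary.\<close>
  moreover have "r s (fst ?l) = r s (fst (hd ys))" using m collapse_eq by blast
  moreover have "steps (xs @ [?l]) = lsteps xs \<union> {(fst (last xs), snd (last xs), fst ?l), (fst ?l, snd ?l, fst (hd xs))}"
    using steps_append[of xs "[?l]"] across(2) 1 by simp
  ultimately show ?thesis unfolding across(6) steps_rotate steps_map by auto
qed

lemma disk_step_cut:
  assumes "d \<in> disks \<Omega>" "disk_verts \<Omega> d \<inter> P s \<noteq> {}"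
  shows "disk_step \<Gamma> (d, s) x f y \<longleftrightarrow> (\<exists>v e u. disk_step \<Omega> d v e u \<and> (v \<in> P s \<or> u \<in> P s) \<and> x = r s v \<and> f = (e, s) \<and> y = r s u)"
  unfolding disk_step_def[of \<Gamma>] steps_cut[OF assms] by (simp add: image_iff Bex_def)

lemma disk_edges_cut: "d \<in> disks \<Omega> \<Longrightarrow> disk_edges \<Gamma> (d, s) = {(e, s) | e. e \<in> disk_edges \<Omega> d \<and> ends \<Omega> e \<inter> P s \<noteq> {}}"
  unfolding disk_edges_def cut_simps(5) by force

lemma disk_verts_cut:
  assumes d: "d \<in> disks \<Omega>" "disk_verts \<Omega> d \<inter> P s \<noteq> {}"
  shows "disk_verts \<Gamma> (d, s) = r s ` disk_verts \<Omega> d"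
  using d
proof (cases rule: cut_glue_cases)
  case inside
  then show ?thesis unfolding disk_verts_def by (simp add: image_image)
next
  case (across k k' xs ys)
  have "r s ` fst ` set ys = {Inr s}" using across(3,5) collapse_simps(2) by (auto simp: image_iff disjoint_iff) (metis last_in_set)
  moreover have "r s (fst (last ys)) = Inr s" using across(3,5) collapse_simps(2) by (auto simp: disjoint_iff)
  ultimately show ?thesis unfolding disk_verts_def across(1,6) by (auto simp: image_Un image_image)
qed

lemma disk_ok_cut:
  assumes d: "d \<in> disks \<Omega>" "disk_verts \<Omega> d \<inter> P s \<noteq> {}"
  shows "disk_ok (vertices \<Gamma>) (edges \<Gamma>) (ends \<Gamma>) (glue \<Gamma> (d, s))"
proof -
  note ok = disk_ok[OF d(1), unfolded disk_ok_def]
  have inj: "inj_on (r s) (P s)" by (auto simp: inj_on_def collapse_def)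
  have "glue \<Gamma> (d, s) \<noteq> [] \<and> distinct (map fst (glue \<Gamma> (d, s))) \<and> distinct (map snd (glue \<Gamma> (d, s)))"
    using d
  proof (cases rule: cut_glue_cases)
    case inside
    have f: "map fst (glue \<Gamma> (d, s)) = map (r s) (map fst (glue \<Omega> d))"
      "map snd (glue \<Gamma> (d, s)) = map (\<lambda>e. (e, s)) (map snd (glue \<Omega> d))" unfolding inside(2) by simp_all
    have "inj_on (r s) (set (map fst (glue \<Omega> d)))" using inj inside(1) unfolding disk_verts_def by (auto intro: inj_on_subset)
    then show ?thesis unfolding f distinct_map[of "r s"] distinct_map[of "\<lambda>e. (e, s)"]
      using ok inside(2) by (auto simp: inj_on_def)
  next
    case (across k k' xs ys)
    have dist: "distinct (map fst (xs @ ys))" "distinct (map snd (xs @ ys))"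
      using ok unfolding across(1) by (simp_all add: rotate_map[symmetric])
    have f: "map fst (map (map_prod (r s) (\<lambda>e. (e, s))) (xs @ [last ys])) = map (r s) (map fst (xs @ [last ys]))"
      "map snd (map (map_prod (r s) (\<lambda>e. (e, s))) (xs @ [last ys])) = map (\<lambda>e. (e, s)) (map snd (xs @ [last ys]))" by simp_all
    have ys: "set [last ys] \<subseteq> set ys" using across(3) by simp
    have d1: "distinct (map fst (xs @ [last ys]))" "distinct (map snd (xs @ [last ys]))"
      using dist ys by (auto simp: distinct_map)
    \<comment> \<open>The word has kept a single vertex beyond the cut, so contracting that side
      does not identify two of its vertices.\<close>
    have "inj_on (r s) (set (map fst (xs @ [last ys])))"
    proof (rule inj_onI)
      fix x y assume xy: "x \<in> set (map fst (xs @ [last ys]))" "y \<in> set (map fst (xs @ [last ys]))" "r s x = r s y"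
      have "x \<in> P s \<or> x = fst (last ys)" "y \<in> P s \<or> y = fst (last ys)" using xy(1,2) across(4) by auto
      then show "x = y" using xy(3) collapse_eq by blast
    qed
    then have "distinct (map (r s) (map fst (xs @ [last ys])))" using d1 by (simp only: distinct_map[of "r s"])
    moreover have "distinct (map (\<lambda>e. (e, s)) (map snd (xs @ [last ys])))" using d1(2) by (simp only: distinct_map[of "\<lambda>e. (e, s)"]) (auto simp: inj_on_def)
    ultimately show ?thesis unfolding across(6) rotate_map[symmetric] distinct_rotate f by simp
  qed
  moreover have "set (glue \<Gamma> (d, s)) \<subseteq> vertices \<Gamma> \<times> edges \<Gamma>"
  proof
    fix x assume "x \<in> set (glue \<Gamma> (d, s))"
    then obtain v e where ve: "(v, e) \<in> set (glue \<Omega> d)" "ends \<Omega> e \<inter> P s \<noteq> {}" "x = (r s v, (e, s))"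
      unfolding cut_simps(5) by auto
    have "e \<in> edges \<Omega>" using ok ve(1) by auto
    moreover have "r s v \<in> vertices \<Gamma>" using collapse_half[of s v] unfolding cut_simps(1) by (cases s) auto
    ultimately show "x \<in> vertices \<Gamma> \<times> edges \<Gamma>" using ve unfolding cut_simps(2) by auto
  qed
  moreover have "\<forall>(v, e, u)\<in>steps (glue \<Gamma> (d, s)). ends \<Gamma> e = {v, u}"
    unfolding steps_cut[OF d] using disk_step_ends(2)[OF d(1)] by (auto simp: cut_simps(3))
  ultimately show ?thesis unfolding disk_ok_def by blast
qed

lemma regular_cut: "regular_complex \<Gamma>"
  unfolding regular_complex_conv
proof (intro conjI ballI)
  have fs: "finite (half s)" for s unfolding half_def using finite_subset[OF side_facts(1) finite_cells(1)] by simp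
  show "finite (vertices \<Gamma>)" unfolding cut_simps(1) using fs by simp
  have "edges \<Gamma> \<subseteq> edges \<Omega> \<times> UNIV" unfolding cut_simps by auto
  then show "finite (edges \<Gamma>)" by (rule finite_subset) (use finite_cells in simp)
  have "disks \<Gamma> \<subseteq> disks \<Omega> \<times> UNIV" unfolding cut_simps by auto
  then show "finite (disks \<Gamma>)" by (rule finite_subset) (use finite_cells in simp)
  fix f assume "f \<in> edges \<Gamma>"
  then obtain e s where e: "f = (e, s)" "e \<in> edges \<Omega>" "ends \<Omega> e \<inter> P s \<noteq> {}" unfolding cut_simps by auto
  show "ends \<Gamma> f \<subseteq> vertices \<Gamma>" unfolding e(1) cut_simps(1,3) using collapse_half[of s] by (cases s) auto
  obtain v u where vu: "ends \<Omega> e = {v, u}" "v \<noteq> u" using ends_sub(2)[OF e(2)] by (auto simp: card_2_iff)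
  then have "r s v \<noteq> r s u" using e(3) collapse_eq by auto
  then show "card (ends \<Gamma> f) = 2" unfolding e(1) cut_simps(3) vu(1) by simp
next
  fix f assume "f \<in> disks \<Gamma>"
  then show "disk_ok (vertices \<Gamma>) (edges \<Gamma>) (ends \<Gamma>) (glue \<Gamma> f)" using disk_ok_cut unfolding cut_simps(4) by auto
next
  show "\<Union> (disk_edges \<Gamma> ` disks \<Gamma>) = edges \<Gamma>"
  proof (intro set_eqI iffI)
    fix f assume "f \<in> \<Union> (disk_edges \<Gamma> ` disks \<Gamma>)"
    then obtain d s where d: "d \<in> disks \<Omega>" "f \<in> disk_edges \<Gamma> (d, s)" unfolding cut_simps(4) by auto
    then show "f \<in> edges \<Gamma>" using disk_edges_cut[OF d(1)] disk_sub(2)[OF d(1)] unfolding cut_simps(2) by auto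
  next
    fix f assume "f \<in> edges \<Gamma>"
    then obtain e s where e: "f = (e, s)" "e \<in> edges \<Omega>" "ends \<Omega> e \<inter> P s \<noteq> {}" unfolding cut_simps by auto
    obtain d where d: "d \<in> disks \<Omega>" "e \<in> disk_edges \<Omega> d" using edge_disk[OF e(2)] by blast
    then have "disk_verts \<Omega> d \<inter> P s \<noteq> {}" using edge_in_disk e(3) by blast
    then show "f \<in> \<Union> (disk_edges \<Gamma> ` disks \<Gamma>)" using d e disk_edges_cut[OF d(1)] unfolding cut_simps(4) by blast
  qed
  show "\<Union> (disk_verts \<Gamma> ` disks \<Gamma>) = vertices \<Gamma>"
  proof
    show "\<Union> (disk_verts \<Gamma> ` disks \<Gamma>) \<subseteq> vertices \<Gamma>"
    proof
      fix x assume "x \<in> \<Union> (disk_verts \<Gamma> ` disks \<Gamma>)"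
      then obtain d s where "d \<in> disks \<Omega>" "disk_verts \<Omega> d \<inter> P s \<noteq> {}" "x \<in> disk_verts \<Gamma> (d, s)" unfolding cut_simps(4) by auto
      then have "x \<in> half s" using disk_verts_cut collapse_half by auto
      then show "x \<in> vertices \<Gamma>" unfolding cut_simps(1) by (cases s) auto
    qed
    have "half s \<subseteq> \<Union> (disk_verts \<Gamma> ` disks \<Gamma>)" for s
    proof
      fix x assume "x \<in> half s"
      have inP: "r s v \<in> \<Union> (disk_verts \<Gamma> ` disks \<Gamma>)" if "d \<in> disks \<Omega>" "v \<in> disk_verts \<Omega> d" "disk_verts \<Omega> d \<inter> P s \<noteq> {}" for d v
        using that disk_verts_cut[OF that(1,3)] unfolding cut_simps(4) by blast
      from \<open>x \<in> half s\<close> consider v where "v \<in> P s" "x = Inl v" | "x = Inr s" unfolding half_def by auto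
      then show "x \<in> \<Union> (disk_verts \<Gamma> ` disks \<Gamma>)"
      proof cases
        case 1
        then obtain d where d: "d \<in> disks \<Omega>" "v \<in> disk_verts \<Omega> d" using vertex_disk side_facts(1)[of s] by blast
        then have "disk_verts \<Omega> d \<inter> P s \<noteq> {}" using 1 by blast
        then show ?thesis using inP[OF d] collapse_simps(1)[OF 1(1)] 1(2) by simp
      next
        case 2
        \<comment> \<open>By connectedness some edge crosses the cut, and a disk along this edge
          reaches the new point.\<close>
        obtain e where e: "e \<in> cross \<Omega> (P s)" using cross_nonempty[OF side_facts(1,2,3)] by blast
        then obtain v where v: "e \<in> edges \<Omega>" "v \<in> ends \<Omega> e" "v \<notin> P s" "ends \<Omega> e \<inter> P s \<noteq> {}" unfolding cross_def by blast
        obtain d where d: "d \<in> disks \<Omega>" "e \<in> disk_edges \<Omega> d" using edge_disk[OF v(1)] by blast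
        then have "ends \<Omega> e \<subseteq> disk_verts \<Omega> d" using edge_in_disk by blast
        then have "v \<in> disk_verts \<Omega> d" "disk_verts \<Omega> d \<inter> P s \<noteq> {}" using v by blast+
        then show ?thesis using inP[OF d(1), of v] collapse_simps(2)[OF v(3)] 2 by simp
      qed
    qed
    then show "vertices \<Gamma> \<subseteq> \<Union> (disk_verts \<Gamma> ` disks \<Gamma>)" unfolding cut_simps(1) by blast
  qed
qed

sublocale cut: regular_cx \<Gamma> by unfold_locales (rule regular_cut)

lemma edge_half: "(e, s) \<in> edges \<Gamma> \<Longrightarrow> ends \<Gamma> (e, s) \<subseteq> half t \<longleftrightarrow> s = t"
proof -
  assume "(e, s) \<in> edges \<Gamma>"
  then obtain v where "v \<in> ends \<Omega> e" unfolding cut_simps by auto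
  then show "ends \<Gamma> (e, s) \<subseteq> half t \<longleftrightarrow> s = t"
    unfolding cut_simps(3) using collapse_half half_disjoint by blast
qed

lemma disk_half: "(d, s) \<in> disks \<Gamma> \<Longrightarrow> disk_verts \<Gamma> (d, s) \<subseteq> half t \<longleftrightarrow> s = t"
proof -
  assume a: "(d, s) \<in> disks \<Gamma>"
  then obtain v where v: "v \<in> disk_verts \<Omega> d" "disk_verts \<Gamma> (d, s) = r s ` disk_verts \<Omega> d"
    using disk_verts_cut unfolding cut_simps by auto
  show "disk_verts \<Gamma> (d, s) \<subseteq> half t \<longleftrightarrow> s = t"
  proof
    assume "disk_verts \<Gamma> (d, s) \<subseteq> half t"
    then have "r s v \<in> half t" using v by blast
    then show "s = t" using half_disjoint[OF collapse_half] by blast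
  next
    assume "s = t"
    then show "disk_verts \<Gamma> (d, s) \<subseteq> half t" using v(2) collapse_half by auto
  qed
qed

text \<open>An edge without an end on side \<open>s\<close> vanishes in the cut complex, but both
  its ends go to the new point; all other edges survive.\<close>

lemma hconn_collapse:
  assumes "hconn X (inner \<Omega> X)"
  shows "hconn (r s ` X) {ends \<Gamma> e | e. e \<in> edges \<Gamma> \<and> ends \<Gamma> e \<subseteq> half s \<and> ends \<Gamma> e \<subseteq> r s ` X}"
proof (rule hconn_image[OF assms])
  fix b x y assume "b \<in> inner \<Omega> X" "x \<in> b" "y \<in> b"
  then obtain e where e: "e \<in> edges \<Omega>" "ends \<Omega> e \<subseteq> X" "x \<in> ends \<Omega> e" "y \<in> ends \<Omega> e" unfolding inner_def by auto
  show "r s x = r s y \<or> (\<exists>e'\<in>{ends \<Gamma> e | e. e \<in> edges \<Gamma> \<and> ends \<Gamma> e \<subseteq> half s \<and> ends \<Gamma> e \<subseteq> r s ` X}. r s x \<in> e' \<and> r s y \<in> e')"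
  proof (cases "r s x = r s y")
    case False
    then have "ends \<Omega> e \<inter> P s \<noteq> {}" using e collapse_eq by blast
    then have ed: "(e, s) \<in> edges \<Gamma>" using e unfolding cut_simps by simp
    moreover have "r s x \<in> ends \<Gamma> (e, s)" "r s y \<in> ends \<Gamma> (e, s)" "ends \<Gamma> (e, s) \<subseteq> r s ` X"
      unfolding cut_simps(3) using e by auto
    moreover have "ends \<Gamma> (e, s) \<subseteq> half s" using edge_half[OF ed] by simp
    ultimately show ?thesis by blast
  qed simp
qed (auto simp: inner_def)

lemma components_cut_complex: "components \<Gamma> = {half True, half False}"
  unfolding cut.components_cut_iff blocks_of_def
proof (intro conjI)
  show "\<Union> {half True, half False} = vertices \<Gamma>" using cut_simps(1) by auto
  show "\<forall>C\<in>{half True, half False}. \<forall>D\<in>{half True, half False}. C \<inter> D \<noteq> {} \<longrightarrow> C = D"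
    using half_disjoint[of _ True False] by auto
  have "hconn (half s) {ends \<Gamma> e | e. e \<in> edges \<Gamma> \<and> ends \<Gamma> e \<subseteq> half s}" for s
    using hconn_collapse[OF conn, of s] unfolding collapse_image by simp
  then show "\<forall>C\<in>{half True, half False}. hconn C {ends \<Gamma> e | e. e \<in> edges \<Gamma> - {} \<and> ends \<Gamma> e \<subseteq> C}" by simp
  have "\<exists>s. ends \<Gamma> e \<subseteq> half s" if "e \<in> edges \<Gamma>" for e using that edge_half by (cases e) blast
  then show "\<forall>e\<in>edges \<Gamma> - {}. \<exists>C\<in>{half True, half False}. ends \<Gamma> e \<subseteq> C" by (metis DiffD1 insertCI)
qed

lemma cyc_cut_half: "(x, y, z) \<in> cyc \<Gamma> \<Longrightarrow> \<exists>s. x \<in> half s \<and> y \<in> half s \<and> z \<in> half s"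
  unfolding cut_simps(7) using collapse_half by blast

text \<open>Vertices beyond the cut are indistinguishable as seen from \<open>b\<close> and
  \<open>c\<close>: otherwise \<open>b\<close>, \<open>\<beta>\<close>, \<open>c\<close>,
  \<open>a\<close> would be met in this order and alternate between the groups.\<close>

lemma cyc_replace:
  assumes "\<beta> \<in> vertices \<Omega>" "\<beta> \<notin> P s" "a \<notin> P s" "b \<in> P s" "c \<in> P s" "(a, b, c) \<in> cyc \<Omega>"
  shows "(\<beta>, b, c) \<in> cyc \<Omega>"
proof (rule ccontr)
  assume n: "(\<beta>, b, c) \<notin> cyc \<Omega>"
  have m: "a \<in> vertices \<Omega>" "b \<in> vertices \<Omega>" "c \<in> vertices \<Omega>" "b \<noteq> c" using O.sub O.distinct3 assms(6) by blast+
  have "\<beta> \<noteq> b" "\<beta> \<noteq> c" using assms by auto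
  then have "(c, b, \<beta>) \<in> cyc \<Omega>" using O.total[of \<beta> b c] n m assms(1) by blast
  then have "(b, \<beta>, c) \<in> cyc \<Omega>" using O.rot by blast
  moreover have "(c, a, b) \<in> cyc \<Omega>" using O.rot assms(6) by blast
  ultimately show False using side_facts(5)[of s] assms m unfolding consec_def by blast
qed

text \<open>A vertex \<open>\<beta>\<close> beyond the cut stands for the new point and embeds the
  half into the vertices of \<open>\<Omega>\<close>. By \<open>cyc_replace\<close> its choice does
  not matter, so the order defined for the cut complex is the given one pulled back along this
  embedding.\<close>

lemma cyclic_order_half: "cyclic_order_on (half s) (cyc (component_complex \<Gamma> (half s)))"
proof -
  obtain \<beta> where \<beta>: "\<beta> \<in> vertices \<Omega>" "\<beta> \<notin> P s" using side_facts(1,3)[of s] by blast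
  define u where "u = case_sum (\<lambda>v. v) (\<lambda>b::bool. \<beta>)"
  have inj: "inj_on u (half s)" unfolding u_def half_def inj_on_def using \<beta> by auto
  have ran: "u ` half s \<subseteq> vertices \<Omega>" unfolding u_def half_def using \<beta> side_facts(1)[of s] by auto
  have ru: "r s (u x) = x" if "x \<in> half s" for x
    using that \<beta> unfolding u_def half_def by (auto simp: collapse_def)
  have "cyc (component_complex \<Gamma> (half s)) =
    {(x, y, z). x \<in> half s \<and> y \<in> half s \<and> z \<in> half s \<and> (u x, u y, u z) \<in> cyc \<Omega>}"
  proof (intro set_eqI iffI)
    fix p assume p: "p \<in> cyc (component_complex \<Gamma> (half s))"
    obtain x y z where xyz: "p = (x, y, z)" by (cases p)
    have h: "(x, y, z) \<in> cyc \<Gamma>" "x \<in> half s" "y \<in> half s" "z \<in> half s" using p xyz by auto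
    then obtain t a b c where t: "(a, b, c) \<in> cyc \<Omega>" "x = r t a" "y = r t b" "z = r t c" "x \<noteq> y" "y \<noteq> z" "x \<noteq> z"
      unfolding cut_simps(7) by blast
    have "t = s" using half_disjoint[OF h(2)] collapse_half[of t a] t(2) by blast
    then have xyz': "x = r s a" "y = r s b" "z = r s c" using t by auto
    have V: "a \<in> P s \<Longrightarrow> u x = a" "b \<in> P s \<Longrightarrow> u y = b" "c \<in> P s \<Longrightarrow> u z = c"
      "a \<notin> P s \<Longrightarrow> u x = \<beta>" "b \<notin> P s \<Longrightarrow> u y = \<beta>" "c \<notin> P s \<Longrightarrow> u z = \<beta>"
      unfolding xyz' u_def collapse_def by auto
    \<comment> \<open>Two vertices beyond the cut would have the same image, so at most one of the
      three lies there.\<close>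
    have two: "\<not> (a \<notin> P s \<and> b \<notin> P s)" "\<not> (b \<notin> P s \<and> c \<notin> P s)" "\<not> (a \<notin> P s \<and> c \<notin> P s)"
      using t(5-7) unfolding xyz' collapse_eq by auto
    have "(u x, u y, u z) \<in> cyc \<Omega>"
    proof (cases "a \<in> P s")
      case a: False
      then show ?thesis using cyc_replace[OF \<beta> a, of b c] t(1) two V by metis
    next
      case a: True
      show ?thesis
      proof (cases "b \<in> P s")
        case b: False
        then have "(\<beta>, c, a) \<in> cyc \<Omega>" using cyc_replace[OF \<beta> b, of c a] O.rot[OF t(1)] two by blast
        then show ?thesis using V a b two O.rot by metis
      next
        case b: True
        show ?thesis
        proof (cases "c \<in> P s")
          case c: False
          then have "(\<beta>, a, b) \<in> cyc \<Omega>" using cyc_replace[OF \<beta> c, of a b] O.rot[OF O.rot[OF t(1)]] a b by blast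
          then show ?thesis using V a b c O.rot by metis
        qed (use V a b t(1) in metis)
      qed
    qed
    then show "p \<in> {(x, y, z). x \<in> half s \<and> y \<in> half s \<and> z \<in> half s \<and> (u x, u y, u z) \<in> cyc \<Omega>}"
      using h xyz by simp
  next
    fix p assume "p \<in> {(x, y, z). x \<in> half s \<and> y \<in> half s \<and> z \<in> half s \<and> (u x, u y, u z) \<in> cyc \<Omega>}"
    then obtain x y z where xyz: "p = (x, y, z)" "x \<in> half s" "y \<in> half s" "z \<in> half s" "(u x, u y, u z) \<in> cyc \<Omega>" by auto
    then have "x \<noteq> y" "y \<noteq> z" "x \<noteq> z" using O.distinct3 by blast+
    then have "(x, y, z) \<in> cyc \<Gamma>" unfolding cut_simps(7) using ru xyz by metis
    then show "p \<in> cyc (component_complex \<Gamma> (half s))" using xyz by simp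
  qed
  then show ?thesis using cyclic_order_on_inj[OF order inj ran] by simp
qed

lemma cyc_list_collapse:
  assumes cl: "cyc_list (cyc \<Omega>) vs" and di: "distinct (map (r s) vs)"
  shows "cyc_list (cyc (component_complex \<Gamma> (half s))) (map (r s) vs)"
  unfolding cyc_list_def
proof (intro allI impI)
  fix i j k assume ijk: "i < j \<and> j < k \<and> k < length (map (r s) vs)"
  then have "(vs ! i, vs ! j, vs ! k) \<in> cyc \<Omega>" using cyc_listD[OF cl] by auto
  moreover have "map (r s) vs ! i \<noteq> map (r s) vs ! j" "map (r s) vs ! j \<noteq> map (r s) vs ! k" "map (r s) vs ! i \<noteq> map (r s) vs ! k"
    using di ijk by (auto simp: nth_eq_iff_index_eq simp del: nth_map)
  ultimately have "(r s (vs ! i), r s (vs ! j), r s (vs ! k)) \<in> cyc \<Gamma>"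
    unfolding cut_simps(7) using ijk by auto
  then show "(map (r s) vs ! i, map (r s) vs ! j, map (r s) vs ! k) \<in> cyc (component_complex \<Gamma> (half s))"
    using ijk collapse_half by simp
qed

lemma cyc_list_cut:
  assumes d: "d \<in> disks \<Omega>" "disk_verts \<Omega> d \<inter> P s \<noteq> {}"
  shows "cyc_list (cyc (component_complex \<Gamma> (half s))) (map fst (glue \<Gamma> (d, s)))"
proof -
  interpret H: cyclic_order "half s" "cyc (component_complex \<Gamma> (half s))" by unfold_locales (rule cyclic_order_half)
  have dist: "distinct (map fst (glue \<Gamma> (d, s)))" using disk_ok_cut[OF d] unfolding disk_ok_def by simp
  show ?thesis using d
  proof (cases rule: cut_glue_cases)
    case inside
    then have "map fst (glue \<Gamma> (d, s)) = map (r s) (map fst (glue \<Omega> d))" by simp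
    then show ?thesis using cyc_list_collapse[OF disk_cyc[OF d(1)]] dist by simp
  next
    case (across k k' xs ys)
    let ?vs = "map fst (xs @ [last ys])"
    have f: "map fst (glue \<Gamma> (d, s)) = rotate k' (map (r s) ?vs)" unfolding across(6) rotate_map[symmetric] by simp
    obtain m where "xs @ ys = rotate m (glue \<Omega> d)" using rotate_back[of k "xs @ ys"] across(1) by metis
    then have cl: "cyc_list (cyc \<Omega>) (map fst (xs @ ys))" using O.cyc_list_rot[OF disk_cyc[OF d(1)], of m] by (simp add: rotate_map)
    \<comment> \<open>\<open>xs @ [last ys]\<close> is a subsequence of \<open>xs @ ys\<close>; only
      its last position moves, namely to the end of the longer word.\<close>
    have n: "?vs ! i = map fst (xs @ ys) ! (if i = length xs then length xs + (length ys - 1) else i)" if "i \<le> length xs" for i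
      using that across(3) by (auto simp: nth_append last_conv_nth)
    have "cyc_list (cyc \<Omega>) ?vs" unfolding cyc_list_def
    proof (intro allI impI)
      fix i j l assume ijl: "i < j \<and> j < l \<and> l < length ?vs"
      have ly: "0 < length ys" using across(3) by simp
      show "(?vs ! i, ?vs ! j, ?vs ! l) \<in> cyc \<Omega>"
        using n[of i] n[of j] n[of l] ijl ly cyc_listD[OF cl, of i j "if l = length xs then length xs + (length ys - 1) else l"]
        by (auto split: if_splits)
    qed
    then have "cyc_list (cyc (component_complex \<Gamma> (half s))) (map (r s) ?vs)"
      using cyc_list_collapse dist unfolding f distinct_rotate by blast
    then show ?thesis unfolding f by (rule H.cyc_list_rot)
  qed
qed

lemma almost_cyclic_half: "almost_cyclic_cx (component_complex \<Gamma> (half s))"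
proof -
  have C: "half s \<in> components \<Gamma>" unfolding components_cut_complex by (cases s) auto
  show ?thesis unfolding cut.almost_cyclic_component[OF C]
  proof (intro conjI ballI)
    fix f assume "f \<in> disks (component_complex \<Gamma> (half s))"
    then obtain d t where f: "f = (d, t)" "(d, t) \<in> disks \<Gamma>" "disk_verts \<Gamma> (d, t) \<subseteq> half s" by (cases f) auto
    then have "t = s" using disk_half by blast
    then show "cyc_list (cyc (component_complex \<Gamma> (half s))) (map fst (glue \<Gamma> f))" using f cyc_list_cut unfolding cut_simps(4) by auto
  qed (rule cyclic_order_half)
qed

text \<open>A division of the half is pulled back along the contraction, the whole far side joining
  the group of the new point. This is a division of \<open>\<Omega>\<close>, for which
  \<open>cut_ok\<close> is known, and contracting again carries the connectedness of the groups and
  of the crossing edges to the half.\<close>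

lemma cut_ok_half:
  assumes dv: "division (component_complex \<Gamma> (half s)) X' Y'"
  shows "cut_ok (component_complex \<Gamma> (half s)) X' Y'"
proof -
  let ?H = "component_complex \<Gamma> (half s)"
  define X Y where "X = {v \<in> vertices \<Omega>. r s v \<in> X'}" and "Y = {v \<in> vertices \<Omega>. r s v \<in> Y'}"
  have dv': "X' \<union> Y' = half s" "X' \<inter> Y' = {}" "X' \<noteq> {}" "Y' \<noteq> {}" "consec (cyc ?H) X' Y'"
    using dv unfolding division_conv by auto
  have im: "r s ` X = X'" "r s ` Y = Y'"
  proof -
    have *: "r s ` {v \<in> vertices \<Omega>. r s v \<in> Z'} = Z'" if "Z' \<subseteq> half s" for Z'
      using that unfolding collapse_image[of s, symmetric] by auto
    show "r s ` X = X'" unfolding X_def by (rule *) (use dv'(1) in blast)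
    show "r s ` Y = Y'" unfolding Y_def by (rule *) (use dv'(1) in blast)
  qed
  have ne: "X \<noteq> {}" "Y \<noteq> {}" using dv'(3,4) im by auto
  have "r s v \<in> X' \<union> Y'" for v unfolding dv'(1) by (rule collapse_half)
  then have "r s v \<in> X' \<or> r s v \<in> Y'" for v by (meson UnE)
  then have XY: "X \<union> Y = vertices \<Omega>" unfolding X_def Y_def by auto
  have XY': "X \<inter> Y = {}" using dv'(2) unfolding X_def Y_def by blast
  have "consec (cyc \<Omega>) X Y" unfolding consec_def
  proof (intro ballI notI, elim conjE)
    fix a a' b b' assume h: "a \<in> X" "a' \<in> X" "b \<in> Y" "b' \<in> Y" "(a, b, a') \<in> cyc \<Omega>" "(a', b', a) \<in> cyc \<Omega>"
    have m: "r s a \<in> X'" "r s a' \<in> X'" "r s b \<in> Y'" "r s b' \<in> Y'" using h unfolding X_def Y_def by auto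
    then have ne: "r s a \<noteq> r s b" "r s a' \<noteq> r s b" "r s a \<noteq> r s b'" "r s a' \<noteq> r s b'" using dv'(2) by auto
    show False
    proof (cases "r s a = r s a'")
      \<comment> \<open>Both vertices collapse to the new point. Then \<open>b\<close> and
        \<open>b'\<close> lie on side \<open>s\<close>, and the alternation contradicts the division
        along which \<open>\<Omega>\<close> is being cut.\<close>
      case True
      then have "a \<notin> P s" "a' \<notin> P s" using O.distinct3[OF h(5)] collapse_eq[of s a a'] by blast+
      moreover have "b \<in> P s" "b' \<in> P s" using ne calculation collapse_eq by blast+
      ultimately show False using side_facts(6)[of s] h X_def unfolding consec_def by blast
    next
      case False
      have "(r s a, r s b, r s a') \<in> cyc \<Gamma>" "(r s a', r s b', r s a) \<in> cyc \<Gamma>"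
        unfolding cut_simps(7) using False ne h(5,6) by metis+
      then have "(r s a, r s b, r s a') \<in> cyc ?H" "(r s a', r s b', r s a) \<in> cyc ?H" using collapse_half by auto
      then show False using dv'(5) m unfolding consec_def by blast
    qed
  qed
  then have "division \<Omega> X Y" unfolding division_conv using XY XY' ne by blast
  then have ok: "hconn X (inner \<Omega> X)" "hconn Y (inner \<Omega> Y)" "hconn (cross \<Omega> X) (cut_blocks \<Omega> X)"
    using cut_ok unfolding cut_ok_def by blast+
  have inn: "inner ?H Z = {ends \<Gamma> e | e. e \<in> edges \<Gamma> \<and> ends \<Gamma> e \<subseteq> half s \<and> ends \<Gamma> e \<subseteq> Z}" for Z
    unfolding inner_def by auto
  have "hconn X' (inner ?H X')" "hconn Y' (inner ?H Y')"
    using hconn_collapse[OF ok(1), of s] hconn_collapse[OF ok(2), of s] unfolding im inn .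
  \<comment> \<open>An edge whose ends are separated by \<open>X\<close> has ends with different
    images, hence an end on side \<open>s\<close>: no crossing edge is lost in passing to the
    half.\<close>
  moreover have cr: "cross ?H X' = (\<lambda>e. (e, s)) ` cross \<Omega> X"
  proof (intro set_eqI iffI)
    fix f assume "f \<in> cross ?H X'"
    then have f: "f \<in> edges \<Gamma>" "ends \<Gamma> f \<subseteq> half s" "ends \<Gamma> f \<inter> X' \<noteq> {}" "\<not> ends \<Gamma> f \<subseteq> X'" unfolding cross_def by auto
    obtain e t where et: "f = (e, t)" by (cases f)
    have "t = s" using f et edge_half by blast
    then have e: "f = (e, s)" "e \<in> edges \<Omega>" using f et unfolding cut_simps by auto
    have "r s ` ends \<Omega> e \<inter> X' \<noteq> {}" "\<not> r s ` ends \<Omega> e \<subseteq> X'" using f(3,4) unfolding e(1) cut_simps(3) by auto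
    then have "ends \<Omega> e \<inter> X \<noteq> {}" "\<not> ends \<Omega> e \<subseteq> X" using ends_sub(1)[OF e(2)] unfolding X_def by blast+
    then show "f \<in> (\<lambda>e. (e, s)) ` cross \<Omega> X" using e unfolding cross_def by blast
  next
    fix f assume "f \<in> (\<lambda>e. (e, s)) ` cross \<Omega> X"
    then obtain e where e: "f = (e, s)" "e \<in> edges \<Omega>" "ends \<Omega> e \<inter> X \<noteq> {}" "\<not> ends \<Omega> e \<subseteq> X" unfolding cross_def by auto
    then obtain v u where vu: "v \<in> ends \<Omega> e" "v \<in> X" "u \<in> ends \<Omega> e" "u \<notin> X" by blast
    then have m: "r s v \<in> X'" "r s u \<notin> X'" using ends_sub(1)[OF e(2)] unfolding X_def by auto
    then have "r s v \<noteq> r s u" by auto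
    then have "ends \<Omega> e \<inter> P s \<noteq> {}" using vu collapse_eq by blast
    then have ed: "(e, s) \<in> edges \<Gamma>" using e unfolding cut_simps by simp
    moreover have "ends \<Gamma> (e, s) \<inter> X' \<noteq> {}" "\<not> ends \<Gamma> (e, s) \<subseteq> X'" using m vu unfolding cut_simps(3) by auto
    ultimately show "f \<in> cross ?H X'" using e(1) edge_half[OF ed] unfolding cross_def by auto
  qed
  moreover have "hconn ((\<lambda>e. (e, s)) ` cross \<Omega> X) (cut_blocks ?H X')"
  proof (rule hconn_image[OF ok(3)])
    fix b x y assume "b \<in> cut_blocks \<Omega> X" "x \<in> b" "y \<in> b"
    then obtain d where d: "d \<in> disks \<Omega>" "x \<in> disk_edges \<Omega> d" "x \<in> cross \<Omega> X" "y \<in> disk_edges \<Omega> d" "y \<in> cross \<Omega> X"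
      unfolding cut_blocks_def by auto
    have c: "(x, s) \<in> cross ?H X'" "(y, s) \<in> cross ?H X'" using d cr by auto
    then have "ends \<Omega> x \<inter> P s \<noteq> {}" "ends \<Omega> y \<inter> P s \<noteq> {}" unfolding cross_def cut_simps component_complex_simps by auto
    moreover have "disk_verts \<Omega> d \<inter> P s \<noteq> {}" using calculation edge_in_disk[OF d(1,2)] by blast
    ultimately have "(d, s) \<in> disks \<Gamma>" "(x, s) \<in> disk_edges ?H (d, s)" "(y, s) \<in> disk_edges ?H (d, s)"
      using d disk_edges_cut[OF d(1)] unfolding cut_simps by auto
    moreover from this have "(d, s) \<in> disks ?H" using disk_half by auto
    ultimately show "(x, s) = (y, s) \<or> (\<exists>e'\<in>cut_blocks ?H X'. (x, s) \<in> e' \<and> (y, s) \<in> e')"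
      using c unfolding cut_blocks_def by blast
  qed (auto simp: cut_blocks_def)
  ultimately show ?thesis unfolding cut_ok_def by simp
qed

lemma film_half: "film_conn S (component_complex \<Gamma> (half s))"
  unfolding film_conn_def
proof (intro conjI allI impI)
  have D: "disks (component_complex \<Gamma> (half s)) \<subseteq> (\<lambda>d. (d, s)) ` disks \<Omega>"
  proof
    fix f assume "f \<in> disks (component_complex \<Gamma> (half s))"
    then obtain d t where f: "f = (d, t)" "(d, t) \<in> disks \<Gamma>" "disk_verts \<Gamma> (d, t) \<subseteq> half s" by (cases f) auto
    then have "t = s" using disk_half by blast
    then show "f \<in> (\<lambda>d. (d, s)) ` disks \<Omega>" using f unfolding cut_simps(4) by auto
  qed
  have i: "inj_on (dcol \<Omega>) (disks \<Omega>)" "dcol \<Omega> ` disks \<Omega> \<subseteq> S" using film unfolding film_conn_def by auto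
  have c: "dcol (component_complex \<Gamma> (half s)) (d, s) = dcol \<Omega> d" for d using cut_simps(6) by simp
  have "inj_on (dcol (component_complex \<Gamma> (half s))) ((\<lambda>d. (d, s)) ` disks \<Omega>)"
    unfolding inj_on_def ball_simps c using i(1) by (auto simp: inj_on_def)
  then show "inj_on (dcol (component_complex \<Gamma> (half s))) (disks (component_complex \<Gamma> (half s)))"
    using D by (rule inj_on_subset)
  have "dcol (component_complex \<Gamma> (half s)) ` (\<lambda>d. (d, s)) ` disks \<Omega> \<subseteq> S"
    unfolding image_image c by (rule i(2))
  then show "dcol (component_complex \<Gamma> (half s)) ` disks (component_complex \<Gamma> (half s)) \<subseteq> S"
    using D by blast
qed (use almost_cyclic_half cut_ok_half in auto)

lemma film_cut: "film_surface S \<Gamma>"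
  unfolding film_surface_components components_cut_complex
proof (intro conjI)
  show "cyc \<Gamma> \<subseteq> (\<Union>C\<in>{half True, half False}. C \<times> C \<times> C)"
  proof
    fix p assume p: "p \<in> cyc \<Gamma>"
    obtain x y z where xyz: "p = (x, y, z)" by (cases p)
    then obtain s where "x \<in> half s" "y \<in> half s" "z \<in> half s" using cyc_cut_half p by blast
    then show "p \<in> (\<Union>C\<in>{half True, half False}. C \<times> C \<times> C)" using xyz by (cases s) auto
  qed
qed (use regular_cut film_half in auto)

lemma vertex_ok: "q \<in> vertices \<Omega> \<Longrightarrow> vertex_ok \<Omega> q"
  using film_vertex_ok[of S \<Omega> q] film_conn_iff[of S \<Omega>] film by blast

lemma cut_vertex_ok: "x \<in> vertices \<Gamma> \<Longrightarrow> vertex_ok \<Gamma> x"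
  by (rule film_vertex_ok[OF film_cut])

text \<open>All edges and disks at \<open>q\<close> meet the side of \<open>q\<close>, so the
  surroundings of an old vertex survive the cut unchanged.\<close>

lemma vertex_class_cut:
  assumes q: "q \<in> vertices \<Omega>"
  shows "vertex_class \<Gamma> (Inl q) = vertex_class \<Omega> q"
proof -
  have "q \<in> P True \<or> q \<in> P False" using q side_facts(4)[of True] by auto
  then obtain s where s: "q \<in> P s" by blast
  then have v: "Inl q \<in> vertices \<Gamma>" unfolding cut_simps(1) half_def by (cases s) auto
  show ?thesis
  proof (rule vertex_class_transfer[OF vertex_ok[OF q] cut_vertex_ok[OF v], of "\<lambda>d. (d, s)" "\<lambda>e. (e, s)"])
    show "(\<lambda>d. (d, s)) ` {d \<in> disks \<Omega>. q \<in> disk_verts \<Omega> d} = {d \<in> disks \<Gamma>. Inl q \<in> disk_verts \<Gamma> d}"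
    proof (intro set_eqI iffI)
      fix f assume "f \<in> (\<lambda>d. (d, s)) ` {d \<in> disks \<Omega>. q \<in> disk_verts \<Omega> d}"
      then obtain d where d: "f = (d, s)" "d \<in> disks \<Omega>" "q \<in> disk_verts \<Omega> d" by blast
      then have ne: "disk_verts \<Omega> d \<inter> P s \<noteq> {}" using s by blast
      then have "Inl q \<in> disk_verts \<Gamma> (d, s)" using disk_verts_cut[OF d(2) ne] d(3) collapse_simps(1)[OF s] by (metis image_eqI)
      then show "f \<in> {d \<in> disks \<Gamma>. Inl q \<in> disk_verts \<Gamma> d}" using d ne unfolding cut_simps by auto
    next
      fix f assume f: "f \<in> {d \<in> disks \<Gamma>. Inl q \<in> disk_verts \<Gamma> d}"
      obtain d t where dt: "f = (d, t)" by (cases f)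
      have d: "d \<in> disks \<Omega>" "disk_verts \<Omega> d \<inter> P t \<noteq> {}" "Inl q \<in> r t ` disk_verts \<Omega> d"
        using f dt disk_verts_cut unfolding cut_simps by auto
      then obtain v where v: "v \<in> disk_verts \<Omega> d" "Inl q = r t v" by blast
      then have "v = q" "q \<in> P t" unfolding collapse_def by (auto split: if_splits)
      moreover have "t = s" using half_disjoint[of "Inl q" t s] \<open>q \<in> P t\<close> s unfolding half_def by blast
      ultimately show "f \<in> (\<lambda>d. (d, s)) ` {d \<in> disks \<Omega>. q \<in> disk_verts \<Omega> d}" using d dt v by blast
    qed
    fix d t e assume d: "d \<in> disks \<Omega>" and i: "corner_edge \<Omega> d q t e"
    then have ne: "disk_verts \<Omega> d \<inter> P s \<noteq> {}" using s corner_edge_mem(3) by blast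
    show "corner_edge \<Gamma> (d, s) (Inl q) t (e, s)"
      using i s collapse_simps(1)[OF s] unfolding corner_edge_def disk_step_cut[OF d ne] by (cases t) (simp; metis)+
  qed (auto simp: cut_simps inj_on_def)
qed

text \<open>Around both new points lie the crossing edges and the disks meeting both sides. A
  crossing edge along which the boundary of a disk leaves one new point is, on the other side, the
  edge along which the boundary reaches the other new point.\<close>

lemma vertex_class_cut_dual: "vertex_class \<Gamma> (Inr False) = dual (vertex_class \<Gamma> (Inr True))"
proof -
  have v: "Inr True \<in> vertices \<Gamma>" "Inr False \<in> vertices \<Gamma>" unfolding cut_simps(1) half_def by auto
  have PF: "v \<in> P False \<longleftrightarrow> v \<notin> P True" if "v \<in> vertices \<Omega>" for v using side_facts(4)[of True] that by auto
  have mem: "(d, s) \<in> disks \<Gamma> \<and> Inr s \<in> disk_verts \<Gamma> (d, s) \<longleftrightarrow>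
    d \<in> disks \<Omega> \<and> disk_verts \<Omega> d \<inter> P True \<noteq> {} \<and> disk_verts \<Omega> d \<inter> P False \<noteq> {}" for d s
  proof -
    have "Inr s \<in> r s ` disk_verts \<Omega> d \<longleftrightarrow> \<not> disk_verts \<Omega> d \<subseteq> P s" unfolding collapse_def by auto
    moreover have "\<not> disk_verts \<Omega> d \<subseteq> P s \<longleftrightarrow> disk_verts \<Omega> d \<inter> P (\<not> s) \<noteq> {}" if "d \<in> disks \<Omega>"
      using disk_sub(1)[OF that] side_facts(4)[of s] by auto
    ultimately show ?thesis using disk_verts_cut[of d s] unfolding cut_simps by (cases s) auto
  qed
  have inr: "Inr s \<in> half t \<longleftrightarrow> s = t" for s t unfolding half_def by auto
  show ?thesis
  proof (rule vertex_class_transfer_dual[OF cut_vertex_ok[OF v(1)] cut_vertex_ok[OF v(2)], of "\<lambda>(d, t). (d, False)" "\<lambda>(e, t). (e, False)"])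
    have own: "s = t" if "(d, t) \<in> disks \<Gamma>" "Inr s \<in> disk_verts \<Gamma> (d, t)" for d s t
      using that disk_half[of d t t] inr by auto
    show "(\<lambda>(d, t). (d, False)) ` {d \<in> disks \<Gamma>. Inr True \<in> disk_verts \<Gamma> d} = {d \<in> disks \<Gamma>. Inr False \<in> disk_verts \<Gamma> d}"
    proof (intro set_eqI iffI)
      fix f assume "f \<in> (\<lambda>(d, t). (d, False)) ` {d \<in> disks \<Gamma>. Inr True \<in> disk_verts \<Gamma> d}"
      then obtain d t where d: "(d, t) \<in> disks \<Gamma>" "Inr True \<in> disk_verts \<Gamma> (d, t)" "f = (d, False)" by auto
      then have "t = True" using own by blast
      then show "f \<in> {d \<in> disks \<Gamma>. Inr False \<in> disk_verts \<Gamma> d}" using d mem[of d True] mem[of d False] by simp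
    next
      fix f assume f: "f \<in> {d \<in> disks \<Gamma>. Inr False \<in> disk_verts \<Gamma> d}"
      obtain d t where dt: "f = (d, t)" by (cases f)
      then have "t = False" using f own by blast
      then have "(d, True) \<in> {d \<in> disks \<Gamma>. Inr True \<in> disk_verts \<Gamma> d}" "f = (d, False)"
        using f dt mem[of d True] mem[of d False] by auto
      then show "f \<in> (\<lambda>(d, t). (d, False)) ` {d \<in> disks \<Gamma>. Inr True \<in> disk_verts \<Gamma> d}"
        by (intro image_eqI[of _ _ "(d, True)"]) auto
    qed
    fix f t g assume f: "f \<in> disks \<Gamma>" and i: "corner_edge \<Gamma> f (Inr True) t g"
    obtain d t' where dt: "f = (d, t')" by (cases f)
    have "Inr True \<in> disk_verts \<Gamma> f" using cut.corner_edge_mem(3)[OF f i] .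
    then have t': "t' = True" using own f dt by blast
    then have d: "d \<in> disks \<Omega>" "disk_verts \<Omega> d \<inter> P True \<noteq> {}" "disk_verts \<Omega> d \<inter> P False \<noteq> {}"
      using mem[of d True] f dt \<open>Inr True \<in> disk_verts \<Gamma> f\<close> by auto
    show "corner_edge \<Gamma> (case f of (d, t) \<Rightarrow> (d, False)) (Inr False) (\<not> t) (case g of (e, t) \<Rightarrow> (e, False))"
    proof (cases t)
      case True
      then obtain y where "disk_step \<Gamma> (d, True) (Inr True) g y" using i unfolding corner_edge_def dt t' by auto
      then obtain v e u where s: "disk_step \<Omega> d v e u" "v \<in> P True \<or> u \<in> P True" "Inr True = r True v" "g = (e, True)"
        unfolding disk_step_cut[OF d(1,2)] by blast
      have "v \<notin> P True" using s(3) unfolding collapse_def by (auto split: if_splits)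
      then have "v \<in> P False" "r False u = Inr False"
        using s(2) PF disk_step_ends(4,5)[OF d(1) s(1)] unfolding collapse_def by auto
      then have "disk_step \<Gamma> (d, False) (r False v) (e, False) (Inr False)" unfolding disk_step_cut[OF d(1,3)] using s(1) by metis
      then show ?thesis using True s(4) dt unfolding corner_edge_def by auto
    next
      case False
      then obtain y where "disk_step \<Gamma> (d, True) y g (Inr True)" using i unfolding corner_edge_def dt t' by auto
      then obtain v e u where s: "disk_step \<Omega> d v e u" "v \<in> P True \<or> u \<in> P True" "Inr True = r True u" "g = (e, True)"
        unfolding disk_step_cut[OF d(1,2)] by blast
      have "u \<notin> P True" using s(3) unfolding collapse_def by (auto split: if_splits)
      then have "u \<in> P False" "r False v = Inr False"
        using s(2) PF disk_step_ends(4,5)[OF d(1) s(1)] unfolding collapse_def by auto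
      then have "disk_step \<Gamma> (d, False) (Inr False) (e, False) (r False u)" unfolding disk_step_cut[OF d(1,3)] using s(1) by metis
      then show ?thesis using False s(4) dt unfolding corner_edge_def by auto
    qed
  next
    show "inj_on (\<lambda>(e, t). (e, False)) {e \<in> edges \<Gamma>. Inr True \<in> ends \<Gamma> e}"
    proof (rule inj_onI)
      fix f g assume fg: "f \<in> {e \<in> edges \<Gamma>. Inr True \<in> ends \<Gamma> e}" "g \<in> {e \<in> edges \<Gamma>. Inr True \<in> ends \<Gamma> e}"
        "(case f of (e, t) \<Rightarrow> (e, False)) = (case g of (e, t) \<Rightarrow> (e, False))"
      obtain e s e' t where f: "f = (e, s)" "g = (e', t)" by (cases f, cases g)
      have "Inr True \<in> half s" using edge_half[of e s s] fg(1) f(1) by blast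
      moreover have "Inr True \<in> half t" using edge_half[of e' t t] fg(2) f(2) by blast
      ultimately show "f = g" using fg(3) f inr by auto
    qed
  qed (auto simp: cut_simps)
qed

lemma graph_cut_exists: "\<exists>\<gamma>. graph_cut \<Omega> \<gamma> A B"
  using graph_cut_iff cut_ok div by blast

end

section \<open>Relabelling, disjoint unions and components\<close>

text \<open>The axioms of the field theory concern complexes labelled by natural numbers; cut
  complexes get there by an injective relabelling.\<close>

definition relabel :: "('v \<Rightarrow> 'w) \<Rightarrow> ('e \<Rightarrow> 'f) \<Rightarrow> ('d \<Rightarrow> 'g) \<Rightarrow>
    ('v, 'e, 'd, 'c) complex2 \<Rightarrow> ('w, 'f, 'g, 'c) complex2" where
  "relabel fv fe fd \<Omega> =
     \<lparr>vertices = fv ` vertices \<Omega>, edges = fe ` edges \<Omega>, ends = (\<lambda>e. fv ` ends \<Omega> (inv fe e)),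
      disks = fd ` disks \<Omega>, glue = (\<lambda>d. map (map_prod fv fe) (glue \<Omega> (inv fd d))),
      cyc = map_prod fv (map_prod fv fv) ` cyc \<Omega>, dcol = (\<lambda>d. dcol \<Omega> (inv fd d))\<rparr>"

locale relabelling =
  fixes fv :: "'v \<Rightarrow> 'w" and fe :: "'e \<Rightarrow> 'f" and fd :: "'d \<Rightarrow> 'g"
  assumes inj: "inj fv" "inj fe" "inj fd"
begin

abbreviation "rl \<equiv> relabel fv fe fd"

lemma rl_simps:
  "vertices (rl \<Omega>) = fv ` vertices \<Omega>" "edges (rl \<Omega>) = fe ` edges \<Omega>" "ends (rl \<Omega>) (fe e) = fv ` ends \<Omega> e"
  "disks (rl \<Omega>) = fd ` disks \<Omega>" "glue (rl \<Omega>) (fd d) = map (map_prod fv fe) (glue \<Omega> d)"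
  "cyc (rl \<Omega>) = map_prod fv (map_prod fv fv) ` cyc \<Omega>" "dcol (rl \<Omega>) (fd d) = dcol \<Omega> d"
  "disk_verts (rl \<Omega>) (fd d) = fv ` disk_verts \<Omega> d" "disk_edges (rl \<Omega>) (fd d) = fe ` disk_edges \<Omega> d"
  unfolding disk_verts_def disk_edges_def by (simp_all add: relabel_def inj image_image)

lemma cyc_rl: "(fv a, fv b, fv c) \<in> cyc (rl \<Omega>) \<longleftrightarrow> (a, b, c) \<in> cyc \<Omega>"
  unfolding rl_simps using inj(1) by (auto simp: image_iff inj_eq Bex_def)

lemma rl_sub:
  "ends (rl \<Omega>) (fe e) \<subseteq> fv ` C \<longleftrightarrow> ends \<Omega> e \<subseteq> C"
  "disk_verts (rl \<Omega>) (fd d) \<subseteq> fv ` C \<longleftrightarrow> disk_verts \<Omega> d \<subseteq> C"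
  "ends (rl \<Omega>) (fe e) \<inter> fv ` C = {} \<longleftrightarrow> ends \<Omega> e \<inter> C = {}"
  unfolding rl_simps image_Int[OF inj(1), symmetric] by (simp_all add: inj_image_subset_iff[OF inj(1)])

lemma rl_component: "component_complex (rl \<Omega>) (fv ` C) = rl (component_complex \<Omega> C)"
proof -
  have "{e \<in> fe ` edges \<Omega>. ends (rl \<Omega>) e \<subseteq> fv ` C} = fe ` {e \<in> edges \<Omega>. ends \<Omega> e \<subseteq> C}"
    unfolding Compr_image_eq rl_sub ..
  moreover have "{d \<in> fd ` disks \<Omega>. disk_verts (rl \<Omega>) d \<subseteq> fv ` C} = fd ` {d \<in> disks \<Omega>. disk_verts \<Omega> d \<subseteq> C}"
    unfolding Compr_image_eq rl_sub ..
  moreover have "map_prod fv (map_prod fv fv) ` cyc \<Omega> \<inter> fv ` C \<times> fv ` C \<times> fv ` C =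
      map_prod fv (map_prod fv fv) ` (cyc \<Omega> \<inter> C \<times> C \<times> C)"
  proof -
    have "map_prod fv (map_prod fv fv) ` (cyc \<Omega> \<inter> C \<times> C \<times> C) =
      map_prod fv (map_prod fv fv) ` cyc \<Omega> \<inter> map_prod fv (map_prod fv fv) ` (C \<times> C \<times> C)"
      using inj(1) by (intro image_Int) (simp add: prod.inj_map)
    moreover have "map_prod fv (map_prod fv fv) ` (C \<times> C \<times> C) = fv ` C \<times> fv ` C \<times> fv ` C"
      by (simp add: map_prod_surj_on)
    ultimately show ?thesis by simp
  qed
  ultimately show ?thesis unfolding component_complex_def by (simp add: relabel_def)
qed

lemma regular_rl:
  assumes "regular_complex \<Omega>" shows "regular_complex (rl \<Omega>)"
proof -
  interpret regular_cx \<Omega> by unfold_locales fact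
  have ok: "disk_ok (fv ` vertices \<Omega>) (fe ` edges \<Omega>) (ends (rl \<Omega>)) (map (map_prod fv fe) (glue \<Omega> d))" if d: "d \<in> disks \<Omega>" for d
  proof -
    have f: "map fst (map (map_prod fv fe) (glue \<Omega> d)) = map fv (map fst (glue \<Omega> d))"
      "map snd (map (map_prod fv fe) (glue \<Omega> d)) = map fe (map snd (glue \<Omega> d))" by simp_all
    have g: "distinct (map fst (glue \<Omega> d))" "distinct (map snd (glue \<Omega> d))" "set (glue \<Omega> d) \<subseteq> vertices \<Omega> \<times> edges \<Omega>"
      "glue \<Omega> d \<noteq> []" "\<And>v e u. (v, e, u) \<in> steps (glue \<Omega> d) \<Longrightarrow> ends \<Omega> e = {v, u}"
      using disk_ok[OF d] unfolding disk_ok_def by auto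
    have "distinct (map fv (map fst (glue \<Omega> d)))" "distinct (map fe (map snd (glue \<Omega> d)))"
      using g(1,2) inj(1,2) unfolding distinct_map[of fv] distinct_map[of fe] by (auto intro: inj_on_subset)
    moreover have "set (map (map_prod fv fe) (glue \<Omega> d)) \<subseteq> fv ` vertices \<Omega> \<times> fe ` edges \<Omega>" using g(3) by auto
    moreover have "\<forall>(v, e, u)\<in>steps (map (map_prod fv fe) (glue \<Omega> d)). ends (rl \<Omega>) e = {v, u}"
      unfolding steps_map using g(5) by (auto simp: rl_simps(3))
    ultimately show ?thesis unfolding disk_ok_def f using g(4) by simp
  qed
  have "card (fv ` ends \<Omega> e) = card (ends \<Omega> e)" for e using inj(1) by (intro card_image inj_on_subset[OF inj(1)]) auto
  moreover have "(\<Union>d\<in>disks \<Omega>. fe ` disk_edges \<Omega> d) = fe ` edges \<Omega>" "(\<Union>d\<in>disks \<Omega>. fv ` disk_verts \<Omega> d) = fv ` vertices \<Omega>"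
    using regular unfolding regular_complex_conv by (auto simp: image_UN[symmetric])
  ultimately show ?thesis unfolding regular_complex_conv rl_simps(1,2,4)
    using finite_cells ends_sub ok by (simp add: rl_simps image_mono)
qed

lemma inner_rl: "inner (rl \<Omega>) (fv ` X) = (`) fv ` inner \<Omega> X"
proof -
  have "inner (rl \<Omega>) (fv ` X) = (\<lambda>e. ends (rl \<Omega>) (fe e)) ` {e \<in> edges \<Omega>. ends (rl \<Omega>) (fe e) \<subseteq> fv ` X}"
    unfolding inner_def rl_simps(2) by blast
  moreover have "inner \<Omega> X = ends \<Omega> ` {e \<in> edges \<Omega>. ends \<Omega> e \<subseteq> X}" unfolding inner_def by blast
  ultimately show ?thesis unfolding rl_sub by (simp add: rl_simps(3) image_image)
qed

lemma cross_rl: "cross (rl \<Omega>) (fv ` X) = fe ` cross \<Omega> X"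
  unfolding cross_def rl_simps(2) Compr_image_eq rl_sub ..

lemma cut_blocks_rl: "cut_blocks (rl \<Omega>) (fv ` X) = (`) fe ` cut_blocks \<Omega> X"
  unfolding cut_blocks_def cross_rl rl_simps(4) image_image rl_simps(9) image_Int[OF inj(2)] ..

lemma hconn_inj_image:
  assumes "hconn V E" "\<And>e. e \<in> E \<Longrightarrow> e \<subseteq> V" shows "hconn (f ` V) ((`) f ` E)"
  by (rule hconn_image[OF assms]) auto

lemma film_conn_rl:
  assumes f: "film_conn S \<Omega>" shows "film_conn S (rl \<Omega>)"
proof -
  interpret almost_cyclic_cx \<Omega> using f unfolding film_conn_def by blast
  have inner_sub: "e \<in> inner \<Omega> X \<Longrightarrow> e \<subseteq> X" for e X unfolding inner_def by auto
  have "almost_cyclic_cx (rl \<Omega>)"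
  proof
    show "regular_complex (rl \<Omega>)" using regular_rl regular .
    show "hconn (vertices (rl \<Omega>)) (inner (rl \<Omega>) (vertices (rl \<Omega>)))"
      unfolding rl_simps(1) inner_rl by (rule hconn_inj_image[OF conn inner_sub])
    have "cyc (rl \<Omega>) = {(x, y, z). x \<in> fv ` vertices \<Omega> \<and> y \<in> fv ` vertices \<Omega> \<and> z \<in> fv ` vertices \<Omega> \<and> (inv fv x, inv fv y, inv fv z) \<in> cyc \<Omega>}"
      (is "_ = ?R")
    proof (intro set_eqI iffI)
      fix p assume "p \<in> cyc (rl \<Omega>)"
      then obtain a b c where "p = (fv a, fv b, fv c)" "(a, b, c) \<in> cyc \<Omega>" unfolding rl_simps by auto
      then show "p \<in> ?R" using O.sub inj(1) by auto
    next
      fix p assume "p \<in> ?R"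
      then obtain a b c where "p = (fv a, fv b, fv c)" "(a, b, c) \<in> cyc \<Omega>" using inj(1) by auto
      then show "p \<in> cyc (rl \<Omega>)" using cyc_rl by blast
    qed
    moreover have "inj_on (inv fv) (fv ` vertices \<Omega>)" "inv fv ` fv ` vertices \<Omega> \<subseteq> vertices \<Omega>"
      using inj(1) by (auto simp: inj_on_def)
    ultimately show "cyclic_order_on (vertices (rl \<Omega>)) (cyc (rl \<Omega>))"
      unfolding rl_simps(1) using cyclic_order_on_inj[OF order, of "inv fv" "fv ` vertices \<Omega>"] by simp
    fix d' assume "d' \<in> disks (rl \<Omega>)"
    then obtain d where d: "d' = fd d" "d \<in> disks \<Omega>" unfolding rl_simps by auto
    have "map fst (glue (rl \<Omega>) d') = map fv (map fst (glue \<Omega> d))" unfolding d(1) rl_simps by simp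
    then show "cyc_list (cyc (rl \<Omega>)) (map fst (glue (rl \<Omega>) d'))"
      using disk_cyc[OF d(2)] unfolding cyc_list_def by (auto simp: cyc_rl)
  qed
  moreover have "cut_ok (rl \<Omega>) X' Y'" if dv: "division (rl \<Omega>) X' Y'" for X' Y'
  proof -
    have dv': "X' \<union> Y' = fv ` vertices \<Omega>" "X' \<inter> Y' = {}" "X' \<noteq> {}" "Y' \<noteq> {}" "consec (cyc (rl \<Omega>)) X' Y'"
      using dv unfolding division_conv rl_simps by auto
    have "X' \<subseteq> fv ` vertices \<Omega>" "Y' \<subseteq> fv ` vertices \<Omega>" using dv'(1) by auto
    then obtain X Y where XY: "X \<subseteq> vertices \<Omega>" "X' = fv ` X" "Y \<subseteq> vertices \<Omega>" "Y' = fv ` Y" by (meson subset_imageE)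
    have "fv ` (X \<union> Y) = fv ` vertices \<Omega>" using dv'(1) XY by (simp add: image_Un)
    then have "X \<union> Y = vertices \<Omega>" using inj(1) by (simp add: inj_image_eq_iff)
    moreover have "X \<inter> Y = {}" "X \<noteq> {}" "Y \<noteq> {}" using dv' XY by auto
    moreover have "consec (cyc \<Omega>) X Y" using dv'(5) unfolding XY consec_def ball_simps(9) cyc_rl .
    ultimately have "division \<Omega> X Y" unfolding division_conv by blast
    then have "hconn X (inner \<Omega> X)" "hconn Y (inner \<Omega> Y)" "hconn (cross \<Omega> X) (cut_blocks \<Omega> X)"
      using f unfolding film_conn_def cut_ok_def by blast+
    then show ?thesis unfolding cut_ok_def XY inner_rl cross_rl cut_blocks_rl
      by (intro conjI hconn_inj_image) (auto simp: inner_def cut_blocks_def)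
  qed
  moreover have "inj_on (dcol (rl \<Omega>)) (disks (rl \<Omega>))" "dcol (rl \<Omega>) ` disks (rl \<Omega>) \<subseteq> S"
    using f unfolding film_conn_def rl_simps(4) by (auto simp: rl_simps(7) inj_on_def)
  ultimately show ?thesis unfolding film_conn_def by blast
qed

lemma components_rl:
  assumes "regular_complex \<Omega>" shows "components (rl \<Omega>) = (`) fv ` components \<Omega>"
proof -
  interpret regular_cx \<Omega> by unfold_locales fact
  interpret R: regular_cx "rl \<Omega>" using regular_rl[OF assms] by unfold_locales
  show ?thesis unfolding R.components_cut_iff blocks_of_def
  proof (intro conjI ballI impI)
    show "\<Union> ((`) fv ` components \<Omega>) = vertices (rl \<Omega>)"
      unfolding rl_simps(1) components_facts(1)[symmetric] by blast
    fix C' assume "C' \<in> (`) fv ` components \<Omega>"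
    then obtain C where C: "C \<in> components \<Omega>" "C' = fv ` C" by blast
    show "C' = D'" if "D' \<in> (`) fv ` components \<Omega>" "C' \<inter> D' \<noteq> {}" for D'
    proof -
      obtain D where D: "D \<in> components \<Omega>" "D' = fv ` D" using \<open>D' \<in> (`) fv ` components \<Omega>\<close> by blast
      have "C \<inter> D \<noteq> {}" using that(2) unfolding C(2) D(2) image_Int[OF inj(1), symmetric] by simp
      then show ?thesis using components_facts(2)[OF C(1) D(1)] C(2) D(2) by simp
    qed
    have "{ends (rl \<Omega>) e |e. e \<in> edges (rl \<Omega>) - {} \<and> ends (rl \<Omega>) e \<subseteq> C'} = inner (rl \<Omega>) C'" unfolding inner_def by auto
    moreover have "inner \<Omega> C = {ends \<Omega> e | e. e \<in> edges \<Omega> \<and> ends \<Omega> e \<subseteq> C}" unfolding inner_def by auto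
    then have "hconn (fv ` C) ((`) fv ` inner \<Omega> C)" using components_facts(4)[OF C(1)] by (intro hconn_inj_image) auto
    ultimately show "hconn C' {ends (rl \<Omega>) e |e. e \<in> edges (rl \<Omega>) - {} \<and> ends (rl \<Omega>) e \<subseteq> C'}"
      unfolding C(2) inner_rl by simp
  next
    fix e' assume "e' \<in> edges (rl \<Omega>) - {}"
    then obtain e where e: "e' = fe e" "e \<in> edges \<Omega>" unfolding rl_simps by auto
    obtain C where "C \<in> components \<Omega>" "ends \<Omega> e \<subseteq> C" using components_facts(3)[OF e(2)] by blast
    then show "\<exists>C\<in>(`) fv ` components \<Omega>. ends (rl \<Omega>) e' \<subseteq> C" unfolding e(1) rl_simps(3) by blast
  qed
qed

lemma film_surface_rl:
  assumes f: "film_surface S \<Omega>" shows "film_surface S (rl \<Omega>)"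
proof -
  have reg: "regular_complex \<Omega>" and c: "cyc \<Omega> \<subseteq> (\<Union>C\<in>components \<Omega>. C \<times> C \<times> C)"
    and fc: "\<And>C. C \<in> components \<Omega> \<Longrightarrow> film_conn S (component_complex \<Omega> C)"
    using f unfolding film_surface_components by auto
  have "cyc (rl \<Omega>) \<subseteq> (\<Union>C\<in>components (rl \<Omega>). C \<times> C \<times> C)"
  proof
    fix p assume "p \<in> cyc (rl \<Omega>)"
    then obtain a b d where p: "p = (fv a, fv b, fv d)" "(a, b, d) \<in> cyc \<Omega>" unfolding rl_simps by auto
    then obtain C where "C \<in> components \<Omega>" "a \<in> C" "b \<in> C" "d \<in> C" using c by blast
    then show "p \<in> (\<Union>C\<in>components (rl \<Omega>). C \<times> C \<times> C)" unfolding components_rl[OF reg] p(1) by blast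
  qed
  then show ?thesis unfolding film_surface_components using regular_rl[OF reg] fc film_conn_rl
    by (auto simp: components_rl[OF reg] rl_component)
qed

lemma complex_iso_rl: "complex_iso fv fe fd \<Omega> (rl \<Omega>)"
  unfolding complex_iso_def using inj
  by (auto simp: rl_simps bij_betw_def intro: inj_on_subset exI[of _ 0])

end

section \<open>Vertex classes under isomorphisms, disjoint unions and passage to components\<close>

lemma complex_iso_steps:
  assumes "complex_iso fv fe fd \<Omega> \<Omega>'" "d \<in> disks \<Omega>"
  shows "steps (glue \<Omega>' (fd d)) = (\<lambda>(v, e, u). (fv v, fe e, fv u)) ` steps (glue \<Omega> d)"
    "disk_verts \<Omega>' (fd d) = fv ` disk_verts \<Omega> d"
proof -
  obtain k where k: "glue \<Omega>' (fd d) = rotate k (map (map_prod fv fe) (glue \<Omega> d))"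
    using assms unfolding complex_iso_def by blast
  show "steps (glue \<Omega>' (fd d)) = (\<lambda>(v, e, u). (fv v, fe e, fv u)) ` steps (glue \<Omega> d)"
    unfolding k steps_rotate steps_map ..
  show "disk_verts \<Omega>' (fd d) = fv ` disk_verts \<Omega> d" unfolding disk_verts_def k by (simp add: image_image)
qed

lemma complex_iso_vertex_class:
  assumes iso: "complex_iso fv fe fd \<Omega> \<Omega>'" and q: "q \<in> vertices \<Omega>"
    and ok: "vertex_ok \<Omega> q" "vertex_ok \<Omega>' (fv q)"
  shows "vertex_class \<Omega>' (fv q) = vertex_class \<Omega> q"
proof -
  interpret regular_cx \<Omega> using ok(1) unfolding vertex_ok_def by unfold_locales blast
  have I: "inj_on fv (vertices \<Omega>)" "inj_on fe (edges \<Omega>)" "fd ` disks \<Omega> = disks \<Omega>'"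
    using iso unfolding complex_iso_def bij_betw_def by auto
  show ?thesis
  proof (rule vertex_class_transfer[OF ok, of fd fe])
    have "fv q \<in> disk_verts \<Omega>' (fd d) \<longleftrightarrow> q \<in> disk_verts \<Omega> d" if "d \<in> disks \<Omega>" for d
      unfolding complex_iso_steps(2)[OF iso that] using inj_on_image_mem_iff[OF I(1) q disk_sub(1)[OF that]] .
    then show "fd ` {d \<in> disks \<Omega>. q \<in> disk_verts \<Omega> d} = {d \<in> disks \<Omega>'. fv q \<in> disk_verts \<Omega>' d}"
      unfolding I(3)[symmetric] by blast
    show "dcol \<Omega>' (fd d) = dcol \<Omega> d" if "d \<in> disks \<Omega>" for d using iso that unfolding complex_iso_def by blast
    show "inj_on fe {e \<in> edges \<Omega>. q \<in> ends \<Omega> e}" using I(2) by (rule inj_on_subset) auto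
    fix d s e assume d: "d \<in> disks \<Omega>" and i: "corner_edge \<Omega> d q s e"
    have st: "disk_step \<Omega>' (fd d) (fv v) (fe e) (fv u)" if "disk_step \<Omega> d v e u" for v e u
      using that unfolding disk_step_def complex_iso_steps(1)[OF iso d] by force
    show "corner_edge \<Omega>' (fd d) (fv q) s (fe e)" using i st unfolding corner_edge_def by (auto split: if_splits)
  qed
qed

lemma disjoint_union_simps:
  "vertices (disjoint_union \<Omega>' \<Omega>'') = vertices \<Omega>' <+> vertices \<Omega>''"
  "edges (disjoint_union \<Omega>' \<Omega>'') = edges \<Omega>' <+> edges \<Omega>''"
  "disks (disjoint_union \<Omega>' \<Omega>'') = disks \<Omega>' <+> disks \<Omega>''"
  "ends (disjoint_union \<Omega>' \<Omega>'') (Inl e) = Inl ` ends \<Omega>' e" "ends (disjoint_union \<Omega>' \<Omega>'') (Inr f) = Inr ` ends \<Omega>'' f"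
  "glue (disjoint_union \<Omega>' \<Omega>'') (Inl d) = map (map_prod Inl Inl) (glue \<Omega>' d)"
  "glue (disjoint_union \<Omega>' \<Omega>'') (Inr g) = map (map_prod Inr Inr) (glue \<Omega>'' g)"
  "dcol (disjoint_union \<Omega>' \<Omega>'') (Inl d) = dcol \<Omega>' d" "dcol (disjoint_union \<Omega>' \<Omega>'') (Inr g) = dcol \<Omega>'' g"
  "cyc (disjoint_union \<Omega>' \<Omega>'') = map_prod Inl (map_prod Inl Inl) ` cyc \<Omega>' \<union> map_prod Inr (map_prod Inr Inr) ` cyc \<Omega>''"
  "disk_verts (disjoint_union \<Omega>' \<Omega>'') (Inl d) = Inl ` disk_verts \<Omega>' d"
  "disk_verts (disjoint_union \<Omega>' \<Omega>'') (Inr g) = Inr ` disk_verts \<Omega>'' g"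
  "disk_edges (disjoint_union \<Omega>' \<Omega>'') (Inl d) = Inl ` disk_edges \<Omega>' d"
  "disk_edges (disjoint_union \<Omega>' \<Omega>'') (Inr g) = Inr ` disk_edges \<Omega>'' g"
  unfolding disjoint_union_def disk_verts_def disk_edges_def by (simp_all add: image_image)

lemma disk_ok_map:
  assumes "disk_ok V E en w" "inj fv" "inj fe" "fv ` V \<subseteq> V'" "fe ` E \<subseteq> E'" "\<And>e. en' (fe e) = fv ` en e"
  shows "disk_ok V' E' en' (map (map_prod fv fe) w)"
proof -
  have f: "map fst (map (map_prod fv fe) w) = map fv (map fst w)"
    "map snd (map (map_prod fv fe) w) = map fe (map snd w)" by simp_all
  have "distinct (map fv (map fst w))" "distinct (map fe (map snd w))"
    using assms(1-3) unfolding disk_ok_def distinct_map[of fv] distinct_map[of fe] by (auto intro: inj_on_subset)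
  moreover have "fv v \<in> V' \<and> fe e \<in> E'" if "(v, e) \<in> set w" for v e
    using that assms(1,4,5) unfolding disk_ok_def by blast
  then have "set (map (map_prod fv fe) w) \<subseteq> V' \<times> E'" by auto
  moreover have "\<forall>(v, e, u)\<in>steps (map (map_prod fv fe) w). en' e = {v, u}"
    unfolding steps_map using assms(1,6) unfolding disk_ok_def by auto
  ultimately show ?thesis using assms(1) unfolding disk_ok_def f by simp
qed

lemma regular_disjoint_union:
  assumes "regular_complex \<Omega>'" "regular_complex \<Omega>''"
  shows "regular_complex (disjoint_union \<Omega>' \<Omega>'')"
proof -
  interpret A: regular_cx \<Omega>' by unfold_locales fact
  interpret B: regular_cx \<Omega>'' by unfold_locales fact
  let ?D = "disjoint_union \<Omega>' \<Omega>''"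
  have "disk_ok (vertices ?D) (edges ?D) (ends ?D) (glue ?D d)" if "d \<in> disks ?D" for d
    using that unfolding disjoint_union_simps(1-3)
  proof (elim PlusE)
    fix a assume a: "a \<in> disks \<Omega>'" "d = Inl a"
    show "disk_ok (vertices \<Omega>' <+> vertices \<Omega>'') (edges \<Omega>' <+> edges \<Omega>'') (ends ?D) (glue ?D d)"
      unfolding a(2) disjoint_union_simps(6) by (rule disk_ok_map[OF A.disk_ok[OF a(1)]]) (auto simp: disjoint_union_simps)
  next
    fix a assume a: "a \<in> disks \<Omega>''" "d = Inr a"
    show "disk_ok (vertices \<Omega>' <+> vertices \<Omega>'') (edges \<Omega>' <+> edges \<Omega>'') (ends ?D) (glue ?D d)"
      unfolding a(2) disjoint_union_simps(7) by (rule disk_ok_map[OF B.disk_ok[OF a(1)]]) (auto simp: disjoint_union_simps)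
  qed
  moreover have "ends ?D e \<subseteq> vertices ?D \<and> card (ends ?D e) = 2" if "e \<in> edges ?D" for e
    using that unfolding disjoint_union_simps(1-3)
  proof (elim PlusE)
    fix a assume a: "a \<in> edges \<Omega>'" "e = Inl a"
    show "ends ?D e \<subseteq> vertices \<Omega>' <+> vertices \<Omega>'' \<and> card (ends ?D e) = 2"
      unfolding a(2) disjoint_union_simps using A.ends_sub[OF a(1)] by (auto simp: card_image)
  next
    fix a assume a: "a \<in> edges \<Omega>''" "e = Inr a"
    show "ends ?D e \<subseteq> vertices \<Omega>' <+> vertices \<Omega>'' \<and> card (ends ?D e) = 2"
      unfolding a(2) disjoint_union_simps using B.ends_sub[OF a(1)] by (auto simp: card_image)
  qed
  moreover have "(\<Union>d\<in>disks ?D. disk_edges ?D d) = edges ?D" "(\<Union>d\<in>disks ?D. disk_verts ?D d) = vertices ?D"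
    using A.regular B.regular unfolding regular_complex_conv disjoint_union_simps(1-3) Plus_def
    by (simp_all add: disjoint_union_simps image_image image_UN[symmetric])
  ultimately show ?thesis unfolding regular_complex_conv
    using A.finite_cells B.finite_cells by (simp add: disjoint_union_simps(1-3))
qed

lemma vertex_class_disjoint_union:
  fixes \<Omega>' :: "('v, 'e, 'd, 'c) complex2" and \<Omega>'' :: "('w, 'f, 'g, 'c) complex2"
  assumes reg: "regular_complex \<Omega>'" "regular_complex \<Omega>''"
  shows "vertex_ok \<Omega>' q \<Longrightarrow> vertex_ok (disjoint_union \<Omega>' \<Omega>'') (Inl q) \<and>
      vertex_class (disjoint_union \<Omega>' \<Omega>'') (Inl q) = vertex_class \<Omega>' q"
    and "vertex_ok \<Omega>'' p \<Longrightarrow> vertex_ok (disjoint_union \<Omega>' \<Omega>'') (Inr p) \<and>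
      vertex_class (disjoint_union \<Omega>' \<Omega>'') (Inr p) = vertex_class \<Omega>'' p"
proof -
  let ?D = "disjoint_union \<Omega>' \<Omega>''"
  note R = regular_disjoint_union[OF reg]
  {
    assume ok: "vertex_ok \<Omega>' q"
    have dk: "{d \<in> disks ?D. Inl q \<in> disk_verts ?D d} = Inl ` {d \<in> disks \<Omega>'. q \<in> disk_verts \<Omega>' d}"
      unfolding disjoint_union_simps(3) by (auto simp: disjoint_union_simps)
    have ok': "vertex_ok ?D (Inl q)" using ok R unfolding vertex_ok_def dk by (auto simp: inj_on_def disjoint_union_simps)
    have st: "disk_step ?D (Inl d) (Inl v) (Inl e) (Inl u)" if "disk_step \<Omega>' d v e u" for d v e u
      using that unfolding disk_step_def disjoint_union_simps steps_map by force
    have "vertex_class ?D (Inl q) = vertex_class \<Omega>' q"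
      by (rule vertex_class_transfer[OF ok ok', of Inl Inl])
        (auto simp: dk disjoint_union_simps(8) corner_edge_def dest: st split: if_splits)
    then show "vertex_ok ?D (Inl q) \<and> vertex_class ?D (Inl q) = vertex_class \<Omega>' q" using ok' by blast
  next
    assume ok: "vertex_ok \<Omega>'' p"
    have dk: "{d \<in> disks ?D. Inr p \<in> disk_verts ?D d} = Inr ` {d \<in> disks \<Omega>''. p \<in> disk_verts \<Omega>'' d}"
      unfolding disjoint_union_simps(3) by (auto simp: disjoint_union_simps)
    have ok': "vertex_ok ?D (Inr p)" using ok R unfolding vertex_ok_def dk by (auto simp: inj_on_def disjoint_union_simps)
    have st: "disk_step ?D (Inr d) (Inr v) (Inr e) (Inr u)" if "disk_step \<Omega>'' d v e u" for d v e u
      using that unfolding disk_step_def disjoint_union_simps steps_map by force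
    have "vertex_class ?D (Inr p) = vertex_class \<Omega>'' p"
      by (rule vertex_class_transfer[OF ok ok', of Inr Inr])
        (auto simp: dk disjoint_union_simps(9) corner_edge_def dest: st split: if_splits)
    then show "vertex_ok ?D (Inr p) \<and> vertex_class ?D (Inr p) = vertex_class \<Omega>'' p" using ok' by blast
  }
qed

lemma vertex_class_component:
  assumes f: "film_surface S \<Omega>" and C: "C \<in> components \<Omega>" and q: "q \<in> C"
  shows "vertex_class (component_complex \<Omega> C) q = vertex_class \<Omega> q"
proof -
  interpret regular_cx \<Omega> using f unfolding film_surface_components by unfold_locales blast
  have qV: "q \<in> vertices \<Omega>" using components_facts(1) C q by blast
  have dk: "{d \<in> disks (component_complex \<Omega> C). q \<in> disk_verts \<Omega> d} = {d \<in> disks \<Omega>. q \<in> disk_verts \<Omega> d}"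
    using disk_in_component[OF _ C _ q] by auto
  have ok: "vertex_ok (component_complex \<Omega> C) q" using film_surface_component(1)[OF f C] q by (intro film_vertex_ok) auto
  have "vertex_class \<Omega> q = vertex_class (component_complex \<Omega> C) q"
    by (rule vertex_class_transfer[OF ok film_vertex_ok[OF f qV], of "\<lambda>d. d" "\<lambda>e. e"]) (use dk in auto)
  then show ?thesis by simp
qed

text \<open>A cut surface is not literally a \<open>disjoint_union\<close>, while multiplicativity
  is stated for one. The isomorphism forgets the labels \<open>Inl\<close> and
  \<open>Inr\<close>.\<close>

lemma complex_iso_two_components:
  assumes f: "film_surface S \<Omega>" and comp: "components \<Omega> = {C, D}" "C \<noteq> D"
  shows "complex_iso (case_sum id id) (case_sum id id) (case_sum id id)
    (disjoint_union (component_complex \<Omega> C) (component_complex \<Omega> D)) \<Omega>"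
proof -
  interpret regular_cx \<Omega> using f unfolding film_surface_components by unfold_locales blast
  let ?U = "disjoint_union (component_complex \<Omega> C) (component_complex \<Omega> D)" and ?h = "\<lambda>x. case_sum id id x"
  have disj: "C \<inter> D = {}" using components_facts(2)[of C D] comp by auto
  have V: "vertices \<Omega> = C \<union> D" using components_facts(1) comp by auto
  have E: "edges \<Omega> = {e \<in> edges \<Omega>. ends \<Omega> e \<subseteq> C} \<union> {e \<in> edges \<Omega>. ends \<Omega> e \<subseteq> D}" using components_facts(3) comp by auto
  have E': "{e \<in> edges \<Omega>. ends \<Omega> e \<subseteq> C} \<inter> {e \<in> edges \<Omega>. ends \<Omega> e \<subseteq> D} = {}"
    using disj ends_sub(2) by (fastforce simp: subset_iff disjoint_iff dest: card_2_iff[THEN iffD1])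
  have Dk: "disks \<Omega> = {d \<in> disks \<Omega>. disk_verts \<Omega> d \<subseteq> C} \<union> {d \<in> disks \<Omega>. disk_verts \<Omega> d \<subseteq> D}" using disk_component comp by auto
  have "disk_verts \<Omega> d \<noteq> {}" if "d \<in> disks \<Omega>" for d using disk_ok[OF that] unfolding disk_ok_def disk_verts_def by auto
  then have Dk': "{d \<in> disks \<Omega>. disk_verts \<Omega> d \<subseteq> C} \<inter> {d \<in> disks \<Omega>. disk_verts \<Omega> d \<subseteq> D} = {}" using disj by blast
  have bij: "bij_betw (case_sum id id) (X <+> Y) (X \<union> Y)" if "X \<inter> Y = {}" for X Y :: "'z set"
    using that by (auto simp: bij_betw_def inj_on_def Plus_def image_Un image_image)
  have cy: "cyc \<Omega> = cyc \<Omega> \<inter> C \<times> C \<times> C \<union> cyc \<Omega> \<inter> D \<times> D \<times> D" using f comp unfolding film_surface_components by auto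
  have g: "map (map_prod (case_sum id id) (case_sum id id)) (map (map_prod Inl Inl) w) = w"
    "map (map_prod (case_sum id id) (case_sum id id)) (map (map_prod Inr Inr) w) = w" for w :: "('v \<times> 'e) list"
    unfolding map_map by (auto intro!: map_idI)
  show ?thesis unfolding complex_iso_def
  proof (intro conjI)
    show "bij_betw (case_sum id id) (vertices ?U) (vertices \<Omega>)" unfolding disjoint_union_simps V using bij[OF disj] by simp
    show "bij_betw (case_sum id id) (edges ?U) (edges \<Omega>)" using bij[OF E'] E unfolding disjoint_union_simps by simp
    show "bij_betw (case_sum id id) (disks ?U) (disks \<Omega>)" using bij[OF Dk'] Dk unfolding disjoint_union_simps by simp
    show "\<forall>e\<in>edges ?U. ends \<Omega> (case_sum id id e) = case_sum id id ` ends ?U e"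
      unfolding disjoint_union_simps(2) by (auto simp: disjoint_union_simps image_image)
    show "\<forall>d\<in>disks ?U. \<exists>k. glue \<Omega> (case_sum id id d) = rotate k (map (map_prod (case_sum id id) (case_sum id id)) (glue ?U d))"
      unfolding disjoint_union_simps(3) by (auto simp: disjoint_union_simps g simp del: map_map intro!: exI[of _ 0])
    show "\<forall>d\<in>disks ?U. dcol \<Omega> (case_sum id id d) = dcol ?U d"
      unfolding disjoint_union_simps(3) by (auto simp: disjoint_union_simps)
    show "cyc \<Omega> = map_prod (case_sum id id) (map_prod (case_sum id id) (case_sum id id)) ` cyc ?U"
      unfolding disjoint_union_simps(10) image_Un image_image
      by (subst cy) (force simp: image_iff)
  qed
qed

section \<open>Uniqueness of the surface with given vertex graphs\<close>

text \<open>Rotate until both words start at the same vertex; from there each step determines the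
  next. This recovers the condition on \<open>glue\<close> in \<open>complex_iso\<close> from the
  sets of steps.\<close>

lemma steps_eq_rotate:
  assumes d: "distinct (map fst w)" "distinct (map snd w)" "distinct (map fst w')"
    and eq: "steps w = steps w'" and ne: "w' \<noteq> []"
  shows "\<exists>k. w' = rotate k w"
proof -
  have fs: "fst ` set w = fst ` set w'"
  proof (rule set_eqI)
    fix x show "x \<in> fst ` set w \<longleftrightarrow> x \<in> fst ` set w'"
      unfolding steps_exhaust(2)[of x w] steps_exhaust(2)[of x w'] eq ..
  qed
  have len: "length w = length w'"
    using fs distinct_card[OF d(1)] distinct_card[OF d(3)] by simp
  have "fst (w' ! 0) \<in> fst ` set w" unfolding fs using ne by simp
  then obtain j where j: "j < length w" "fst (w' ! 0) = fst (w ! j)" by (auto simp: in_set_conv_nth)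
  define u where "u = rotate j w"
  have u: "length u = length w'" "steps u = steps w'" "distinct (map fst u)" "distinct (map snd u)"
    unfolding u_def using len eq d by (simp_all add: rotate_map[symmetric])
  have u0: "fst (u ! 0) = fst (w' ! 0)" unfolding u_def using j nth_rotate[of 0 w j] by (cases w) auto
  have st: "snd (u ! i) = snd (w' ! i) \<and> fst (u ! (Suc i mod length w')) = fst (w' ! (Suc i mod length w'))"
    if i: "i < length w'" "fst (u ! i) = fst (w' ! i)" for i
  proof -
    have "(fst (u ! i), snd (u ! i), fst (u ! (Suc i mod length w'))) \<in> steps u"
      unfolding steps_def u(1) using i(1) by blast
    moreover have "(fst (w' ! i), snd (w' ! i), fst (w' ! (Suc i mod length w'))) \<in> steps u"
      unfolding u(2) unfolding steps_def using i(1) by blast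
    ultimately show ?thesis using steps_unique[OF u(3,4)] i(2) by metis
  qed
  have f: "fst (u ! i) = fst (w' ! i)" if "i < length w'" for i
    using that
  proof (induction i)
    case (Suc i)
    then show ?case using st[of i] by simp
  qed (use u0 in simp)
  have "u = w'" using u(1) f st by (intro nth_equalityI) (auto simp: prod_eq_iff)
  then show ?thesis unfolding u_def by blast
qed

text \<open>The triple is increasing up to rotation. Through \<open>cyc_index\<close>, statements
  about \<open>cyc\<close> become linear arithmetic on positions.\<close>

definition cyclic_index :: "nat \<Rightarrow> nat \<Rightarrow> nat \<Rightarrow> bool" where
  "cyclic_index i j k \<longleftrightarrow> i < j \<and> j < k \<or> j < k \<and> k < i \<or> k < i \<and> i < j"

definition colours :: "('v, 'e, 'd, 'c) complex2 \<Rightarrow> 'v \<Rightarrow> 'c set" where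
  "colours \<Omega> q = dcol \<Omega> ` {d \<in> disks \<Omega>. q \<in> disk_verts \<Omega> d}"

lemma colours_incidence: "c \<in> colours \<Omega> q \<longleftrightarrow> ((c, s), (c, s)) \<in> incidence (vertex_graph \<Omega> q)"
  unfolding incidence_colour[symmetric] colours_def by (simp add: vertex_graph_def)

lemma colours_vertex_class:
  assumes "vertex_ok \<Omega> q" "vertex_ok \<Omega>' q'" "vertex_class \<Omega> q = vertex_class \<Omega>' q' \<or> vertex_class \<Omega> q = dual (vertex_class \<Omega>' q')"
  shows "colours \<Omega> q = colours \<Omega>' q'"
  using assms(3)
proof
  assume "vertex_class \<Omega> q = vertex_class \<Omega>' q'"
  then show ?thesis using vertex_class_eq_iff[OF assms(1,2)] colours_incidence[of _ \<Omega> q] colours_incidence[of _ \<Omega>' q'] by blast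
next
  assume "vertex_class \<Omega> q = dual (vertex_class \<Omega>' q')"
  then have p: "incidence (vertex_graph \<Omega> q) = swap_incidence (incidence (vertex_graph \<Omega>' q'))"
    using vertex_class_dual_iff[OF assms(1,2)] by blast
  have "c \<in> colours \<Omega> q \<longleftrightarrow> c \<in> colours \<Omega>' q'" for c
    using colours_incidence[of c \<Omega> q True] colours_incidence[of c \<Omega>' q' False] unfolding p swap_incidence_iff by simp
  then show ?thesis by blast
qed

locale numbered = almost_cyclic_cx \<Omega> for \<Omega> :: "('v, 'e, 'd, 'c) complex2" +
  fixes S :: "'c set" and qs :: "'v list"
  assumes film: "film_conn S \<Omega>" and dist: "distinct qs" and verts: "vertices \<Omega> = set qs"
    and cl: "cyc_list (cyc \<Omega>) qs"
begin

lemma inj_dcol: "inj_on (dcol \<Omega>) (disks \<Omega>)"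
  using film unfolding film_conn_def by blast

lemma qs_in: "i < length qs \<Longrightarrow> qs ! i \<in> vertices \<Omega>" unfolding verts by simp

lemma vertex_index: "v \<in> vertices \<Omega> \<Longrightarrow> \<exists>i<length qs. qs ! i = v" unfolding verts by (metis in_set_conv_nth)

lemma qs_eq: "i < length qs \<Longrightarrow> j < length qs \<Longrightarrow> qs ! i = qs ! j \<longleftrightarrow> i = j"
  using dist by (simp add: nth_eq_iff_index_eq)

lemma vertex_ok: "q \<in> vertices \<Omega> \<Longrightarrow> vertex_ok \<Omega> q"
  using film_vertex_ok[of S \<Omega> q] film_conn_iff[of S \<Omega>] film by blast

lemma cyc_index:
  assumes "i < length qs" "j < length qs" "k < length qs"
  shows "(qs ! i, qs ! j, qs ! k) \<in> cyc \<Omega> \<longleftrightarrow> cyclic_index i j k"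
proof -
  have imp: "cyclic_index i j k \<Longrightarrow> (qs ! i, qs ! j, qs ! k) \<in> cyc \<Omega>" if "i < length qs" "j < length qs" "k < length qs" for i j k
    using cyc_listD[OF cl, of i j k] cyc_listD[OF cl, of j k i] cyc_listD[OF cl, of k i j] that O.rot unfolding cyclic_index_def by blast
  show ?thesis
  proof
    assume c: "(qs ! i, qs ! j, qs ! k) \<in> cyc \<Omega>"
    then have "i \<noteq> j" "j \<noteq> k" "i \<noteq> k" using O.distinct3 by blast+
    moreover have "\<not> cyclic_index k j i" using imp[of k j i] assms O.asym[OF c] by blast
    ultimately show "cyclic_index i j k" unfolding cyclic_index_def by linarith
  qed (rule imp[OF assms])
qed

text \<open>Rotating the boundary word to start at \<open>v\<close> puts \<open>u\<close> second and
  every other vertex of the disk later. So the successor of a vertex on a disk is fixed by the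
  vertex set of the disk and the cyclic order.\<close>

lemma disk_step_next:
  assumes d: "d \<in> disks \<Omega>" and s: "disk_step \<Omega> d v e u" and w: "w \<in> disk_verts \<Omega> d" "w \<noteq> v" "w \<noteq> u"
  shows "(v, u, w) \<in> cyc \<Omega>"
proof -
  let ?g = "glue \<Omega> d"
  obtain i where i: "i < length ?g" "v = fst (?g ! i)" "u = fst (?g ! (Suc i mod length ?g))"
    using s unfolding disk_step_def steps_def by auto
  define g where "g = map fst (rotate i ?g)"
  have cl: "cyc_list (cyc \<Omega>) g" unfolding g_def rotate_map[symmetric] using O.cyc_list_rot[OF disk_cyc[OF d]] .
  have len: "length g = length ?g" "0 < length ?g" unfolding g_def using i by auto
  have g0: "g ! 0 = v" unfolding g_def using i len by (simp add: nth_rotate)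
  have uv: "v \<noteq> u" using disk_step_ends(3)[OF d s] .
  have l1: "length ?g \<noteq> 1" using i uv by (auto simp: less_Suc0)
  then have "1 < length g" using len by linarith
  then have g1: "g ! 1 = u" unfolding g_def using i len by (simp add: nth_rotate)
  have "w \<in> set g" using w(1) unfolding g_def disk_verts_def by auto
  then obtain k where k: "k < length g" "g ! k = w" by (metis in_set_conv_nth)
  have "k \<noteq> 0" using k(2) g0 w(2) by metis
  moreover have "k \<noteq> 1" using k(2) g1 w(3) by metis
  ultimately have "0 < (1::nat)" "1 < k" by auto
  then have "(g ! 0, g ! 1, g ! k) \<in> cyc \<Omega>" using cyc_listD[OF cl] k(1) by blast
  then show ?thesis using g0 g1 k by simp
qed

lemma disk_colour: "d \<in> disks \<Omega> \<Longrightarrow> q \<in> disk_verts \<Omega> d \<longleftrightarrow> dcol \<Omega> d \<in> colours \<Omega> q"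
  using inj_dcol unfolding colours_def by (auto simp: inj_on_eq_iff)

lemma disk_nonempty: "d \<in> disks \<Omega> \<Longrightarrow> \<exists>i<length qs. qs ! i \<in> disk_verts \<Omega> d"
proof -
  assume d: "d \<in> disks \<Omega>"
  then have "disk_verts \<Omega> d \<noteq> {}" using disk_ok[OF d] unfolding disk_ok_def disk_verts_def by auto
  then show ?thesis using disk_sub(1)[OF d] vertex_index by blast
qed

lemma dcol_disks: "dcol \<Omega> ` disks \<Omega> = (\<Union>i<length qs. colours \<Omega> (qs ! i))"
  using disk_nonempty unfolding colours_def by blast

lemma disk_two:
  assumes "d \<in> disks \<Omega>" "q \<in> disk_verts \<Omega> d" shows "\<exists>q'\<in>disk_verts \<Omega> d. q' \<noteq> q"
proof -
  obtain e u where s: "disk_step \<Omega> d q e u" using disk_step_exists(1)[OF assms(2)] by blast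
  show ?thesis using disk_step_ends(3)[OF assms(1) s] disk_step_mem(2)[OF s] by metis
qed

end

lemma surfaces_numbered:
  "(\<Omega>, qs) \<in> surfaces S \<sigma>s \<longleftrightarrow> numbered \<Omega> S qs \<and> map (vertex_class \<Omega>) qs = \<sigma>s"
proof -
  have "(\<Omega>, qs) \<in> surfaces S \<sigma>s \<longleftrightarrow> (film_surface S \<Omega> \<and> connected_complex \<Omega>) \<and>
     distinct qs \<and> vertices \<Omega> = set qs \<and> map (vertex_class \<Omega>) qs = \<sigma>s \<and> cyc_list (cyc \<Omega>) qs"
    unfolding surfaces_def cyc_list_def by auto
  moreover have "film_conn S \<Omega> \<Longrightarrow> almost_cyclic_cx \<Omega>" unfolding film_conn_def by blast
  ultimately show ?thesis unfolding numbered_def numbered_axioms_def film_conn_iff by blast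
qed

text \<open>At the vertex of index \<open>m\<close>, if there is one, only the colours are required to agree: the classes at all the
  others determine the surface.\<close>
locale numbered_pair = A: numbered \<Omega> S qs + B: numbered \<Omega>' S qs'
  for \<Omega> :: "('v, 'e, 'd, 'c) complex2" and S qs and \<Omega>' :: "('w, 'f, 'g, 'c) complex2" and qs' +
  fixes m :: nat
  assumes len: "length qs' = length qs"
    and agree: "i < length qs \<Longrightarrow> i \<noteq> m \<Longrightarrow> vertex_class \<Omega> (qs ! i) = vertex_class \<Omega>' (qs' ! i)"
    and col: "m < length qs \<Longrightarrow> colours \<Omega> (qs ! m) = colours \<Omega>' (qs' ! m)"
begin

lemma colours_eq:
  assumes "i < length qs" shows "colours \<Omega> (qs ! i) = colours \<Omega>' (qs' ! i)"
proof (cases "i = m")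
  case False
  show ?thesis by (rule colours_vertex_class) (use assms len agree[OF assms False] A.vertex_ok B.vertex_ok A.qs_in B.qs_in in auto)
qed (use assms col in auto)

definition fd :: "'d \<Rightarrow> 'g" where "fd d = inv_into (disks \<Omega>') (dcol \<Omega>') (dcol \<Omega> d)"

lemma dcol_eq: "dcol \<Omega> ` disks \<Omega> = dcol \<Omega>' ` disks \<Omega>'"
  unfolding A.dcol_disks B.dcol_disks len using colours_eq by simp

lemma fd:
  assumes "d \<in> disks \<Omega>" shows "fd d \<in> disks \<Omega>'" "dcol \<Omega>' (fd d) = dcol \<Omega> d"
proof -
  have "dcol \<Omega> d \<in> dcol \<Omega>' ` disks \<Omega>'" using assms dcol_eq by blast
  then show "fd d \<in> disks \<Omega>'" "dcol \<Omega>' (fd d) = dcol \<Omega> d" unfolding fd_def by (auto intro: inv_into_into f_inv_into_f)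
qed

lemma fd_at:
  assumes "d \<in> disks \<Omega>" "i < length qs" shows "qs ! i \<in> disk_verts \<Omega> d \<longleftrightarrow> qs' ! i \<in> disk_verts \<Omega>' (fd d)"
  using A.disk_colour[OF assms(1)] B.disk_colour[OF fd(1)[OF assms(1)]] colours_eq[OF assms(2)] fd(2)[OF assms(1)] by simp

text \<open>Disks of the same colour have vertices with the same numbers, and the successor of a
  vertex is the next of them in cyclic order. Two different successors \<open>j\<close> and
  \<open>k\<close> would each come before the other.\<close>

lemma fd_step:
  assumes d: "d \<in> disks \<Omega>" and ik: "i < length qs" "k < length qs" and s: "disk_step \<Omega> d (qs ! i) e (qs ! k)"
  shows "\<exists>e'. disk_step \<Omega>' (fd d) (qs' ! i) e' (qs' ! k)"
proof -
  note d' = fd(1)[OF d]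
  have ne: "i \<noteq> k" using A.disk_step_ends(3)[OF d s] by blast
  have "qs' ! i \<in> disk_verts \<Omega>' (fd d)" "qs' ! k \<in> disk_verts \<Omega>' (fd d)"
    using fd_at[OF d ik(1)] fd_at[OF d ik(2)] disk_step_mem[OF s] by auto
  obtain e' u' where s': "disk_step \<Omega>' (fd d) (qs' ! i) e' u'" using disk_step_exists(1)[OF \<open>qs' ! i \<in> _\<close>] by blast
  obtain j where j: "j < length qs" "u' = qs' ! j" using B.vertex_index B.disk_step_ends(5)[OF d' s'] len by metis
  have ij: "i \<noteq> j" using B.disk_step_ends(3)[OF d' s'] j by blast
  have "j = k"
  proof (rule ccontr)
    assume jk: "j \<noteq> k"
    have "qs ! j \<in> disk_verts \<Omega> d" using fd_at[OF d j(1)] disk_step_mem(2)[OF s'] j by simp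
    moreover have "qs ! j \<noteq> qs ! i" "qs ! j \<noteq> qs ! k" using A.qs_eq ik j ij jk by auto
    ultimately have "cyclic_index i k j" using A.disk_step_next[OF d s] A.cyc_index ik j by blast
    moreover have "qs' ! k \<noteq> qs' ! i" "qs' ! k \<noteq> u'" using B.qs_eq ik j ne jk len by auto
    then have "cyclic_index i j k" using B.disk_step_next[OF d' s' \<open>qs' ! k \<in> _\<close>] B.cyc_index ik j len by metis
    ultimately show False unfolding cyclic_index_def by linarith
  qed
  then show ?thesis using s' j by blast
qed

text \<open>Every edge has two ends, and at least one of them is a vertex where the classes are known
  to agree: the vertex graph there decides which sides of disks are glued along the edge.\<close>
lemma edge_transfer:
  assumes d: "d \<in> disks \<Omega>" "d2 \<in> disks \<Omega>" and ik: "i < length qs" "k < length qs" "i2 < length qs" "k2 < length qs"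
    and s: "disk_step \<Omega> d (qs ! i) e (qs ! k)" "disk_step \<Omega> d2 (qs ! i2) e (qs ! k2)"
    and s': "disk_step \<Omega>' (fd d) (qs' ! i) e' (qs' ! k)" "disk_step \<Omega>' (fd d2) (qs' ! i2) e2' (qs' ! k2)"
  shows "e' = e2'"
proof -
  have "{qs ! i, qs ! k} = {qs ! i2, qs ! k2}" using A.disk_step_ends(2)[OF d(1) s(1)] A.disk_step_ends(2)[OF d(2) s(2)] by simp
  then have ii: "i2 = i \<and> k2 = k \<or> i2 = k \<and> k2 = i" using A.qs_eq ik by (auto simp: doubleton_eq_iff)
  have ne: "i \<noteq> k" using A.disk_step_ends(3)[OF d(1) s(1)] by blast
  obtain j where j: "j = i \<or> j = k" "j \<noteq> m" using ne by metis
  have jl: "j < length qs" using j ik by blast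
  have "corner_edge \<Omega> d (qs ! j) (j = i) e" "corner_edge \<Omega> d2 (qs ! j) (j = i2) e"
    using s j ii ne unfolding corner_edge_def by auto
  then have "((dcol \<Omega> d, j = i), (dcol \<Omega> d2, j = i2)) \<in> incidence (vertex_graph \<Omega> (qs ! j))"
    unfolding A.vertex_incidence_iff using d by blast
  moreover have "incidence (vertex_graph \<Omega> (qs ! j)) = incidence (vertex_graph \<Omega>' (qs' ! j))"
    using agree[OF jl j(2)] vertex_class_eq_iff[OF A.vertex_ok[OF A.qs_in[OF jl]] B.vertex_ok[OF B.qs_in]] jl len by simp
  ultimately have "((dcol \<Omega> d, j = i), (dcol \<Omega> d2, j = i2)) \<in> incidence (vertex_graph \<Omega>' (qs' ! j))" by simp
  then obtain a b f where ab: "a \<in> disks \<Omega>'" "b \<in> disks \<Omega>'" "dcol \<Omega>' a = dcol \<Omega> d" "dcol \<Omega>' b = dcol \<Omega> d2"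
    "corner_edge \<Omega>' a (qs' ! j) (j = i) f" "corner_edge \<Omega>' b (qs' ! j) (j = i2) f" unfolding B.vertex_incidence_iff by blast
  have "a = fd d" using inj_onD[OF B.inj_dcol _ ab(1) fd(1)[OF d(1)]] ab(3) fd(2)[OF d(1)] by simp
  moreover have "b = fd d2" using inj_onD[OF B.inj_dcol _ ab(2) fd(1)[OF d(2)]] ab(4) fd(2)[OF d(2)] by simp
  moreover have "corner_edge \<Omega>' (fd d) (qs' ! j) (j = i) e'" "corner_edge \<Omega>' (fd d2) (qs' ! j) (j = i2) e2'"
    using s' j ii ne unfolding corner_edge_def by auto
  ultimately show ?thesis using B.corner_edge_unique ab by metis
qed

end

lemma numbered_pair_sym:
  assumes "numbered_pair \<Omega> S qs \<Omega>' qs' m" shows "numbered_pair \<Omega>' S qs' \<Omega> qs m"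
  using assms unfolding numbered_pair_def numbered_pair_axioms_def by auto

context numbered_pair
begin

interpretation W: numbered_pair \<Omega>' S qs' \<Omega> qs m
  by (rule numbered_pair_sym) (unfold_locales)

lemma fd_fd: "d \<in> disks \<Omega> \<Longrightarrow> W.fd (fd d) = d"
  using W.fd[OF fd(1)] fd(2) A.inj_dcol by (metis inj_onD)

lemma fd_bij: "bij_betw fd (disks \<Omega>) (disks \<Omega>')"
proof (rule bij_betw_byWitness[where f' = W.fd])
  have "fd (W.fd d) = d" if "d \<in> disks \<Omega>'" for d
    using fd[OF W.fd(1)[OF that]] W.fd(2)[OF that] B.inj_dcol that by (metis inj_onD)
  then show "\<forall>d\<in>disks \<Omega>'. fd (W.fd d) = d" by blast
qed (use fd_fd fd(1) W.fd(1) in auto)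

text \<open>Vertices correspond by number, disks by colour, and edges through the disks along them.
  The same pair read in the opposite direction gives the inverse on disks and the injectivity on
  edges.\<close>

lemma isomorphic:
  obtains fv fe where "complex_iso fv fe fd \<Omega> \<Omega>'" "\<And>i. i < length qs \<Longrightarrow> fv (qs ! i) = qs' ! i"
proof -
  define fv where "fv v = qs' ! (THE i. i < length qs \<and> qs ! i = v)" for v
  have fv: "fv (qs ! i) = qs' ! i" if "i < length qs" for i
  proof -
    have "(THE j. j < length qs \<and> qs ! j = qs ! i) = i" using that A.qs_eq by (intro the_equality) auto
    then show ?thesis unfolding fv_def by simp
  qed
  \<comment> \<open>A disk along \<open>e\<close> tells which edge corresponds to it;
    \<open>edge_transfer\<close> shows that all disks along \<open>e\<close> agree.\<close>
  define fe where "fe e = (SOME e'. \<exists>d\<in>disks \<Omega>. \<exists>i<length qs. \<exists>k<length qs.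
    disk_step \<Omega> d (qs ! i) e (qs ! k) \<and> disk_step \<Omega>' (fd d) (qs' ! i) e' (qs' ! k))" for e
  have fe: "fe e = e'" if "d \<in> disks \<Omega>" "i < length qs" "k < length qs"
    "disk_step \<Omega> d (qs ! i) e (qs ! k)" "disk_step \<Omega>' (fd d) (qs' ! i) e' (qs' ! k)" for d i k e e'
    unfolding fe_def
  proof (rule some_equality)
    show "\<exists>d\<in>disks \<Omega>. \<exists>i<length qs. \<exists>k<length qs. disk_step \<Omega> d (qs ! i) e (qs ! k) \<and> disk_step \<Omega>' (fd d) (qs' ! i) e' (qs' ! k)"
      using that by blast
    fix e2 assume "\<exists>d\<in>disks \<Omega>. \<exists>i<length qs. \<exists>k<length qs. disk_step \<Omega> d (qs ! i) e (qs ! k) \<and> disk_step \<Omega>' (fd d) (qs' ! i) e2 (qs' ! k)"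
    then obtain d2 i2 k2 where *: "d2 \<in> disks \<Omega>" "i2 < length qs" "k2 < length qs" "disk_step \<Omega> d2 (qs ! i2) e (qs ! k2)"
      "disk_step \<Omega>' (fd d2) (qs' ! i2) e2 (qs' ! k2)" by blast
    show "e2 = e'" by (rule edge_transfer[OF *(1) that(1) *(2,3) that(2,3) *(4) that(4) *(5) that(5)])
  qed
  have step: "disk_step \<Omega>' (fd d) (fv v) (fe e) (fv u)" if d: "d \<in> disks \<Omega>" and s: "disk_step \<Omega> d v e u" for d v e u
  proof -
    obtain i k where ik: "i < length qs" "v = qs ! i" "k < length qs" "u = qs ! k"
      using A.vertex_index A.disk_step_ends(4,5)[OF d s] by metis
    then obtain e' where "disk_step \<Omega>' (fd d) (qs' ! i) e' (qs' ! k)" using fd_step[OF d ik(1,3)] s by blast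
    then show ?thesis using fe[OF d ik(1,3)] s ik fv by simp
  qed
  have step': "\<exists>v e u. disk_step \<Omega> d v e u \<and> v' = fv v \<and> e' = fe e \<and> u' = fv u" if d: "d \<in> disks \<Omega>" and s: "disk_step \<Omega>' (fd d) v' e' u'" for d v' e' u'
  proof -
    obtain i k where ik: "i < length qs" "v' = qs' ! i" "k < length qs" "u' = qs' ! k"
      using B.vertex_index B.disk_step_ends(4,5)[OF fd(1)[OF d] s] len by metis
    then obtain e where e: "disk_step \<Omega> d (qs ! i) e (qs ! k)"
      using W.fd_step[OF fd(1)[OF d], of i k e'] s len unfolding fd_fd[OF d] by auto
    then show ?thesis using fe[OF d ik(1,3) e] s ik fv by metis
  qed
  have bv: "bij_betw fv (vertices \<Omega>) (vertices \<Omega>')"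
  proof -
    have "fv v = fv u \<longleftrightarrow> v = u" if "v \<in> vertices \<Omega>" "u \<in> vertices \<Omega>" for v u
      using A.vertex_index[OF that(1)] A.vertex_index[OF that(2)] fv B.qs_eq len by metis
    then have "inj_on fv (vertices \<Omega>)" by (auto simp: inj_on_def)
    moreover have "fv ` vertices \<Omega> = vertices \<Omega>'"
      unfolding A.verts B.verts set_conv_nth using fv len by (auto simp: image_iff) (metis+)
    ultimately show ?thesis unfolding bij_betw_def by blast
  qed
  have be: "bij_betw fe (edges \<Omega>) (edges \<Omega>')"
  proof -
    have "inj_on fe (edges \<Omega>)"
    proof (rule inj_onI)
      fix e e2 assume e: "e \<in> edges \<Omega>" "e2 \<in> edges \<Omega>" "fe e = fe e2"
      obtain d v u where d: "d \<in> disks \<Omega>" "disk_step \<Omega> d v e u" using A.edge_disk[OF e(1)] disk_step_exists(3) by metis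
      obtain d2 v2 u2 where d2: "d2 \<in> disks \<Omega>" "disk_step \<Omega> d2 v2 e2 u2" using A.edge_disk[OF e(2)] disk_step_exists(3) by metis
      obtain i k where ik: "i < length qs" "v = qs ! i" "k < length qs" "u = qs ! k"
        using A.vertex_index A.disk_step_ends(4,5)[OF d] by metis
      obtain i2 k2 where ik2: "i2 < length qs" "v2 = qs ! i2" "k2 < length qs" "u2 = qs ! k2"
        using A.vertex_index A.disk_step_ends(4,5)[OF d2] by metis
      have 1: "disk_step \<Omega>' (fd d) (qs' ! i) (fe e) (qs' ! k)" "disk_step \<Omega>' (fd d2) (qs' ! i2) (fe e) (qs' ! k2)"
        using step[OF d] step[OF d2] e(3) ik ik2 fv by auto
      have 2: "disk_step \<Omega> (W.fd (fd d)) (qs ! i) e (qs ! k)" "disk_step \<Omega> (W.fd (fd d2)) (qs ! i2) e2 (qs ! k2)"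
        using d d2 ik ik2 fd_fd by auto
      show "e = e2"
        by (rule W.edge_transfer[OF fd(1)[OF d(1)] fd(1)[OF d2(1)] _ _ _ _ 1 2]) (use ik ik2 len in auto)
    qed
    moreover have "fe ` edges \<Omega> = edges \<Omega>'"
    proof (intro set_eqI iffI)
      fix e' assume "e' \<in> fe ` edges \<Omega>"
      then obtain e where e: "e \<in> edges \<Omega>" "e' = fe e" by blast
      obtain d v u where d: "d \<in> disks \<Omega>" "disk_step \<Omega> d v e u" using A.edge_disk[OF e(1)] disk_step_exists(3) by metis
      then show "e' \<in> edges \<Omega>'" using B.disk_step_ends(1)[OF fd(1)[OF d(1)] step[OF d]] e(2) by simp
    next
      fix e' assume e': "e' \<in> edges \<Omega>'"
      obtain d' v u where d': "d' \<in> disks \<Omega>'" "disk_step \<Omega>' d' v e' u" using B.edge_disk[OF e'] disk_step_exists(3) by metis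
      obtain d where d: "d \<in> disks \<Omega>" "d' = fd d" using fd_bij d'(1) unfolding bij_betw_def by blast
      then obtain e where "\<exists>v u. disk_step \<Omega> d v e u" "e' = fe e" using step'[OF d(1)] d' by blast
      then show "e' \<in> fe ` edges \<Omega>" using A.disk_step_ends(1)[OF d(1)] by blast
    qed
    ultimately show ?thesis unfolding bij_betw_def by blast
  qed
  have "complex_iso fv fe fd \<Omega> \<Omega>'" unfolding complex_iso_def
  proof (intro conjI ballI)
    fix e assume e: "e \<in> edges \<Omega>"
    obtain d v u where d: "d \<in> disks \<Omega>" "disk_step \<Omega> d v e u" using A.edge_disk[OF e] disk_step_exists(3) by metis
    show "ends \<Omega>' (fe e) = fv ` ends \<Omega> e"
      using B.disk_step_ends(2)[OF fd(1)[OF d(1)] step[OF d]] A.disk_step_ends(2)[OF d] by simp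
  next
    fix d assume d: "d \<in> disks \<Omega>"
    note ok = A.disk_ok[OF d, unfolded disk_ok_def] and ok' = B.disk_ok[OF fd(1)[OF d], unfolded disk_ok_def]
    have f: "map fst (map (map_prod fv fe) (glue \<Omega> d)) = map fv (map fst (glue \<Omega> d))"
      "map snd (map (map_prod fv fe) (glue \<Omega> d)) = map fe (map snd (glue \<Omega> d))" by simp_all
    have "set (map fst (glue \<Omega> d)) \<subseteq> vertices \<Omega>" using ok by auto
    then have "inj_on fv (set (map fst (glue \<Omega> d)))" using bv unfolding bij_betw_def by (blast intro: inj_on_subset)
    then have "distinct (map fv (map fst (glue \<Omega> d)))" using ok unfolding distinct_map[of fv] by blast
    moreover have "set (map snd (glue \<Omega> d)) \<subseteq> edges \<Omega>" using ok by auto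
    then have "inj_on fe (set (map snd (glue \<Omega> d)))" using be unfolding bij_betw_def by (blast intro: inj_on_subset)
    then have "distinct (map fe (map snd (glue \<Omega> d)))" using ok unfolding distinct_map[of fe] by blast
    moreover have "steps (map (map_prod fv fe) (glue \<Omega> d)) = steps (glue \<Omega>' (fd d))"
    proof (intro set_eqI iffI)
      fix x assume "x \<in> steps (map (map_prod fv fe) (glue \<Omega> d))"
      then obtain v e u where "disk_step \<Omega> d v e u" "x = (fv v, fe e, fv u)" unfolding steps_map disk_step_def by auto
      then show "x \<in> steps (glue \<Omega>' (fd d))" using step[OF d] unfolding disk_step_def by simp
    next
      fix x assume x: "x \<in> steps (glue \<Omega>' (fd d))"
      obtain v e u where "x = (v, e, u)" by (cases x)
      then show "x \<in> steps (map (map_prod fv fe) (glue \<Omega> d))"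
        using step'[OF d, of v e u] x unfolding disk_step_def steps_map by force
    qed
    ultimately show "\<exists>k. glue \<Omega>' (fd d) = rotate k (map (map_prod fv fe) (glue \<Omega> d))"
      using ok' by (intro steps_eq_rotate) (simp_all only: f, simp_all)
  next
    show "cyc \<Omega>' = map_prod fv (map_prod fv fv) ` cyc \<Omega>"
    proof (intro set_eqI iffI)
      fix x assume x: "x \<in> cyc \<Omega>'"
      obtain a b c where abc: "x = (a, b, c)" by (cases x)
      then obtain i j k where ijk: "i < length qs" "j < length qs" "k < length qs" "a = qs' ! i" "b = qs' ! j" "c = qs' ! k"
        using B.O.sub[of a b c] x B.vertex_index len by metis
      then have "(qs ! i, qs ! j, qs ! k) \<in> cyc \<Omega>" using B.cyc_index[of i j k] A.cyc_index[of i j k] x abc len by simp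
      moreover have "x = map_prod fv (map_prod fv fv) (qs ! i, qs ! j, qs ! k)" using abc ijk fv by simp
      ultimately show "x \<in> map_prod fv (map_prod fv fv) ` cyc \<Omega>" by blast
    next
      fix x assume "x \<in> map_prod fv (map_prod fv fv) ` cyc \<Omega>"
      then obtain a b c where abc: "x = (fv a, fv b, fv c)" "(a, b, c) \<in> cyc \<Omega>" by auto
      then obtain i j k where ijk: "i < length qs" "j < length qs" "k < length qs" "a = qs ! i" "b = qs ! j" "c = qs ! k"
        using A.O.sub[of a b c] A.vertex_index by metis
      then show "x \<in> cyc \<Omega>'" using B.cyc_index[of i j k] A.cyc_index[of i j k] abc len fv by simp
    qed
  qed (use bv be fd_bij fd(2) in auto)
  then show thesis using that fv by blast
qed

end

lemma surfaces_isomorphic: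
  assumes "(\<Omega>, qs) \<in> surfaces S \<sigma>s" "(\<Omega>', qs') \<in> surfaces S \<sigma>s"
  obtains fv fe fd where "complex_iso fv fe fd \<Omega> \<Omega>'" "map fv qs = qs'"
proof -
  have n: "numbered \<Omega> S qs" "numbered \<Omega>' S qs'" "map (vertex_class \<Omega>) qs = \<sigma>s" "map (vertex_class \<Omega>') qs' = \<sigma>s"
    using assms unfolding surfaces_numbered by auto
  then have len: "length qs' = length qs" by (metis length_map)
  \<comment> \<open>The index \<open>length qs\<close> is out of range: no vertex is exceptional
    here.\<close>
  interpret numbered_pair \<Omega> S qs \<Omega>' qs' "length qs"
    unfolding numbered_pair_def numbered_pair_axioms_def using n len by (metis less_irrefl nth_map)
  obtain fv fe where "complex_iso fv fe fd \<Omega> \<Omega>'" "\<And>i. i < length qs \<Longrightarrow> fv (qs ! i) = qs' ! i" using isomorphic by blast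
  moreover from this(2) have "map fv qs = qs'" using len by (intro nth_equalityI) auto
  ultimately show thesis using that by blast
qed

section \<open>The surfaces with two vertices and the class of a cut\<close>

lemma surfaces_rotate:
  assumes "(\<Omega>, qs) \<in> surfaces S \<sigma>s" shows "(\<Omega>, rotate k qs) \<in> surfaces S (rotate k \<sigma>s)"
proof -
  have n: "numbered \<Omega> S qs" "map (vertex_class \<Omega>) qs = \<sigma>s" using assms unfolding surfaces_numbered by auto
  interpret numbered \<Omega> S qs by (rule n(1))
  have "numbered \<Omega> S (rotate k qs)"
    by unfold_locales (use film dist verts O.cyc_list_rot[OF cl] in auto)
  then show ?thesis unfolding surfaces_numbered using n(2) by (simp add: rotate_map[symmetric])
qed

context numbered
begin

text \<open>All positions in \<open>as\<close> precede those in \<open>bs\<close>, which is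
  incompatible with an alternation of four positions.\<close>

lemma division_append:
  assumes "qs = as @ bs" "as \<noteq> []" "bs \<noteq> []" shows "division \<Omega> (set as) (set bs)"
proof -
  have "consec (cyc \<Omega>) (set as) (set bs)" unfolding consec_def
  proof (intro ballI notI, elim conjE)
    fix a a' b b' assume m: "a \<in> set as" "a' \<in> set as" "b \<in> set bs" "b' \<in> set bs"
      and c: "(a, b, a') \<in> cyc \<Omega>" "(a', b', a) \<in> cyc \<Omega>"
    have A: "\<exists>i<length as. qs ! i = x" if "x \<in> set as" for x
      using that unfolding assms(1) in_set_conv_nth by (metis nth_append)
    have B: "\<exists>i. length as \<le> i \<and> i < length qs \<and> qs ! i = x" if "x \<in> set bs" for x
      using that unfolding assms(1) in_set_conv_nth by (metis le_add1 length_append nat_add_left_cancel_less nth_append_length_plus)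
    obtain i i' where i: "i < length as" "qs ! i = a" "i' < length as" "qs ! i' = a'" using A m by metis
    obtain j j' where j: "length as \<le> j" "j < length qs" "qs ! j = b" "length as \<le> j'" "j' < length qs" "qs ! j' = b'" using B m by metis
    have l: "i < length qs" "i' < length qs" using i unfolding assms(1) by auto
    have "cyclic_index i j i'" "cyclic_index i' j' i" using cyc_index l j i c by metis+
    then show False using i j unfolding cyclic_index_def by linarith
  qed
  then show ?thesis unfolding division_conv verts using dist assms by auto
qed

lemma division_single:
  assumes "q \<in> vertices \<Omega>" shows "division \<Omega> {q} (vertices \<Omega> - {q})"
proof -
  obtain d where d: "d \<in> disks \<Omega>" "q \<in> disk_verts \<Omega> d" using vertex_disk[OF assms] by blast
  then obtain q' where "q' \<in> disk_verts \<Omega> d" "q' \<noteq> q" using disk_two by blast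
  then have "vertices \<Omega> - {q} \<noteq> {}" using disk_sub(1)[OF d(1)] by blast
  moreover have "consec (cyc \<Omega>) {q} (vertices \<Omega> - {q})" using O.distinct3 unfolding consec_def by blast
  ultimately show ?thesis unfolding division_conv using assms by blast
qed

text \<open>Splitting off the single vertex \<open>q\<close> is a division. Its crossing edges are
  the edges at \<open>q\<close>, and the connectedness of this cut is that of the vertex graph; here
  the condition of being cyclic enters. A loop would be an edge along which one disk both reaches
  and leaves \<open>q\<close>.\<close>

lemma vertex_graph_regular:
  assumes q: "q \<in> vertices \<Omega>" shows "regular_cgraph S (vertex_graph \<Omega> q)"
proof -
  let ?G = "fst (vertex_graph \<Omega> q)"
  have A: "arcs ?G = {d \<in> disks \<Omega>. q \<in> disk_verts \<Omega> d}" "snd (vertex_graph \<Omega> q) = dcol \<Omega>"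
    "verts ?G = {e \<in> edges \<Omega>. q \<in> ends \<Omega> e}" by (simp_all add: vertex_graph_def)
  have ep: "tail ?G d = arc_end ?G d False" "head ?G d = arc_end ?G d True" for d unfolding arc_end_def by simp_all
  have corner_edge: "corner_edge \<Omega> d q s (arc_end ?G d s)" if "d \<in> arcs ?G" for d s using arc_end_vertex_graph[of d q s] that A by simp
  have cr: "cross \<Omega> {q} = verts ?G"
  proof -
    have "\<not> ends \<Omega> e \<subseteq> {q}" if "e \<in> edges \<Omega>" for e
    proof
      assume "ends \<Omega> e \<subseteq> {q}"
      then have "card (ends \<Omega> e) \<le> card {q}" by (intro card_mono) auto
      then show False using ends_sub(2)[OF that] by simp
    qed
    then show ?thesis unfolding cross_def A by auto
  qed
  have "hconn (cross \<Omega> {q}) (cut_blocks \<Omega> {q})"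
    using division_single[OF q] film unfolding film_conn_def cut_ok_def by blast
  then have "hconn (verts ?G) ((\<lambda>a. {tail ?G a, head ?G a}) ` arcs ?G)" unfolding cr
  proof (rule hconn_mono)
    show "b \<subseteq> verts ?G" if "b \<in> cut_blocks \<Omega> {q}" for b using that cr unfolding cut_blocks_def by auto
    fix b x y assume "b \<in> cut_blocks \<Omega> {q}" "x \<in> b" "y \<in> b"
    then obtain d where d: "d \<in> disks \<Omega>" "x \<in> disk_edges \<Omega> d" "x \<in> verts ?G" "y \<in> disk_edges \<Omega> d" "y \<in> verts ?G"
      unfolding cut_blocks_def cr by blast
    have ex: "q \<in> disk_verts \<Omega> d \<and> (\<exists>s. z = arc_end ?G d s)" if "z \<in> disk_edges \<Omega> d" "z \<in> verts ?G" for z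
    proof -
      obtain v u where s: "disk_step \<Omega> d v z u" using disk_step_exists(3)[OF \<open>z \<in> disk_edges \<Omega> d\<close>] by blast
      then have "q = v \<or> q = u" using that(2) disk_step_ends(2)[OF d(1) s] A by auto
      then obtain s where "corner_edge \<Omega> d q s z" using s unfolding corner_edge_def by (metis (full_types))
      then show ?thesis using corner_edge_mem(3)[OF d(1)] arc_end_vertex_graph[OF d(1)] by blast
    qed
    have "x \<in> {tail ?G d, head ?G d}" "y \<in> {tail ?G d, head ?G d}" unfolding ep using ex[OF d(2,3)] ex[OF d(4,5)] by (metis (full_types) insertCI)+
    moreover have "d \<in> arcs ?G" using A d ex[OF d(2,3)] by simp
    ultimately show "x = y \<or> (\<exists>e'\<in>(\<lambda>a. {tail ?G a, head ?G a}) ` arcs ?G. x \<in> e' \<and> y \<in> e')" by blast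
  qed
  moreover have "tail ?G d \<noteq> head ?G d" if "d \<in> arcs ?G" for d
  proof
    assume eq: "tail ?G d = head ?G d"
    have d: "d \<in> disks \<Omega>" using that A by simp
    obtain p u where "disk_step \<Omega> d p (tail ?G d) q" "disk_step \<Omega> d q (tail ?G d) u"
      using corner_edge[OF \<open>d \<in> arcs ?G\<close>, of True] corner_edge[OF \<open>d \<in> arcs ?G\<close>, of False] unfolding ep[symmetric] eq corner_edge_def by auto
    then show False using disk_step_unique(1)[OF d] disk_step_ends(3)[OF d] by metis
  qed
  moreover have "arcs ?G \<noteq> {}" unfolding A using vertex_disk[OF q] by blast
  moreover have "dcol \<Omega> ` arcs ?G \<subseteq> S" using film unfolding film_conn_def A by blast
  ultimately show ?thesis unfolding regular_conv A(2) using vertex_ok_arc_spanned[OF vertex_ok[OF q]] by blast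
qed

lemma colour_two:
  assumes "c \<in> colours \<Omega> q" shows "\<exists>q'\<in>vertices \<Omega>. q' \<noteq> q \<and> c \<in> colours \<Omega> q'"
proof -
  obtain d where d: "d \<in> disks \<Omega>" "q \<in> disk_verts \<Omega> d" "c = dcol \<Omega> d" using assms unfolding colours_def by blast
  then obtain q' where "q' \<in> disk_verts \<Omega> d" "q' \<noteq> q" using disk_two by blast
  then show ?thesis using d disk_sub(1)[OF d(1)] unfolding colours_def by blast
qed

end

lemma numbered_vertex_class:
  fixes \<Omega> :: "'c surface"
  assumes "numbered \<Omega> S qs" "q \<in> vertices \<Omega>" shows "vertex_class \<Omega> q \<in> Sigma_classes S"
  using numbered.vertex_graph_regular[OF assms] unfolding vertex_class_def Sigma_classes_def by blast

text \<open>All disks are bigons through both vertices, and the edge along which a boundary leaves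
  one vertex is the edge along which it reaches the other.\<close>

lemma surfaces_pair_dual:
  assumes "(\<Omega>, qs) \<in> surfaces S [\<sigma>1, \<sigma>2]" shows "\<sigma>2 = dual \<sigma>1"
proof -
  have n: "numbered \<Omega> S qs" "map (vertex_class \<Omega>) qs = [\<sigma>1, \<sigma>2]" using assms unfolding surfaces_numbered by auto
  interpret numbered \<Omega> S qs by (rule n(1))
  obtain q1 q2 where qs: "qs = [q1, q2]" "vertex_class \<Omega> q1 = \<sigma>1" "vertex_class \<Omega> q2 = \<sigma>2" using n(2) by auto
  then have V: "vertices \<Omega> = {q1, q2}" using verts by auto
  have both: "q1 \<in> disk_verts \<Omega> d \<and> q2 \<in> disk_verts \<Omega> d" if "d \<in> disks \<Omega>" for d
  proof -
    obtain q where q: "q \<in> disk_verts \<Omega> d" using disk_nonempty \<open>d \<in> disks \<Omega>\<close> by blast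
    then obtain q' where "q' \<in> disk_verts \<Omega> d" "q' \<noteq> q" using disk_two \<open>d \<in> disks \<Omega>\<close> by blast
    moreover from this have "q \<in> {q1, q2}" "q' \<in> {q1, q2}" using q disk_sub(1)[OF \<open>d \<in> disks \<Omega>\<close>] V by auto
    ultimately show ?thesis using q by auto
  qed
  have "vertex_class \<Omega> q2 = dual (vertex_class \<Omega> q1)"
  proof (rule vertex_class_transfer_dual[of _ _ _ _ "\<lambda>d. d" "\<lambda>e. e"])
    show "vertex_ok \<Omega> q1" "vertex_ok \<Omega> q2" using vertex_ok V by auto
    show "(\<lambda>d. d) ` {d \<in> disks \<Omega>. q1 \<in> disk_verts \<Omega> d} = {d \<in> disks \<Omega>. q2 \<in> disk_verts \<Omega> d}" using both by auto
    fix d s e assume d: "d \<in> disks \<Omega>" and i: "corner_edge \<Omega> d q1 s e"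
    show "corner_edge \<Omega> d q2 (\<not> s) e"
    proof (cases s)
      case True
      then obtain u where u: "disk_step \<Omega> d q1 e u" using i unfolding corner_edge_def by auto
      then have "u = q2" using disk_step_ends(3,5)[OF d u] V by auto
      then show ?thesis using u True unfolding corner_edge_def by auto
    next
      case False
      then obtain u where u: "disk_step \<Omega> d u e q1" using i unfolding corner_edge_def by auto
      then have "u = q2" using disk_step_ends(3,4)[OF d u] V by auto
      then show ?thesis using u False unfolding corner_edge_def by auto
    qed
  qed auto
  then show ?thesis using qs by simp
qed

text \<open>One bigon for each arc and one edge for each vertex of \<open>X\<close>. The boundary
  leaves \<open>0\<close> along the head of the arc because the head of a disk in a vertex graph is
  its outgoing edge; so the vertex graph at \<open>0\<close> is \<open>X\<close> and not its
  reverse.\<close>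

definition suspension :: "(nat, nat, 'c) cgraph \<Rightarrow> 'c surface" where
  "suspension X = \<lparr>vertices = {0, 1}, edges = verts (fst X), ends = (\<lambda>e. {0, 1}), disks = arcs (fst X),
     glue = (\<lambda>d. [(0, head (fst X) d), (1, tail (fst X) d)]), cyc = {}, dcol = snd X\<rparr>"

text \<open>The only divisions separate \<open>0\<close> from \<open>1\<close>. All edges cross, and
  the cut is connected because \<open>X\<close> is.\<close>

lemma suspension_surface:
  assumes X: "regular_cgraph S X"
  shows "(suspension X, [0, 1]) \<in> surfaces S [iso_class X, dual (iso_class X)]"
proof -
  let ?G = "fst X" and ?O = "suspension X"
  have R: "arc_spanned X" "\<forall>a\<in>arcs ?G. tail ?G a \<noteq> head ?G a"
     "hconn (verts ?G) ((\<lambda>a. {tail ?G a, head ?G a}) ` arcs ?G)" "arcs ?G \<noteq> {}" "snd X ` arcs ?G \<subseteq> S"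
    using X unfolding regular_conv by auto
  have wf: "wf_digraph ?G" using arc_spanned_wf[of ?G "snd X"] R(1) by simp
  have V: "verts ?G = {arc_end ?G a s |a s. a \<in> arcs ?G}" "finite (arcs ?G)" "inj_on (snd X) (arcs ?G)" using R(1) unfolding arc_spanned_def by auto
  have O: "vertices ?O = {0, 1}" "edges ?O = verts ?G" "ends ?O e = {0, 1}" "disks ?O = arcs ?G"
    "glue ?O d = [(0, head ?G d), (1, tail ?G d)]" "cyc ?O = {}" "dcol ?O = snd X"
    "disk_verts ?O d = {0, 1}" "disk_edges ?O d = {tail ?G d, head ?G d}" for e d
    unfolding suspension_def disk_verts_def disk_edges_def by auto
  have st: "steps (glue ?O d) = {(0, head ?G d, 1), (1, tail ?G d, 0)}" for d
    unfolding O steps_def by (auto simp: lessThan_Suc numeral_2_eq_2)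
  have "finite (verts ?G)"
  proof (rule finite_subset)
    show "verts ?G \<subseteq> head ?G ` arcs ?G \<union> tail ?G ` arcs ?G" unfolding V(1) arc_end_def by auto
  qed (use V(2) in simp)
  moreover have "tail ?G d \<in> verts ?G" "head ?G d \<in> verts ?G" if "d \<in> arcs ?G" for d
    using wf that by (auto simp: wf_digraph_def)
  moreover have "(\<Union>d\<in>arcs ?G. {tail ?G d, head ?G d}) = verts ?G" unfolding V(1) arc_end_def by (auto; metis)
  ultimately have reg: "regular_complex ?O" unfolding regular_complex_conv disk_ok_def st
    using R(2,4) V(2) by (auto simp: O eq_commute)
  have innr: "inner ?O {0, 1} = (if verts ?G = {} then {} else {{0, 1}})" unfolding inner_def O by auto
  have vne: "verts ?G \<noteq> {}" using R(3) unfolding hconn_def by simp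
  have "almost_cyclic_cx ?O"
  proof
    show "regular_complex ?O" by (rule reg)
    show "hconn (vertices ?O) (inner ?O (vertices ?O))" unfolding O innr using vne unfolding hconn_def by auto
    show "cyclic_order_on (vertices ?O) (cyc ?O)" unfolding cyclic_order_on_def O by auto
    show "cyc_list (cyc ?O) (map fst (glue ?O d))" for d unfolding O cyc_list_def by auto
  qed
  moreover have "cut_ok ?O A B" if "division ?O A B" for A B
  proof -
    have "(A = {0} \<and> B = {1}) \<or> (A = {1} \<and> B = {0})"
    proof -
      have d: "A \<union> B = {0, 1}" "A \<inter> B = {}" "A \<noteq> {}" "B \<noteq> {}"
        using \<open>division ?O A B\<close> unfolding division_conv O(1) by - (elim conjE, assumption)+
      have "B = {0, 1} - A" using d(1,2) by blast
      moreover have "A \<in> Pow {0, 1}" using d(1) by blast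
      then have "A = {} \<or> A = {0} \<or> A = {1} \<or> A = {0, 1}" by (simp only: Pow_insert Pow_empty) blast
      ultimately show ?thesis using d(3,4) by auto
    qed
    moreover have "cross ?O {0} = verts ?G" "cross ?O {1} = verts ?G" unfolding cross_def O by auto
    moreover have "cut_blocks ?O {0} = (\<lambda>a. {tail ?G a, head ?G a}) ` arcs ?G" "cut_blocks ?O {1} = (\<lambda>a. {tail ?G a, head ?G a}) ` arcs ?G"
      unfolding cut_blocks_def calculation(2,3) O using wf by (auto simp: wf_digraph_def intro!: image_cong)
    ultimately show ?thesis unfolding cut_ok_def using R(3) by auto
  qed
  ultimately have film: "film_conn S ?O" unfolding film_conn_def O using V(3) R(5) by blast
  have num: "numbered ?O S [0, 1]"
    unfolding numbered_def numbered_axioms_def using \<open>almost_cyclic_cx ?O\<close> film by (auto simp: O cyc_list_def)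
  interpret numbered ?O S "[0, 1]" by (rule num)
  have disk_step: "disk_step ?O d v e u \<longleftrightarrow> (v, e, u) \<in> {(0, head ?G d, 1), (1, tail ?G d, 0)}" for d v e u
    unfolding disk_step_def st ..
  have inc0: "corner_edge ?O d 0 s e \<longleftrightarrow> e = arc_end ?G d s" for d s e unfolding corner_edge_def disk_step arc_end_def by auto
  have vo: "vertex_ok ?O 0" using vertex_ok by (simp add: O)
  have "incidence (vertex_graph ?O 0) = incidence X"
    unfolding set_eq_iff split_paired_All vertex_incidence_iff inc0 incidence_iff[of _ _ _ _ X] O by auto
  then have "vertex_class ?O 0 = iso_class X"
    unfolding vertex_class_def using iso_class_eq_iff[OF vertex_ok_arc_spanned[OF vo] R(1)] by simp
  moreover have "(?O, [0, 1]) \<in> surfaces S [vertex_class ?O 0, vertex_class ?O 1]" unfolding surfaces_numbered using num by simp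
  ultimately show ?thesis using surfaces_pair_dual[of ?O "[0, 1]" S "vertex_class ?O 0" "vertex_class ?O 1"] by simp
qed

section \<open>The two pieces of a surface cut between consecutive vertices\<close>

locale numbered_cut = numbered \<Omega> S "as @ bs" for \<Omega> :: "'c surface" and S as bs +
  assumes ne: "as \<noteq> []" "bs \<noteq> []"
begin

sublocale C: film_cut \<Omega> "set as" "set bs" S
  by unfold_locales (use film division_append[OF refl ne] in auto)

sublocale R: relabelling "to_nat :: nat + bool \<Rightarrow> nat" "to_nat :: nat \<times> bool \<Rightarrow> nat" "to_nat :: nat \<times> bool \<Rightarrow> nat"
  by unfold_locales auto

definition pieces :: "'c surface" where
  "pieces = relabel (to_nat :: nat + bool \<Rightarrow> nat) (to_nat :: nat \<times> bool \<Rightarrow> nat) (to_nat :: nat \<times> bool \<Rightarrow> nat)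
     (cut_complex \<Omega> (set as) (set bs))"

definition piece :: "bool \<Rightarrow> 'c surface" where
  "piece s = component_complex pieces (to_nat ` C.half s)"

abbreviation "old q \<equiv> to_nat (Inl q :: nat + bool)"
abbreviation "new s \<equiv> to_nat (Inr s :: nat + bool)"

definition "new_class = vertex_class (cut_complex \<Omega> (set as) (set bs)) (Inr True)"

lemma film_pieces: "film_surface S pieces"
  unfolding pieces_def by (rule R.film_surface_rl[OF C.film_cut])

lemma complex_iso_pieces: "complex_iso to_nat to_nat to_nat (cut_complex \<Omega> (set as) (set bs)) pieces"
  unfolding pieces_def by (rule R.complex_iso_rl)

lemma components_pieces: "components pieces = {to_nat ` C.half True, to_nat ` C.half False}"
  unfolding pieces_def R.components_rl[OF C.regular_cut] C.components_cut_complex by simp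

lemma piece_in: "to_nat ` C.half s \<in> components pieces"
  unfolding components_pieces by (cases s) auto

lemma halves_neq: "to_nat ` C.half True \<noteq> to_nat ` C.half False"
proof
  assume "to_nat ` C.half True = to_nat ` C.half False"
  then have "C.half True = C.half False" by (simp add: inj_image_eq_iff)
  then show False using C.half_disjoint[of "Inr True" True False] unfolding C.half_def by auto
qed

lemma piece_conv: "piece s = relabel to_nat to_nat to_nat (component_complex (cut_complex \<Omega> (set as) (set bs)) (C.half s))"
  unfolding piece_def pieces_def R.rl_component ..

lemma film_piece: "film_conn S (piece s)"
  unfolding piece_conv by (rule R.film_conn_rl[OF C.film_half])

lemma cut_half_in: "x \<in> C.half s \<Longrightarrow> x \<in> vertices (cut_complex \<Omega> (set as) (set bs))"
  unfolding C.cut_simps(1) by (cases s) auto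

lemma pieces_vertices: "vertices pieces = to_nat ` vertices (cut_complex \<Omega> (set as) (set bs))"
  unfolding pieces_def R.rl_simps ..

lemma pieces_class:
  assumes "x \<in> vertices (cut_complex \<Omega> (set as) (set bs))"
  shows "vertex_class pieces (to_nat x) = vertex_class (cut_complex \<Omega> (set as) (set bs)) x"
  by (rule complex_iso_vertex_class[OF complex_iso_pieces assms C.cut_vertex_ok[OF assms]])
    (use film_vertex_ok[OF film_pieces] pieces_vertices assms in auto)

lemma piece_class:
  assumes "x \<in> C.half s"
  shows "vertex_class (piece s) (to_nat x) = vertex_class (cut_complex \<Omega> (set as) (set bs)) x"
  unfolding piece_def using vertex_class_component[OF film_pieces piece_in] pieces_class[OF cut_half_in[OF assms]] assms by simp

lemma piece_numbered:
  assumes "distinct xs" "set xs = C.half s" "cyc_list (cyc (component_complex (cut_complex \<Omega> (set as) (set bs)) (C.half s))) xs"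
  shows "numbered (piece s) S (map to_nat xs)"
proof -
  have "almost_cyclic_cx (piece s)" using film_piece unfolding film_conn_def by blast
  moreover have "cyc_list (cyc (piece s)) (map to_nat xs)"
    using assms(3) unfolding piece_conv cyc_list_def by (auto simp: R.cyc_rl simp del: component_complex_simps)
  moreover have "vertices (piece s) = set (map to_nat xs)" unfolding piece_conv R.rl_simps using assms(2) by simp
  moreover have "distinct (map (to_nat :: nat + bool \<Rightarrow> nat) xs)" using assms(1) by (simp add: distinct_map inj_on_def)
  ultimately show ?thesis unfolding numbered_def numbered_axioms_def using film_piece by blast
qed

text \<open>Any vertex beyond the cut represents the new point in the cyclic order. Taking
  \<open>hd bs\<close> places it after \<open>as\<close>, and taking \<open>last as\<close> places
  it before \<open>bs\<close>; this gives the numberings of the pieces.\<close>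

lemma piece_surfaces:
  "(piece True, map old as @ [new True]) \<in> surfaces S (map (vertex_class \<Omega>) as @ [new_class])"
  "(piece False, new False # map old bs) \<in> surfaces S (dual new_class # map (vertex_class \<Omega>) bs)"
proof -
  have d: "distinct as" "distinct bs" "set as \<inter> set bs = {}" using dist by auto
  have hb: "hd bs \<in> set bs" "last as \<in> set as" using ne by auto
  have P: "C.P True = set as" "C.P False = set bs" unfolding side_def by auto
  have clA: "cyc_list (cyc \<Omega>) (as @ [hd bs])" unfolding cyc_list_def
  proof (intro allI impI)
    fix i j k assume "i < j \<and> j < k \<and> k < length (as @ [hd bs])"
    moreover have "(as @ [hd bs]) ! l = (as @ bs) ! l" if "l < length (as @ [hd bs])" for l
      using that ne by (auto simp: nth_append hd_conv_nth less_Suc_eq)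
    ultimately show "((as @ [hd bs]) ! i, (as @ [hd bs]) ! j, (as @ [hd bs]) ! k) \<in> cyc \<Omega>"
      using cyc_listD[OF cl, of i j k] ne by (cases bs) auto
  qed
  have clB: "cyc_list (cyc \<Omega>) (last as # bs)" unfolding cyc_list_def
  proof (intro allI impI)
    fix i j k assume a: "i < j \<and> j < k \<and> k < length (last as # bs)"
    have la: "0 < length as" using ne by simp
    have n: "(last as # bs) ! l = (as @ bs) ! (length as - 1 + l)" if "l < length (last as # bs)" for l
    proof (cases l)
      case 0
      then show ?thesis using la ne by (simp add: nth_append last_conv_nth)
    next
      case (Suc m)
      then have "length as - 1 + l = length as + m" using la by linarith
      then have "(as @ bs) ! (length as - 1 + l) = bs ! m" by (simp only: nth_append_length_plus)
      then show ?thesis using Suc by (simp only: nth_Cons_Suc)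
    qed
    show "((last as # bs) ! i, (last as # bs) ! j, (last as # bs) ! k) \<in> cyc \<Omega>"
    proof -
      have "i < length (last as # bs)" "j < length (last as # bs)" "k < length (last as # bs)" using a by linarith+
      note n = this[THEN n]
      show ?thesis unfolding n by (rule cyc_listD[OF cl]) (use a la in linarith, use a la in linarith, use a la in \<open>simp, linarith\<close>)
    qed
  qed
  have mA: "map (C.r True) (as @ [hd bs]) = map Inl as @ [Inr True]"
    using d(3) hb P by (auto simp: collapse_def)
  have mB: "map (C.r False) (last as # bs) = Inr False # map Inl bs"
    using d(3) hb P by (auto simp: collapse_def)
  have dA: "distinct (map Inl as @ [Inr True])" "distinct (Inr False # map Inl bs)" using d by (auto simp: distinct_map)
  have "numbered (piece True) S (map to_nat (map Inl as @ [Inr True]))"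
    by (rule piece_numbered[OF dA(1)]) (use C.cyc_list_collapse[OF clA, where s = True, unfolded mA, OF dA(1)] in \<open>auto simp: C.half_def P simp del: component_complex_simps\<close>)
  moreover have "numbered (piece False) S (map to_nat (Inr False # map Inl bs))"
    by (rule piece_numbered[OF dA(2)]) (use C.cyc_list_collapse[OF clB, where s = False, unfolded mB, OF dA(2)] in \<open>auto simp: C.half_def P simp del: component_complex_simps\<close>)
  moreover have "vertex_class (piece True) (old q) = vertex_class \<Omega> q" if "q \<in> set as" for q
    using piece_class[of "Inl q" True] C.vertex_class_cut[of q] that P verts unfolding C.half_def by auto
  moreover have "vertex_class (piece False) (old q) = vertex_class \<Omega> q" if "q \<in> set bs" for q
    using piece_class[of "Inl q" False] C.vertex_class_cut[of q] that P verts unfolding C.half_def by auto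
  moreover have "vertex_class (piece True) (new True) = new_class"
    using piece_class[of "Inr True" True] unfolding C.half_def new_class_def by auto
  moreover have "vertex_class (piece False) (new False) = dual new_class"
    using piece_class[of "Inr False" False] C.vertex_class_cut_dual unfolding C.half_def new_class_def by auto
  ultimately show "(piece True, map old as @ [new True]) \<in> surfaces S (map (vertex_class \<Omega>) as @ [new_class])"
    "(piece False, new False # map old bs) \<in> surfaces S (dual new_class # map (vertex_class \<Omega>) bs)"
    unfolding surfaces_numbered by (auto simp: comp_def)
qed

lemma new_class_Sigma: "new_class \<in> Sigma_classes S"
proof -
  have "numbered (piece True) S (map old as @ [new True])" using piece_surfaces(1) unfolding surfaces_numbered by blast
  then have "vertex_class (piece True) (new True) \<in> Sigma_classes S"
    by (rule numbered_vertex_class) (simp add: piece_def C.half_def)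
  then show ?thesis using piece_class[of "Inr True" True] unfolding C.half_def new_class_def by auto
qed

text \<open>On the side of \<open>as\<close>, a disk passes through the new point precisely if some
  of its vertices have been contracted, that is, if the cut divides it.\<close>

lemma colours_new: "colours (piece True) (new True) = {dcol \<Omega> d | d. d \<in> disks \<Omega> \<and> disk_verts \<Omega> d \<inter> set as \<noteq> {} \<and> disk_verts \<Omega> d \<inter> set bs \<noteq> {}}"
proof -
  let ?\<Gamma> = "cut_complex \<Omega> (set as) (set bs)"
  have P: "C.P True = set as" unfolding side_def by auto
  have h: "Inr True \<in> C.half True" unfolding C.half_def by simp
  have n: "numbered (piece True) S (map old as @ [new True])" using piece_surfaces(1) unfolding surfaces_numbered by blast
  have "vertex_ok (piece True) (new True)" using numbered.vertex_ok[OF n] by (simp add: piece_def C.half_def)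
  moreover have "vertex_ok ?\<Gamma> (Inr True)" using C.cut_vertex_ok cut_half_in h by blast
  ultimately have "colours (piece True) (new True) = colours ?\<Gamma> (Inr True)"
    using piece_class[OF h] by (intro colours_vertex_class) auto
  also have "\<dots> = {dcol \<Omega> d | d. d \<in> disks \<Omega> \<and> disk_verts \<Omega> d \<inter> set as \<noteq> {} \<and> disk_verts \<Omega> d \<inter> set bs \<noteq> {}}" (is "_ = ?R")
  proof (intro set_eqI iffI)
    fix c assume "c \<in> colours ?\<Gamma> (Inr True)"
    then obtain d s where d: "(d, s) \<in> disks ?\<Gamma>" "Inr True \<in> disk_verts ?\<Gamma> (d, s)" "c = dcol \<Omega> d"
      unfolding colours_def using C.cut_simps(6) by auto
    then have d': "d \<in> disks \<Omega>" "disk_verts \<Omega> d \<inter> C.P s \<noteq> {}" unfolding C.cut_simps(4) by auto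
    then have "Inr True \<in> C.r s ` disk_verts \<Omega> d" using d(2) C.disk_verts_cut by simp
    then obtain v where v: "v \<in> disk_verts \<Omega> d" "Inr True = C.r s v" by blast
    then have "s = True" "v \<notin> C.P s" unfolding collapse_def by (auto split: if_splits)
    then have "v \<in> set bs" using v(1) disk_sub(1)[OF d'(1)] verts P by auto
    then show "c \<in> ?R" using d d' v \<open>s = True\<close> P by auto
  next
    fix c assume "c \<in> ?R"
    then obtain d v where d: "d \<in> disks \<Omega>" "disk_verts \<Omega> d \<inter> set as \<noteq> {}" "v \<in> disk_verts \<Omega> d" "v \<in> set bs" "c = dcol \<Omega> d" by blast
    then have "C.r True v = Inr True" using P dist unfolding collapse_def by auto
    then have "Inr True \<in> disk_verts ?\<Gamma> (d, True)" using C.disk_verts_cut[of d True] d P by (metis image_eqI)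
    moreover have "(d, True) \<in> disks ?\<Gamma>" using d P unfolding C.cut_simps(4) by auto
    ultimately show "c \<in> colours ?\<Gamma> (Inr True)" unfolding colours_def using C.cut_simps(6)[of d True] d(5) by force
  qed
  finally show ?thesis .
qed

end

section \<open>Uniqueness of the class of a cut\<close>

lemma incidence_transfer:
  assumes ok: "vertex_ok \<Omega> q" "vertex_ok \<Omega>' q'" and eq: "vertex_class \<Omega> q = vertex_class \<Omega>' q'"
    and d: "d \<in> disks \<Omega>" "d2 \<in> disks \<Omega>" "corner_edge \<Omega> d q s e" "corner_edge \<Omega> d2 q t e"
  obtains a b f where "a \<in> disks \<Omega>'" "b \<in> disks \<Omega>'" "dcol \<Omega>' a = dcol \<Omega> d" "dcol \<Omega>' b = dcol \<Omega> d2"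
    "corner_edge \<Omega>' a q' s f" "corner_edge \<Omega>' b q' t f"
proof -
  interpret A: regular_cx \<Omega> using ok unfolding vertex_ok_def by unfold_locales blast
  interpret B: regular_cx \<Omega>' using ok unfolding vertex_ok_def by unfold_locales blast
  have "((dcol \<Omega> d, s), (dcol \<Omega> d2, t)) \<in> incidence (vertex_graph \<Omega> q)" unfolding A.vertex_incidence_iff using d by blast
  then have "((dcol \<Omega> d, s), (dcol \<Omega> d2, t)) \<in> incidence (vertex_graph \<Omega>' q')"
    using vertex_class_eq_iff[OF ok] eq by simp
  then show thesis using that unfolding B.vertex_incidence_iff by blast
qed

text \<open>The colours of \<open>\<sigma>\<^bsub>(1,2|3,4)\<^esub>\<close> are forced to be those of the disks that meet both sides of the cut: a
  colour could only be missing if its disk in \<open>\<Omega>(\<sigma>\<^sub>1,\<dots>,\<sigma>\<^sub>4)\<close> meets all four vertices, and then every disk glued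
  to it along the cut would have to be missing, too. Since the cut is connected, no colour would be left.\<close>
lemma cut_class_unique:
  fixes \<Omega> :: "'c surface"
  assumes O: "(\<Omega>, [q1, q2, q3, q4]) \<in> surfaces S [\<sigma>1, \<sigma>2, \<sigma>3, \<sigma>4]"
    and T: "(\<Omega>3, [p1, p2, p3]) \<in> surfaces S [\<sigma>1, \<sigma>2, \<sigma>]" and U: "(\<Omega>4, [r0, r3, r4]) \<in> surfaces S [dual \<sigma>, \<sigma>3, \<sigma>4]"
  shows "\<sigma> = numbered_cut.new_class \<Omega> [q1, q2] [q3, q4]"
proof -
  have nO: "numbered \<Omega> S [q1, q2, q3, q4]" and cO: "vertex_class \<Omega> q1 = \<sigma>1" "vertex_class \<Omega> q2 = \<sigma>2"
    "vertex_class \<Omega> q3 = \<sigma>3" "vertex_class \<Omega> q4 = \<sigma>4" using O unfolding surfaces_numbered by auto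
  have nT: "numbered \<Omega>3 S [p1, p2, p3]" and cT: "vertex_class \<Omega>3 p1 = \<sigma>1" "vertex_class \<Omega>3 p2 = \<sigma>2" "vertex_class \<Omega>3 p3 = \<sigma>"
    using T unfolding surfaces_numbered by auto
  have nU: "numbered \<Omega>4 S [r0, r3, r4]" and cU: "vertex_class \<Omega>4 r0 = dual \<sigma>" "vertex_class \<Omega>4 r3 = \<sigma>3" "vertex_class \<Omega>4 r4 = \<sigma>4"
    using U unfolding surfaces_numbered by auto
  interpret A: numbered_cut \<Omega> S "[q1, q2]" "[q3, q4]"
    unfolding numbered_cut_def numbered_cut_axioms_def using nO by simp
  interpret T: numbered \<Omega>3 S "[p1, p2, p3]" by (rule nT)
  interpret U: numbered \<Omega>4 S "[r0, r3, r4]" by (rule nU)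
  have VA: "vertices \<Omega> = {q1, q2, q3, q4}" and VT: "vertices \<Omega>3 = {p1, p2, p3}" and VU: "vertices \<Omega>4 = {r0, r3, r4}"
    using A.verts T.verts U.verts by auto
  have dA: "q1 \<noteq> q2" "q1 \<noteq> q3" "q1 \<noteq> q4" "q2 \<noteq> q3" "q2 \<noteq> q4" "q3 \<noteq> q4" using A.dist by auto
  have dT: "p1 \<noteq> p2" "p1 \<noteq> p3" "p2 \<noteq> p3" using T.dist by auto
  have dU: "r0 \<noteq> r3" "r0 \<noteq> r4" "r3 \<noteq> r4" using U.dist by auto
  have cyA: "(q1, q2, q3) \<in> cyc \<Omega>" "(q1, q2, q4) \<in> cyc \<Omega>" "(q1, q3, q4) \<in> cyc \<Omega>" "(q2, q3, q4) \<in> cyc \<Omega>"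
    using A.cl by (auto simp: cyc_list_Cons)
  have cyT: "(p1, p2, p3) \<in> cyc \<Omega>3" using T.cl by (auto simp: cyc_list_Cons)
  have okA: "vertex_ok \<Omega> q" if "q \<in> {q1, q2, q3, q4}" for q using A.vertex_ok that unfolding VA by blast
  have okT: "vertex_ok \<Omega>3 q" if "q \<in> {p1, p2, p3}" for q using T.vertex_ok that unfolding VT by blast
  have okU: "vertex_ok \<Omega>4 q" if "q \<in> {r0, r3, r4}" for q using U.vertex_ok that unfolding VU by blast
  define K where "K = colours \<Omega>3 p3"
  have col: "colours \<Omega>3 p1 = colours \<Omega> q1" "colours \<Omega>3 p2 = colours \<Omega> q2" "colours \<Omega>4 r3 = colours \<Omega> q3"
    "colours \<Omega>4 r4 = colours \<Omega> q4" "colours \<Omega>4 r0 = K"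
    unfolding K_def by (rule colours_vertex_class; use okA okT okU cO cT cU in simp)+
  \<comment> \<open>A disk has at least two vertices, so a colour at the third vertex of
    \<open>\<Omega>3\<close>, or at the first of \<open>\<Omega>4\<close>, occurs at one of the two
    others as well.\<close>
  have KT: "c \<in> colours \<Omega> q1 \<or> c \<in> colours \<Omega> q2" "c \<in> colours \<Omega> q3 \<or> c \<in> colours \<Omega> q4" if "c \<in> K" for c
    using T.colour_two[of c p3] U.colour_two[of c r0] that col unfolding VT VU K_def by auto
  \<comment> \<open>For the same reason, a colour absent from the intermediate vertex occurs at both
    or at neither of the two others.\<close>
  have miss: "c \<in> K \<or> (c \<in> colours \<Omega> q1 \<longleftrightarrow> c \<in> colours \<Omega> q2)" "c \<in> K \<or> (c \<in> colours \<Omega> q3 \<longleftrightarrow> c \<in> colours \<Omega> q4)" for c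
    using T.colour_two[of c p1] T.colour_two[of c p2] U.colour_two[of c r3] U.colour_two[of c r4] col unfolding VT VU K_def by auto
  \<comment> \<open>The disks that would contradict the claim: divided by the cut, but with a colour
    absent from \<open>\<sigma>\<close>. By \<open>miss\<close> such a disk meets all four
    vertices.\<close>
  define F where "F = {d \<in> disks \<Omega>. {q1, q2, q3, q4} \<subseteq> disk_verts \<Omega> d \<and> dcol \<Omega> d \<notin> K}"
  let ?cr = "cross \<Omega> {q1, q2}"
  have FI: "d \<in> F" if "d \<in> disks \<Omega>" "q1 \<in> disk_verts \<Omega> d \<or> q2 \<in> disk_verts \<Omega> d" "q3 \<in> disk_verts \<Omega> d \<or> q4 \<in> disk_verts \<Omega> d"
    "dcol \<Omega> d \<notin> K" for d
    using that miss[of "dcol \<Omega> d"] A.disk_colour[OF that(1)] unfolding F_def by auto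
  text \<open>In the smaller surface, the disk with the colour of \<open>d'\<close> meets \<open>p1\<close> and \<open>p2\<close> only, so that the edge
    shared with \<open>d\<close> joins these two vertices.\<close>
  have spread: "d \<in> F" if d': "d' \<in> F" and d: "d \<in> disks \<Omega>" and e: "e \<in> disk_edges \<Omega> d" "e \<in> disk_edges \<Omega> d'" "e \<in> ?cr" for d d' e
  proof -
    have D': "d' \<in> disks \<Omega>" "{q1, q2, q3, q4} \<subseteq> disk_verts \<Omega> d'" "dcol \<Omega> d' \<notin> K" using d' unfolding F_def by auto
    obtain v u where s': "disk_step \<Omega> d' v e u" using disk_step_exists(3)[OF e(2)] by blast
    obtain v2 u2 where s: "disk_step \<Omega> d v2 e u2" using disk_step_exists(3)[OF e(1)] by blast
    note en' = A.disk_step_ends[OF D'(1) s'] and en = A.disk_step_ends[OF d s]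
    have vu: "{v2, u2} = {v, u}" using en(2) en'(2) by simp
    have nx: "(v, u, w) \<in> cyc \<Omega>" if "w \<in> {q1, q2, q3, q4}" "w \<noteq> v" "w \<noteq> u" for w
      using A.disk_step_next[OF D'(1) s'] that D'(2) by blast
    have nx2: "(v2, u2, w) \<in> cyc \<Omega>" if "w \<in> disk_verts \<Omega> d" "w \<noteq> v2" "w \<noteq> u2" for w
      using A.disk_step_next[OF d s] that by blast
    have no: "(a, c, b) \<notin> cyc \<Omega>" if "(a, b, c) \<in> cyc \<Omega>" for a b c using A.O.asym A.O.rot that by blast
    have rt: "(b, c, a) \<in> cyc \<Omega>" if "(a, b, c) \<in> cyc \<Omega>" for a b c using A.O.rot that by blast
    \<comment> \<open>The boundary of \<open>d'\<close> meets all four vertices in cyclic order, so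
      it crosses the cut only from \<open>q2\<close> to \<open>q3\<close> and from \<open>q4\<close>
      to \<open>q1\<close>; the other six directions are excluded one by one.\<close>
    have "v \<in> {q1, q2, q3, q4}" "u \<in> {q1, q2, q3, q4}" "(v \<in> {q1, q2}) \<noteq> (u \<in> {q1, q2})"
      using en' e(3) unfolding VA cross_def by auto
    moreover have "\<not> (v = q1 \<and> u = q3)" using nx[of q2] no[OF cyA(1)] dA by auto
    moreover have "\<not> (v = q1 \<and> u = q4)" using nx[of q2] no[OF cyA(2)] dA by auto
    moreover have "\<not> (v = q2 \<and> u = q4)" using nx[of q3] no[OF cyA(4)] dA by auto
    moreover have "\<not> (v = q3 \<and> u = q1)" using nx[of q4] no[OF rt[OF cyA(3)]] dA by auto
    moreover have "\<not> (v = q3 \<and> u = q2)" using nx[of q4] no[OF rt[OF cyA(4)]] dA by auto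
    moreover have "\<not> (v = q4 \<and> u = q2)" using nx[of q1] no[OF rt[OF rt[OF cyA(2)]]] dA by auto
    ultimately have "v = q2 \<and> u = q3 \<or> v = q4 \<and> u = q1" by auto
    then show ?thesis
    proof (elim disjE conjE)
      assume vu': "v = q2" "u = q3"
      have i': "corner_edge \<Omega> d' q2 True e" using s' vu' unfolding corner_edge_def by auto
      \<comment> \<open>Tells whether \<open>d\<close> runs along \<open>e\<close> in the same
        direction as \<open>d'\<close>, leaving \<open>q2\<close>, or in the opposite one.\<close>
      define t where "t \<longleftrightarrow> v2 = q2"
      have i: "corner_edge \<Omega> d q2 t e" using s vu vu' dA unfolding corner_edge_def t_def by (auto simp: doubleton_eq_iff)
      obtain a b f where ab: "a \<in> disks \<Omega>3" "b \<in> disks \<Omega>3" "dcol \<Omega>3 a = dcol \<Omega> d'" "dcol \<Omega>3 b = dcol \<Omega> d"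
        "corner_edge \<Omega>3 a p2 True f" "corner_edge \<Omega>3 b p2 t f"
        using incidence_transfer[OF okA[of q2] okT[of p2] _ D'(1) d i' i] cO cT by auto
      obtain x where x: "disk_step \<Omega>3 a p2 f x" using ab(5) unfolding corner_edge_def by auto
      have "p3 \<notin> disk_verts \<Omega>3 a" using T.disk_colour[OF ab(1), of p3] ab(3) D'(3) unfolding K_def by simp
      then have "x = p1" using T.disk_step_ends(3,5)[OF ab(1) x] disk_step_mem(2)[OF x] VT by auto
      then have ef: "ends \<Omega>3 f = {p2, p1}" using T.disk_step_ends(2)[OF ab(1) x] by simp
      show ?thesis
      proof (cases t)
        case True
        then obtain y where y: "disk_step \<Omega>3 b p2 f y" using ab(6) unfolding corner_edge_def by auto
        then have "y = p1" using T.disk_step_ends(2,3)[OF ab(2) y] ef by (auto simp: doubleton_eq_iff)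
        \<comment> \<open>On \<open>b\<close> the vertex \<open>p1\<close> follows \<open>p2\<close>
          at once, although \<open>p3\<close> comes between them in the cyclic order; so
          \<open>p3\<close> is not on \<open>b\<close>.\<close>
        then have "p3 \<notin> disk_verts \<Omega>3 b" using T.disk_step_next[OF ab(2) y, of p3] T.O.asym T.O.rot cyT dT by metis
        then have "dcol \<Omega> d \<notin> K" using T.disk_colour[OF ab(2), of p3] ab(4) unfolding K_def by simp
        moreover have "q2 \<in> disk_verts \<Omega> d" "q3 \<in> disk_verts \<Omega> d" using disk_step_mem[OF s] vu vu' by auto
        ultimately show ?thesis using FI[OF d] by blast
      next
        case False
        then obtain y where y: "disk_step \<Omega>3 b y f p2" using ab(6) unfolding corner_edge_def by auto
        then have "y = p1" using T.disk_step_ends(2,3)[OF ab(2) y] ef by (auto simp: doubleton_eq_iff)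
        then have "dcol \<Omega> d \<in> colours \<Omega> q1" using T.disk_colour[OF ab(2), of p1] disk_step_mem(1)[OF y] ab(4) col(1) by simp
        then have "q1 \<in> disk_verts \<Omega> d" using A.disk_colour[OF d] by simp
        moreover have "v2 = q3" "u2 = q2" using False vu vu' unfolding t_def by (auto simp: doubleton_eq_iff)
        \<comment> \<open>Running along \<open>e\<close> from \<open>q3\<close> to
          \<open>q2\<close>, the disk \<open>d\<close> would meet \<open>q1\<close> after
          \<open>q2\<close>, against the cyclic order.\<close>
        ultimately have "(q3, q2, q1) \<in> cyc \<Omega>" using nx2[of q1] dA by auto
        then show ?thesis using A.O.asym[OF cyA(1)] by blast
      qed
    next
      assume vu': "v = q4" "u = q1"
      have i': "corner_edge \<Omega> d' q1 False e" using s' vu' unfolding corner_edge_def by auto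
      \<comment> \<open>Here \<open>d'\<close> reaches \<open>q1\<close> along \<open>e\<close>, so
        \<open>t\<close> now stands for the opposite direction and the two cases change
        places.\<close>
      define t where "t \<longleftrightarrow> v2 = q1"
      have i: "corner_edge \<Omega> d q1 t e" using s vu vu' dA unfolding corner_edge_def t_def by (auto simp: doubleton_eq_iff)
      obtain a b f where ab: "a \<in> disks \<Omega>3" "b \<in> disks \<Omega>3" "dcol \<Omega>3 a = dcol \<Omega> d'" "dcol \<Omega>3 b = dcol \<Omega> d"
        "corner_edge \<Omega>3 a p1 False f" "corner_edge \<Omega>3 b p1 t f"
        using incidence_transfer[OF okA[of q1] okT[of p1] _ D'(1) d i' i] cO cT by auto
      obtain x where x: "disk_step \<Omega>3 a x f p1" using ab(5) unfolding corner_edge_def by auto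
      have "p3 \<notin> disk_verts \<Omega>3 a" using T.disk_colour[OF ab(1), of p3] ab(3) D'(3) unfolding K_def by simp
      then have "x = p2" using T.disk_step_ends(3,4)[OF ab(1) x] disk_step_mem(1)[OF x] VT by auto
      then have ef: "ends \<Omega>3 f = {p2, p1}" using T.disk_step_ends(2)[OF ab(1) x] by simp
      show ?thesis
      proof (cases t)
        case False
        then obtain y where y: "disk_step \<Omega>3 b y f p1" using ab(6) unfolding corner_edge_def by auto
        then have "y = p2" using T.disk_step_ends(2,3)[OF ab(2) y] ef by (auto simp: doubleton_eq_iff)
        then have "p3 \<notin> disk_verts \<Omega>3 b" using T.disk_step_next[OF ab(2) y, of p3] T.O.asym T.O.rot cyT dT by metis
        then have "dcol \<Omega> d \<notin> K" using T.disk_colour[OF ab(2), of p3] ab(4) unfolding K_def by simp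
        moreover have "q4 \<in> disk_verts \<Omega> d" "q1 \<in> disk_verts \<Omega> d" using disk_step_mem[OF s] vu vu' by auto
        ultimately show ?thesis using FI[OF d] by blast
      next
        case True
        then obtain y where y: "disk_step \<Omega>3 b p1 f y" using ab(6) unfolding corner_edge_def by auto
        then have "y = p2" using T.disk_step_ends(2,3)[OF ab(2) y] ef by (auto simp: doubleton_eq_iff)
        then have "dcol \<Omega> d \<in> colours \<Omega> q2" using T.disk_colour[OF ab(2), of p2] disk_step_mem(2)[OF y] ab(4) col(2) by simp
        then have "q2 \<in> disk_verts \<Omega> d" using A.disk_colour[OF d] by simp
        moreover have "v2 = q1" "u2 = q4" using True vu vu' dA unfolding t_def by (auto simp: doubleton_eq_iff)
        ultimately have "(q1, q4, q2) \<in> cyc \<Omega>" using nx2[of q2] dA by auto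
        then show ?thesis using no[OF cyA(2)] by blast
      qed
    qed
  qed
  have div: "division \<Omega> {q1, q2} {q3, q4}" using A.division_append[of "[q1, q2]" "[q3, q4]"] by simp
  have hc: "hconn ?cr (cut_blocks \<Omega> {q1, q2})" using A.film div unfolding film_conn_def cut_ok_def by blast
  have crossing: "\<exists>e. e \<in> disk_edges \<Omega> d \<and> e \<in> ?cr" if d: "d \<in> disks \<Omega>" "disk_verts \<Omega> d \<inter> {q1, q2} \<noteq> {}" "disk_verts \<Omega> d \<inter> {q3, q4} \<noteq> {}" for d
  proof -
    have "\<not> disk_verts \<Omega> d \<subseteq> {q1, q2}" using d(3) dA by auto
    then obtain k xs ys where w: "glue \<Omega> d = rotate k (xs @ ys)" "xs \<noteq> []" "ys \<noteq> []"
      "fst ` set xs \<subseteq> {q1, q2}" "fst ` set ys \<inter> {q1, q2} = {}"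
      using A.disk_arcs[OF d(1) A.divisionD(5)[OF div]] d(2) by metis
    have "disk_step \<Omega> d (fst (last xs)) (snd (last xs)) (fst (hd ys))"
      unfolding disk_step_def w(1) steps_rotate using steps_append[OF w(2,3)] by simp
    note s = this
    have "fst (last xs) \<in> {q1, q2}" "fst (hd ys) \<notin> {q1, q2}" using w(2-5) by (auto simp: image_subset_iff disjoint_iff)
    then have "snd (last xs) \<in> ?cr" unfolding cross_def using A.disk_step_ends(1,2)[OF d(1) s] by auto
    then show ?thesis using disk_step_mem(3)[OF s] by blast
  qed
  have Kdisk: "\<exists>d\<in>disks \<Omega>. dcol \<Omega> d = c \<and> disk_verts \<Omega> d \<inter> {q1, q2} \<noteq> {} \<and> disk_verts \<Omega> d \<inter> {q3, q4} \<noteq> {}" if c: "c \<in> K" for c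
  proof -
    obtain d where d: "d \<in> disks \<Omega>" "dcol \<Omega> d = c" using KT(1)[OF c] unfolding colours_def by blast
    then show ?thesis using KT[OF c] A.disk_colour[OF d(1)] by blast
  qed
  have Fempty: "F = {}"
  proof (rule ccontr)
    assume "F \<noteq> {}"
    then obtain d0 where d0: "d0 \<in> F" by blast
    define W where "W = (\<Union>d\<in>F. disk_edges \<Omega> d) \<inter> ?cr"
    have "W = ?cr"
    proof (rule hconnD[OF hc])
      have "d0 \<in> disks \<Omega>" "disk_verts \<Omega> d0 \<inter> {q1, q2} \<noteq> {}" "disk_verts \<Omega> d0 \<inter> {q3, q4} \<noteq> {}" using d0 unfolding F_def by auto
      then show "W \<noteq> {}" using crossing d0 unfolding W_def by blast
      fix b assume b: "b \<in> cut_blocks \<Omega> {q1, q2}" "b \<inter> W \<noteq> {}"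
      then obtain d where d: "d \<in> disks \<Omega>" "b = disk_edges \<Omega> d \<inter> ?cr" unfolding cut_blocks_def by blast
      then obtain e d' where "e \<in> disk_edges \<Omega> d" "e \<in> ?cr" "d' \<in> F" "e \<in> disk_edges \<Omega> d'" using b(2) unfolding W_def by blast
      then have "d \<in> F" using spread d(1) by blast
      then show "b \<subseteq> W" using d(2) unfolding W_def by blast
    qed (auto simp: W_def)
    \<comment> \<open>\<open>K\<close> is nonempty because \<open>p3\<close> lies on some
      disk.\<close>
    obtain d3 where "d3 \<in> disks \<Omega>3" "p3 \<in> disk_verts \<Omega>3 d3" using T.vertex_disk VT by blast
    then obtain c where c: "c \<in> K" unfolding K_def colours_def by blast
    then obtain d where d: "d \<in> disks \<Omega>" "dcol \<Omega> d = c" "disk_verts \<Omega> d \<inter> {q1, q2} \<noteq> {}" "disk_verts \<Omega> d \<inter> {q3, q4} \<noteq> {}"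
      using Kdisk by blast
    obtain e where e: "e \<in> disk_edges \<Omega> d" "e \<in> ?cr" using crossing[OF d(1,3,4)] by blast
    then obtain d' where "d' \<in> F" "e \<in> disk_edges \<Omega> d'" using \<open>W = ?cr\<close> unfolding W_def by blast
    then have "d \<in> F" using spread d(1) e by blast
    then show False using d(2) c unfolding F_def by blast
  qed
  have K: "K = colours (A.piece True) (A.new True)"
  proof -
    have "{dcol \<Omega> d | d. d \<in> disks \<Omega> \<and> disk_verts \<Omega> d \<inter> {q1, q2} \<noteq> {} \<and> disk_verts \<Omega> d \<inter> {q3, q4} \<noteq> {}} \<subseteq> K"
      using FI Fempty by blast
    then have "K = {dcol \<Omega> d | d. d \<in> disks \<Omega> \<and> disk_verts \<Omega> d \<inter> {q1, q2} \<noteq> {} \<and> disk_verts \<Omega> d \<inter> {q3, q4} \<noteq> {}}" using Kdisk by blast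
    then show ?thesis unfolding A.colours_new by simp
  qed
  let ?N = "A.piece True" and ?ns = "[A.old q1, A.old q2, A.new True]"
  have N: "numbered ?N S ?ns" "vertex_class ?N (A.old q1) = \<sigma>1" "vertex_class ?N (A.old q2) = \<sigma>2" "vertex_class ?N (A.new True) = A.new_class"
    using A.piece_surfaces(1) cO unfolding surfaces_numbered by auto
  \<comment> \<open>The vertex of unknown class is the third one, hence the index 2. There the two
    surfaces are known to have the same colours, namely \<open>K\<close>.\<close>
  interpret NP: numbered_pair ?N S ?ns \<Omega>3 "[p1, p2, p3]" 2
  proof (rule numbered_pair.intro[OF N(1) nT], unfold_locales)
    show "vertex_class ?N (?ns ! i) = vertex_class \<Omega>3 ([p1, p2, p3] ! i)" if "i < length ?ns" "i \<noteq> 2" for i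
      using that N cT by (auto simp: less_Suc_eq)
  qed (use K K_def in auto)
  obtain fv fe where iso: "complex_iso fv fe NP.fd ?N \<Omega>3" "\<And>i. i < length ?ns \<Longrightarrow> fv (?ns ! i) = [p1, p2, p3] ! i"
    using NP.isomorphic by blast
  have fv: "fv (A.new True) = p3" using iso(2)[of 2] by simp
  have "vertex_class \<Omega>3 (fv (A.new True)) = vertex_class ?N (A.new True)"
    by (rule complex_iso_vertex_class[OF iso(1)]) (use NP.A.verts NP.A.vertex_ok okT fv in auto)
  then show ?thesis using fv cT N(4) by simp
qed

text \<open>Justifies the definite description in \<open>cut_class\<close>: the pieces of the cut
  give existence, and \<open>cut_class_unique\<close> gives uniqueness.\<close>

lemma cut_class_eq:
  fixes \<Omega> :: "'c surface"
  assumes O: "(\<Omega>, [q1, q2, q3, q4]) \<in> surfaces S [\<sigma>1, \<sigma>2, \<sigma>3, \<sigma>4]"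
  shows "cut_class S \<sigma>1 \<sigma>2 \<sigma>3 \<sigma>4 = numbered_cut.new_class \<Omega> [q1, q2] [q3, q4]"
proof -
  have nO: "numbered \<Omega> S [q1, q2, q3, q4]" and cO: "vertex_class \<Omega> q1 = \<sigma>1" "vertex_class \<Omega> q2 = \<sigma>2"
    "vertex_class \<Omega> q3 = \<sigma>3" "vertex_class \<Omega> q4 = \<sigma>4" using O unfolding surfaces_numbered by auto
  interpret A: numbered_cut \<Omega> S "[q1, q2]" "[q3, q4]"
    unfolding numbered_cut_def numbered_cut_axioms_def using nO by simp
  show ?thesis unfolding cut_class_def
  proof (rule the_equality)
    show "A.new_class \<in> Sigma_classes S \<and> surfaces S [\<sigma>1, \<sigma>2, A.new_class] \<noteq> {} \<and> surfaces S [dual A.new_class, \<sigma>3, \<sigma>4] \<noteq> {}"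
      using A.new_class_Sigma A.piece_surfaces cO by auto
    fix \<sigma> assume a: "\<sigma> \<in> Sigma_classes S \<and> surfaces S [\<sigma>1, \<sigma>2, \<sigma>] \<noteq> {} \<and> surfaces S [dual \<sigma>, \<sigma>3, \<sigma>4] \<noteq> {}"
    then obtain \<Omega>3 ps \<Omega>4 rs where *: "(\<Omega>3, ps) \<in> surfaces S [\<sigma>1, \<sigma>2, \<sigma>]" "(\<Omega>4, rs) \<in> surfaces S [dual \<sigma>, \<sigma>3, \<sigma>4]" by fastforce
    have "length ps = 3" "length rs = 3" using * unfolding surfaces_numbered by (auto dest!: arg_cong[of _ _ length])
    then obtain p1 p2 p3 r0 r3 r4 where "ps = [p1, p2, p3]" "rs = [r0, r3, r4]"
      by (auto simp: numeral_3_eq_3 length_Suc_conv)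
    then show "\<sigma> = A.new_class" using cut_class_unique[OF O] * by blast
  qed
qed

section \<open>Tensors\<close>

lemma lookup_formal_scale: "Poly_Mapping.lookup (formal_scale a t) f = a * Poly_Mapping.lookup t f"
  unfolding formal_scale_def by (simp add: Poly_Mapping.map.rep_eq when_def)

lemma formal_module: "module (formal_scale :: 'k \<Rightarrow> ('m, 'b, 'k::field) formal \<Rightarrow> ('m, 'b, 'k) formal)"
  by unfold_locales (auto intro!: poly_mapping_eqI simp: lookup_formal_scale lookup_add algebra_simps)

lemma formal_scale_single [simp]: "formal_scale a (Poly_Mapping.single f c) = Poly_Mapping.single f (a * c)"
  by (rule poly_mapping_eqI) (simp add: lookup_formal_scale lookup_single when_def)

text \<open>The common form of \<open>formal_push\<close> and, in each factor, of
  \<open>formal_prod\<close>. The coefficient is an argument of \<open>\<phi>\<close>, so that the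
  target type carries no scalar action.\<close>

definition lin_ext :: "('x \<Rightarrow> 'k \<Rightarrow> 'y) \<Rightarrow> ('x \<Rightarrow>\<^sub>0 'k::zero) \<Rightarrow> 'y::comm_monoid_add" where
  "lin_ext \<phi> t = (\<Sum>f\<in>Poly_Mapping.keys t. \<phi> f (Poly_Mapping.lookup t f))"

lemma lin_ext_superset:
  assumes "finite A" "Poly_Mapping.keys t \<subseteq> A" "\<And>f. \<phi> f 0 = 0"
  shows "lin_ext \<phi> t = (\<Sum>f\<in>A. \<phi> f (Poly_Mapping.lookup t f))"
  unfolding lin_ext_def using assms by (intro sum.mono_neutral_left) (auto simp: in_keys_iff)

lemma lin_ext_add:
  fixes \<phi> :: "'x \<Rightarrow> 'k::monoid_add \<Rightarrow> 'y::comm_monoid_add"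
  assumes "\<And>f. \<phi> f 0 = 0" "\<And>f a b. \<phi> f (a + b) = \<phi> f a + \<phi> f b"
  shows "lin_ext \<phi> (t + u) = lin_ext \<phi> t + lin_ext \<phi> u"
proof -
  let ?A = "Poly_Mapping.keys t \<union> Poly_Mapping.keys u"
  have k: "Poly_Mapping.keys (t + u) \<subseteq> ?A" by (rule keys_add)
  show ?thesis
    using lin_ext_superset[of ?A "t + u" \<phi>] lin_ext_superset[of ?A t \<phi>] lin_ext_superset[of ?A u \<phi>] k assms
    by (simp add: lookup_add sum.distrib)
qed

lemma lin_ext_single:
  assumes "\<phi> f 0 = 0" shows "lin_ext \<phi> (Poly_Mapping.single f c) = \<phi> f c"
  unfolding lin_ext_def using assms by (cases "c = 0") auto

lemma lin_ext_zero [simp]: "lin_ext \<phi> 0 = 0" unfolding lin_ext_def by simp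

lemma lin_ext_scale:
  fixes t :: "('m, 'b, 'k::field) formal"
  assumes "\<And>f. \<phi> f 0 = 0" "\<And>f b. \<phi> f (a * b) = h (\<phi> f b)" "h 0 = 0" "\<And>x y. h (x + y) = h x + h y"
  shows "lin_ext \<phi> (formal_scale a t) = h (lin_ext \<phi> t)"
proof -
  have "Poly_Mapping.keys (formal_scale a t) \<subseteq> Poly_Mapping.keys t" by (auto simp: in_keys_iff lookup_formal_scale)
  then have "lin_ext \<phi> (formal_scale a t) = (\<Sum>f\<in>Poly_Mapping.keys t. h (\<phi> f (Poly_Mapping.lookup t f)))"
    using lin_ext_superset[of "Poly_Mapping.keys t" "formal_scale a t" \<phi>] assms by (simp add: lookup_formal_scale)
  also have "\<dots> = h (lin_ext \<phi> t)" unfolding lin_ext_def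
    using sum_comp_morphism[of h] assms(3,4) by (simp add: comp_def)
  finally show ?thesis .
qed

lemma formal_push_ext: "formal_push g = lin_ext (\<lambda>f c. Poly_Mapping.single (g f) c)"
  unfolding formal_push_def lin_ext_def by (rule refl)

lemma formal_push_simps:
  fixes t u :: "('m, 'b, 'k::field) formal"
  shows "formal_push g (t + u) = formal_push g t + formal_push g u"
    "formal_push g (formal_scale a t) = formal_scale a (formal_push g t)"
    "formal_push g (Poly_Mapping.single f c) = Poly_Mapping.single (g f) c" "formal_push g 0 = 0"
proof -
  show "formal_push g (t + u) = formal_push g t + formal_push g u"
    unfolding formal_push_ext by (rule lin_ext_add) (auto simp: single_add)
  show "formal_push g (formal_scale a t) = formal_scale a (formal_push g t)"
    unfolding formal_push_ext by (rule lin_ext_scale) (auto intro!: poly_mapping_eqI simp: lookup_formal_scale lookup_add algebra_simps)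
qed (auto simp: formal_push_ext lin_ext_single)

lemma formal_prod_ext: "formal_prod t u = lin_ext (\<lambda>f a. lin_ext (\<lambda>g b. Poly_Mapping.single (case_sum f g) (a * b)) u) t"
  unfolding formal_prod_def lin_ext_def by (rule refl)

lemma formal_prod_ext': "formal_prod t u = lin_ext (\<lambda>g b. lin_ext (\<lambda>f a. Poly_Mapping.single (case_sum f g) (a * b)) t) u"
  unfolding formal_prod_def lin_ext_def by (rule sum.swap)

lemma lin_ext_const_zero [simp]: "lin_ext (\<lambda>f c. 0) t = 0"
  unfolding lin_ext_def by simp

lemma lin_ext_distrib: "lin_ext (\<lambda>f c. \<phi> f c + \<psi> f c) t = lin_ext \<phi> t + lin_ext \<psi> t"
  unfolding lin_ext_def by (rule sum.distrib)

lemma lin_ext_scale_fun: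
  fixes t :: "'x \<Rightarrow>\<^sub>0 'k::field" and \<phi> :: "'x \<Rightarrow> 'k \<Rightarrow> ('m, 'b, 'k) formal"
  shows "lin_ext (\<lambda>f c. formal_scale a (\<phi> f c)) t = formal_scale a (lin_ext \<phi> t)"
  unfolding lin_ext_def by (rule poly_mapping_eqI) (simp add: lookup_formal_scale lookup_sum sum_distrib_left)

lemma formal_prod_simps:
  fixes t t' :: "('m, 'b, 'k::field) formal" and u u' :: "('n, 'b, 'k) formal"
  shows "formal_prod (t + t') u = formal_prod t u + formal_prod t' u"
    "formal_prod t (u + u') = formal_prod t u + formal_prod t u'"
    "formal_prod (formal_scale a t) u = formal_scale a (formal_prod t u)"
    "formal_prod t (formal_scale a u) = formal_scale a (formal_prod t u)"
    "formal_prod (Poly_Mapping.single f b) (Poly_Mapping.single g c) = Poly_Mapping.single (case_sum f g) (b * c)"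
    "formal_prod 0 u = 0" "formal_prod t 0 = 0"
proof -
  show "formal_prod (t + t') u = formal_prod t u + formal_prod t' u"
    unfolding formal_prod_ext by (rule lin_ext_add) (auto simp: lin_ext_const_zero lin_ext_distrib[symmetric] single_add distrib_right)
  show "formal_prod t (u + u') = formal_prod t u + formal_prod t u'"
    unfolding formal_prod_ext' by (rule lin_ext_add) (auto simp: lin_ext_const_zero lin_ext_distrib[symmetric] single_add distrib_left)
  have z: "formal_scale a 0 = (0 :: ('m + 'n, 'b, 'k) formal)"
    "formal_scale a (x + y) = formal_scale a x + formal_scale a y" for x y :: "('m + 'n, 'b, 'k) formal"
    by (auto intro!: poly_mapping_eqI simp: lookup_formal_scale lookup_add algebra_simps)
  show "formal_prod (formal_scale a t) u = formal_scale a (formal_prod t u)"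
    unfolding formal_prod_ext by (rule lin_ext_scale) (auto simp: lin_ext_const_zero lin_ext_scale_fun[symmetric] z mult.assoc)
  show "formal_prod t (formal_scale a u) = formal_scale a (formal_prod t u)"
    unfolding formal_prod_ext' by (rule lin_ext_scale) (auto simp: lin_ext_const_zero lin_ext_scale_fun[symmetric] z mult.left_commute)
  show "formal_prod (Poly_Mapping.single f b) (Poly_Mapping.single g c) = Poly_Mapping.single (case_sum f g) (b * c)"
    unfolding formal_prod_ext by (subst lin_ext_single; subst lin_ext_single; simp)
qed (auto simp: formal_prod_ext formal_prod_ext')

lemma formal_prod_single:
  "formal_prod u (Poly_Mapping.single h b) = lin_ext (\<lambda>f a. Poly_Mapping.single (case_sum f h) (a * b)) u"
  "formal_prod (Poly_Mapping.single h' a) w = lin_ext (\<lambda>g b. Poly_Mapping.single (case_sum h' g) (a * b)) w"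
  unfolding formal_prod_ext'[of u] formal_prod_ext[of _ w] by (subst lin_ext_single; simp)+

text \<open>Reduces claims about one factor to the case where the other factor is a single family;
  in this way products with relations are treated in \<open>tensor_class_prod\<close>.\<close>

lemma formal_prod_decomp:
  fixes u :: "('m, 'b, 'k::field) formal" and w :: "('n, 'b, 'k) formal"
  shows "formal_prod u w = (\<Sum>h\<in>Poly_Mapping.keys w. formal_scale (Poly_Mapping.lookup w h) (formal_prod u (Poly_Mapping.single h 1)))"
    and "formal_prod u w = (\<Sum>h\<in>Poly_Mapping.keys u. formal_scale (Poly_Mapping.lookup u h) (formal_prod (Poly_Mapping.single h 1) w))"
proof -
  show "formal_prod u w = (\<Sum>h\<in>Poly_Mapping.keys w. formal_scale (Poly_Mapping.lookup w h) (formal_prod u (Poly_Mapping.single h 1)))"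
  proof -
    have "formal_scale b (formal_prod u (Poly_Mapping.single h 1)) =
      lin_ext (\<lambda>f a. Poly_Mapping.single (case_sum f h) (a * b)) u" for h :: "'n \<Rightarrow> 'b" and b
      using formal_prod_simps(4)[of u b "Poly_Mapping.single h 1"] formal_prod_single(1)[of u h b] by simp
    then show ?thesis unfolding formal_prod_ext'[of u w] lin_ext_def[of _ w] by simp
  qed
  show "formal_prod u w = (\<Sum>h\<in>Poly_Mapping.keys u. formal_scale (Poly_Mapping.lookup u h) (formal_prod (Poly_Mapping.single h 1) w))"
  proof -
    have "formal_scale a (formal_prod (Poly_Mapping.single h 1) w) =
      lin_ext (\<lambda>g b. Poly_Mapping.single (case_sum h g) (a * b)) w" for h :: "'m \<Rightarrow> 'b" and a
      using formal_prod_simps(3)[of a "Poly_Mapping.single h 1" w] formal_prod_single(2)[of h a w] by simp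
    then show ?thesis unfolding formal_prod_ext[of u w] lin_ext_def[of _ u] by simp
  qed
qed

lemma keys_subset:
  fixes x y :: "('m, 'b, 'k::field) formal"
  shows "Poly_Mapping.keys x \<subseteq> A \<Longrightarrow> Poly_Mapping.keys y \<subseteq> A \<Longrightarrow> Poly_Mapping.keys (x + y) \<subseteq> A"
    "Poly_Mapping.keys x \<subseteq> A \<Longrightarrow> Poly_Mapping.keys y \<subseteq> A \<Longrightarrow> Poly_Mapping.keys (x - y) \<subseteq> A"
    "Poly_Mapping.keys x \<subseteq> A \<Longrightarrow> Poly_Mapping.keys (formal_scale a x) \<subseteq> A"
    "f \<in> A \<Longrightarrow> Poly_Mapping.keys (Poly_Mapping.single f a :: ('m, 'b, 'k) formal) \<subseteq> A"
  using keys_add[of x y] keys_add[of x "- y"]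
  by (auto simp: subset_iff in_keys_iff lookup_formal_scale)

lemma formal_minus:
  fixes t u :: "('m, 'b, 'k::field) formal" and h :: "('m, 'b, 'k) formal \<Rightarrow> ('n, 'b, 'k) formal"
  assumes "\<And>x y. h (x + y) = h x + h y" shows "h (t - u) = h t - h u"
  using assms[of "t - u" u] by simp

abbreviation fspan :: "('m, 'b, 'k::field) formal set \<Rightarrow> ('m, 'b, 'k) formal set" where
  "fspan \<equiv> module.span formal_scale"

lemma fspan_map:
  assumes t: "t \<in> fspan R" and h: "\<And>x y. h (x + y) = h x + h y" "\<And>a x. h (formal_scale a x) = formal_scale a (h x)" "h 0 = 0"
    and R: "\<And>x. x \<in> R \<Longrightarrow> h x \<in> fspan R'"
  shows "h t \<in> fspan R'"
  using t
proof (induction rule: module.span_induct_alt[OF formal_module, consumes 1])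
  case 1
  then show ?case using h(3) module.span_zero[OF formal_module] by simp
next
  case (2 c x y)
  then show ?case using h R module.span_add[OF formal_module] module.span_scale[OF formal_module] by metis
qed

section \<open>Maps between tensor products are well defined on cosets\<close>

context char_0_space
begin

lemma tensor_class_eq_iff: "tensor_class M X t = tensor_class M X u \<longleftrightarrow> t - u \<in> fspan (tensor_relations M X)"
proof -
  note sd = module.span_diff[OF formal_module] and sz = module.span_zero[OF formal_module] and sa = module.span_add[OF formal_module]
  show ?thesis
  proof
    assume "tensor_class M X t = tensor_class M X u"
    moreover have "t \<in> tensor_class M X t" unfolding tensor_class_def using sz by simp
    ultimately show "t - u \<in> fspan (tensor_relations M X)" unfolding tensor_class_def by blast
  next
    assume a: "t - u \<in> fspan (tensor_relations M X)"
    have "w - t \<in> fspan (tensor_relations M X) \<longleftrightarrow> w - u \<in> fspan (tensor_relations M X)" for w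
      using sd[of "w - u" "tensor_relations M X" "t - u"] sa[of "w - t" "tensor_relations M X" "t - u"] a by (auto simp: algebra_simps)
    then show "tensor_class M X t = tensor_class M X u" unfolding tensor_class_def by blast
  qed
qed

lemma tensor_class_self: "t \<in> tensor_class M X t"
  unfolding tensor_class_def using module.span_zero[OF formal_module] by simp

lemma tensor_class_mem: "u \<in> tensor_class M X t \<longleftrightarrow> u - t \<in> fspan (tensor_relations M X)"
  unfolding tensor_class_def by simp

lemma tensor_relations_cases:
  assumes "x \<in> tensor_relations M X"
  obtains (add) f m y z where "x = Poly_Mapping.single (f(m := y + z)) 1
      - Poly_Mapping.single (f(m := y)) 1 - Poly_Mapping.single (f(m := z)) 1" "f \<in> Pi\<^sub>E M X" "m \<in> M" "y \<in> X m" "z \<in> X m"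
    | (scale) f m a y where "x = Poly_Mapping.single (f(m := a *s y)) 1 - Poly_Mapping.single (f(m := y)) a"
      "f \<in> Pi\<^sub>E M X" "m \<in> M" "y \<in> X m"
  using assms unfolding tensor_relations_def by blast

lemma tensor_relations_add:
  "f \<in> Pi\<^sub>E M X \<Longrightarrow> m \<in> M \<Longrightarrow> y \<in> X m \<Longrightarrow> z \<in> X m \<Longrightarrow> Poly_Mapping.single (f(m := y + z)) 1
      - Poly_Mapping.single (f(m := y)) 1 - Poly_Mapping.single (f(m := z)) 1 \<in> tensor_relations M X"
  unfolding tensor_relations_def by blast

lemma tensor_relations_scale:
  "f \<in> Pi\<^sub>E M X \<Longrightarrow> m \<in> M \<Longrightarrow> y \<in> X m \<Longrightarrow>
    Poly_Mapping.single (f(m := a *s y)) 1 - Poly_Mapping.single (f(m := y)) a \<in> tensor_relations M X"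
  unfolding tensor_relations_def by blast

lemma fun_upd_PiE: "f \<in> Pi\<^sub>E M X \<Longrightarrow> m \<in> M \<Longrightarrow> y \<in> X m \<Longrightarrow> f(m := y) \<in> Pi\<^sub>E M X"
  by (auto simp: PiE_def extensional_def)

text \<open>The relations involve \<open>x + y\<close> and \<open>a *s x\<close>, which stay in
  \<open>X m\<close> because it is a subspace.\<close>

lemma fspan_relations_formal:
  assumes sub: "\<And>m. m \<in> M \<Longrightarrow> subspace (X m)" and t: "t \<in> fspan (tensor_relations M X)"
  shows "t \<in> formal_space M X"
proof -
  have fsp: "0 \<in> formal_space M X" "x \<in> formal_space M X \<Longrightarrow> y \<in> formal_space M X \<Longrightarrow> x + y \<in> formal_space M X"
    "x \<in> formal_space M X \<Longrightarrow> y \<in> formal_space M X \<Longrightarrow> x - y \<in> formal_space M X"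
    "x \<in> formal_space M X \<Longrightarrow> formal_scale a x \<in> formal_space M X"
    "f \<in> Pi\<^sub>E M X \<Longrightarrow> Poly_Mapping.single f a \<in> formal_space M X" for x y a f
    unfolding formal_space_def mem_Collect_eq by (simp, (rule keys_subset; assumption)+)
  show ?thesis using t
  proof (induction rule: module.span_induct_alt[OF formal_module, consumes 1])
    case (2 c x y)
    have "x \<in> formal_space M X" using 2(1)
    proof (cases rule: tensor_relations_cases)
      case (add f m y z)
      then have "y + z \<in> X m" using sub subspace_add by blast
      then show ?thesis unfolding add(1) by (intro fsp(3) fsp(5) fun_upd_PiE add)
    next
      case (scale f m a y)
      then have "a *s y \<in> X m" using sub subspace_scale by blast
      then show ?thesis unfolding scale(1) by (intro fsp(3) fsp(5) fun_upd_PiE scale)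
    qed
    then show ?case using 2 by (intro fsp(2) fsp(4))
  qed (rule fsp)
qed

text \<open>\<open>iso_push\<close> is a union over all representatives of a coset. Relations go to
  relations, so all representatives yield the same coset, which is then the union.\<close>

lemma tensor_class_push:
  fixes X :: "'m \<Rightarrow> 'b set" and X' :: "'n \<Rightarrow> 'b set"
  assumes bij: "bij_betw fv M M'" and X: "\<And>m. m \<in> M \<Longrightarrow> X' (fv m) = X m"
  defines "g \<equiv> (\<lambda>f. \<lambda>q\<in>M'. f (inv_into M fv q))"
  shows "(\<Union>u\<in>tensor_class M X t. tensor_class M' X' (formal_push g u)) = tensor_class M' X' (formal_push g t)"
proof -
  have inv: "inv_into M fv (fv m) = m" if "m \<in> M" for m using bij that by (simp add: bij_betw_inv_into_left)
  have upd: "g (f(m := y)) = (g f)(fv m := y)" if "m \<in> M" for f :: "'m \<Rightarrow> 'b" and m y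
  proof
    fix q show "g (f(m := y)) q = ((g f)(fv m := y)) q"
    proof (cases "q \<in> M'")
      case True
      then have "inv_into M fv q = m \<longleftrightarrow> q = fv m" using bij that inv by (auto simp: bij_betw_inv_into_right)
      then show ?thesis using True unfolding g_def by simp
    next
      case False
      then have "q \<noteq> fv m" using bij that unfolding bij_betw_def by blast
      then show ?thesis using False unfolding g_def by simp
    qed
  qed
  have gP: "g f \<in> Pi\<^sub>E M' X'" if "f \<in> Pi\<^sub>E M X" for f
  proof (rule PiE_I)
    fix q assume q: "q \<in> M'"
    then have m: "inv_into M fv q \<in> M" "fv (inv_into M fv q) = q"
      using bij by (metis bij_betw_def inv_into_into, metis bij_betw_inv_into_right)
    then have "f (inv_into M fv q) \<in> X (inv_into M fv q)" using that by blast
    then show "g f q \<in> X' q" unfolding g_def using q X[OF m(1)] m(2) by simp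
  qed (simp add: g_def)
  have fvM: "fv m \<in> M'" if "m \<in> M" for m using bij that unfolding bij_betw_def by blast
  have eq: "tensor_class M' X' (formal_push g u) = tensor_class M' X' (formal_push g t)" if "u \<in> tensor_class M X t" for u
  proof -
    have mn: "formal_push g (x - y) = formal_push g x - formal_push g y" for x y :: "('m, 'b, 'k) formal"
      by (rule formal_minus) (rule formal_push_simps)
    have "formal_push g (u - t) \<in> fspan (tensor_relations M' X')"
    proof (rule fspan_map[where R = "tensor_relations M X"])
      show "u - t \<in> fspan (tensor_relations M X)" using that unfolding tensor_class_mem .
      fix x assume "x \<in> tensor_relations M X"
      then have "formal_push g x \<in> tensor_relations M' X'"
      proof (cases rule: tensor_relations_cases)
        case (add f m y z)
        then show ?thesis using tensor_relations_add[OF gP fvM, of f m y z] X by (simp add: mn formal_push_simps upd)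
      next
        case (scale f m a y)
        then show ?thesis using tensor_relations_scale[OF gP fvM, of f m y a] X by (simp add: mn formal_push_simps upd)
      qed
      then show "formal_push g x \<in> fspan (tensor_relations M' X')" by (rule module.span_base[OF formal_module])
    qed (rule formal_push_simps)+
    then show ?thesis unfolding tensor_class_eq_iff by (simp add: mn)
  qed
  show ?thesis using eq tensor_class_self by blast
qed

text \<open>A relation times a family from the other factor is a relation. Independence of both
  representatives follows by writing the difference of the products as (u - t) w + t (w -
  k).\<close>

lemma tensor_class_prod:
  fixes X :: "'m \<Rightarrow> 'b set" and Y :: "'n \<Rightarrow> 'b set"
  assumes XY: "\<And>m. m \<in> M \<Longrightarrow> Z (Inl m) = X m" "\<And>n. n \<in> N \<Longrightarrow> Z (Inr n) = Y n"
    and sub: "\<And>m. m \<in> M \<Longrightarrow> subspace (X m)" "\<And>n. n \<in> N \<Longrightarrow> subspace (Y n)"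
    and t: "t \<in> formal_space M X" and k: "k \<in> formal_space N Y"
  shows "(\<Union>u\<in>tensor_class M X t. \<Union>w\<in>tensor_class N Y k. tensor_class (M <+> N) Z (formal_prod u w)) =
    tensor_class (M <+> N) Z (formal_prod t k)"
proof -
  let ?R = "fspan (tensor_relations (M <+> N) Z)"
  have cs: "case_sum f h \<in> Pi\<^sub>E (M <+> N) Z" if "f \<in> Pi\<^sub>E M X" "h \<in> Pi\<^sub>E N Y" for f h
    using that XY by (fastforce simp: PiE_def Pi_def extensional_def Plus_def split: sum.splits)
  have updl: "case_sum (f(m := y)) h = (case_sum f h)(Inl m := y)" for f :: "'m \<Rightarrow> 'b" and h :: "'n \<Rightarrow> 'b" and m y
    by (auto simp: fun_eq_iff split: sum.splits)
  have updr: "case_sum f (h(m := y)) = (case_sum f h)(Inr m := y)" for f :: "'m \<Rightarrow> 'b" and h :: "'n \<Rightarrow> 'b" and m y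
    by (auto simp: fun_eq_iff split: sum.splits)
  have mn: "formal_prod (x - y) w = formal_prod x w - formal_prod y w" "formal_prod u (w - w') = formal_prod u w - formal_prod u w'"
    for x y u :: "('m, 'b, 'k) formal" and w w' :: "('n, 'b, 'k) formal"
    by (rule formal_minus[of "\<lambda>x. formal_prod x w"], rule formal_prod_simps, rule formal_minus[of "formal_prod u"], rule formal_prod_simps)
  have left: "formal_prod x w \<in> ?R" if x: "x \<in> fspan (tensor_relations M X)" and w: "w \<in> formal_space N Y" for x w
  proof -
    have "formal_prod x (Poly_Mapping.single h 1) \<in> ?R" if h: "h \<in> Pi\<^sub>E N Y" for h
    proof (rule fspan_map[where h = "\<lambda>x. formal_prod x (Poly_Mapping.single h 1)", OF x])
      fix r assume "r \<in> tensor_relations M X"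
      then have "formal_prod r (Poly_Mapping.single h 1) \<in> tensor_relations (M <+> N) Z"
      proof (cases rule: tensor_relations_cases)
        case (add f m y z)
        then show ?thesis using tensor_relations_add[OF cs[OF _ h], of f "Inl m" y z] XY by (auto simp: mn formal_prod_simps updl)
      next
        case (scale f m a y)
        then show ?thesis using tensor_relations_scale[OF cs[OF _ h], of f "Inl m" y a] XY by (auto simp: mn formal_prod_simps updl)
      qed
      then show "formal_prod r (Poly_Mapping.single h 1) \<in> ?R" by (rule module.span_base[OF formal_module])
    qed (simp_all add: formal_prod_simps)
    then show ?thesis unfolding formal_prod_decomp(1)[of x w] using w unfolding formal_space_def
      by (intro module.span_sum[OF formal_module] module.span_scale[OF formal_module]) auto
  qed
  have right: "formal_prod u x \<in> ?R" if x: "x \<in> fspan (tensor_relations N Y)" and u: "u \<in> formal_space M X" for x u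
  proof -
    have "formal_prod (Poly_Mapping.single h 1) x \<in> ?R" if h: "h \<in> Pi\<^sub>E M X" for h
    proof (rule fspan_map[where h = "\<lambda>x. formal_prod (Poly_Mapping.single h 1) x", OF x])
      fix r assume "r \<in> tensor_relations N Y"
      then have "formal_prod (Poly_Mapping.single h 1) r \<in> tensor_relations (M <+> N) Z"
      proof (cases rule: tensor_relations_cases)
        case (add f m y z)
        then show ?thesis using tensor_relations_add[OF cs[OF h], of f "Inr m" y z] XY by (auto simp: mn formal_prod_simps updr)
      next
        case (scale f m a y)
        then show ?thesis using tensor_relations_scale[OF cs[OF h], of f "Inr m" y a] XY by (auto simp: mn formal_prod_simps updr)
      qed
      then show "formal_prod (Poly_Mapping.single h 1) r \<in> ?R" by (rule module.span_base[OF formal_module])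
    qed (simp_all add: formal_prod_simps)
    then show ?thesis unfolding formal_prod_decomp(2)[of u x] using u unfolding formal_space_def
      by (intro module.span_sum[OF formal_module] module.span_scale[OF formal_module]) auto
  qed
  have eq: "tensor_class (M <+> N) Z (formal_prod u w) = tensor_class (M <+> N) Z (formal_prod t k)"
    if u: "u \<in> tensor_class M X t" and w: "w \<in> tensor_class N Y k" for u w
  proof -
    have ut: "u - t \<in> fspan (tensor_relations M X)" and wk: "w - k \<in> fspan (tensor_relations N Y)" using u w unfolding tensor_class_mem by auto
    have "w - k \<in> formal_space N Y" using fspan_relations_formal[OF sub(2) wk] .
    moreover have "Poly_Mapping.keys w \<subseteq> Poly_Mapping.keys (w - k) \<union> Poly_Mapping.keys k"
      using keys_add[of "w - k" k] by simp
    \<comment> \<open>\<open>left\<close> multiplies relations only by formal sums of families from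
      the spaces \<open>Y n\<close>, so the arbitrary representative \<open>w\<close> must be one of
      these.\<close>
    ultimately have "w \<in> formal_space N Y" using k unfolding formal_space_def by blast
    then have "formal_prod (u - t) w + formal_prod t (w - k) \<in> ?R"
      using left[OF ut] right[OF wk t] module.span_add[OF formal_module] by blast
    then show ?thesis unfolding tensor_class_eq_iff mn by simp
  qed
  have ne: "tensor_class M X t \<noteq> {}" "tensor_class N Y k \<noteq> {}" using tensor_class_self by blast+
  show ?thesis by (intro SUP_eq_const ne eq)
qed

section \<open>Linear forms on tensor products\<close>

lemma linear_formD:
  assumes "tensor_linear_form M X L"
  shows "t \<in> formal_space M X \<Longrightarrow> u \<in> formal_space M X \<Longrightarrow>
      L (tensor_class M X (t + u)) = L (tensor_class M X t) + L (tensor_class M X u)"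
    and "t \<in> formal_space M X \<Longrightarrow> L (tensor_class M X (formal_scale a t)) = a * L (tensor_class M X t)"
  using assms unfolding tensor_linear_form_def by blast+

lemma linear_form_sum:
  assumes L: "tensor_linear_form M X L" and I: "finite I" "\<And>i. i \<in> I \<Longrightarrow> f i \<in> Pi\<^sub>E M X"
  shows "L (tensor_class M X (\<Sum>i\<in>I. Poly_Mapping.single (f i) (c i))) = (\<Sum>i\<in>I. c i * L (tensor_class M X (Poly_Mapping.single (f i) 1)))"
  using I
proof (induction I rule: finite_induct)
  case empty
  have "0 \<in> formal_space M X" unfolding formal_space_def by simp
  then have "L (tensor_class M X (0 + 0)) = L (tensor_class M X 0) + L (tensor_class M X 0)"
    using L unfolding tensor_linear_form_def by blast
  then show ?case by simp
next
  case (insert i I)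
  have "Poly_Mapping.keys (\<Sum>i\<in>I. Poly_Mapping.single (f i) (c i)) \<subseteq> (\<Union>i\<in>I. Poly_Mapping.keys (Poly_Mapping.single (f i) (c i)))"
    by (rule keys_sum)
  also have "\<dots> \<subseteq> Pi\<^sub>E M X" using insert by auto
  finally have "(\<Sum>i\<in>I. Poly_Mapping.single (f i) (c i)) \<in> formal_space M X" unfolding formal_space_def by simp
  moreover have m: "Poly_Mapping.single (f i) a \<in> formal_space M X" for a
    using insert(4)[of i] unfolding formal_space_def by (auto intro!: keys_subset(4) simp del: keys_single)
  ultimately have "L (tensor_class M X (Poly_Mapping.single (f i) (c i) + (\<Sum>i\<in>I. Poly_Mapping.single (f i) (c i)))) =
      L (tensor_class M X (Poly_Mapping.single (f i) (c i))) + L (tensor_class M X (\<Sum>i\<in>I. Poly_Mapping.single (f i) (c i)))"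
    by (intro linear_formD(1)[OF L])
  moreover have "L (tensor_class M X (Poly_Mapping.single (f i) (c i))) = c i * L (tensor_class M X (Poly_Mapping.single (f i) 1))"
    using linear_formD(2)[OF L m, of "c i" 1] by simp
  ultimately show ?case using insert by simp
qed

lemma linear_form_multilinear:
  assumes L: "tensor_linear_form M X L" and f: "f \<in> Pi\<^sub>E M X" "m \<in> M"
    and sub: "subspace (X m)"
  shows "x \<in> X m \<Longrightarrow> y \<in> X m \<Longrightarrow> L (tensor_class M X (Poly_Mapping.single (f(m := x + y)) 1)) =
      L (tensor_class M X (Poly_Mapping.single (f(m := x)) 1)) + L (tensor_class M X (Poly_Mapping.single (f(m := y)) 1))"
    and "x \<in> X m \<Longrightarrow> L (tensor_class M X (Poly_Mapping.single (f(m := a *s x)) 1)) =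
      a * L (tensor_class M X (Poly_Mapping.single (f(m := x)) 1))"
proof -
  assume x: "x \<in> X m"
  have s: "Poly_Mapping.single (f(m := z)) c \<in> formal_space M X" if "z \<in> X m" for z c
    using fun_upd_PiE[OF f that] unfolding formal_space_def by auto
  {
    assume y: "y \<in> X m"
    have "Poly_Mapping.single (f(m := x + y)) 1 - (Poly_Mapping.single (f(m := x)) 1 + Poly_Mapping.single (f(m := y)) 1)
      \<in> fspan (tensor_relations M X)"
      using module.span_base[OF formal_module tensor_relations_add[OF f x y]] by (simp add: algebra_simps)
    then have "tensor_class M X (Poly_Mapping.single (f(m := x + y)) 1) =
      tensor_class M X (Poly_Mapping.single (f(m := x)) 1 + Poly_Mapping.single (f(m := y)) 1)" unfolding tensor_class_eq_iff .
    then show "L (tensor_class M X (Poly_Mapping.single (f(m := x + y)) 1)) =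
      L (tensor_class M X (Poly_Mapping.single (f(m := x)) 1)) + L (tensor_class M X (Poly_Mapping.single (f(m := y)) 1))"
      using linear_formD(1)[OF L s[OF x] s[OF y]] by simp
  }
  have eq: "tensor_class M X (Poly_Mapping.single (f(m := a *s x)) 1) = tensor_class M X (Poly_Mapping.single (f(m := x)) a)"
    using module.span_base[OF formal_module tensor_relations_scale[OF f x]] unfolding tensor_class_eq_iff .
  show "L (tensor_class M X (Poly_Mapping.single (f(m := a *s x)) 1)) =
      a * L (tensor_class M X (Poly_Mapping.single (f(m := x)) 1))"
    unfolding eq using linear_formD(2)[OF L s[OF x, of 1], of a] by (simp only: formal_scale_single mult_1_right)
qed

end

section \<open>Correlators\<close>

definition assign :: "'v list \<Rightarrow> 'b list \<Rightarrow> 'v \<Rightarrow> 'b" where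
  "assign qs xs = the \<circ> map_of (zip qs xs)"

lemma assign_nth: "distinct qs \<Longrightarrow> length xs = length qs \<Longrightarrow> i < length qs \<Longrightarrow> assign qs xs (qs ! i) = xs ! i"
  unfolding assign_def by (simp add: map_of_zip_nth)

context char_0_space
begin

lemma single_formal_space: "f \<in> Pi\<^sub>E M X \<Longrightarrow> Poly_Mapping.single f a \<in> formal_space M X"
  unfolding formal_space_def mem_Collect_eq by (rule keys_subset(4))

lemma V_pure_in:
  assumes "\<And>q. q \<in> vertices \<Omega> \<Longrightarrow> f q \<in> vertex_space B \<Omega> q" shows "V_pure B \<Omega> f \<in> V_space B \<Omega>"
  unfolding V_pure_def V_space_def V_class_def tensor_space_def
  using assms by (intro imageI single_formal_space) auto

lemma iso_push_class:
  assumes iso: "complex_iso fv fe fd \<Omega> \<Omega>'"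
    and ok: "\<And>q. q \<in> vertices \<Omega> \<Longrightarrow> vertex_ok \<Omega> q" "\<And>q. q \<in> vertices \<Omega> \<Longrightarrow> vertex_ok \<Omega>' (fv q)"
  shows "iso_push B \<Omega> \<Omega>' fv (V_class B \<Omega> t) =
    V_class B \<Omega>' (formal_push (\<lambda>f. \<lambda>q\<in>vertices \<Omega>'. f (inv_into (vertices \<Omega>) fv q)) t)"
  unfolding iso_push_def V_class_def
proof (rule tensor_class_push)
  show "bij_betw fv (vertices \<Omega>) (vertices \<Omega>')" using iso unfolding complex_iso_def by blast
  show "vertex_space B \<Omega>' (fv m) = vertex_space B \<Omega> m" if "m \<in> vertices \<Omega>" for m
    unfolding vertex_space_def using complex_iso_vertex_class[OF iso that ok[OF that]] by simp
qed

lemma iso_push_pure: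
  assumes iso: "complex_iso fv fe fd \<Omega> \<Omega>'"
    and ok: "\<And>q. q \<in> vertices \<Omega> \<Longrightarrow> vertex_ok \<Omega> q" "\<And>q. q \<in> vertices \<Omega> \<Longrightarrow> vertex_ok \<Omega>' (fv q)"
    and h: "\<And>q. q \<in> vertices \<Omega> \<Longrightarrow> h (fv q) = f q"
  shows "iso_push B \<Omega> \<Omega>' fv (V_pure B \<Omega> f) = V_pure B \<Omega>' h"
proof -
  have bij: "bij_betw fv (vertices \<Omega>) (vertices \<Omega>')" using iso unfolding complex_iso_def by blast
  have "(\<lambda>q\<in>vertices \<Omega>'. restrict f (vertices \<Omega>) (inv_into (vertices \<Omega>) fv q)) = restrict h (vertices \<Omega>')"
  proof (rule restrict_ext)
    fix q assume "q \<in> vertices \<Omega>'"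
    then obtain p where "p \<in> vertices \<Omega>" "q = fv p" using bij unfolding bij_betw_def by blast
    then show "restrict f (vertices \<Omega>) (inv_into (vertices \<Omega>) fv q) = h q"
      using h bij_betw_inv_into_left[OF bij] by simp
  qed
  note eq = this
  have "iso_push B \<Omega> \<Omega>' fv (V_class B \<Omega> t) =
    V_class B \<Omega>' (formal_push (\<lambda>f. \<lambda>q\<in>vertices \<Omega>'. f (inv_into (vertices \<Omega>) fv q)) t)" for t
    using iso ok by (rule iso_push_class)
  then show ?thesis unfolding V_pure_def by (simp only: formal_push_simps(3) eq)
qed

end

context film_TFT
begin

abbreviation corr :: "'c gclass list \<Rightarrow> 'b list \<Rightarrow> 'k" where
  "corr \<equiv> correlator S B \<Phi>"

lemma value_iso:
  assumes f: "film_surface S \<Omega>" "film_surface S \<Omega>'" and iso: "complex_iso fv fe fd \<Omega> \<Omega>'"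
    and x: "\<And>q. q \<in> vertices \<Omega> \<Longrightarrow> f q \<in> vertex_space B \<Omega> q" and h: "\<And>q. q \<in> vertices \<Omega> \<Longrightarrow> h (fv q) = f q"
  shows "\<Phi> \<Omega>' (V_pure B \<Omega>' h) = \<Phi> \<Omega> (V_pure B \<Omega> f)"
proof -
  have "bij_betw fv (vertices \<Omega>) (vertices \<Omega>')" using iso unfolding complex_iso_def by blast
  then have fv: "fv q \<in> vertices \<Omega>'" if "q \<in> vertices \<Omega>" for q by (rule bij_betwE[THEN bspec]) (rule that)
  have "iso_push B \<Omega> \<Omega>' fv (V_pure B \<Omega> f) = V_pure B \<Omega>' h"
    using iso film_vertex_ok[OF f(1)] film_vertex_ok[OF f(2) fv] h by (rule iso_push_pure)
  moreover have "\<Phi> \<Omega>' (iso_push B \<Omega> \<Omega>' fv (V_pure B \<Omega> f)) = \<Phi> \<Omega> (V_pure B \<Omega> f)"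
    by (rule isomorphism[OF f iso V_pure_in[OF x]])
  ultimately show ?thesis by simp
qed

text \<open>\<open>correlator\<close> selects a surface by \<open>SOME\<close>. Any other one is
  isomorphic to it with the numbering preserved, so the isomorphism axiom permits evaluation on
  every representing surface.\<close>

lemma corr_eq:
  assumes O: "(\<Omega>, qs) \<in> surfaces S \<sigma>s" and xs: "length xs = length \<sigma>s" "\<And>i. i < length \<sigma>s \<Longrightarrow> xs ! i \<in> B (\<sigma>s ! i)"
    and h: "\<And>i. i < length qs \<Longrightarrow> h (qs ! i) = xs ! i"
  shows "corr \<sigma>s xs = \<Phi> \<Omega> (V_pure B \<Omega> h)"
proof -
  define p where "p = (SOME p. p \<in> surfaces S \<sigma>s)"
  obtain \<Omega>0 ps where p0: "p = (\<Omega>0, ps)" by (cases p)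
  have "p \<in> surfaces S \<sigma>s" unfolding p_def using O by (rule someI)
  then have P: "(\<Omega>0, ps) \<in> surfaces S \<sigma>s" using p0 by simp
  have ne: "surfaces S \<sigma>s \<noteq> {}" using O by blast
  have c: "corr \<sigma>s xs = \<Phi> \<Omega>0 (V_pure B \<Omega>0 (assign ps xs))"
    unfolding correlator_def p_def[symmetric] p0 assign_def using ne by simp
  have s: "film_surface S \<Omega>0" "film_surface S \<Omega>" "distinct ps" "vertices \<Omega>0 = set ps" "map (vertex_class \<Omega>0) ps = \<sigma>s"
    "map (vertex_class \<Omega>) qs = \<sigma>s" using O P unfolding surfaces_def by auto
  have l: "length ps = length \<sigma>s" "length qs = length \<sigma>s" using s(5,6) by (metis length_map)+
  obtain fv fe fd where iso: "complex_iso fv fe fd \<Omega>0 \<Omega>" "map fv ps = qs" using surfaces_isomorphic[OF P O] .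
  have q: "\<exists>i<length ps. q = ps ! i" if "q \<in> vertices \<Omega>0" for q using that s(4) by (metis in_set_conv_nth)
  have "\<Phi> \<Omega> (V_pure B \<Omega> h) = \<Phi> \<Omega>0 (V_pure B \<Omega>0 (assign ps xs))"
  proof (rule value_iso[OF s(1,2) iso(1)])
    fix q assume "q \<in> vertices \<Omega>0"
    then obtain i where i: "i < length ps" "q = ps ! i" using q by blast
    have a: "assign ps xs q = xs ! i" unfolding i(2) using assign_nth[OF s(3) _ i(1)] xs(1) l by simp
    have "vertex_class \<Omega>0 q = \<sigma>s ! i" unfolding i(2) s(5)[symmetric] using i(1) by simp
    then show "assign ps xs q \<in> vertex_space B \<Omega>0 q" unfolding vertex_space_def a using xs(2) i(1) l by simp
    have "fv q = qs ! i" unfolding i(2) iso(2)[symmetric] using i(1) by simp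
    then show "h (fv q) = assign ps xs q" unfolding a using h i(1) l by simp
  qed
  then show ?thesis using c by simp
qed

lemma corr_empty: "surfaces S \<sigma>s = {} \<Longrightarrow> corr \<sigma>s xs = 0"
  unfolding correlator_def by simp

text \<open>The same surface, with its vertices renumbered, represents the rotated list of classes:
  a cyclic order has no first vertex.\<close>

lemma corr_rotate:
  assumes "length xs = length \<sigma>s" "\<And>i. i < length \<sigma>s \<Longrightarrow> xs ! i \<in> B (\<sigma>s ! i)"
  shows "corr (rotate1 \<sigma>s) (rotate1 xs) = corr \<sigma>s xs"
proof (cases "surfaces S \<sigma>s = {}")
  case True
  have "surfaces S (rotate1 \<sigma>s) = {}"
  proof (rule ccontr)
    assume "surfaces S (rotate1 \<sigma>s) \<noteq> {}"
    then obtain \<Omega> qs where "(\<Omega>, qs) \<in> surfaces S (rotate 1 \<sigma>s)" by auto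
    moreover obtain k where "rotate k (rotate 1 \<sigma>s) = \<sigma>s" using rotate_back by blast
    ultimately show False using surfaces_rotate[of \<Omega> qs S "rotate 1 \<sigma>s" k] True by auto
  qed
  then show ?thesis using True corr_empty by simp
next
  case False
  then obtain \<Omega> qs where O: "(\<Omega>, qs) \<in> surfaces S \<sigma>s" by auto
  then have s: "distinct qs" "map (vertex_class \<Omega>) qs = \<sigma>s" unfolding surfaces_def by auto
  then have l: "length qs = length \<sigma>s" by (metis length_map)
  let ?h = "assign qs xs"
  have n: "?h (qs ! i) = xs ! i" if "i < length qs" for i using assign_nth[OF s(1)] assms(1) l that by simp
  have r: "(\<Omega>, rotate1 qs) \<in> surfaces S (rotate1 \<sigma>s)" using surfaces_rotate[OF O, of 1] by simp
  have nr: "rotate1 zs ! i = zs ! (Suc i mod length zs)" if "i < length zs" for i and zs :: "'z list"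
    using nth_rotate[of i zs 1] that by simp
  have m: "Suc i mod n < n" if "i < n" for i n :: nat using that by (intro mod_less_divisor) auto
  have "corr (rotate1 \<sigma>s) (rotate1 xs) = \<Phi> \<Omega> (V_pure B \<Omega> ?h)"
  proof (rule corr_eq[OF r])
    show "rotate1 xs ! i \<in> B (rotate1 \<sigma>s ! i)" if "i < length (rotate1 \<sigma>s)" for i
      using that nr[of i xs] nr[of i \<sigma>s] assms m[of i "length \<sigma>s"] by simp
    show "?h (rotate1 qs ! i) = rotate1 xs ! i" if "i < length (rotate1 qs)" for i
      using that nr[of i xs] nr[of i qs] assms(1) l n m[of i "length \<sigma>s"] by simp
  qed (use assms in simp)
  also have "\<dots> = corr \<sigma>s xs" using corr_eq[OF O assms n] by simp
  finally show ?thesis .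
qed

lemma corr_multilinear:
  assumes xs: "length xs = length \<sigma>s" "\<And>i. i < length \<sigma>s \<Longrightarrow> xs ! i \<in> B (\<sigma>s ! i)" and i: "i < length \<sigma>s"
    and x: "x \<in> B (\<sigma>s ! i)"
  shows "y \<in> B (\<sigma>s ! i) \<Longrightarrow> corr \<sigma>s (xs[i := x + y]) = corr \<sigma>s (xs[i := x]) + corr \<sigma>s (xs[i := y])"
    and "corr \<sigma>s (xs[i := a *s x]) = a * corr \<sigma>s (xs[i := x])"
proof -
  have "(y \<in> B (\<sigma>s ! i) \<longrightarrow> corr \<sigma>s (xs[i := x + y]) = corr \<sigma>s (xs[i := x]) + corr \<sigma>s (xs[i := y])) \<and>
    corr \<sigma>s (xs[i := a *s x]) = a * corr \<sigma>s (xs[i := x])"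
  proof (cases "surfaces S \<sigma>s = {}")
    case True
    then show ?thesis using corr_empty by simp
  next
    case False
    then obtain \<Omega> qs where O: "(\<Omega>, qs) \<in> surfaces S \<sigma>s" by auto
    then have n: "numbered \<Omega> S qs" "map (vertex_class \<Omega>) qs = \<sigma>s" unfolding surfaces_numbered by auto
    interpret numbered \<Omega> S qs by (rule n(1))
    have l: "length qs = length \<sigma>s" using n(2) by (metis length_map)
    have vc: "vertex_space B \<Omega> (qs ! j) = B (\<sigma>s ! j)" if "j < length qs" for j
      unfolding vertex_space_def n(2)[symmetric] using that by simp
    let ?h = "restrict (assign qs xs) (vertices \<Omega>)" and ?m = "qs ! i"
    have m: "?m \<in> vertices \<Omega>" using i l qs_in by simp
    have hP: "?h \<in> Pi\<^sub>E (vertices \<Omega>) (vertex_space B \<Omega>)"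
    proof (rule restrict_PiE_iff[THEN iffD2], rule ballI)
      fix q assume "q \<in> vertices \<Omega>"
      then obtain j where j: "j < length qs" "q = qs ! j" using vertex_index by metis
      show "assign qs xs q \<in> vertex_space B \<Omega> q"
        unfolding j(2) vc[OF j(1)] using assign_nth[OF dist _ j(1), of xs] xs(1) xs(2)[of j] l j(1) by simp
    qed
    have c: "corr \<sigma>s (xs[i := z]) = \<Phi> \<Omega> (V_class B \<Omega> (Poly_Mapping.single (?h(?m := z)) 1))" if "z \<in> B (\<sigma>s ! i)" for z
    proof -
      have "corr \<sigma>s (xs[i := z]) = \<Phi> \<Omega> (V_pure B \<Omega> (?h(?m := z)))"
      proof (rule corr_eq[OF O])
        show "xs[i := z] ! j \<in> B (\<sigma>s ! j)" if "j < length \<sigma>s" for j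
          using that \<open>z \<in> B (\<sigma>s ! i)\<close> xs i by (cases "j = i") auto
        show "(?h(?m := z)) (qs ! j) = xs[i := z] ! j" if "j < length qs" for j
          using that qs_eq[of j i] i l xs(1) assign_nth[OF dist, of xs j] qs_in[of j] by auto
      qed (use xs in simp)
      moreover have "restrict (?h(?m := z)) (vertices \<Omega>) = ?h(?m := z)" using m by (auto simp: restrict_def fun_eq_iff)
      ultimately show ?thesis unfolding V_pure_def by simp
    qed
    have "\<sigma>s ! i \<in> Sigma_classes S" using numbered_vertex_class[OF n(1) m] n(2) i l by (metis nth_map)
    then have sub: "subspace (B (\<sigma>s ! i))" by (rule subspace_B)
    have L: "tensor_linear_form (vertices \<Omega>) (vertex_space B \<Omega>) (\<Phi> \<Omega>)"
      by (rule linear_form) (use film film_conn_iff[of S \<Omega>] in blast)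
    have B: "vertex_space B \<Omega> ?m = B (\<sigma>s ! i)" using vc i l by simp
    note ml = linear_form_multilinear[OF L hP m, unfolded B, OF sub]
    show ?thesis using ml(1)[OF x, of y] ml(2)[OF x, of a] c[OF x] c[of y] c[of "x + y"] c[of "a *s x"]
      subspace_add[OF sub x, of y] subspace_scale[OF sub x, of a] unfolding V_class_def by simp
  qed
  then show "y \<in> B (\<sigma>s ! i) \<Longrightarrow> corr \<sigma>s (xs[i := x + y]) = corr \<sigma>s (xs[i := x]) + corr \<sigma>s (xs[i := y])"
    "corr \<sigma>s (xs[i := a *s x]) = a * corr \<sigma>s (xs[i := x])" by blast+
qed

section \<open>Values on disjoint unions and on cut surfaces\<close>

lemma V_prod_class:
  assumes XY: "\<And>m. m \<in> M \<Longrightarrow> vertex_space B \<Omega> (Inl m) = X m" "\<And>n. n \<in> N \<Longrightarrow> vertex_space B \<Omega> (Inr n) = Y n"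
    and V: "vertices \<Omega> = M <+> N"
    and sub: "\<And>m. m \<in> M \<Longrightarrow> subspace (X m)" "\<And>n. n \<in> N \<Longrightarrow> subspace (Y n)"
    and t: "t \<in> formal_space M X" and k: "k \<in> formal_space N Y"
  shows "V_prod B \<Omega> (tensor_class M X t) (tensor_class N Y k) = V_class B \<Omega> (formal_prod t k)"
  unfolding V_prod_def V_class_def V by (rule tensor_class_prod) fact+

lemma numbered_subspace:
  fixes \<Omega> :: "'c surface"
  assumes "numbered \<Omega> S qs" "q \<in> vertices \<Omega>" shows "subspace (vertex_space B \<Omega> q)"
  unfolding vertex_space_def using subspace_B numbered_vertex_class[OF assms] by blast

text \<open>This is multiplicativity for pure tensors, moved through the isomorphism from the
  disjoint union of the two components.\<close>

lemma value_components:
  assumes f: "film_surface S \<Omega>" and comp: "components \<Omega> = {C, D}" "C \<noteq> D"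
    and n: "numbered (component_complex \<Omega> C) S ps" "numbered (component_complex \<Omega> D) S qs"
    and h: "\<And>q. q \<in> vertices \<Omega> \<Longrightarrow> h q \<in> vertex_space B \<Omega> q"
  shows "\<Phi> \<Omega> (V_pure B \<Omega> h) = \<Phi> (component_complex \<Omega> C) (V_pure B (component_complex \<Omega> C) h) *
    \<Phi> (component_complex \<Omega> D) (V_pure B (component_complex \<Omega> D) h)"
proof -
  let ?C = "component_complex \<Omega> C" and ?D = "component_complex \<Omega> D"
  let ?U = "disjoint_union ?C ?D"
  have CD: "C \<in> components \<Omega>" "D \<in> components \<Omega>" using comp by auto
  note fC = film_surface_component[OF f CD(1)] and fD = film_surface_component[OF f CD(2)]
  interpret regular_cx \<Omega> using f unfolding film_surface_components by unfold_locales blast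
  have V: "C \<subseteq> vertices \<Omega>" "D \<subseteq> vertices \<Omega>" "vertices \<Omega> = C \<union> D" using components_facts(1) comp by auto
  have reg: "regular_complex ?C" "regular_complex ?D" using regular_component CD by auto
  have okC: "vertex_ok ?U (Inl q) \<and> vertex_class ?U (Inl q) = vertex_class ?C q" if "q \<in> C" for q
    using vertex_class_disjoint_union(1)[OF reg film_vertex_ok[OF fC(1)]] that by simp
  have okD: "vertex_ok ?U (Inr q) \<and> vertex_class ?U (Inr q) = vertex_class ?D q" if "q \<in> D" for q
    using vertex_class_disjoint_union(2)[OF reg film_vertex_ok[OF fD(1)]] that by simp
  have hC: "h q \<in> vertex_space B ?C q" if "q \<in> C" for q
    using h[of q] vertex_class_component[OF f CD(1) that] that V unfolding vertex_space_def by auto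
  have hD: "h q \<in> vertex_space B ?D q" if "q \<in> D" for q
    using h[of q] vertex_class_component[OF f CD(2) that] that V unfolding vertex_space_def by auto
  note iso = complex_iso_two_components[OF f comp]
  have UV: "vertices ?U = C <+> D" by (simp add: disjoint_union_simps)
  have "V_prod B ?U (V_pure B ?C h) (V_pure B ?D h) =
    V_class B ?U (formal_prod (Poly_Mapping.single (restrict h C) 1) (Poly_Mapping.single (restrict h D) 1))"
    unfolding V_pure_def V_class_def[of B ?C] V_class_def[of B ?D] component_complex_simps(1)
  proof (rule V_prod_class)
    show "vertex_space B ?U (Inl m) = vertex_space B ?C m" if "m \<in> C" for m using okC[OF that] unfolding vertex_space_def by simp
    show "vertex_space B ?U (Inr m) = vertex_space B ?D m" if "m \<in> D" for m using okD[OF that] unfolding vertex_space_def by simp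
    show "vertices ?U = C <+> D" by (rule UV)
    show "subspace (vertex_space B ?C m)" if "m \<in> C" for m using numbered_subspace[OF n(1)] that by simp
    show "subspace (vertex_space B ?D m)" if "m \<in> D" for m using numbered_subspace[OF n(2)] that by simp
    show "Poly_Mapping.single (restrict h C) 1 \<in> formal_space C (vertex_space B ?C)" using hC by (intro single_formal_space) auto
    show "Poly_Mapping.single (restrict h D) 1 \<in> formal_space D (vertex_space B ?D)" using hD by (intro single_formal_space) auto
  qed
  also have "\<dots> = V_pure B ?U (case_sum h h)"
  proof -
    have "case_sum (restrict h C) (restrict h D) = restrict (case_sum h h) (vertices ?U)"
      unfolding UV by (auto simp: fun_eq_iff restrict_def split: sum.splits)
    then show ?thesis unfolding V_pure_def by (simp add: formal_prod_simps)
  qed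
  finally have vp: "V_prod B ?U (V_pure B ?C h) (V_pure B ?D h) = V_pure B ?U (case_sum h h)" .
  have "iso_push B ?U \<Omega> (case_sum id id) (V_pure B ?U (case_sum h h)) = V_pure B \<Omega> h"
  proof (rule iso_push_pure[OF iso])
    fix q assume "q \<in> vertices ?U"
    then have q: "q \<in> C <+> D" unfolding UV .
    then show "vertex_ok ?U q" by (elim PlusE) (use okC okD in simp_all)
    have "case_sum id id q \<in> vertices \<Omega>" using q by (elim PlusE) (use V in auto)
    then show "vertex_ok \<Omega> (case_sum id id q)" by (rule film_vertex_ok[OF f])
    show "h (case_sum id id q) = case_sum h h q" by (cases q) auto
  qed
  moreover have "V_pure B ?C h \<in> V_space B ?C" "V_pure B ?D h \<in> V_space B ?D" using hC hD by (auto intro!: V_pure_in)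
  ultimately show ?thesis using multiplicative[OF fC(1) fD(1) f iso, of "V_pure B ?C h" "V_pure B ?D h"] unfolding vp by simp
qed

abbreviation K_spaces :: "'c gclass \<Rightarrow> bool \<Rightarrow> 'b set" where
  "K_spaces \<sigma> \<equiv> \<lambda>s. if s then B \<sigma> else B (dual \<sigma>)"

text \<open>A fixed formal sum for \<open>K \<sigma>\<close>. Its keys \<open>g\<close> are the pure
  terms, with factor \<open>g True\<close> at \<open>q\<^sub>+\<close> and factor
  \<open>g False\<close> at \<open>q\<^sub>-\<close>.\<close>

definition K_rep :: "'c gclass \<Rightarrow> (bool, 'b, 'k) formal" where
  "K_rep \<sigma> = (SOME t. t \<in> formal_space UNIV (K_spaces \<sigma>) \<and> K \<sigma> = tensor_class UNIV (K_spaces \<sigma>) t)"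

lemma K_rep:
  assumes "\<sigma> \<in> Sigma_classes S"
  shows "K_rep \<sigma> \<in> formal_space UNIV (K_spaces \<sigma>)" "K \<sigma> = tensor_class UNIV (K_spaces \<sigma>) (K_rep \<sigma>)"
    "g \<in> Poly_Mapping.keys (K_rep \<sigma>) \<Longrightarrow> g True \<in> B \<sigma> \<and> g False \<in> B (dual \<sigma>)"
proof -
  have "\<exists>t. t \<in> formal_space UNIV (K_spaces \<sigma>) \<and> K \<sigma> = tensor_class UNIV (K_spaces \<sigma>) t"
    using K_in[OF assms] unfolding tensor_space_def by blast
  from someI_ex[OF this] show 1: "K_rep \<sigma> \<in> formal_space UNIV (K_spaces \<sigma>)" "K \<sigma> = tensor_class UNIV (K_spaces \<sigma>) (K_rep \<sigma>)"
    unfolding K_rep_def by auto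
  show "g True \<in> B \<sigma> \<and> g False \<in> B (dual \<sigma>)" if "g \<in> Poly_Mapping.keys (K_rep \<sigma>)"
  proof -
    have "g \<in> Pi\<^sub>E UNIV (K_spaces \<sigma>)" using 1(1) that unfolding formal_space_def by blast
    then have "g True \<in> K_spaces \<sigma> True" "g False \<in> K_spaces \<sigma> False" by blast+
    then show ?thesis by simp
  qed
qed

text \<open>The cut axiom is applied to a pure tensor, \<open>K\<close> is expanded into its terms,
  and each term splits by multiplicativity. \<open>F g\<close> decodes a vertex label and places
  \<open>f\<close> at the old vertices and \<open>g\<close> at the new points.\<close>

lemma value_cut:
  assumes nc: "numbered_cut \<Omega> S as bs" and f: "\<And>q. q \<in> vertices \<Omega> \<Longrightarrow> f q \<in> vertex_space B \<Omega> q"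
  defines "\<rho> \<equiv> numbered_cut.new_class \<Omega> as bs" and "N \<equiv> numbered_cut.piece \<Omega> as bs"
    and "F \<equiv> (\<lambda>g q. case_sum f g (from_nat q :: nat + bool))"
  shows "\<Phi> \<Omega> (V_pure B \<Omega> f) = (\<Sum>g\<in>Poly_Mapping.keys (K_rep \<rho>). Poly_Mapping.lookup (K_rep \<rho>) g *
    (\<Phi> (N True) (V_pure B (N True) (F g)) * \<Phi> (N False) (V_pure B (N False) (F g))))"
proof -
  interpret numbered_cut \<Omega> S as bs by (rule nc)
  let ?\<Gamma> = "cut_complex \<Omega> (set as) (set bs)" and ?k = "K_rep \<rho>" and ?f = "restrict f (vertices \<Omega>)"
  have \<rho>: "\<rho> \<in> Sigma_classes S" "vertex_class ?\<Gamma> (Inr True) = \<rho>" "vertex_class ?\<Gamma> (Inr False) = dual \<rho>"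
    using new_class_Sigma C.vertex_class_cut_dual unfolding \<rho>_def new_class_def by auto
  have film\<Omega>: "film_surface S \<Omega>" "connected_complex \<Omega>" using film_conn_iff[of S \<Omega>] film by auto
  have V\<Gamma>: "vertices ?\<Gamma> = vertices \<Omega> <+> UNIV" unfolding cut_complex_def by simp
  obtain \<gamma> where \<gamma>: "graph_cut \<Omega> \<gamma> (set as) (set bs)" using C.graph_cut_exists by blast
  have "V_prod B ?\<Gamma> (V_pure B \<Omega> f) (K \<rho>) = V_class B ?\<Gamma> (formal_prod (Poly_Mapping.single ?f 1) ?k)"
    unfolding V_pure_def V_class_def[of B \<Omega>] K_rep(2)[OF \<rho>(1)]
  proof (rule V_prod_class)
    show "vertex_space B ?\<Gamma> (Inl m) = vertex_space B \<Omega> m" if "m \<in> vertices \<Omega>" for m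
      using C.vertex_class_cut[OF that] unfolding vertex_space_def by simp
    show "vertex_space B ?\<Gamma> (Inr n) = K_spaces \<rho> n" for n using \<rho> unfolding vertex_space_def by (cases n) auto
    show "subspace (vertex_space B \<Omega> m)" if "m \<in> vertices \<Omega>" for m by (rule numbered_subspace[OF numbered_axioms that])
    show "subspace (K_spaces \<rho> n)" for n using subspace_B \<rho>(1) dual_Sigma by auto
    show "Poly_Mapping.single ?f 1 \<in> formal_space (vertices \<Omega>) (vertex_space B \<Omega>)" using f by (intro single_formal_space) auto
    show "?k \<in> formal_space UNIV (K_spaces \<rho>)" by (rule K_rep(1)[OF \<rho>(1)])
  qed (rule V\<Gamma>)
  also have "formal_prod (Poly_Mapping.single ?f 1) ?k = (\<Sum>g\<in>Poly_Mapping.keys ?k. Poly_Mapping.single (case_sum ?f g) (Poly_Mapping.lookup ?k g))"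
    unfolding formal_prod_single lin_ext_def by simp
  finally have vp: "V_prod B ?\<Gamma> (V_pure B \<Omega> f) (K \<rho>) =
    V_class B ?\<Gamma> (\<Sum>g\<in>Poly_Mapping.keys ?k. Poly_Mapping.single (case_sum ?f g) (Poly_Mapping.lookup ?k g))" .
  have Vp: "vertices pieces = to_nat ` (vertices \<Omega> <+> (UNIV :: bool set))" using pieces_vertices V\<Gamma> by simp
  define G where "G = (\<lambda>f. \<lambda>q\<in>vertices pieces. f (inv_into (vertices ?\<Gamma>) to_nat q) :: 'b)"
  \<comment> \<open>Decoding a label by \<open>from_nat\<close> agrees with inverting
    \<open>to_nat\<close> on the vertices, so the transported families are the restrictions of
    \<open>F g\<close>.\<close>
  have GF: "G (case_sum ?f g) = restrict (F g) (vertices pieces)" for g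
    unfolding G_def
  proof (rule restrict_ext)
    fix q assume "q \<in> vertices pieces"
    then obtain x where x: "x \<in> vertices ?\<Gamma>" "q = to_nat x" using Vp V\<Gamma> by auto
    then have "inv_into (vertices ?\<Gamma>) to_nat q = x" by (simp add: inj_on_def)
    then show "case_sum ?f g (inv_into (vertices ?\<Gamma>) to_nat q) = F g q"
      using x(1) unfolding F_def x(2) V\<Gamma> by auto
  qed
  have FB: "F g q \<in> vertex_space B pieces q" if "g \<in> Poly_Mapping.keys ?k" "q \<in> vertices pieces" for g q
  proof -
    obtain x where x: "x \<in> vertices ?\<Gamma>" "q = to_nat x" using \<open>q \<in> vertices pieces\<close> Vp V\<Gamma> by auto
    have "vertex_class pieces q = vertex_class ?\<Gamma> x" unfolding x(2) by (rule pieces_class[OF x(1)])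
    moreover have "case_sum f g x \<in> B (vertex_class ?\<Gamma> x)"
    proof (cases x)
      case (Inl v)
      then have "v \<in> vertices \<Omega>" using x(1) unfolding V\<Gamma> by auto
      then show ?thesis using f C.vertex_class_cut Inl unfolding vertex_space_def by simp
    next
      case (Inr b)
      then show ?thesis using K_rep(3)[OF \<rho>(1) that(1)] \<rho> by (cases b) auto
    qed
    ultimately show ?thesis unfolding vertex_space_def F_def x(2) by simp
  qed
  have "iso_push B ?\<Gamma> pieces to_nat (V_prod B ?\<Gamma> (V_pure B \<Omega> f) (K \<rho>)) =
    V_class B pieces (formal_push G (\<Sum>g\<in>Poly_Mapping.keys ?k. Poly_Mapping.single (case_sum ?f g) (Poly_Mapping.lookup ?k g)))"
    unfolding vp G_def
    by (rule iso_push_class[OF complex_iso_pieces C.cut_vertex_ok])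
      (use film_vertex_ok[OF film_pieces] pieces_vertices in auto)
  also have "formal_push G (\<Sum>g\<in>Poly_Mapping.keys ?k. Poly_Mapping.single (case_sum ?f g) (Poly_Mapping.lookup ?k g)) =
    (\<Sum>g\<in>Poly_Mapping.keys ?k. Poly_Mapping.single (restrict (F g) (vertices pieces)) (Poly_Mapping.lookup ?k g))"
    by (subst sum_comp_morphism[symmetric, where h = "formal_push G"]) (simp_all add: formal_push_simps comp_def GF)
  finally have ip: "iso_push B ?\<Gamma> pieces to_nat (V_prod B ?\<Gamma> (V_pure B \<Omega> f) (K \<rho>)) =
    V_class B pieces (\<Sum>g\<in>Poly_Mapping.keys ?k. Poly_Mapping.single (restrict (F g) (vertices pieces)) (Poly_Mapping.lookup ?k g))" .
  have "\<Phi> \<Omega> (V_pure B \<Omega> f) = \<Phi> pieces (iso_push B ?\<Gamma> pieces to_nat (V_prod B ?\<Gamma> (V_pure B \<Omega> f) (K \<rho>)))"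
    by (rule cut[OF film\<Omega> \<gamma> film_pieces complex_iso_pieces V_pure_in[OF f] \<rho>(2)[symmetric], symmetric])
  also have "\<dots> = (\<Sum>g\<in>Poly_Mapping.keys ?k. Poly_Mapping.lookup ?k g * \<Phi> pieces (V_pure B pieces (F g)))"
    unfolding ip V_pure_def[of B pieces] V_class_def[of B pieces]
    by (rule linear_form_sum[OF linear_form[OF film_pieces]]) (use FB in auto)
  also have "\<dots> = (\<Sum>g\<in>Poly_Mapping.keys ?k. Poly_Mapping.lookup ?k g *
    (\<Phi> (N True) (V_pure B (N True) (F g)) * \<Phi> (N False) (V_pure B (N False) (F g))))"
  proof (intro sum.cong refl arg_cong2[where f = "(*)"])
    fix g assume g: "g \<in> Poly_Mapping.keys ?k"
    have n: "numbered (piece True) S (map old as @ [new True])" "numbered (piece False) S (new False # map old bs)"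
      using piece_surfaces unfolding surfaces_numbered by blast+
    show "\<Phi> pieces (V_pure B pieces (F g)) = \<Phi> (N True) (V_pure B (N True) (F g)) * \<Phi> (N False) (V_pure B (N False) (F g))"
      unfolding N_def piece_def
      by (rule value_components[OF film_pieces components_pieces halves_neq n[unfolded piece_def] FB[OF g]])
  qed
  finally show ?thesis .
qed

text \<open>The numberings from \<open>piece_surfaces\<close> put the factors of \<open>K\<close>
  last in one piece and first in the other, which turns the two values into correlators.\<close>

lemma corr_cut:
  assumes O: "(\<Omega>, as @ bs) \<in> surfaces S (\<sigma>s @ \<tau>s)" and ne: "as \<noteq> []" "bs \<noteq> []" and l: "length as = length \<sigma>s"
    and xs: "length xs = length \<sigma>s" "\<And>i. i < length \<sigma>s \<Longrightarrow> xs ! i \<in> B (\<sigma>s ! i)"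
    and ys: "length ys = length \<tau>s" "\<And>i. i < length \<tau>s \<Longrightarrow> ys ! i \<in> B (\<tau>s ! i)"
  defines "\<rho> \<equiv> numbered_cut.new_class \<Omega> as bs"
  shows "corr (\<sigma>s @ \<tau>s) (xs @ ys) = (\<Sum>g\<in>Poly_Mapping.keys (K_rep \<rho>). Poly_Mapping.lookup (K_rep \<rho>) g *
    (corr (\<sigma>s @ [\<rho>]) (xs @ [g True]) * corr (dual \<rho> # \<tau>s) (g False # ys)))"
proof -
  have n: "numbered \<Omega> S (as @ bs)" "map (vertex_class \<Omega>) (as @ bs) = \<sigma>s @ \<tau>s" using O unfolding surfaces_numbered by auto
  then have cls: "map (vertex_class \<Omega>) as = \<sigma>s" "map (vertex_class \<Omega>) bs = \<tau>s"
    using l append_eq_append_conv[of "map (vertex_class \<Omega>) as" \<sigma>s "map (vertex_class \<Omega>) bs" \<tau>s] by auto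
  have lb: "length bs = length \<tau>s" using cls(2) by (metis length_map)
  have nc: "numbered_cut \<Omega> S as bs" unfolding numbered_cut_def numbered_cut_axioms_def using n(1) ne by blast
  interpret numbered_cut \<Omega> S as bs by (rule nc)
  define f where "f = assign (as @ bs) (xs @ ys)"
  have fi: "f ((as @ bs) ! i) = (xs @ ys) ! i" if "i < length (as @ bs)" for i
    unfolding f_def using assign_nth[OF dist, of "xs @ ys" i] that l lb xs(1) ys(1) by simp
  have fa: "f (as ! i) = xs ! i" if "i < length as" for i using fi[of i] that l xs(1) by (simp add: nth_append)
  have fb: "f (bs ! i) = ys ! i" if "i < length bs" for i using fi[of "length as + i"] that l xs(1) by (simp add: nth_append)
  have xys: "(xs @ ys) ! i \<in> B ((\<sigma>s @ \<tau>s) ! i)" if "i < length (\<sigma>s @ \<tau>s)" for i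
    using that xs ys by (cases "i < length \<sigma>s") (auto simp: nth_append)
  have f: "f q \<in> vertex_space B \<Omega> q" if "q \<in> vertices \<Omega>" for q
  proof -
    obtain i where i: "i < length (as @ bs)" "q = (as @ bs) ! i"
      using vertex_index[OF \<open>q \<in> vertices \<Omega>\<close>] by blast
    have "vertex_class \<Omega> q = (\<sigma>s @ \<tau>s) ! i" unfolding i(2) n(2)[symmetric] using i(1) by (simp only: nth_map)
    moreover have "f q \<in> B ((\<sigma>s @ \<tau>s) ! i)" unfolding i(2) fi[OF i(1)] by (rule xys) (use i(1) l lb in simp)
    ultimately show ?thesis unfolding vertex_space_def by simp
  qed
  have \<rho>: "\<rho> = new_class" "\<rho> \<in> Sigma_classes S" unfolding \<rho>_def using new_class_Sigma by auto
  have "corr (\<sigma>s @ \<tau>s) (xs @ ys) = \<Phi> \<Omega> (V_pure B \<Omega> f)"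
    by (rule corr_eq[OF O _ xys fi]) (use xs ys in auto)
  also have "\<dots> = (\<Sum>g\<in>Poly_Mapping.keys (K_rep \<rho>). Poly_Mapping.lookup (K_rep \<rho>) g *
    (\<Phi> (piece True) (V_pure B (piece True) (\<lambda>q. case_sum f g (from_nat q :: nat + bool))) *
     \<Phi> (piece False) (V_pure B (piece False) (\<lambda>q. case_sum f g (from_nat q :: nat + bool)))))"
    unfolding \<rho>_def by (rule value_cut[OF nc f])
  also have "\<dots> = (\<Sum>g\<in>Poly_Mapping.keys (K_rep \<rho>). Poly_Mapping.lookup (K_rep \<rho>) g *
    (corr (\<sigma>s @ [\<rho>]) (xs @ [g True]) * corr (dual \<rho> # \<tau>s) (g False # ys)))"
  proof (intro sum.cong refl arg_cong2[where f = "(*)"])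
    fix g assume g: "g \<in> Poly_Mapping.keys (K_rep \<rho>)"
    note gB = K_rep(3)[OF \<rho>(2) g]
    have s: "(piece True, map old as @ [new True]) \<in> surfaces S (\<sigma>s @ [\<rho>])"
      "(piece False, new False # map old bs) \<in> surfaces S (dual \<rho> # \<tau>s)"
      using piece_surfaces unfolding cls \<rho>(1) .
    show "\<Phi> (piece True) (V_pure B (piece True) (\<lambda>q. case_sum f g (from_nat q :: nat + bool))) = corr (\<sigma>s @ [\<rho>]) (xs @ [g True])"
    proof (rule corr_eq[OF s(1), symmetric])
      show "(xs @ [g True]) ! i \<in> B ((\<sigma>s @ [\<rho>]) ! i)" if "i < length (\<sigma>s @ [\<rho>])" for i
        using that xs gB by (auto simp: nth_append less_Suc_eq)
      show "case_sum f g (from_nat ((map old as @ [new True]) ! i) :: nat + bool) = (xs @ [g True]) ! i"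
        if "i < length (map old as @ [new True])" for i
        using that fa l xs(1) by (auto simp: nth_append less_Suc_eq)
    qed (use xs in simp)
    show "\<Phi> (piece False) (V_pure B (piece False) (\<lambda>q. case_sum f g (from_nat q :: nat + bool))) = corr (dual \<rho> # \<tau>s) (g False # ys)"
    proof (rule corr_eq[OF s(2), symmetric])
      show "(g False # ys) ! i \<in> B ((dual \<rho> # \<tau>s) ! i)" if "i < length (dual \<rho> # \<tau>s)" for i
        using that ys gB by (cases i) auto
      show "case_sum f g (from_nat ((new False # map old bs) ! i) :: nat + bool) = (g False # ys) ! i"
        if "i < length (new False # map old bs)" for i
        using that fb lb ys(1) by (cases i) auto
    qed (use ys in simp)
  qed
  finally show ?thesis .
qed

end

section \<open>Dual bases and the Frobenius structure\<close>

lemma sum_kronecker: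
  fixes f :: "nat \<Rightarrow> 'a::semiring_1"
  assumes "j < n"
  shows "(\<Sum>k<n. f k * (if j = k then 1 else 0)) = f j" "(\<Sum>k<n. f k * (if k = j then 1 else 0)) = f j"
  using assms by (simp_all add: if_distrib[of "(*) _"] cong: if_cong)

context char_0_space
begin

definition linear_on :: "'b set \<Rightarrow> ('b \<Rightarrow> 'k) \<Rightarrow> bool" where
  "linear_on W L \<longleftrightarrow> (\<forall>x\<in>W. \<forall>y\<in>W. L (x + y) = L x + L y) \<and> (\<forall>a. \<forall>x\<in>W. L (a *s x) = a * L x)"

lemma linear_on_sum:
  fixes n :: nat
  assumes W: "subspace W" and L: "linear_on W L" and b: "\<And>i. i < n \<Longrightarrow> b i \<in> W"
  shows "L (\<Sum>i<n. c i *s b i) = (\<Sum>i<n. c i * L (b i))"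
  using b
proof (induction n)
  case 0
  have "L (0 *s 0) = 0 * L 0" using L subspace_0[OF W] unfolding linear_on_def by blast
  then show ?case by simp
next
  case (Suc n)
  have "(\<Sum>i<n. c i *s b i) \<in> W" using Suc(2) by (intro subspace_sum[OF W] subspace_scale[OF W]) auto
  moreover have "c n *s b n \<in> W" "b n \<in> W" using Suc(2)[of n] subspace_scale[OF W] by auto
  ultimately show ?case using Suc L unfolding linear_on_def by simp
qed

lemma linear_on_zero: "linear_on W L \<Longrightarrow> 0 \<in> W \<Longrightarrow> L 0 = 0"
  unfolding linear_on_def by (metis mult_zero_left scale_zero_right)

lemma is_basis_expand:
  assumes "is_basis W n b" "x \<in> W"
  obtains c where "x = (\<Sum>i<n. c i *s b i)"
proof -
  have b: "inj_on b {..<n}" "x \<in> span (b ` {..<n})" using assms unfolding is_basis_def by auto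
  obtain u where "x = (\<Sum>v\<in>b ` {..<n}. u v *s v)" using b(2) span_finite[of "b ` {..<n}"] by auto
  then have "x = (\<Sum>i<n. u (b i) *s b i)" using sum.reindex[OF b(1)] by simp
  then show thesis by (rule that)
qed

lemma is_basis_in: "is_basis W n b \<Longrightarrow> i < n \<Longrightarrow> b i \<in> W"
  unfolding is_basis_def using span_base[of "b i" "b ` {..<n}"] by auto

text \<open>By \<open>rep\<close>, the tensor with terms \<open>p g\<close>, \<open>q g\<close> and
  coefficients \<open>\<kappa> g\<close> reproduces \<open>\<beta>\<close>. Expand \<open>T1\<close>
  and \<open>T2\<close> in the coordinates of \<open>p g\<close> and \<open>q g\<close>, which
  \<open>F\<close> computes from values of \<open>\<beta>\<close>. Then \<open>rep\<close> applies
  to the sum over \<open>g\<close>, and one copy of \<open>F\<close> cancels against the pairing of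
  the bases.\<close>

lemma dual_basis_contraction:
  fixes p :: "'g \<Rightarrow> 'b" and n :: nat
  assumes U: "subspace U" and V: "subspace V" and b: "is_basis U n b" and b': "is_basis V n b'"
    and lin: "\<And>y. y \<in> V \<Longrightarrow> linear_on U (\<beta> y)" "\<And>x. x \<in> U \<Longrightarrow> linear_on V (\<lambda>y. \<beta> y x)"
    and nd: "\<And>x. x \<in> U \<Longrightarrow> (\<And>y. y \<in> V \<Longrightarrow> \<beta> y x = 0) \<Longrightarrow> x = 0"
    and F: "\<And>j l. j < n \<Longrightarrow> l < n \<Longrightarrow> (\<Sum>i<n. F i j * \<beta> (b' l) (b i)) = (if j = l then 1 else 0)"
    and pq: "\<And>g. g \<in> G \<Longrightarrow> p g \<in> U" "\<And>g. g \<in> G \<Longrightarrow> q g \<in> V"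
    and rep: "\<And>x y. x \<in> U \<Longrightarrow> y \<in> V \<Longrightarrow> \<beta> y x = (\<Sum>g\<in>G. \<kappa> g * (\<beta> y (p g) * \<beta> (q g) x))"
    and T: "linear_on U T1" "linear_on V T2"
  shows "(\<Sum>g\<in>G. \<kappa> g * (T1 (p g) * T2 (q g))) = (\<Sum>i<n. \<Sum>j<n. T1 (b i) * F i j * T2 (b' j))"
proof -
  note bU = is_basis_in[OF b] and bV = is_basis_in[OF b']
  \<comment> \<open>\<open>F\<close> inverts the matrix of the pairing, so it recovers the
    coordinates of \<open>y\<close> from its pairings with the \<open>b i\<close>.\<close>
  have y_eq: "y = (\<Sum>j<n. (\<Sum>i<n. F i j * \<beta> y (b i)) *s b' j)" if y: "y \<in> V" for y
  proof -
    obtain d where d: "y = (\<Sum>k<n. d k *s b' k)" using is_basis_expand[OF b' y] .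
    have "(\<Sum>i<n. F i j * \<beta> y (b i)) = d j" if j: "j < n" for j
    proof -
      have "(\<Sum>i<n. F i j * \<beta> y (b i)) = (\<Sum>i<n. F i j * (\<Sum>k<n. d k * \<beta> (b' k) (b i)))"
        unfolding d by (intro sum.cong refl arg_cong2[where f = "(*)"] linear_on_sum[OF V lin(2)] bU bV) auto
      also have "\<dots> = (\<Sum>k<n. d k * (\<Sum>i<n. F i j * \<beta> (b' k) (b i)))"
        unfolding sum_distrib_left by (subst sum.swap) (simp add: mult.left_commute)
      also have "\<dots> = (\<Sum>k<n. d k * (if j = k then 1 else 0))" using F[OF j] by simp
      also have "\<dots> = d j" by (rule sum_kronecker(1)[OF j])
      finally show ?thesis .
    qed
    then show ?thesis using d by simp
  qed
  \<comment> \<open>Computing coordinates here would take the inverse on the other side of the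
    matrix. Instead, both sides are seen to pair equally with every \<open>b' l\<close>, and
    non-degeneracy makes them equal.\<close>
  have x_eq: "x = (\<Sum>i<n. (\<Sum>j<n. F i j * \<beta> (b' j) x) *s b i)" (is "x = ?s") if x: "x \<in> U" for x
  proof -
    have s: "?s \<in> U" by (intro subspace_sum[OF U] subspace_scale[OF U] bU) auto
    have z: "\<beta> (b' l) (x - ?s) = 0" if l: "l < n" for l
    proof -
      have "\<beta> (b' l) ?s = (\<Sum>i<n. (\<Sum>j<n. F i j * \<beta> (b' j) x) * \<beta> (b' l) (b i))"
        by (rule linear_on_sum[OF U lin(1)[OF bV[OF l]] bU])
      also have "\<dots> = (\<Sum>j<n. \<beta> (b' j) x * (\<Sum>i<n. F i j * \<beta> (b' l) (b i)))"
        unfolding sum_distrib_left sum_distrib_right by (subst sum.swap) (simp add: mult.assoc mult.left_commute)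
      also have "\<dots> = (\<Sum>j<n. \<beta> (b' j) x * (if j = l then 1 else 0))" using F l by simp
      also have "\<dots> = \<beta> (b' l) x" by (rule sum_kronecker(2)[OF l])
      finally have "\<beta> (b' l) ?s = \<beta> (b' l) x" .
      moreover have "\<beta> (b' l) (x - ?s + ?s) = \<beta> (b' l) (x - ?s) + \<beta> (b' l) ?s"
        using lin(1)[OF bV[OF l]] subspace_diff[OF U x s] s unfolding linear_on_def by blast
      ultimately show ?thesis by simp
    qed
    have xs: "x - ?s \<in> U" by (rule subspace_diff[OF U x s])
    have "x - ?s = 0"
    proof (rule nd[OF xs])
      fix y assume "y \<in> V"
      then obtain d where d: "y = (\<Sum>k<n. d k *s b' k)" by (rule is_basis_expand[OF b'])
      have "\<beta> y (x - ?s) = (\<Sum>k<n. d k * \<beta> (b' k) (x - ?s))" unfolding d by (rule linear_on_sum[OF V lin(2)[OF xs] bV])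
      then show "\<beta> y (x - ?s) = 0" using z by simp
    qed
    then show ?thesis by simp
  qed
  have T1: "T1 x = (\<Sum>i<n. \<Sum>j<n. T1 (b i) * F i j * \<beta> (b' j) x)" if "x \<in> U" for x
    by (subst x_eq[OF that], subst linear_on_sum[OF U T(1) bU]) (simp_all add: sum_distrib_right sum_distrib_left mult_ac)
  have T2: "T2 y = (\<Sum>j<n. \<Sum>i<n. T2 (b' j) * F i j * \<beta> y (b i))" if "y \<in> V" for y
    by (subst y_eq[OF that], subst linear_on_sum[OF V T(2) bV]) (simp_all add: sum_distrib_right sum_distrib_left mult_ac)
  have "(\<Sum>g\<in>G. \<kappa> g * (T1 (p g) * T2 (q g))) =
    (\<Sum>g\<in>G. \<Sum>i<n. \<Sum>j<n. T1 (b i) * F i j * (\<kappa> g * (\<beta> (b' j) (p g) * T2 (q g))))"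
    by (intro sum.cong refl) (simp add: T1 pq sum_distrib_right sum_distrib_left mult_ac)
  also have "\<dots> = (\<Sum>i<n. \<Sum>j<n. \<Sum>g\<in>G. T1 (b i) * F i j * (\<kappa> g * (\<beta> (b' j) (p g) * T2 (q g))))"
    by (subst sum.swap) (intro sum.cong refl sum.swap)
  also have "\<dots> = (\<Sum>i<n. \<Sum>j<n. T1 (b i) * F i j * T2 (b' j))"
  proof (intro sum.cong refl)
    fix i j assume "j \<in> {..<n}"
    then have j: "j < n" by simp
    have "(\<Sum>g\<in>G. \<kappa> g * (\<beta> (b' j) (p g) * T2 (q g))) =
      (\<Sum>g\<in>G. \<Sum>k<n. \<Sum>l<n. T2 (b' k) * F l k * (\<kappa> g * (\<beta> (b' j) (p g) * \<beta> (q g) (b l))))"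
      by (intro sum.cong refl) (simp add: T2 pq sum_distrib_right sum_distrib_left mult_ac)
    also have "\<dots> = (\<Sum>k<n. \<Sum>l<n. \<Sum>g\<in>G. T2 (b' k) * F l k * (\<kappa> g * (\<beta> (b' j) (p g) * \<beta> (q g) (b l))))"
      by (subst sum.swap) (intro sum.cong refl sum.swap)
    also have "\<dots> = (\<Sum>k<n. T2 (b' k) * (\<Sum>l<n. F l k * \<beta> (b' j) (b l)))"
      by (intro sum.cong refl) (use rep[OF bU bV[OF j]] in \<open>simp add: sum_distrib_left mult.assoc\<close>)
    also have "\<dots> = (\<Sum>k<n. T2 (b' k) * (if k = j then 1 else 0))" using F j by simp
    also have "\<dots> = T2 (b' j)" by (rule sum_kronecker(2)[OF j])
    finally show "(\<Sum>g\<in>G. T1 (b i) * F i j * (\<kappa> g * (\<beta> (b' j) (p g) * T2 (q g)))) = T1 (b i) * F i j * T2 (b' j)"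
      unfolding sum_distrib_left[symmetric] by simp
  qed
  finally show ?thesis .
qed

end

section \<open>Linear forms on the direct sum\<close>

context graph_graded_space
begin

lemma emb_B_star: "\<sigma> \<in> Sigma_classes S \<Longrightarrow> x \<in> B \<sigma> \<Longrightarrow> emb \<sigma> x \<in> B_star S B"
proof -
  assume a: "\<sigma> \<in> Sigma_classes S" "x \<in> B \<sigma>"
  have "{\<tau>. emb \<sigma> x \<tau> \<noteq> 0} \<subseteq> {\<sigma>}" unfolding emb_def by auto
  then have "finite {\<tau>. emb \<sigma> x \<tau> \<noteq> 0}" by (rule finite_subset) simp
  then show ?thesis using a subspace_0[OF subspace_B] unfolding B_star_def emb_def by auto
qed

lemma sum_emb: "h \<sigma> 0 = 0 \<Longrightarrow> (\<Sum>\<tau> | emb \<sigma> x \<tau> \<noteq> 0. h \<tau> (emb \<sigma> x \<tau>)) = h \<sigma> x"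
proof -
  assume "h \<sigma> 0 = 0"
  then have "(\<Sum>\<tau> | emb \<sigma> x \<tau> \<noteq> 0. h \<tau> (emb \<sigma> x \<tau>)) = (\<Sum>\<tau>\<in>{\<sigma>}. h \<tau> (emb \<sigma> x \<tau>))"
    by (intro sum.mono_neutral_left) (auto simp: emb_def)
  then show ?thesis by (simp add: emb_def)
qed

lemma B_starD: "x \<in> B_star S B \<Longrightarrow> x \<sigma> \<noteq> 0 \<Longrightarrow> \<sigma> \<in> Sigma_classes S \<and> x \<sigma> \<in> B \<sigma>"
  unfolding B_star_def by auto

text \<open>The sums run over the supports of \<open>x\<close>, of \<open>y\<close> and of their
  sum, which differ. Over a common finite set of classes the additional summands vanish, because
  each \<open>g \<sigma>\<close> is linear.\<close>

lemma star_linear_sum: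
  assumes g: "\<And>\<sigma>. \<sigma> \<in> Sigma_classes S \<Longrightarrow> linear_on (B \<sigma>) (g \<sigma>)"
  shows "star_linear (\<lambda>u. \<Sum>\<sigma> | u \<sigma> \<noteq> 0. g \<sigma> (u \<sigma>))"
proof -
  have z: "g \<sigma> 0 = 0" if "\<sigma> \<in> Sigma_classes S" for \<sigma> by (rule linear_on_zero[OF g[OF that] subspace_0[OF subspace_B[OF that]]])
  have sup: "(\<Sum>\<sigma> | u \<sigma> \<noteq> 0. g \<sigma> (u \<sigma>)) = (\<Sum>\<sigma>\<in>A. g \<sigma> (u \<sigma>))"
    if "finite A" "A \<subseteq> Sigma_classes S" "{\<sigma>. u \<sigma> \<noteq> 0} \<subseteq> A" for A u
    using that z by (intro sum.mono_neutral_left) auto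
  show ?thesis unfolding star_linear_def
  proof (intro conjI ballI allI)
    fix x y assume x: "x \<in> B_star S B" and y: "y \<in> B_star S B"
    let ?A = "{\<sigma>. x \<sigma> \<noteq> 0} \<union> {\<sigma>. y \<sigma> \<noteq> 0}"
    have A: "finite ?A" "?A \<subseteq> Sigma_classes S" using x y unfolding B_star_def by auto
    have "g \<sigma> (x \<sigma> + y \<sigma>) = g \<sigma> (x \<sigma>) + g \<sigma> (y \<sigma>)" if "\<sigma> \<in> ?A" for \<sigma>
      using g[of \<sigma>] x y A(2) that unfolding B_star_def linear_on_def by blast
    then have sumeq: "(\<Sum>\<sigma>\<in>?A. g \<sigma> (x \<sigma> + y \<sigma>)) = (\<Sum>\<sigma>\<in>?A. g \<sigma> (x \<sigma>)) + (\<Sum>\<sigma>\<in>?A. g \<sigma> (y \<sigma>))"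
      unfolding sum.distrib[symmetric] by (intro sum.cong refl)
    have le: "{\<sigma>. x \<sigma> + y \<sigma> \<noteq> 0} \<subseteq> ?A" by auto
    show "(\<Sum>\<sigma> | x \<sigma> + y \<sigma> \<noteq> 0. g \<sigma> (x \<sigma> + y \<sigma>)) = (\<Sum>\<sigma> | x \<sigma> \<noteq> 0. g \<sigma> (x \<sigma>)) + (\<Sum>\<sigma> | y \<sigma> \<noteq> 0. g \<sigma> (y \<sigma>))"
      using sup[OF A, of x] sup[OF A, of y] sup[OF A, of "\<lambda>\<sigma>. x \<sigma> + y \<sigma>"] sumeq le by simp
  next
    fix a x assume x: "x \<in> B_star S B"
    let ?A = "{\<sigma>. x \<sigma> \<noteq> 0}"
    have A: "finite ?A" "?A \<subseteq> Sigma_classes S" using x unfolding B_star_def by auto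
    have "g \<sigma> (a *s x \<sigma>) = a * g \<sigma> (x \<sigma>)" if "\<sigma> \<in> ?A" for \<sigma>
      using g[of \<sigma>] x A(2) that unfolding B_star_def linear_on_def by blast
    then show "(\<Sum>\<sigma> | a *s x \<sigma> \<noteq> 0. g \<sigma> (a *s x \<sigma>)) = a * (\<Sum>\<sigma> | x \<sigma> \<noteq> 0. g \<sigma> (x \<sigma>))"
      using sup[OF A, of "\<lambda>\<sigma>. a *s x \<sigma>"] by (auto simp: sum_distrib_left)
  qed
qed

lemma linear_on_sum_fun:
  "(\<And>i. i \<in> I \<Longrightarrow> linear_on W (L i)) \<Longrightarrow> linear_on W (\<lambda>x. \<Sum>i\<in>I. L i x)"
  unfolding linear_on_def by (simp add: sum.distrib sum_distrib_left)

end

section \<open>The bilinear and the three-linear form\<close>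

context film_TFT
begin

lemma corr_linear:
  assumes "list_all2 (\<lambda>\<sigma> x. x \<in> B \<sigma>) \<rho>s us" "list_all2 (\<lambda>\<sigma> x. x \<in> B \<sigma>) \<tau>s vs"
  shows "linear_on (B \<sigma>) (\<lambda>x. corr (\<rho>s @ \<sigma> # \<tau>s) (us @ x # vs))"
proof -
  have l: "length us = length \<rho>s" "length vs = length \<tau>s" using assms by (auto dest: list_all2_lengthD)
  have u: "(us @ x # vs)[length \<rho>s := z] = us @ z # vs" for x z unfolding l(1)[symmetric] by (rule list_update_length)
  have s: "(\<rho>s @ \<sigma> # \<tau>s) ! length \<rho>s = \<sigma>" by (rule nth_append_length)
  have m: "(us @ x # vs) ! i \<in> B ((\<rho>s @ \<sigma> # \<tau>s) ! i)" if "x \<in> B \<sigma>" "i < length (\<rho>s @ \<sigma> # \<tau>s)" for x i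
  proof -
    have "list_all2 (\<lambda>\<sigma> x. x \<in> B \<sigma>) (\<rho>s @ \<sigma> # \<tau>s) (us @ x # vs)"
      using assms that(1) by (intro list_all2_appendI) auto
    then show ?thesis using that(2) by (rule list_all2_nthD)
  qed
  note ml = corr_multilinear[where \<sigma>s = "\<rho>s @ \<sigma> # \<tau>s" and i = "length \<rho>s" and xs = "us @ x # vs" for x, unfolded u s]
  show ?thesis unfolding linear_on_def
    using ml(1)[OF _ m] ml(2)[OF _ m] l by simp
qed

lemmas corr_linear2 = corr_linear[of "[]" "[]" "[\<tau>]" "[y]", simplified] corr_linear[of "[\<sigma>]" "[x]" "[]" "[]", simplified] for \<sigma> \<tau> x y
lemmas corr_linear3 = corr_linear[of "[]" "[]" "[\<tau>, \<rho>]" "[y, z]", simplified, OF conjI]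
  corr_linear[of "[\<sigma>]" "[x]" "[\<rho>]" "[z]", simplified] corr_linear[of "[\<sigma>, \<tau>]" "[x, y]" "[]" "[]", simplified, OF conjI] for \<sigma> \<tau> \<rho> x y z

abbreviation bil :: "('c gclass \<Rightarrow> 'b) \<Rightarrow> ('c gclass \<Rightarrow> 'b) \<Rightarrow> 'k" where "bil \<equiv> TFT_bilinear S B \<Phi>"
abbreviation tri :: "('c gclass \<Rightarrow> 'b) \<Rightarrow> ('c gclass \<Rightarrow> 'b) \<Rightarrow> ('c gclass \<Rightarrow> 'b) \<Rightarrow> 'k" where "tri \<equiv> TFT_trilinear S B \<Phi>"

lemma bil_linear:
  assumes x: "x \<in> B_star S B"
  shows "star_linear (\<lambda>u. bil u x)" "star_linear (\<lambda>u. bil x u)"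
proof -
  show "star_linear (\<lambda>u. bil u x)" unfolding TFT_bilinear_def
    by (rule star_linear_sum, rule linear_on_sum_fun, rule corr_linear2) (use B_starD[OF x] in auto)
  \<comment> \<open>\<open>star_linear_sum\<close> wants the sum over the support of the varying
    argument outside.\<close>
  have "bil x = (\<lambda>u. \<Sum>\<sigma>2 | u \<sigma>2 \<noteq> 0. \<Sum>\<sigma>1 | x \<sigma>1 \<noteq> 0. corr [\<sigma>1, \<sigma>2] [x \<sigma>1, u \<sigma>2])"
    unfolding TFT_bilinear_def by (rule ext) (rule sum.swap)
  then show "star_linear (\<lambda>u. bil x u)"
    by (simp only:) (rule star_linear_sum, rule linear_on_sum_fun, rule corr_linear2, use B_starD[OF x] in auto)
qed

lemma tri_linear:
  assumes x: "x \<in> B_star S B" and y: "y \<in> B_star S B"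
  shows "star_linear (\<lambda>u. tri u x y)" "star_linear (\<lambda>u. tri x u y)" "star_linear (\<lambda>u. tri x y u)"
proof -
  show "star_linear (\<lambda>u. tri u x y)" unfolding TFT_trilinear_def
    by (rule star_linear_sum, rule linear_on_sum_fun, rule linear_on_sum_fun, rule corr_linear3)
      (use B_starD[OF x] B_starD[OF y] in auto)
  have "(\<lambda>u. tri x u y) = (\<lambda>u. \<Sum>\<sigma>2 | u \<sigma>2 \<noteq> 0. \<Sum>\<sigma>1 | x \<sigma>1 \<noteq> 0. \<Sum>\<sigma>3 | y \<sigma>3 \<noteq> 0. corr [\<sigma>1, \<sigma>2, \<sigma>3] [x \<sigma>1, u \<sigma>2, y \<sigma>3])"
    unfolding TFT_trilinear_def by (rule ext) (rule sum.swap)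
  then show "star_linear (\<lambda>u. tri x u y)"
    by (simp only:) (rule star_linear_sum, rule linear_on_sum_fun, rule linear_on_sum_fun, rule corr_linear3,
      use B_starD[OF x] B_starD[OF y] in auto)
  have "(\<lambda>u. tri x y u) = (\<lambda>u. \<Sum>\<sigma>3 | u \<sigma>3 \<noteq> 0. \<Sum>\<sigma>1 | x \<sigma>1 \<noteq> 0. \<Sum>\<sigma>2 | y \<sigma>2 \<noteq> 0. corr [\<sigma>1, \<sigma>2, \<sigma>3] [x \<sigma>1, y \<sigma>2, u \<sigma>3])"
    unfolding TFT_trilinear_def
    by (rule ext, subst sum.swap, subst (2) sum.swap) (intro sum.cong refl sum.swap)
  then show "star_linear (\<lambda>u. tri x y u)"
    by (simp only:) (rule star_linear_sum, rule linear_on_sum_fun, rule linear_on_sum_fun, rule corr_linear3,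
      use B_starD[OF x] B_starD[OF y] in auto)
qed

lemma corr_zero2: "y \<in> B \<tau> \<Longrightarrow> 0 \<in> B \<sigma> \<Longrightarrow> corr [\<sigma>, \<tau>] [0, y] = 0" "x \<in> B \<sigma> \<Longrightarrow> 0 \<in> B \<tau> \<Longrightarrow> corr [\<sigma>, \<tau>] [x, 0] = 0"
  using linear_on_zero[OF corr_linear2(1)] linear_on_zero[OF corr_linear2(2)] by auto

lemma zero_B: "\<sigma> \<in> Sigma_classes S \<Longrightarrow> 0 \<in> B \<sigma>"
  by (rule subspace_0[OF subspace_B])

lemma bil_emb_left:
  assumes "\<sigma> \<in> Sigma_classes S" "x \<in> B_star S B"
  shows "bil (emb \<sigma> y) x = (\<Sum>\<tau> | x \<tau> \<noteq> 0. corr [\<sigma>, \<tau>] [y, x \<tau>])"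
proof -
  have "corr [\<sigma>, \<tau>] [0, x \<tau>] = 0" if "x \<tau> \<noteq> 0" for \<tau>
    using corr_zero2(1) zero_B[OF assms(1)] B_starD[OF assms(2) that] by blast
  then show ?thesis unfolding TFT_bilinear_def
    by (intro sum_emb[where h = "\<lambda>\<sigma> y. \<Sum>\<tau> | x \<tau> \<noteq> 0. corr [\<sigma>, \<tau>] [y, x \<tau>]"] sum.neutral) auto
qed

lemma bil_emb_right:
  assumes "\<tau> \<in> Sigma_classes S" "x \<in> B_star S B"
  shows "bil x (emb \<tau> y) = (\<Sum>\<sigma> | x \<sigma> \<noteq> 0. corr [\<sigma>, \<tau>] [x \<sigma>, y])"
proof -
  have "corr [\<sigma>, \<tau>] [x \<sigma>, 0] = 0" if "x \<sigma> \<noteq> 0" for \<sigma>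
    using corr_zero2(2) zero_B[OF assms(1)] B_starD[OF assms(2) that] by blast
  then show ?thesis unfolding TFT_bilinear_def
    by (intro sum.cong refl sum_emb[where h = "\<lambda>\<tau>. corr [_, \<tau>] \<circ> (\<lambda>y. [_, y])", unfolded comp_def]) auto
qed

lemma bil_emb:
  assumes "\<sigma> \<in> Sigma_classes S" "\<tau> \<in> Sigma_classes S" "x \<in> B \<sigma>" "y \<in> B \<tau>"
  shows "bil (emb \<sigma> x) (emb \<tau> y) = corr [\<sigma>, \<tau>] [x, y]"
  unfolding bil_emb_right[OF assms(2) emb_B_star[OF assms(1,3)]]
  by (rule sum_emb[where h = "\<lambda>\<sigma> x. corr [\<sigma>, \<tau>] [x, y]"]) (rule corr_zero2(1)[OF assms(4) zero_B[OF assms(1)]])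

lemma tri_emb:
  assumes "\<sigma> \<in> Sigma_classes S" "\<tau> \<in> Sigma_classes S" "\<rho> \<in> Sigma_classes S" "x \<in> B \<sigma>" "y \<in> B \<tau>" "z \<in> B \<rho>"
  shows "tri (emb \<sigma> x) (emb \<tau> y) (emb \<rho> z) = corr [\<sigma>, \<tau>, \<rho>] [x, y, z]"
proof -
  have "tri (emb \<sigma> x) (emb \<tau> y) (emb \<rho> z) =
    (\<Sum>\<sigma>1 | emb \<sigma> x \<sigma>1 \<noteq> 0. \<Sum>\<sigma>2 | emb \<tau> y \<sigma>2 \<noteq> 0. corr [\<sigma>1, \<sigma>2, \<rho>] [emb \<sigma> x \<sigma>1, emb \<tau> y \<sigma>2, z])"
    unfolding TFT_trilinear_def
  proof (intro sum.cong refl)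
    fix \<sigma>1 \<sigma>2 assume "\<sigma>1 \<in> {\<sigma>1. emb \<sigma> x \<sigma>1 \<noteq> 0}" "\<sigma>2 \<in> {\<sigma>2. emb \<tau> y \<sigma>2 \<noteq> 0}"
    then have "emb \<sigma> x \<sigma>1 \<in> B \<sigma>1" "emb \<tau> y \<sigma>2 \<in> B \<sigma>2" using B_starD[OF emb_B_star] assms by blast+
    then show "(\<Sum>\<sigma>3 | emb \<rho> z \<sigma>3 \<noteq> 0. corr [\<sigma>1, \<sigma>2, \<sigma>3] [emb \<sigma> x \<sigma>1, emb \<tau> y \<sigma>2, emb \<rho> z \<sigma>3]) =
      corr [\<sigma>1, \<sigma>2, \<rho>] [emb \<sigma> x \<sigma>1, emb \<tau> y \<sigma>2, z]"
      by (intro sum_emb[where h = "\<lambda>\<sigma>3 z. corr [\<sigma>1, \<sigma>2, \<sigma>3] [emb \<sigma> x \<sigma>1, emb \<tau> y \<sigma>2, z]"]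
        linear_on_zero[OF corr_linear3(3) zero_B[OF assms(3)]])
  qed
  also have "\<dots> = (\<Sum>\<sigma>1 | emb \<sigma> x \<sigma>1 \<noteq> 0. corr [\<sigma>1, \<tau>, \<rho>] [emb \<sigma> x \<sigma>1, y, z])"
  proof (intro sum.cong refl)
    fix \<sigma>1 assume "\<sigma>1 \<in> {\<sigma>1. emb \<sigma> x \<sigma>1 \<noteq> 0}"
    then have "emb \<sigma> x \<sigma>1 \<in> B \<sigma>1" using B_starD[OF emb_B_star] assms by blast
    then show "(\<Sum>\<sigma>2 | emb \<tau> y \<sigma>2 \<noteq> 0. corr [\<sigma>1, \<sigma>2, \<rho>] [emb \<sigma> x \<sigma>1, emb \<tau> y \<sigma>2, z]) =
      corr [\<sigma>1, \<tau>, \<rho>] [emb \<sigma> x \<sigma>1, y, z]"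
      by (intro sum_emb[where h = "\<lambda>\<sigma>2 y. corr [\<sigma>1, \<sigma>2, \<rho>] [emb \<sigma> x \<sigma>1, y, z]"]
        linear_on_zero[OF corr_linear3(2) zero_B[OF assms(2)]] assms(6))
  qed
  also have "\<dots> = corr [\<sigma>, \<tau>, \<rho>] [x, y, z]"
    by (intro sum_emb[where h = "\<lambda>\<sigma>1 x. corr [\<sigma>1, \<tau>, \<rho>] [x, y, z]"]
        linear_on_zero[OF corr_linear3(1) zero_B[OF assms(1)]] assms(5,6))
  finally show ?thesis .
qed

lemma corr_rotate_all: "list_all2 (\<lambda>\<sigma> x. x \<in> B \<sigma>) \<sigma>s xs \<Longrightarrow> corr (rotate1 \<sigma>s) (rotate1 xs) = corr \<sigma>s xs"
  unfolding list_all2_conv_all_nth by (rule corr_rotate) auto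

lemma corr_swap: "x \<in> B \<sigma> \<Longrightarrow> y \<in> B \<tau> \<Longrightarrow> corr [\<tau>, \<sigma>] [y, x] = corr [\<sigma>, \<tau>] [x, y]"
  using corr_rotate_all[of "[\<sigma>, \<tau>]" "[x, y]"] by simp

lemma corr_pair_zero: "\<tau> \<noteq> dual \<sigma> \<Longrightarrow> corr [\<sigma>, \<tau>] xs = 0"
  using surfaces_pair_dual corr_empty by fastforce

lemma pair_surface:
  assumes "\<sigma> \<in> Sigma_classes S" obtains \<Omega> where "(\<Omega>, [0, 1]) \<in> surfaces S [\<sigma>, dual \<sigma>]"
  using assms suspension_surface by (elim SigmaE) blast

lemma corr_nondegenerate:
  assumes \<sigma>: "\<sigma> \<in> Sigma_classes S" and x: "x \<in> B \<sigma>" "\<And>y. y \<in> B (dual \<sigma>) \<Longrightarrow> corr [\<sigma>, dual \<sigma>] [x, y] = 0"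
  shows "x = 0"
proof -
  obtain \<Omega> where O: "(\<Omega>, [0, 1]) \<in> surfaces S [\<sigma>, dual \<sigma>]" using pair_surface[OF \<sigma>] .
  then have s: "film_surface S \<Omega>" "vertices \<Omega> = {0, 1}" "\<sigma> = vertex_class \<Omega> 0" unfolding surfaces_def by auto
  have "corr [\<sigma>, dual \<sigma>] [x, y] = \<Phi> \<Omega> (V_pure B \<Omega> (undefined(0 := x, 1 := y)))" if "y \<in> B (dual \<sigma>)" for y
    by (rule corr_eq[OF O]) (use x(1) that in \<open>auto simp: less_Suc_eq_0_disj nth_Cons'\<close>)
  then have "\<forall>y\<in>B (dual \<sigma>). \<Phi> \<Omega> (V_pure B \<Omega> (undefined(0 := x, 1 := y))) = 0" using x(2) by simp
  then show ?thesis using nondegenerate[OF s(1,2) _ s(3)] x(1) unfolding nondegenerate_on_def by simp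
qed

text \<open>Cutting between the two vertices gives two surfaces with two vertices each, so the class
  of the cut is forced. Taking \<open>dual \<sigma>\<close> first makes the class at
  \<open>q\<^sub>+\<close> equal to \<open>\<sigma>\<close>, as \<open>K \<sigma>\<close>
  requires.\<close>

lemma pair_cut:
  assumes \<sigma>: "\<sigma> \<in> Sigma_classes S" and x: "x \<in> B \<sigma>" and y: "y \<in> B (dual \<sigma>)"
  shows "corr [dual \<sigma>, \<sigma>] [y, x] = (\<Sum>g\<in>Poly_Mapping.keys (K_rep \<sigma>). Poly_Mapping.lookup (K_rep \<sigma>) g *
    (corr [dual \<sigma>, \<sigma>] [y, g True] * corr [dual \<sigma>, \<sigma>] [g False, x]))"
proof -
  obtain \<Omega> where "(\<Omega>, [0, 1]) \<in> surfaces S [dual \<sigma>, dual (dual \<sigma>)]" using pair_surface[OF dual_Sigma[OF \<sigma>]] .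
  then have O: "(\<Omega>, [0] @ [1]) \<in> surfaces S ([dual \<sigma>] @ [\<sigma>])" by simp
  then interpret numbered_cut \<Omega> S "[0]" "[1]"
    unfolding numbered_cut_def numbered_cut_axioms_def surfaces_numbered by simp
  have "vertex_class \<Omega> 0 = dual \<sigma>" using O unfolding surfaces_numbered by simp
  then have "(piece True, [old 0, new True]) \<in> surfaces S [dual \<sigma>, new_class]" using piece_surfaces(1) by simp
  then have "new_class = \<sigma>" using surfaces_pair_dual by fastforce
  then show ?thesis using corr_cut[OF O, of "[y]" "[x]"] x y by simp
qed

text \<open>The pairing is taken with the factor from \<open>B (dual \<sigma>)\<close> first, the
  form in which \<open>pair_cut\<close> reproduces it; \<open>corr_swap\<close> relates it to the
  order used in \<open>dual_bases\<close>.\<close>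

lemma K_contraction:
  assumes \<sigma>: "\<sigma> \<in> Sigma_classes S" and db: "dual_bases bil \<sigma> n b b' F"
    and T: "linear_on (B \<sigma>) T1" "linear_on (B (dual \<sigma>)) T2"
  shows "(\<Sum>g\<in>Poly_Mapping.keys (K_rep \<sigma>). Poly_Mapping.lookup (K_rep \<sigma>) g * (T1 (g True) * T2 (g False))) =
    (\<Sum>i<n. \<Sum>j<n. T1 (b i) * F i j * T2 (b' j))"
proof (rule dual_basis_contraction[where \<beta> = "\<lambda>y x. corr [dual \<sigma>, \<sigma>] [y, x]"])
  note \<sigma>' = dual_Sigma[OF \<sigma>]
  show "subspace (B \<sigma>)" "subspace (B (dual \<sigma>))" using subspace_B \<sigma> \<sigma>' by auto
  show b: "is_basis (B \<sigma>) n b" and b': "is_basis (B (dual \<sigma>)) n b'" using db unfolding dual_bases_def by auto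
  show "linear_on (B \<sigma>) (\<lambda>x. corr [dual \<sigma>, \<sigma>] [y, x])" if "y \<in> B (dual \<sigma>)" for y by (rule corr_linear2(2)[OF that])
  show "linear_on (B (dual \<sigma>)) (\<lambda>y. corr [dual \<sigma>, \<sigma>] [y, x])" if "x \<in> B \<sigma>" for x by (rule corr_linear2(1)[OF that])
  show "x = 0" if "x \<in> B \<sigma>" "\<And>y. y \<in> B (dual \<sigma>) \<Longrightarrow> corr [dual \<sigma>, \<sigma>] [y, x] = 0" for x
    using corr_nondegenerate[OF \<sigma> that(1)] that(2) corr_swap[OF that(1)] by simp
  show "(\<Sum>i<n. F i j * corr [dual \<sigma>, \<sigma>] [b' l, b i]) = (if j = l then 1 else 0)" if "j < n" "l < n" for j l
  proof -
    have "(\<Sum>i<n. F i j * corr [dual \<sigma>, \<sigma>] [b' l, b i]) = (\<Sum>i<n. F i j * bil (emb \<sigma> (b i)) (emb (dual \<sigma>) (b' l)))"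
      using is_basis_in[OF b] is_basis_in[OF b' that(2)] by (intro sum.cong refl) (simp add: bil_emb[OF \<sigma> \<sigma>'] corr_swap)
    then show ?thesis using db that unfolding dual_bases_def by simp
  qed
  show "corr [dual \<sigma>, \<sigma>] [y, x] = (\<Sum>g\<in>Poly_Mapping.keys (K_rep \<sigma>). Poly_Mapping.lookup (K_rep \<sigma>) g *
    (corr [dual \<sigma>, \<sigma>] [y, g True] * corr [dual \<sigma>, \<sigma>] [g False, x]))" if "x \<in> B \<sigma>" "y \<in> B (dual \<sigma>)" for x y
    by (rule pair_cut[OF \<sigma> that])
qed (use K_rep(3)[OF \<sigma>] T in blast)+

text \<open>Cut after the second vertex and replace \<open>K\<close> by the matrix \<open>F\<close>.
  The functionals to be contracted are the correlators of the two pieces as functions of the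
  argument at the new vertex. Both sides of the associativity law have this form.\<close>

lemma corr_factor:
  assumes ne: "surfaces S [\<sigma>1, \<sigma>2, \<sigma>3, \<sigma>4] \<noteq> {}"
    and \<sigma>s: "\<sigma>1 \<in> Sigma_classes S" "\<sigma>2 \<in> Sigma_classes S" "\<sigma>3 \<in> Sigma_classes S" "\<sigma>4 \<in> Sigma_classes S"
    and x: "x1 \<in> B \<sigma>1" "x2 \<in> B \<sigma>2" "x3 \<in> B \<sigma>3" "x4 \<in> B \<sigma>4"
    and \<sigma>: "\<sigma> = cut_class S \<sigma>1 \<sigma>2 \<sigma>3 \<sigma>4" and db: "dual_bases bil \<sigma> n b b' F"
  shows "(\<Sum>i<n. \<Sum>j<n. tri (emb \<sigma>1 x1) (emb \<sigma>2 x2) (emb \<sigma> (b i)) * F i j *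
      tri (emb (dual \<sigma>) (b' j)) (emb \<sigma>3 x3) (emb \<sigma>4 x4)) = corr [\<sigma>1, \<sigma>2, \<sigma>3, \<sigma>4] [x1, x2, x3, x4]"
proof -
  obtain \<Omega> qs where O: "(\<Omega>, qs) \<in> surfaces S [\<sigma>1, \<sigma>2, \<sigma>3, \<sigma>4]" using ne by auto
  then have "map (vertex_class \<Omega>) qs = [\<sigma>1, \<sigma>2, \<sigma>3, \<sigma>4]" unfolding surfaces_numbered by blast
  then obtain q1 q2 q3 q4 where qs: "qs = [q1, q2, q3, q4]" by auto
  interpret numbered_cut \<Omega> S "[q1, q2]" "[q3, q4]"
    using O unfolding numbered_cut_def numbered_cut_axioms_def surfaces_numbered qs by simp
  have n: "new_class = \<sigma>" unfolding \<sigma> using cut_class_eq O unfolding qs by metis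
  have \<sigma>S: "\<sigma> \<in> Sigma_classes S" using new_class_Sigma n by simp
  have b: "b i \<in> B \<sigma>" "b' i \<in> B (dual \<sigma>)" if "i < n" for i
    using db that is_basis_in unfolding dual_bases_def by blast+
  have O': "(\<Omega>, [q1, q2] @ [q3, q4]) \<in> surfaces S ([\<sigma>1, \<sigma>2] @ [\<sigma>3, \<sigma>4])" using O qs by simp
  have "corr ([\<sigma>1, \<sigma>2] @ [\<sigma>3, \<sigma>4]) ([x1, x2] @ [x3, x4]) = (\<Sum>g\<in>Poly_Mapping.keys (K_rep \<sigma>). Poly_Mapping.lookup (K_rep \<sigma>) g *
    (corr ([\<sigma>1, \<sigma>2] @ [\<sigma>]) ([x1, x2] @ [g True]) * corr (dual \<sigma> # [\<sigma>3, \<sigma>4]) (g False # [x3, x4])))"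
    unfolding n[symmetric]
    by (rule corr_cut[OF O']) (use x in \<open>auto simp: less_Suc_eq_0_disj nth_Cons'\<close>)
  also have "\<dots> = (\<Sum>i<n. \<Sum>j<n. corr [\<sigma>1, \<sigma>2, \<sigma>] [x1, x2, b i] * F i j * corr [dual \<sigma>, \<sigma>3, \<sigma>4] [b' j, x3, x4])"
    using K_contraction[OF \<sigma>S db corr_linear3(3)[OF x(1,2)] corr_linear3(1)[OF x(3,4)]] by simp
  also have "\<dots> = (\<Sum>i<n. \<Sum>j<n. tri (emb \<sigma>1 x1) (emb \<sigma>2 x2) (emb \<sigma> (b i)) * F i j *
      tri (emb (dual \<sigma>) (b' j)) (emb \<sigma>3 x3) (emb \<sigma>4 x4))"
    by (intro sum.cong refl) (simp add: tri_emb \<sigma>s \<sigma>S dual_Sigma x b)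
  finally show ?thesis by simp
qed

text \<open>Pairing \<open>x\<close> with elements of the single space
  \<open>B (dual \<sigma>)\<close> isolates its component in \<open>B \<sigma>\<close>, since for
  the other classes there is no surface and the correlator is 0.\<close>

lemma bil_nondegenerate:
  assumes x: "x \<in> B_star S B"
    and 0: "(\<forall>y\<in>B_star S B. bil x y = 0) \<or> (\<forall>y\<in>B_star S B. bil y x = 0)"
  shows "x \<sigma> = 0"
proof (rule ccontr)
  assume nz: "x \<sigma> \<noteq> 0"
  note \<sigma> = B_starD[OF x nz, THEN conjunct1] and x\<sigma> = B_starD[OF x nz, THEN conjunct2]
  have fin: "finite {\<tau>. x \<tau> \<noteq> 0}" using x unfolding B_star_def by blast
  note \<sigma>' = dual_Sigma[OF \<sigma>]
  have "corr [\<sigma>, dual \<sigma>] [x \<sigma>, y] = 0" if y: "y \<in> B (dual \<sigma>)" for y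
  proof -
    have "bil x (emb (dual \<sigma>) y) = (\<Sum>\<tau>\<in>{\<sigma>}. corr [\<tau>, dual \<sigma>] [x \<tau>, y])"
      unfolding bil_emb_right[OF \<sigma>' x]
    proof (rule sum.mono_neutral_right[OF fin])
      show "\<forall>\<tau>\<in>{\<tau>. x \<tau> \<noteq> 0} - {\<sigma>}. corr [\<tau>, dual \<sigma>] [x \<tau>, y] = 0"
        using corr_pair_zero[of "dual \<sigma>"] dual_dual by (metis Diff_iff insertI1)
    qed (use nz in simp)
    moreover have "bil (emb (dual \<sigma>) y) x = (\<Sum>\<tau>\<in>{\<sigma>}. corr [dual \<sigma>, \<tau>] [y, x \<tau>])"
      unfolding bil_emb_left[OF \<sigma>' x]
    proof (rule sum.mono_neutral_right[OF fin])
      show "\<forall>\<tau>\<in>{\<tau>. x \<tau> \<noteq> 0} - {\<sigma>}. corr [dual \<sigma>, \<tau>] [y, x \<tau>] = 0"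
        using corr_pair_zero[of _ "dual \<sigma>"] dual_dual by (metis Diff_iff insertI1)
    qed (use nz in simp)
    ultimately show ?thesis using 0 emb_B_star[OF \<sigma>' y] corr_swap[OF x\<sigma> y] by auto
  qed
  then show False using corr_nondegenerate[OF \<sigma> x\<sigma>] nz by blast
qed

lemma graph_Frobenius: "graph_Frobenius_algebra scale S B bil tri"
proof (intro graph_Frobenius_algebra.intro graph_graded_space_axioms graph_Frobenius_algebra_axioms.intro)
  show "bil (emb \<sigma>1 x1) (emb \<sigma>2 x2) = 0"
    if "\<sigma>1 \<in> Sigma_classes S" "\<sigma>2 \<in> Sigma_classes S" "\<sigma>1 \<noteq> dual \<sigma>2" "x1 \<in> B \<sigma>1" "x2 \<in> B \<sigma>2" for \<sigma>1 \<sigma>2 x1 x2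
  proof -
    have "\<sigma>2 \<noteq> dual \<sigma>1" using that(3) by auto
    then show ?thesis using bil_emb[OF that(1,2,4,5)] corr_pair_zero by simp
  qed
  show "tri (emb \<sigma>1 x1) (emb \<sigma>2 x2) (emb \<sigma>3 x3) = 0"
    if "\<sigma>1 \<in> Sigma_classes S" "\<sigma>2 \<in> Sigma_classes S" "\<sigma>3 \<in> Sigma_classes S"
      "surfaces S [\<sigma>1, \<sigma>2, \<sigma>3] = {}" "x1 \<in> B \<sigma>1" "x2 \<in> B \<sigma>2" "x3 \<in> B \<sigma>3" for \<sigma>1 \<sigma>2 \<sigma>3 x1 x2 x3
    unfolding tri_emb[OF that(1-3,5-7)] by (rule corr_empty[OF that(4)])
  fix \<sigma>1 \<sigma>2 \<sigma>3 \<sigma>4 x1 x2 x3 x4 \<sigma> m b b' F \<tau> n c c' G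
  assume \<sigma>s: "\<sigma>1 \<in> Sigma_classes S" "\<sigma>2 \<in> Sigma_classes S" "\<sigma>3 \<in> Sigma_classes S" "\<sigma>4 \<in> Sigma_classes S"
    and ne: "surfaces S [\<sigma>1, \<sigma>2, \<sigma>3, \<sigma>4] \<noteq> {}" and x: "x1 \<in> B \<sigma>1" "x2 \<in> B \<sigma>2" "x3 \<in> B \<sigma>3" "x4 \<in> B \<sigma>4"
    and \<sigma>: "\<sigma> = cut_class S \<sigma>1 \<sigma>2 \<sigma>3 \<sigma>4" "dual_bases bil \<sigma> m b b' F"
    and \<tau>: "\<tau> = cut_class S \<sigma>4 \<sigma>1 \<sigma>2 \<sigma>3" "dual_bases bil \<tau> n c c' G"
  obtain \<Omega> qs where "(\<Omega>, qs) \<in> surfaces S [\<sigma>1, \<sigma>2, \<sigma>3, \<sigma>4]" using ne by auto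
  \<comment> \<open>Three rotations to the left bring the fourth class to the front, which is the
    order of the second cut.\<close>
  then have "(\<Omega>, rotate 3 qs) \<in> surfaces S (rotate 3 [\<sigma>1, \<sigma>2, \<sigma>3, \<sigma>4])" by (rule surfaces_rotate)
  then have ne': "surfaces S [\<sigma>4, \<sigma>1, \<sigma>2, \<sigma>3] \<noteq> {}" by (auto simp: numeral_3_eq_3)
  have "corr [\<sigma>1, \<sigma>2, \<sigma>3, \<sigma>4] [x1, x2, x3, x4] = corr [\<sigma>4, \<sigma>1, \<sigma>2, \<sigma>3] [x4, x1, x2, x3]"
    using corr_rotate_all[of "[\<sigma>4, \<sigma>1, \<sigma>2, \<sigma>3]" "[x4, x1, x2, x3]"] x by simp
  then show "(\<Sum>i<m. \<Sum>j<m. tri (emb \<sigma>1 x1) (emb \<sigma>2 x2) (emb \<sigma> (b i)) * F i j *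
      tri (emb (dual \<sigma>) (b' j)) (emb \<sigma>3 x3) (emb \<sigma>4 x4)) =
    (\<Sum>i<n. \<Sum>j<n. tri (emb \<sigma>4 x4) (emb \<sigma>1 x1) (emb \<tau> (c i)) * G i j *
      tri (emb (dual \<tau>) (c' j)) (emb \<sigma>2 x2) (emb \<sigma>3 x3))"
    using corr_factor[OF ne \<sigma>s x \<sigma>] corr_factor[OF ne' \<sigma>s(4,1-3) x(4,1-3) \<tau>] by simp
qed (use bil_linear tri_linear bil_nondegenerate in blast)+

end

theorem theorem3p1:
  fixes scale :: "'k::field_char_0 \<Rightarrow> 'b::ab_group_add \<Rightarrow> 'b"
    and S :: "'c set"
    and B :: "'c gclass \<Rightarrow> 'b set"
    and K :: "'c gclass \<Rightarrow> (bool, 'b, 'k) formal set"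
    and \<Phi> :: "'c surface \<Rightarrow> (nat, 'b, 'k) formal set \<Rightarrow> 'k"
  assumes "film_TFT scale S B K \<Phi>"
  shows "graph_Frobenius_algebra scale S B
    (char_0_space.TFT_bilinear scale S B \<Phi>) (char_0_space.TFT_trilinear scale S B \<Phi>)"
  using assms by (rule film_TFT.graph_Frobenius)

end
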